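(* Suppose that $\chi\in\mathfrak g_{\mathbb K}^{*}$ is in standard Levi form and let $\lambda\in\mathfrak t_R^{*}$. If $L_p^\chi(\lambda)\neq 0$, then there is a surjective homomorphism of $U_\chi(\mathfrak g_{\mathbb K})$-modules $L_p^\chi(\lambda)\twoheadrightarrow L_\chi(\widetilde\lambda)$.
   Context: Let $G_{\mathbb C}$ be either a simple simply connected complex algebraic group or $\mathrm{GL}_N(\mathbb C)$, with Lie algebra $\mathfrak g_{\mathbb C}$, maximal torus and Borel subgroup with Lie algebras $\mathfrak t_{\mathbb C}\subseteq\mathfrak b_{\mathbb C}$, root system $\Phi$, positive roots $\Phi^{+}$, simple roots $\Pi$, and $\mathfrak n_{\mathbb C}^{\pm}$ the sums of the root spaces for $\pm\Phi^{+}$. Let $\mathcal B$ be a Chevalley basis $\{e_\alpha\mid\alpha\in\Phi\}\cup\{h_\beta\mid\beta\in\Pi\}$ of $\mathfrak g_{\mathbb C}$ if $G_{\mathbb C}$ is simple, and the basis of matrix units $\{e_{ij}\}$ if $G_{\mathbb C}=\mathrm{GL}_N(\mathbb C)$ (with $\mathfrak t_{\mathbb C}$ diagonal and $\mathfrak b_{\mathbb C}$ upper triangular matrices; $e_{ij}$ is then the root vector for $\varepsilon_i-\varepsilon_j$). Let $R=\mathcal S^{-1}\mathbb Z$ be a localisation of $\mathbb Z$ at a finitely generated multiplicatively closed set containing all primes that are not very good for $\Phi$ (in type $A_{N-1}$, including for $\mathrm{GL}_N$, these are the primes dividing $N$). Let $\mathbb K$ be an algebraically closed field of characteristic $p>0$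 with $p$ not invertible in $R$. Let $\mathfrak g_R,\mathfrak t_R,\mathfrak b_R,\mathfrak n_R^{\pm}$ be the $R$-spans of the relevant subsets of $\mathcal B$, and let $\mathfrak g_{\mathbb K}=\mathfrak g_R\otimes_R\mathbb K$, and similarly for $\mathfrak t_{\mathbb K},\mathfrak b_{\mathbb K},\mathfrak n^{\pm}_{\mathbb K}$. Then $\mathfrak g_{\mathbb K}$ is the Lie algebra of the algebraic group $G_{\mathbb K}$ over $\mathbb K$ with the same root datum as $G_{\mathbb C}$, with restricted structure $x\mapsto x^{[p]}$. Write $\mathfrak t_R^{*}=\mathrm{Hom}_R(\mathfrak t_R,R)\subseteq\mathfrak t_{\mathbb C}^{*}$, and let $\widetilde\lambda\in\mathfrak t_{\mathbb K}^{*}$ be the reduction of $\lambda\in\mathfrak t_R^{*}$. For $\lambda\in\mathfrak t_R^{*}$ let $L_{\mathbb C}(\lambda)$ be the simple quotient of the Verma module $M_{\mathbb C}(\lambda)=U(\mathfrak g_{\mathbb C})\otimes_{U(\mathfrak b_{\mathbb C})}\mathbb C_\lambda$ (unshifted highest weight $\lambda$), with canonical highest weight generator $\overline v_\lambda$. Set $L_R(\lambda)=U(\mathfrak g_R)\overline v_\lambda$ and $L_p(\lambda)=L_R(\lambda)\otimes_R\mathbb K$, a $U(\mathfrak g_{\mathbb K})$-module. For $\chi\in\mathfrak g_{\mathbb K}^{*}$ let $J_\chi$ be the ideal generated by all $x^p-x^{[p]}-\chi(x)^p$, $x\in\mathfrak g_{\mathbb K}$, in the $p$-centre of $U(\mathfrak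 g_{\mathbb K})$ (the central subalgebra generated by the $x^p-x^{[p]}$), and set $L_p^\chi(\lambda)=L_p(\lambda)/J_\chi L_p(\lambda)$. This is a (possibly zero) module over the reduced enveloping algebra $U_\chi(\mathfrak g_{\mathbb K})=U(\mathfrak g_{\mathbb K})/\langle x^p-x^{[p]}-\chi(x)^p\mid x\in\mathfrak g_{\mathbb K}\rangle$. $\chi$ is in standard Levi form if $\chi(\mathfrak b_{\mathbb K})=0$ and there is $I\subseteq\Pi$ such that $\chi(e_{-\alpha})=1$ for $\alpha\in I$ and $\chi(e_{-\alpha})=0$ for $\alpha\in\Phi^{+}\setminus I$. In that case the baby Verma module $Z_\chi(\widetilde\lambda)=U_\chi(\mathfrak g_{\mathbb K})\otimes_{U_0(\mathfrak b_{\mathbb K})}\mathbb K_{\widetilde\lambda}$ (where $\mathfrak n^{+}_{\mathbb K}$ acts on $\mathbb K_{\widetilde\lambda}$ by $0$ and $\mathfrak t_{\mathbb K}$ by $\widetilde\lambda$) has a unique simple quotient, denoted $L_\chi(\widetilde\lambda)$. *)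

theory Defs
  imports
    "HOL-Algebra.QuotRing"
    "HOL-Algebra.Generated_Rings"
    "HOL-Algebra.Module"
    "HOL-Computational_Algebra.Polynomial"
    "HOL-Library.Poly_Mapping"
    "HOL-Library.Function_Algebras"
    "Jordan_Normal_Form.Matrix"
begin

section \<open>Left modules over a not necessarily commutative ring\<close>

text \<open>The locale \<^locale>\<open>module\<close> of HOL-Algebra insists on a commutative base ring; its record of
  module operations and its predicate \<^const>\<open>submodule\<close> do not.\<close>

locale left_module = A?: ring A + M?: abelian_group M
  for A :: "('a, 'c) ring_scheme" and M :: "('a, 'b, 'd) module_scheme" (structure) +
  assumes smult_closed:
      "\<lbrakk>a \<in> carrier A; v \<in> carrier M\<rbrakk> \<Longrightarrow> a \<odot> v \<in> carrier M"
    and smult_l_distr: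
      "\<lbrakk>a \<in> carrier A; b \<in> carrier A; v \<in> carrier M\<rbrakk> \<Longrightarrow> (a \<oplus>\<^bsub>A\<^esub> b) \<odot> v = a \<odot> v \<oplus> b \<odot> v"
    and smult_r_distr:
      "\<lbrakk>a \<in> carrier A; v \<in> carrier M; w \<in> carrier M\<rbrakk> \<Longrightarrow> a \<odot> (v \<oplus> w) = a \<odot> v \<oplus> a \<odot> w"
    and smult_assoc:
      "\<lbrakk>a \<in> carrier A; b \<in> carrier A; v \<in> carrier M\<rbrakk> \<Longrightarrow> (a \<otimes>\<^bsub>A\<^esub> b) \<odot> v = a \<odot> (b \<odot> v)"
    and smult_one: "v \<in> carrier M \<Longrightarrow> \<one>\<^bsub>A\<^esub> \<odot> v = v"

locale left_module_hom = M: left_module A M + N: left_module A N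
  for A :: "('a, 'c) ring_scheme"
    and M :: "('a, 'b, 'd) module_scheme" and N :: "('a, 'e, 'f) module_scheme" +
  fixes f :: "'b \<Rightarrow> 'e"
  assumes hom_closed: "v \<in> carrier M \<Longrightarrow> f v \<in> carrier N"
    and hom_add: "\<lbrakk>v \<in> carrier M; w \<in> carrier M\<rbrakk> \<Longrightarrow> f (v \<oplus>\<^bsub>M\<^esub> w) = f v \<oplus>\<^bsub>N\<^esub> f w"
    and hom_smult: "\<lbrakk>a \<in> carrier A; v \<in> carrier M\<rbrakk> \<Longrightarrow> f (a \<odot>\<^bsub>M\<^esub> v) = a \<odot>\<^bsub>N\<^esub> f v"

locale simple_left_module = left_module +
  assumes nonzero: "carrier M \<noteq> {\<zero>}"
    and simple: "submodule H A M \<Longrightarrow> H = {\<zero>} \<or> H = carrier M"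

definition type_ring :: "'a::ring_1 ring" where
  "type_ring = \<lparr>carrier = UNIV, monoid.mult = (*), monoid.one = 1, ring.zero = 0, ring.add = (+)\<rparr>"

definition with_smult :: "('b, 'd) ring_scheme \<Rightarrow> ('a \<Rightarrow> 'b \<Rightarrow> 'b) \<Rightarrow> ('a, 'b) module" where
  "with_smult V s =
    \<lparr>carrier = carrier V, monoid.mult = monoid.mult V, monoid.one = monoid.one V,
     ring.zero = ring.zero V, ring.add = ring.add V, module.smult = s\<rparr>"

definition quot_module :: "('a, 'b, 'd) module_scheme \<Rightarrow> 'b set \<Rightarrow> ('a, 'b set) module"
    (infixl \<open>QuotM\<close> 65) where
  "M QuotM N =
    \<lparr>carrier = a_rcosets\<^bsub>M\<^esub> N, monoid.mult = undefined, monoid.one = undefined,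
     ring.zero = N, ring.add = set_add M,
     module.smult = (\<lambda>a C. \<Union>v\<in>C. N +>\<^bsub>M\<^esub> (a \<odot>\<^bsub>M\<^esub> v))\<rparr>"

text \<open>A module over \<open>A\<close> that is annihilated by an ideal \<open>I\<close>, regarded as a module over \<open>A Quot I\<close>:
  a coset acts as any one of its elements.\<close>

definition over_quotient :: "('a, 'b, 'd) module_scheme \<Rightarrow> ('a set, 'b) module" where
  "over_quotient M = with_smult M (\<lambda>C v. THE w. \<forall>a\<in>C. a \<odot>\<^bsub>M\<^esub> v = w)"

text \<open>The map \<open>R/J \<rightarrow> S/I\<close> induced by a ring homomorphism \<open>f : R \<rightarrow> S\<close> with \<open>f J \<subseteq> I\<close>; only the
  target is needed to write it down.\<close>

definition quot_map :: "('s, 'd) ring_scheme \<Rightarrow> 's set \<Rightarrow> ('r \<Rightarrow> 's) \<Rightarrow> 'r set \<Rightarrow> 's set" where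
  "quot_map S I f = (\<lambda>C. \<Union>t\<in>C. I +>\<^bsub>S\<^esub> f t)"


section \<open>The tensor product \<open>B \<otimes>\<^sub>A N\<close> along a ring homomorphism \<open>\<phi> : A \<rightarrow> B\<close>\<close>

text \<open>It is the free abelian group on \<open>B \<times> N\<close> modulo the usual relations, with \<open>B\<close> acting on the
  left factor. The free abelian group itself is not a \<open>B\<close>-module: its scalar operation is additive
  in \<open>B\<close> only modulo the relations.\<close>

definition tensor_free :: "('b, 'c) ring_scheme \<Rightarrow> ('a, 'n, 'd) module_scheme
    \<Rightarrow> ('b, ('b \<times> 'n) \<Rightarrow>\<^sub>0 int) module" where
  "tensor_free B N =
    \<lparr>carrier = {t. Poly_Mapping.keys t \<subseteq> carrier B \<times> carrier N}, monoid.mult = undefined,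
     monoid.one = undefined, ring.zero = 0, ring.add = (+),
     module.smult = (\<lambda>b. frag_extend (\<lambda>(c, n). frag_of (b \<otimes>\<^bsub>B\<^esub> c, n)))\<rparr>"

definition tensor_relations :: "('a, 'e) ring_scheme \<Rightarrow> ('a \<Rightarrow> 'b) \<Rightarrow> ('b, 'c) ring_scheme
    \<Rightarrow> ('a, 'n, 'd) module_scheme \<Rightarrow> (('b \<times> 'n) \<Rightarrow>\<^sub>0 int) set" where
  "tensor_relations A \<phi> B N =
    generate (add_monoid (tensor_free B N))
     ({frag_of (b \<oplus>\<^bsub>B\<^esub> c, n) - frag_of (b, n) - frag_of (c, n) | b c n.
         b \<in> carrier B \<and> c \<in> carrier B \<and> n \<in> carrier N}
    \<union> {frag_of (b, m \<oplus>\<^bsub>N\<^esub> n) - frag_of (b, m) - frag_of (b, n) | b m n.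
         b \<in> carrier B \<and> m \<in> carrier N \<and> n \<in> carrier N}
    \<union> {frag_of (b \<otimes>\<^bsub>B\<^esub> \<phi> a, n) - frag_of (b, a \<odot>\<^bsub>N\<^esub> n) | a b n.
         a \<in> carrier A \<and> b \<in> carrier B \<and> n \<in> carrier N})"

definition tensor :: "('a, 'e) ring_scheme \<Rightarrow> ('a \<Rightarrow> 'b) \<Rightarrow> ('b, 'c) ring_scheme
    \<Rightarrow> ('a, 'n, 'd) module_scheme \<Rightarrow> ('b, (('b \<times> 'n) \<Rightarrow>\<^sub>0 int) set) module" where
  "tensor A \<phi> B N = tensor_free B N QuotM tensor_relations A \<phi> B N"

definition pure_tensor :: "('a, 'e) ring_scheme \<Rightarrow> ('a \<Rightarrow> 'b) \<Rightarrow> ('b, 'c) ring_scheme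
    \<Rightarrow> ('a, 'n, 'd) module_scheme \<Rightarrow> 'b \<Rightarrow> 'n \<Rightarrow> (('b \<times> 'n) \<Rightarrow>\<^sub>0 int) set" where
  "pure_tensor A \<phi> B N b n = tensor_relations A \<phi> B N +>\<^bsub>tensor_free B N\<^esub> frag_of (b, n)"

text \<open>The map \<open>id \<otimes> f\<close> for an \<open>A\<close>-linear endomorphism \<open>f\<close> of \<open>N\<close>.\<close>

definition id_tensor :: "('a, 'e) ring_scheme \<Rightarrow> ('a \<Rightarrow> 'b) \<Rightarrow> ('b, 'c) ring_scheme
    \<Rightarrow> ('a, 'n, 'd) module_scheme \<Rightarrow> ('n \<Rightarrow> 'n)
    \<Rightarrow> (('b \<times> 'n) \<Rightarrow>\<^sub>0 int) set \<Rightarrow> (('b \<times> 'n) \<Rightarrow>\<^sub>0 int) set" where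
  "id_tensor A \<phi> B N f =
    (\<lambda>C. \<Union>t\<in>C. tensor_relations A \<phi> B N
            +>\<^bsub>tensor_free B N\<^esub> frag_extend (\<lambda>(b, n). frag_of (b, f n)) t)"


section \<open>Universal enveloping algebras\<close>

datatype 'a word = Word (letters: "'a list")

instantiation word :: (type) monoid_add
begin

definition zero_word :: "'a word" where "0 = Word []"

definition plus_word :: "'a word \<Rightarrow> 'a word \<Rightarrow> 'a word" where
  "u + v = Word (letters u @ letters v)"

instance
  by standard (auto simp: zero_word_def plus_word_def)

end

text \<open>The free algebra on \<open>X\<close>: finitely supported functions on words, multiplied by convolution.\<close>

definition free_algebra :: "'a set \<Rightarrow> ('a word \<Rightarrow>\<^sub>0 'k::field) ring" where
  "free_algebra X =
    type_ring\<lparr>carrier := {t. \<forall>w\<in>Poly_Mapping.keys t. set (letters w) \<subseteq> X}\<rparr>"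

definition gen :: "'a \<Rightarrow> 'a word \<Rightarrow>\<^sub>0 'k::field" where
  "gen x = Poly_Mapping.single (Word [x]) 1"

definition scalar :: "'k \<Rightarrow> 'a word \<Rightarrow>\<^sub>0 'k::field" where
  "scalar c = Poly_Mapping.single 0 c"

text \<open>A \<open>'k\<close>-Lie algebra with underlying set \<^term>\<open>lie_carrier L\<close>, addition being that of the type
  \<open>'a\<close>.\<close>

record ('a, 'k) lie =
  lie_carrier :: "'a set"
  lie_scale :: "'k \<Rightarrow> 'a \<Rightarrow> 'a"
  lie_bracket :: "'a \<Rightarrow> 'a \<Rightarrow> 'a"

definition env_ideal :: "('a::ab_group_add, 'k::field, 'm) lie_scheme \<Rightarrow> ('a word \<Rightarrow>\<^sub>0 'k) set" where
  "env_ideal L =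
    Idl\<^bsub>free_algebra (lie_carrier L)\<^esub>
     ({gen (x + y) - gen x - gen y | x y. x \<in> lie_carrier L \<and> y \<in> lie_carrier L}
    \<union> {gen (lie_scale L c x) - scalar c * gen x | c x. x \<in> lie_carrier L}
    \<union> {gen x * gen y - gen y * gen x - gen (lie_bracket L x y) | x y.
         x \<in> lie_carrier L \<and> y \<in> lie_carrier L})"

definition env_alg :: "('a::ab_group_add, 'k::field, 'm) lie_scheme \<Rightarrow> ('a word \<Rightarrow>\<^sub>0 'k) set ring" where
  "env_alg L = free_algebra (lie_carrier L) Quot env_ideal L"

definition env_incl :: "('a::ab_group_add, 'k::field, 'm) lie_scheme \<Rightarrow> 'a \<Rightarrow> ('a word \<Rightarrow>\<^sub>0 'k) set" where
  "env_incl L x = env_ideal L +>\<^bsub>free_algebra (lie_carrier L)\<^esub> gen x"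

definition env_scalar :: "('a::ab_group_add, 'k::field, 'm) lie_scheme \<Rightarrow> 'k \<Rightarrow> ('a word \<Rightarrow>\<^sub>0 'k) set" where
  "env_scalar L c = env_ideal L +>\<^bsub>free_algebra (lie_carrier L)\<^esub> scalar c"

text \<open>The map \<open>U(L') \<rightarrow> U(L)\<close> for a subalgebra \<open>L'\<close> of \<open>L\<close>.\<close>

definition env_map :: "('a::ab_group_add, 'k::field, 'm) lie_scheme
    \<Rightarrow> ('a word \<Rightarrow>\<^sub>0 'k) set \<Rightarrow> ('a word \<Rightarrow>\<^sub>0 'k) set" where
  "env_map L = quot_map (free_algebra (lie_carrier L)) (env_ideal L) (\<lambda>t. t)"

text \<open>The \<open>U(L)\<close>-module given by a representation \<open>\<rho>\<close> of \<open>L\<close> on a vector space \<open>V\<close>.\<close>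

definition free_algebra_module :: "('k::field, 'v, 'm) module_scheme \<Rightarrow> ('a \<Rightarrow> 'v \<Rightarrow> 'v)
    \<Rightarrow> ('a word \<Rightarrow>\<^sub>0 'k, 'v) module" where
  "free_algebra_module V \<rho> = with_smult V (\<lambda>t v.
     \<Oplus>\<^bsub>V\<^esub>w\<in>Poly_Mapping.keys t. Poly_Mapping.lookup t w \<odot>\<^bsub>V\<^esub> foldr \<rho> (letters w) v)"

definition env_module :: "('k::field, 'v, 'm) module_scheme \<Rightarrow> ('a \<Rightarrow> 'v \<Rightarrow> 'v)
    \<Rightarrow> (('a word \<Rightarrow>\<^sub>0 'k) set, 'v) module" where
  "env_module V \<rho> = over_quotient (free_algebra_module V \<rho>)"

text \<open>The one-dimensional \<open>U(L)\<close>-module on which \<open>L\<close> acts through the linear form \<open>\<mu>\<close>.\<close>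

definition character_module :: "('a \<Rightarrow> 'k::field) \<Rightarrow> (('a word \<Rightarrow>\<^sub>0 'k) set, 'k) module" where
  "character_module \<mu> = env_module (with_smult type_ring (*)) (\<lambda>x v. \<mu> x * v)"


section \<open>Restricted Lie algebras and reduced enveloping algebras\<close>

text \<open>For \<open>0 < i < p\<close>, \<open>i s\<^sub>i(x, y)\<close> is the coefficient of \<open>t\<^sup>i\<^sup>-\<^sup>1\<close> in \<open>ad(t x + y)\<^sup>p\<^sup>-\<^sup>1(x)\<close>. In the
  expansion, \<^term>\<open>bs\<close> records which of the \<open>p - 1\<close> factors contribute \<open>t x\<close>.\<close>

definition jacobson_term :: "('a::ab_group_add, 'k::field, 'm) lie_scheme \<Rightarrow> nat \<Rightarrow> 'a \<Rightarrow> 'a \<Rightarrow> 'a" where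
  "jacobson_term L i x y =
    lie_scale L (1 / of_nat i)
     (\<Sum>bs | length bs = CHAR('k) - 1 \<and> count_list bs True = i - 1.
        foldr (\<lambda>b. lie_bracket L (if b then x else y)) bs x)"

definition restricted_structure :: "('a::ab_group_add, 'k::field, 'm) lie_scheme \<Rightarrow> ('a \<Rightarrow> 'a) \<Rightarrow> bool" where
  "restricted_structure L pm \<longleftrightarrow>
    (\<forall>x\<in>lie_carrier L. pm x \<in> lie_carrier L) \<and>
    (\<forall>x\<in>lie_carrier L. \<forall>y\<in>lie_carrier L. lie_bracket L (pm x) y = (lie_bracket L x ^^ CHAR('k)) y) \<and>
    (\<forall>c. \<forall>x\<in>lie_carrier L. pm (lie_scale L c x) = lie_scale L (c ^ CHAR('k)) (pm x)) \<and>
    (\<forall>x\<in>lie_carrier L. \<forall>y\<in>lie_carrier L.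
       pm (x + y) = pm x + pm y + (\<Sum>i = 1..<CHAR('k). jacobson_term L i x y))"

definition p_central :: "('a::ab_group_add, 'k::field, 'm) lie_scheme \<Rightarrow> ('a \<Rightarrow> 'a) \<Rightarrow> 'a
    \<Rightarrow> ('a word \<Rightarrow>\<^sub>0 'k) set" where
  "p_central L pm x = env_incl L x [^]\<^bsub>env_alg L\<^esub> CHAR('k) \<ominus>\<^bsub>env_alg L\<^esub> env_incl L (pm x)"

definition p_centre :: "('a::ab_group_add, 'k::field, 'm) lie_scheme \<Rightarrow> ('a \<Rightarrow> 'a)
    \<Rightarrow> ('a word \<Rightarrow>\<^sub>0 'k) set ring" where
  "p_centre L pm = (env_alg L)
    \<lparr>carrier := generate_ring (env_alg L) (range (env_scalar L) \<union> p_central L pm ` lie_carrier L)\<rparr>"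

definition p_character_relations :: "('a::ab_group_add, 'k::field, 'm) lie_scheme \<Rightarrow> ('a \<Rightarrow> 'a)
    \<Rightarrow> ('a \<Rightarrow> 'k) \<Rightarrow> ('a word \<Rightarrow>\<^sub>0 'k) set set" where
  "p_character_relations L pm \<chi> =
    (\<lambda>x. p_central L pm x \<ominus>\<^bsub>env_alg L\<^esub> env_scalar L (\<chi> x ^ CHAR('k))) ` lie_carrier L"

text \<open>The ideal \<open>J\<^sub>\<chi>\<close> of the \<open>p\<close>-centre, and the ideal of \<open>U(L)\<close> with the same generators.\<close>

definition J_ideal :: "('a::ab_group_add, 'k::field, 'm) lie_scheme \<Rightarrow> ('a \<Rightarrow> 'a)
    \<Rightarrow> ('a \<Rightarrow> 'k) \<Rightarrow> ('a word \<Rightarrow>\<^sub>0 'k) set set" where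
  "J_ideal L pm \<chi> = Idl\<^bsub>p_centre L pm\<^esub> (p_character_relations L pm \<chi>)"

definition reduced_ideal :: "('a::ab_group_add, 'k::field, 'm) lie_scheme \<Rightarrow> ('a \<Rightarrow> 'a)
    \<Rightarrow> ('a \<Rightarrow> 'k) \<Rightarrow> ('a word \<Rightarrow>\<^sub>0 'k) set set" where
  "reduced_ideal L pm \<chi> = Idl\<^bsub>env_alg L\<^esub> (p_character_relations L pm \<chi>)"

definition reduced_env :: "('a::ab_group_add, 'k::field, 'm) lie_scheme \<Rightarrow> ('a \<Rightarrow> 'a)
    \<Rightarrow> ('a \<Rightarrow> 'k) \<Rightarrow> ('a word \<Rightarrow>\<^sub>0 'k) set set ring" where
  "reduced_env L pm \<chi> = env_alg L Quot reduced_ideal L pm \<chi>"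

definition J_submodule :: "('a::ab_group_add, 'k::field, 'm) lie_scheme \<Rightarrow> ('a \<Rightarrow> 'a) \<Rightarrow> ('a \<Rightarrow> 'k)
    \<Rightarrow> (('a word \<Rightarrow>\<^sub>0 'k) set, 'v, 'd) module_scheme \<Rightarrow> 'v set" where
  "J_submodule L pm \<chi> M =
    generate (add_monoid M) {j \<odot>\<^bsub>M\<^esub> v | j v. j \<in> J_ideal L pm \<chi> \<and> v \<in> carrier M}"


section \<open>Complex Lie algebras with a maximal torus, a base and a basis adapted to them\<close>

text \<open>\<^term>\<open>torus D\<close> is \<open>\<tt>\<close>; the Borel subalgebra is recorded through the base \<^term>\<open>simple_roots D\<close>;
  \<^term>\<open>root_vector D \<alpha>\<close> is \<open>e\<^sub>\<alpha>\<close> and \<^term>\<open>torus_basis D\<close> is the set of basis elements lying in \<open>\<tt>\<close>.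
  Linear forms on \<open>\<tt>\<close> are extended by zero to functions on all of \<open>'g\<close>.\<close>

record 'g split_lie = "('g, complex) lie" +
  torus :: "'g set"
  simple_roots :: "('g \<Rightarrow> complex) set"
  root_vector :: "('g \<Rightarrow> complex) \<Rightarrow> 'g"
  torus_basis :: "'g set"

definition complex_lie_algebra :: "('g::ab_group_add, complex, 'm) lie_scheme \<Rightarrow> bool" where
  "complex_lie_algebra L \<longleftrightarrow>
    lie_carrier L = UNIV \<and> vector_space (lie_scale L) \<and>
    (\<forall>x y z. lie_bracket L (x + y) z = lie_bracket L x z + lie_bracket L y z) \<and>
    (\<forall>x y z. lie_bracket L x (y + z) = lie_bracket L x y + lie_bracket L x z) \<and>
    (\<forall>c x y. lie_bracket L (lie_scale L c x) y = lie_scale L c (lie_bracket L x y)) \<and>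
    (\<forall>c x y. lie_bracket L x (lie_scale L c y) = lie_scale L c (lie_bracket L x y)) \<and>
    (\<forall>x. lie_bracket L x x = 0) \<and>
    (\<forall>x y z. lie_bracket L x (lie_bracket L y z) + lie_bracket L y (lie_bracket L z x)
           + lie_bracket L z (lie_bracket L x y) = 0)"

definition simple_lie_algebra :: "('g::ab_group_add, complex, 'm) lie_scheme \<Rightarrow> bool" where
  "simple_lie_algebra L \<longleftrightarrow>
    complex_lie_algebra L \<and> (\<exists>x y. lie_bracket L x y \<noteq> 0) \<and>
    (\<forall>I. module.subspace (lie_scale L) I \<and> (\<forall>x. \<forall>y\<in>I. lie_bracket L x y \<in> I) \<longrightarrow> I = {0} \<or> I = UNIV)"

definition ad_semisimple :: "('g::ab_group_add, complex, 'm) lie_scheme \<Rightarrow> 'g \<Rightarrow> bool" where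
  "ad_semisimple L h \<longleftrightarrow>
    module.span (lie_scale L) {x. \<exists>c. lie_bracket L h x = lie_scale L c x} = UNIV"

definition toral :: "('g::ab_group_add, complex, 'm) lie_scheme \<Rightarrow> 'g set \<Rightarrow> bool" where
  "toral L T \<longleftrightarrow>
    module.subspace (lie_scale L) T \<and> (\<forall>x\<in>T. \<forall>y\<in>T. lie_bracket L x y = 0) \<and>
    (\<forall>h\<in>T. ad_semisimple L h)"

definition maximal_toral :: "('g::ab_group_add, complex, 'm) lie_scheme \<Rightarrow> 'g set \<Rightarrow> bool" where
  "maximal_toral L T \<longleftrightarrow> toral L T \<and> (\<forall>T'. toral L T' \<and> T \<subseteq> T' \<longrightarrow> T' = T)"

definition torus_dual :: "'g::ab_group_add split_lie \<Rightarrow> ('g \<Rightarrow> complex) set" where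
  "torus_dual D = {\<mu>. (\<forall>x\<in>torus D. \<forall>y\<in>torus D. \<mu> (x + y) = \<mu> x + \<mu> y) \<and>
     (\<forall>c. \<forall>x\<in>torus D. \<mu> (lie_scale D c x) = c * \<mu> x) \<and> (\<forall>x. x \<notin> torus D \<longrightarrow> \<mu> x = 0)}"

definition root_space :: "'g::ab_group_add split_lie \<Rightarrow> ('g \<Rightarrow> complex) \<Rightarrow> 'g set" where
  "root_space D \<alpha> = {x. \<forall>h\<in>torus D. lie_bracket D h x = lie_scale D (\<alpha> h) x}"

definition roots :: "'g::ab_group_add split_lie \<Rightarrow> ('g \<Rightarrow> complex) set" where
  "roots D = {\<alpha> \<in> torus_dual D. \<alpha> \<noteq> 0 \<and> root_space D \<alpha> \<noteq> {0}}"

definition nat_combination :: "'g split_lie \<Rightarrow> (('g \<Rightarrow> complex) \<Rightarrow> nat) \<Rightarrow> 'g \<Rightarrow> complex" where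
  "nat_combination D m = (\<lambda>x. \<Sum>\<beta>\<in>simple_roots D. of_nat (m \<beta>) * \<beta> x)"

definition positive_roots :: "'g::ab_group_add split_lie \<Rightarrow> ('g \<Rightarrow> complex) set" where
  "positive_roots D = {\<alpha> \<in> roots D. \<exists>m. \<alpha> = nat_combination D m}"

definition is_base :: "'g::ab_group_add split_lie \<Rightarrow> bool" where
  "is_base D \<longleftrightarrow>
    finite (simple_roots D) \<and> simple_roots D \<subseteq> roots D \<and>
    (\<forall>c. (\<forall>x. (\<Sum>\<beta>\<in>simple_roots D. c \<beta> * \<beta> x) = (0::complex)) \<longrightarrow> (\<forall>\<beta>\<in>simple_roots D. c \<beta> = 0)) \<and>
    (\<forall>\<alpha>\<in>roots D. \<alpha> \<in> positive_roots D \<or> - \<alpha> \<in> positive_roots D)"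

definition borel_carrier :: "'g::ab_group_add split_lie \<Rightarrow> 'g set" where
  "borel_carrier D = module.span (lie_scale D) (torus D \<union> (\<Union>\<alpha>\<in>positive_roots D. root_space D \<alpha>))"

definition adapted_basis :: "'g::ab_group_add split_lie \<Rightarrow> 'g set" where
  "adapted_basis D = root_vector D ` roots D \<union> torus_basis D"

abbreviation coord :: "'g::ab_group_add split_lie \<Rightarrow> 'g \<Rightarrow> 'g \<Rightarrow> complex" where
  "coord D \<equiv> module.representation (lie_scale D) (adapted_basis D)"

definition coroot :: "'g::ab_group_add split_lie \<Rightarrow> ('g \<Rightarrow> complex) \<Rightarrow> 'g" where
  "coroot D \<alpha> = lie_bracket D (root_vector D \<alpha>) (root_vector D (- \<alpha>))"

text \<open>The condition \<open>\<alpha>([e\<^sub>\<alpha>, e\<^sub>-\<^sub>\<alpha>]) = 2\<close> says that \<open>[e\<^sub>\<alpha>, e\<^sub>-\<^sub>\<alpha>]\<close> is the coroot of \<open>\<alpha>\<close>. For independent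
  roots, \<open>r\<close> is the largest natural number such that \<open>\<beta> - r \<alpha>\<close> is a root. The integrality of all
  structure constants is Chevalley's theorem; as usual it is listed among the properties of a
  Chevalley basis.\<close>

definition chevalley_basis :: "'g::ab_group_add split_lie \<Rightarrow> bool" where
  "chevalley_basis D \<longleftrightarrow>
    finite (adapted_basis D) \<and> \<not> module.dependent (lie_scale D) (adapted_basis D) \<and>
    module.span (lie_scale D) (adapted_basis D) = UNIV \<and>
    torus_basis D = coroot D ` simple_roots D \<and>
    (\<forall>\<alpha>\<in>roots D. root_vector D \<alpha> \<in> root_space D \<alpha> \<and> coroot D \<alpha> \<in> torus D \<and> \<alpha> (coroot D \<alpha>) = 2) \<and>
    (\<forall>\<alpha>\<in>roots D. \<forall>\<beta>\<in>roots D. \<alpha> + \<beta> \<in> roots D \<longrightarrow>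
       (\<exists>\<epsilon>\<in>{1, -1}. lie_bracket D (root_vector D \<alpha>) (root_vector D \<beta>) =
          lie_scale D (\<epsilon> * of_nat (Max {r. (\<lambda>x. \<beta> x - of_nat r * \<alpha> x) \<in> roots D} + 1))
            (root_vector D (\<alpha> + \<beta>)))) \<and>
    (\<forall>a\<in>adapted_basis D. \<forall>b\<in>adapted_basis D. \<forall>c\<in>adapted_basis D.
       coord D (lie_bracket D a b) c \<in> \<int>)"

text \<open>The Lie algebra of a simple, simply connected \<open>G\<^sub>\<complex>\<close>.\<close>

definition simple_datum :: "'g::ab_group_add split_lie \<Rightarrow> bool" where
  "simple_datum D \<longleftrightarrow>
    simple_lie_algebra D \<and> maximal_toral D (torus D) \<and> is_base D \<and> chevalley_basis D"

definition matrix_unit :: "nat \<Rightarrow> nat \<Rightarrow> nat \<Rightarrow> complex mat" where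
  "matrix_unit N i j = mat N N (\<lambda>ij. if ij = (i, j) then 1 else 0)"

text \<open>Up to the isomorphism \<open>\<phi>\<close>, the Lie algebra \<open>\<gg>\<ll>\<^sub>N(\<complex>)\<close> with the diagonal torus, the upper
  triangular Borel subalgebra and the basis of matrix units.\<close>

definition gl_datum :: "nat \<Rightarrow> 'g::ab_group_add split_lie \<Rightarrow> bool" where
  "gl_datum N D \<longleftrightarrow> complex_lie_algebra D \<and>
    (\<exists>\<phi>. bij_betw \<phi> UNIV (carrier_mat N N) \<and>
      (\<forall>x y. \<phi> (x + y) = \<phi> x + \<phi> y) \<and> (\<forall>c x. \<phi> (lie_scale D c x) = c \<cdot>\<^sub>m \<phi> x) \<and>
      (\<forall>x y. \<phi> (lie_bracket D x y) = \<phi> x * \<phi> y - \<phi> y * \<phi> x) \<and>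
      torus D = {x. \<forall>i<N. \<forall>j<N. i \<noteq> j \<longrightarrow> \<phi> x $$ (i, j) = 0} \<and>
      \<phi> ` torus_basis D = {matrix_unit N i i | i. i < N} \<and>
      (let \<epsilon>diff = (\<lambda>i j x. if x \<in> torus D then \<phi> x $$ (i, i) - \<phi> x $$ (j, j) else 0) in
        simple_roots D = {\<epsilon>diff i (i + 1) | i. i + 1 < N} \<and>
        (\<forall>i<N. \<forall>j<N. i \<noteq> j \<longrightarrow> \<phi> (root_vector D (\<epsilon>diff i j)) = matrix_unit N i j)))"


section \<open>Very good primes and the ring \<open>R\<close>\<close>

definition bad_prime :: "'g::ab_group_add split_lie \<Rightarrow> nat \<Rightarrow> bool" where
  "bad_prime D q \<longleftrightarrow> prime q \<and>
    (\<exists>m. nat_combination D m \<in> roots D \<and> (\<exists>\<beta>\<in>simple_roots D. m \<beta> \<noteq> 0 \<and> q dvd m \<beta>))"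

text \<open>Type \<open>A\<^sub>n\<close> with \<open>n\<close> the number of simple roots.\<close>

definition type_A :: "'g::ab_group_add split_lie \<Rightarrow> bool" where
  "type_A D \<longleftrightarrow> (\<exists>\<beta>. bij_betw \<beta> {..<card (simple_roots D)} (simple_roots D) \<and>
    (\<forall>i<card (simple_roots D). \<forall>j<card (simple_roots D).
       \<beta> i (coroot D (\<beta> j)) = (if i = j then 2 else if i = j + 1 \<or> j = i + 1 then -1 else 0)))"

definition very_good_prime :: "'g::ab_group_add split_lie \<Rightarrow> nat \<Rightarrow> bool" where
  "very_good_prime D q \<longleftrightarrow> prime q \<and> \<not> bad_prime D q \<and>
    (type_A D \<longrightarrow> \<not> q dvd card (simple_roots D) + 1)"

definition mult_closure :: "int set \<Rightarrow> int set" where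
  "mult_closure F = {prod_list xs | xs. set xs \<subseteq> F}"

definition localisation :: "int set \<Rightarrow> complex set" where
  "localisation S = {of_int a / of_int s | a s. s \<in> S}"

definition localisation_ring :: "int set \<Rightarrow> complex ring" where
  "localisation_ring S = type_ring\<lparr>carrier := localisation S\<rparr>"

text \<open>The ring homomorphism from \<open>S\<^sup>-\<^sup>1\<int>\<close> to a field in which the elements of \<open>S\<close> do not vanish.\<close>

definition reduction :: "int set \<Rightarrow> complex \<Rightarrow> 'k::field" where
  "reduction S z = (THE y. \<exists>a. \<exists>s\<in>S. z = of_int a / of_int s \<and> y = of_int a / of_int s)"

definition R_span :: "int set \<Rightarrow> ('g::ab_group_add, complex, 'm) lie_scheme \<Rightarrow> 'g set \<Rightarrow> 'g set" where
  "R_span S L X = {\<Sum>b\<in>X. lie_scale L (r b) b | r. \<forall>b\<in>X. r b \<in> localisation S}"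

definition integral_weight :: "int set \<Rightarrow> 'g::ab_group_add split_lie \<Rightarrow> ('g \<Rightarrow> complex) \<Rightarrow> bool" where
  "integral_weight S D lam \<longleftrightarrow>
    lam \<in> torus_dual D \<and> (\<forall>x\<in>R_span S D (torus_basis D). lam x \<in> localisation S)"


section \<open>Base change to \<open>\<bbbK>\<close>\<close>

text \<open>\<open>\<gg>\<^sub>R\<close> is free over \<open>R\<close> on the adapted basis \<open>\<B>\<close>, so \<open>\<gg>\<^sub>\<bbbK> = \<gg>\<^sub>R \<otimes> \<bbbK>\<close> is the \<open>\<bbbK>\<close>-vector space on
  \<open>\<B>\<close>, realised as the functions supported on \<open>\<B>\<close>, with the reduced structure constants.\<close>

definition lie_K :: "int set \<Rightarrow> 'g::ab_group_add split_lie \<Rightarrow> ('g \<Rightarrow> 'k::field, 'k) lie" where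
  "lie_K S D =
    \<lparr>lie_carrier = {y. \<forall>b. b \<notin> adapted_basis D \<longrightarrow> y b = 0},
     lie_scale = (\<lambda>c y b. c * y b),
     lie_bracket = (\<lambda>y z c. if c \<in> adapted_basis D
       then \<Sum>a\<in>adapted_basis D. \<Sum>b\<in>adapted_basis D.
              y a * z b * reduction S (coord D (lie_bracket D a b) c)
       else 0)\<rparr>"

definition basis_K :: "'g \<Rightarrow> 'g \<Rightarrow> 'k::field" where
  "basis_K b = (\<lambda>c. if c = b then 1 else 0)"

definition borel_K :: "int set \<Rightarrow> 'g::ab_group_add split_lie \<Rightarrow> ('g \<Rightarrow> 'k::field, 'k) lie" where
  "borel_K S D = (lie_K S D)
    \<lparr>lie_carrier := {y. \<forall>b. b \<notin> torus_basis D \<union> root_vector D ` positive_roots D \<longrightarrow> y b = 0}\<rparr>"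

definition borel_C :: "'g::ab_group_add split_lie \<Rightarrow> 'g split_lie" where
  "borel_C D = D\<lparr>lie_carrier := borel_carrier D\<rparr>"

text \<open>The extensions of \<open>lam\<close> and of its reduction to the Borel subalgebras that vanish on \<open>\<nn>\<^sup>+\<close>.\<close>

definition weight_C :: "'g::ab_group_add split_lie \<Rightarrow> ('g \<Rightarrow> complex) \<Rightarrow> 'g \<Rightarrow> complex" where
  "weight_C D lam x = (\<Sum>h\<in>torus_basis D. coord D x h * lam h)"

definition weight_K :: "int set \<Rightarrow> 'g::ab_group_add split_lie \<Rightarrow> ('g \<Rightarrow> complex)
    \<Rightarrow> ('g \<Rightarrow> 'k::field) \<Rightarrow> 'k" where
  "weight_K S D lam y = (\<Sum>h\<in>torus_basis D. y h * reduction S (lam h))"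

text \<open>For the simply connected group and for \<open>GL\<^sub>N\<close>, \<open>Lie(G\<^sub>\<bbbK>)\<close> has the restricted structure with
  \<open>e\<^sub>\<alpha>\<^sup>[\<^sup>p\<^sup>] = 0\<close> and \<open>h\<^sup>[\<^sup>p\<^sup>] = h\<close> for the basis elements \<open>h\<close> of \<open>\<tt>\<close>. By Jacobson's formula these values
  determine it.\<close>

definition p_structure :: "int set \<Rightarrow> 'g::ab_group_add split_lie
    \<Rightarrow> (('g \<Rightarrow> 'k::field) \<Rightarrow> 'g \<Rightarrow> 'k) \<Rightarrow> bool" where
  "p_structure S D pm \<longleftrightarrow>
    restricted_structure (lie_K S D :: ('g \<Rightarrow> 'k, 'k) lie) pm \<and>
    (\<forall>\<alpha>\<in>roots D. pm (basis_K (root_vector D \<alpha>)) = 0) \<and>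
    (\<forall>h\<in>torus_basis D. pm (basis_K h) = basis_K h)"

definition dual_K :: "int set \<Rightarrow> 'g::ab_group_add split_lie \<Rightarrow> (('g \<Rightarrow> 'k::field) \<Rightarrow> 'k) set" where
  "dual_K S D = {\<chi>.
    (\<forall>y\<in>lie_carrier (lie_K S D :: ('g \<Rightarrow> 'k, 'k) lie). \<forall>z\<in>lie_carrier (lie_K S D :: ('g \<Rightarrow> 'k, 'k) lie).
       \<chi> (y + z) = \<chi> y + \<chi> z) \<and>
    (\<forall>c. \<forall>y\<in>lie_carrier (lie_K S D :: ('g \<Rightarrow> 'k, 'k) lie).
       \<chi> (lie_scale (lie_K S D) c y) = c * \<chi> y)}"

definition standard_levi_form :: "int set \<Rightarrow> 'g::ab_group_add split_lie
    \<Rightarrow> (('g \<Rightarrow> 'k::field) \<Rightarrow> 'k) \<Rightarrow> bool" where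
  "standard_levi_form S D \<chi> \<longleftrightarrow>
    \<chi> \<in> dual_K S D \<and> (\<forall>y\<in>lie_carrier (borel_K S D :: ('g \<Rightarrow> 'k, 'k) lie). \<chi> y = 0) \<and>
    (\<exists>I\<subseteq>simple_roots D. \<forall>\<alpha>\<in>positive_roots D.
       \<chi> (basis_K (root_vector D (- \<alpha>))) = (if \<alpha> \<in> I then 1 else 0))"


section \<open>Verma modules, baby Verma modules and reduction modulo \<open>p\<close>\<close>

definition verma :: "'g::ab_group_add split_lie \<Rightarrow> ('g \<Rightarrow> complex)
    \<Rightarrow> (('g word \<Rightarrow>\<^sub>0 complex) set, ((('g word \<Rightarrow>\<^sub>0 complex) set \<times> complex) \<Rightarrow>\<^sub>0 int) set) module" where
  "verma D lam =
    tensor (env_alg (borel_C D)) (env_map D) (env_alg D) (character_module (weight_C D lam))"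

definition verma_gen :: "'g::ab_group_add split_lie \<Rightarrow> ('g \<Rightarrow> complex)
    \<Rightarrow> ((('g word \<Rightarrow>\<^sub>0 complex) set \<times> complex) \<Rightarrow>\<^sub>0 int) set" where
  "verma_gen D lam =
    pure_tensor (env_alg (borel_C D)) (env_map D) (env_alg D) (character_module (weight_C D lam))
      \<one>\<^bsub>env_alg D\<^esub> 1"

definition baby_verma :: "int set \<Rightarrow> 'g::ab_group_add split_lie
    \<Rightarrow> (('g \<Rightarrow> 'k::field) \<Rightarrow> 'g \<Rightarrow> 'k) \<Rightarrow> (('g \<Rightarrow> 'k) \<Rightarrow> 'k) \<Rightarrow> ('g \<Rightarrow> complex)
    \<Rightarrow> ((('g \<Rightarrow> 'k) word \<Rightarrow>\<^sub>0 'k) set set, (((('g \<Rightarrow> 'k) word \<Rightarrow>\<^sub>0 'k) set set \<times> 'k) \<Rightarrow>\<^sub>0 int) set) module" where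
  "baby_verma S D pm \<chi> lam =
    tensor (reduced_env (borel_K S D) pm (\<lambda>_. 0))
      (quot_map (env_alg (lie_K S D)) (reduced_ideal (lie_K S D) pm \<chi>) (env_map (lie_K S D)))
      (reduced_env (lie_K S D) pm \<chi>)
      (over_quotient (character_module (weight_K S D lam)))"

text \<open>In what follows \<open>N\<close> is a submodule of \<^term>\<open>verma D lam\<close> with simple quotient.
  There is exactly one, and \<^term>\<open>verma D lam QuotM N\<close> is \<open>L\<^sub>\<complex>(lam)\<close>. \<open>U(\<gg>\<^sub>R)\<close> acts through its image in \<open>U(\<gg>\<^sub>\<complex>)\<close>, which is the subring
  generated by \<open>R\<close> and \<open>\<gg>\<^sub>R\<close>.\<close>

definition env_R :: "int set \<Rightarrow> 'g::ab_group_add split_lie \<Rightarrow> ('g word \<Rightarrow>\<^sub>0 complex) set set" where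
  "env_R S D = generate_ring (env_alg D)
    (env_scalar D ` localisation S \<union> env_incl D ` R_span S D (adapted_basis D))"

definition L_R :: "int set \<Rightarrow> 'g::ab_group_add split_lie \<Rightarrow> ('g \<Rightarrow> complex)
    \<Rightarrow> ((('g word \<Rightarrow>\<^sub>0 complex) set \<times> complex) \<Rightarrow>\<^sub>0 int) set set
    \<Rightarrow> (complex, ((('g word \<Rightarrow>\<^sub>0 complex) set \<times> complex) \<Rightarrow>\<^sub>0 int) set set) module" where
  "L_R S D lam N =
    (let L = verma D lam QuotM N; v = N +>\<^bsub>verma D lam\<^esub> verma_gen D lam
     in (with_smult L (\<lambda>r w. env_scalar D r \<odot>\<^bsub>L\<^esub> w))\<lparr>carrier := (\<lambda>u. u \<odot>\<^bsub>L\<^esub> v) ` env_R S D\<rparr>)"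

text \<open>\<open>L\<^sub>p(lam) = \<bbbK> \<otimes>\<^sub>R L\<^sub>R(lam)\<close>, where \<open>b \<otimes> c \<in> \<gg>\<^sub>R \<otimes> \<bbbK> = \<gg>\<^sub>\<bbbK>\<close> acts by \<open>c (id \<otimes> b)\<close>.\<close>

definition L_p :: "int set \<Rightarrow> 'g::ab_group_add split_lie \<Rightarrow> ('g \<Rightarrow> complex)
    \<Rightarrow> ((('g word \<Rightarrow>\<^sub>0 complex) set \<times> complex) \<Rightarrow>\<^sub>0 int) set set
    \<Rightarrow> ((('g \<Rightarrow> 'k::field) word \<Rightarrow>\<^sub>0 'k) set,
        (('k \<times> ((('g word \<Rightarrow>\<^sub>0 complex) set \<times> complex) \<Rightarrow>\<^sub>0 int) set set) \<Rightarrow>\<^sub>0 int) set) module" where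
  "L_p S D lam N =
    (let R = localisation_ring S; K = type_ring; M = L_R S D lam N;
         V = tensor R (reduction S) K M;
         act = (\<lambda>b v. env_incl D b \<odot>\<^bsub>verma D lam QuotM N\<^esub> v)
     in env_module V (\<lambda>y C. \<Oplus>\<^bsub>V\<^esub>b\<in>adapted_basis D. y b \<odot>\<^bsub>V\<^esub> id_tensor R (reduction S) K M (act b) C))"

definition L_p_chi :: "int set \<Rightarrow> 'g::ab_group_add split_lie
    \<Rightarrow> (('g \<Rightarrow> 'k::field) \<Rightarrow> 'g \<Rightarrow> 'k) \<Rightarrow> (('g \<Rightarrow> 'k) \<Rightarrow> 'k) \<Rightarrow> ('g \<Rightarrow> complex)
    \<Rightarrow> ((('g word \<Rightarrow>\<^sub>0 complex) set \<times> complex) \<Rightarrow>\<^sub>0 int) set set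
    \<Rightarrow> ((('g \<Rightarrow> 'k) word \<Rightarrow>\<^sub>0 'k) set set,
        (('k \<times> ((('g word \<Rightarrow>\<^sub>0 complex) set \<times> complex) \<Rightarrow>\<^sub>0 int) set set) \<Rightarrow>\<^sub>0 int) set set) module" where
  "L_p_chi S D pm \<chi> lam N =
    over_quotient (L_p S D lam N QuotM J_submodule (lie_K S D) pm \<chi> (L_p S D lam N))"

end

theory Submission
  imports Defs
begin

text \<open>Write \<open>A = U\<^sub>\<chi>(\<gg>\<^sub>\<bbbK>)\<close>, \<open>W = L\<^sub>p\<^sup>\<chi>(\<lambda>)\<close> and let \<open>Q\<close> be the simple quotient of the baby Verma module. Both \<open>W\<close>
  and \<open>Q\<close> are generated over \<open>A\<close> by one vector, \<open>w\<close> and \<open>q\<close>, on which the Borel subalgebra acts through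
  one and the same weight. The map \<open>u w \<mapsto> u q\<close> is the required surjection as soon as it is well
  defined, that is, as soon as \<open>u w = 0\<close> implies \<open>u q = 0\<close>.

  Suppose that \<open>u w = 0\<close> but \<open>u q \<noteq> 0\<close>. As \<open>Q\<close> is simple, \<open>u\<close> may be multiplied from the left so that
  \<open>u q = q\<close>. For a positive root \<open>\<alpha>\<close> put \<open>y\<^sub>\<alpha> = e\<^sub>-\<^sub>\<alpha> - \<chi>(e\<^sub>-\<^sub>\<alpha>) \<in> A\<close>. Moving the elements of the Borel subalgebra
  to the right (\<open>common_scalar\<close>) gives one scalar \<open>c\<close> with
  \<open>u w - c w \<in> \<Sum>\<^sub>\<alpha> y\<^sub>\<alpha> W\<close> and \<open>u q - c q \<in> \<Sum>\<^sub>\<alpha> y\<^sub>\<alpha> Q\<close>. If \<open>c \<noteq> 0\<close>, then \<open>w \<in> \<Sum>\<^sub>\<alpha> y\<^sub>\<alpha> W\<close>, and hence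
  \<open>W = \<Sum>\<^sub>\<alpha> y\<^sub>\<alpha> W\<close>; if \<open>c = 0\<close>, then likewise \<open>Q = \<Sum>\<^sub>\<alpha> y\<^sub>\<alpha> Q\<close>. Both are impossible for nonzero modules, by a
  Nakayama-type statement (\<open>neg_span_full_imp_trivial\<close>): every \<open>y\<^sub>\<alpha>\<close> is nilpotent, because
  \<open>y\<^sub>\<alpha>\<^sup>p = e\<^sub>-\<^sub>\<alpha>\<^sup>p - \<chi>(e\<^sub>-\<^sub>\<alpha>)\<^sup>p = e\<^sub>-\<^sub>\<alpha>\<^sup>[\<^sup>p\<^sup>] = 0\<close>, and \<open>[y\<^sub>\<alpha>, y\<^sub>\<beta>]\<close> is a multiple of \<open>y\<^sub>\<alpha>\<^sub>+\<^sub>\<beta>\<close>, because a form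
  in standard Levi form vanishes on the root vectors of roots that are not simple. So the \<open>y\<^sub>\<alpha>\<close> can be
  peeled off one at a time, in the order of increasing height.

  This argument is carried out in the locale \<open>triangular_ring\<close>. The rest shows that \<open>W\<close>, \<open>Q\<close> and
  \<open>A\<close> are as claimed. The \<open>p\<close>-centre of the enveloping algebra is central
  (\<open>p_central_commutes\<close>), so \<open>J\<^sub>\<chi> L\<^sub>p(\<lambda>)\<close> is a submodule and \<open>A\<close> acts on the quotient. The
  module \<open>L\<^sub>p(\<lambda>)\<close> is a representation of \<open>\<gg>\<^sub>\<bbbK>\<close> generated by the image of the highest weight vector
  (\<open>act_commutator\<close>, \<open>Lp_cyclic\<close>). The weight \<open>\<lambda>\<close> gives a one-dimensional module over
  \<open>U\<^sub>0(\<bb>\<^sub>\<bbbK>)\<close> because \<open>\<lambda>(x\<^sup>[\<^sup>p\<^sup>]) = \<lambda>(x)\<^sup>p\<close> on the Borel subalgebra (\<open>pm_borel\<close>). The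
  combinatorial input, additivity of weights and heights, is the same for a Chevalley basis and for
  matrix units; it is derived from the locale \<open>split_datum\<close>.\<close>

section \<open>Modules over noncommutative rings\<close>

lemma with_smult_simps [simp]:
  "carrier (with_smult V s) = carrier V" "ring.zero (with_smult V s) = ring.zero V"
  "ring.add (with_smult V s) = ring.add V" "module.smult (with_smult V s) = s"
  by (simp_all add: with_smult_def)

lemma over_quotient_simps [simp]:
  "carrier (over_quotient M) = carrier M" "ring.zero (over_quotient M) = ring.zero M"
  "ring.add (over_quotient M) = ring.add M"
  by (simp_all add: over_quotient_def)

lemma abelian_group_cong:
  assumes "abelian_group M" "carrier M' = carrier M" "ring.add M' = ring.add M"
    "ring.zero M' = ring.zero M"
  shows "abelian_group M'"
proof -
  interpret M: abelian_group M by fact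
  show ?thesis
    by (rule abelian_groupI) (use assms M.add.inv_closed in \<open>auto simp: M.a_ac intro: bexI[of _ "\<ominus>\<^bsub>M\<^esub> _"]\<close>)
qed

lemma (in abelian_group) diff_eq_iff:
  "a \<in> carrier G \<Longrightarrow> b \<in> carrier G \<Longrightarrow> c \<in> carrier G \<Longrightarrow> a \<ominus> b = c \<longleftrightarrow> a = c \<oplus> b"
  by (auto simp: minus_eq a_assoc l_neg r_neg)

lemma (in abelian_group) diff_zero_iff:
  "a \<in> carrier G \<Longrightarrow> b \<in> carrier G \<Longrightarrow> a \<ominus> b = \<zero> \<longleftrightarrow> a = b"
  by (simp add: diff_eq_iff)

context left_module
begin

lemma smult_zero_left: "v \<in> carrier M \<Longrightarrow> \<zero>\<^bsub>A\<^esub> \<odot> v = \<zero>"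
proof -
  assume v: "v \<in> carrier M"
  have "\<zero>\<^bsub>A\<^esub> \<odot> v \<oplus> \<zero>\<^bsub>A\<^esub> \<odot> v = \<zero>\<^bsub>A\<^esub> \<odot> v"
    using smult_l_distr[of "\<zero>\<^bsub>A\<^esub>" "\<zero>\<^bsub>A\<^esub>" v] v by simp
  then show ?thesis
    using v smult_closed[of "\<zero>\<^bsub>A\<^esub>" v] by (simp add: M.add.r_cancel_one)
qed

lemma smult_zero_right: "a \<in> carrier A \<Longrightarrow> a \<odot> \<zero> = \<zero>"
proof -
  assume a: "a \<in> carrier A"
  have "a \<odot> \<zero> \<oplus> a \<odot> \<zero> = a \<odot> \<zero>"
    using smult_r_distr[of a \<zero> \<zero>] a by simp
  then show ?thesis
    using a smult_closed[of a \<zero>] by (simp add: M.add.r_cancel_one)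
qed

lemma smult_minus_left:
  assumes "a \<in> carrier A" "v \<in> carrier M" shows "(\<ominus>\<^bsub>A\<^esub> a) \<odot> v = \<ominus> (a \<odot> v)"
proof -
  have "(\<ominus>\<^bsub>A\<^esub> a) \<odot> v \<oplus> a \<odot> v = \<zero>"
    using assms smult_l_distr[of "\<ominus>\<^bsub>A\<^esub> a" a v] by (simp add: A.l_neg smult_zero_left)
  then show ?thesis
    using assms by (simp add: M.minus_equality smult_closed)
qed

lemma smult_diff_left:
  assumes "a \<in> carrier A" "b \<in> carrier A" "v \<in> carrier M"
  shows "(a \<ominus>\<^bsub>A\<^esub> b) \<odot> v = a \<odot> v \<ominus> b \<odot> v"
  using assms by (simp add: A.minus_eq M.minus_eq smult_l_distr smult_minus_left)

lemma smult_finsum_right: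
  assumes "finite T" "a \<in> carrier A" "g \<in> T \<rightarrow> carrier M"
  shows "a \<odot> (\<Oplus>i\<in>T. g i) = (\<Oplus>i\<in>T. a \<odot> g i)"
  using assms
  by (induction rule: finite_induct)
    (auto simp: smult_zero_right Pi_def smult_r_distr smult_closed)

lemma smult_finsum_left:
  assumes "finite T" "g \<in> T \<rightarrow> carrier A" "v \<in> carrier M"
  shows "(\<Oplus>\<^bsub>A\<^esub>i\<in>T. g i) \<odot> v = (\<Oplus>i\<in>T. g i \<odot> v)"
  using assms
  by (induction rule: finite_induct)
    (auto simp: smult_zero_left Pi_def smult_l_distr smult_closed)

lemma submodule_abelian_subgroup: "submodule H A M \<Longrightarrow> abelian_subgroup H M"
  by (intro abelian_subgroupI3 additive_subgroup.intro M.abelian_group_axioms)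
    (simp add: submodule_def)

lemma submoduleI':
  assumes "H \<subseteq> carrier M" "\<zero> \<in> H"
    "\<And>v w. v \<in> H \<Longrightarrow> w \<in> H \<Longrightarrow> v \<oplus> w \<in> H"
    "\<And>a v. a \<in> carrier A \<Longrightarrow> v \<in> H \<Longrightarrow> a \<odot> v \<in> H"
  shows "submodule H A M"
proof (intro submodule.intro subgroup.intro submodule_axioms.intro)
  fix v assume "v \<in> H"
  then have "\<ominus> v = (\<ominus>\<^bsub>A\<^esub> \<one>\<^bsub>A\<^esub>) \<odot> v"
    using assms(1) by (auto simp: smult_minus_left smult_one)
  then show "inv\<^bsub>add_monoid M\<^esub> v \<in> H"
    using assms(4)[of "\<ominus>\<^bsub>A\<^esub> \<one>\<^bsub>A\<^esub>" v] \<open>v \<in> H\<close> by (simp add: a_inv_def)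
qed (use assms in auto)

lemma cyclic_submodule:
  assumes m: "m \<in> carrier M" shows "submodule ((\<lambda>a. a \<odot> m) ` carrier A) A M"
proof (rule submoduleI')
  show "\<zero> \<in> (\<lambda>a. a \<odot> m) ` carrier A"
    using smult_zero_left[OF m] by (intro image_eqI[of _ _ "\<zero>\<^bsub>A\<^esub>"]) auto
qed (use m in \<open>auto simp: smult_closed simp flip: smult_l_distr smult_assoc\<close>)

end

subsection \<open>Quotients\<close>

text \<open>A map on a quotient may be given by the union of the cosets of the images of all representatives,
  without a choice of one. The union is a single coset when the map sends the first subgroup into
  the second.\<close>

lemma UN_coset:
  assumes "abelian_subgroup N M" "abelian_subgroup N' M'"
    and f: "\<And>v. v \<in> carrier M \<Longrightarrow> f v \<in> carrier M'"
    and add: "\<And>v w. v \<in> carrier M \<Longrightarrow> w \<in> carrier M \<Longrightarrow> f (v \<oplus>\<^bsub>M\<^esub> w) = f v \<oplus>\<^bsub>M'\<^esub> f w"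
    and sub: "\<And>v. v \<in> N \<Longrightarrow> f v \<in> N'" and x: "x \<in> carrier M"
  shows "(\<Union>v\<in>N +>\<^bsub>M\<^esub> x. N' +>\<^bsub>M'\<^esub> f v) = N' +>\<^bsub>M'\<^esub> f x"
proof -
  interpret N: abelian_subgroup N M by fact
  interpret N': abelian_subgroup N' M' by fact
  have "N' +>\<^bsub>M'\<^esub> f v = N' +>\<^bsub>M'\<^esub> f x" if "v \<in> N +>\<^bsub>M\<^esub> x" for v
  proof -
    obtain n where n: "n \<in> N" "v = n \<oplus>\<^bsub>M\<^esub> x"
      using \<open>v \<in> _\<close> by (auto simp: a_r_coset_def')
    then have "f v \<in> N' +>\<^bsub>M'\<^esub> f x"
      using add[of n x] sub[of n] x by (auto simp: a_r_coset_def')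
    then show ?thesis
      using N'.a_repr_independence' f x by blast
  qed
  moreover have "x \<in> N +>\<^bsub>M\<^esub> x"
    using N.a_rcos_self x by simp
  ultimately show ?thesis
    by (intro UN_constant_eq[of x]) blast+
qed

context
  fixes M :: "('a, 'b, 'd) module_scheme" (structure) and N
  assumes sub: "abelian_subgroup N M"
begin

interpretation abelian_subgroup N M
  by (rule sub)

lemma carrier_quot: "carrier (M QuotM N) = (\<lambda>v. N +> v) ` carrier M"
  by (auto simp: quot_module_def A_RCOSETS_def')

lemma zero_quot: "\<zero>\<^bsub>M QuotM N\<^esub> = N"
  by (simp add: quot_module_def)

lemma add_quot:
  "v \<in> carrier M \<Longrightarrow> w \<in> carrier M \<Longrightarrow> (N +> v) \<oplus>\<^bsub>M QuotM N\<^esub> (N +> w) = N +> (v \<oplus> w)"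
  by (simp add: quot_module_def a_rcos_sum)

lemma abelian_group_quot: "abelian_group (M QuotM N)"
proof (rule abelian_groupI)
  fix C assume "C \<in> carrier (M QuotM N)"
  then obtain v where "v \<in> carrier M" "C = N +> v"
    by (auto simp: carrier_quot)
  then show "\<exists>D\<in>carrier (M QuotM N). D \<oplus>\<^bsub>M QuotM N\<^esub> C = \<zero>\<^bsub>M QuotM N\<^esub>"
    by (intro bexI[of _ "N +> (\<ominus> v)"])
      (auto simp: carrier_quot add_quot zero_quot l_neg a_rcos_const)
next
  have "N +> \<zero> = N"
    by (simp add: a_rcos_const)
  then show "\<zero>\<^bsub>M QuotM N\<^esub> \<in> carrier (M QuotM N)"
    by (auto simp: carrier_quot zero_quot intro!: image_eqI[of _ _ \<zero>])
  show "\<zero>\<^bsub>M QuotM N\<^esub> \<oplus>\<^bsub>M QuotM N\<^esub> C = C" if "C \<in> carrier (M QuotM N)" for C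
    using that add_quot[of \<zero>] \<open>N +> \<zero> = N\<close> by (auto simp: carrier_quot zero_quot)
qed (auto simp: carrier_quot add_quot a_ac)

lemma coset_eq_iff:
  "v \<in> carrier M \<Longrightarrow> w \<in> carrier M \<Longrightarrow> N +> v = N +> w \<longleftrightarrow> v \<ominus> w \<in> N"
  by (metis a_rcos_module a_repr_independence' a_repr_independenceD minus_eq)

lemma coset_eq_subgroup_iff: "v \<in> carrier M \<Longrightarrow> N +> v = N \<longleftrightarrow> v \<in> N"
  by (metis a_rcos_const a_rcos_self)

end

lemma quot_smult:
  assumes "abelian_subgroup N M"
    and "\<And>v. v \<in> carrier M \<Longrightarrow> a \<odot>\<^bsub>M\<^esub> v \<in> carrier M"
    and "\<And>v w. v \<in> carrier M \<Longrightarrow> w \<in> carrier M \<Longrightarrow> a \<odot>\<^bsub>M\<^esub> (v \<oplus>\<^bsub>M\<^esub> w) = a \<odot>\<^bsub>M\<^esub> v \<oplus>\<^bsub>M\<^esub> a \<odot>\<^bsub>M\<^esub> w"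
    and "\<And>v. v \<in> N \<Longrightarrow> a \<odot>\<^bsub>M\<^esub> v \<in> N" and "x \<in> carrier M"
  shows "a \<odot>\<^bsub>M QuotM N\<^esub> (N +>\<^bsub>M\<^esub> x) = N +>\<^bsub>M\<^esub> (a \<odot>\<^bsub>M\<^esub> x)"
  using UN_coset[of N M N M "\<lambda>v. a \<odot>\<^bsub>M\<^esub> v" x] assms by (simp add: quot_module_def)

lemma (in left_module) quot_module_smult:
  assumes "submodule N A M" "a \<in> carrier A" "v \<in> carrier M"
  shows "a \<odot>\<^bsub>M QuotM N\<^esub> (N +> v) = N +> (a \<odot> v)"
  using assms
  by (intro quot_smult submodule_abelian_subgroup) (auto simp: smult_closed smult_r_distr submodule.smult_closed)

lemma (in left_module) left_module_quot:
  assumes N: "submodule N A M"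
  shows "left_module A (M QuotM N)"
proof -
  note sub = submodule_abelian_subgroup[OF N]
  show ?thesis
    by (intro left_module.intro left_module_axioms.intro A.ring_axioms abelian_group_quot[OF sub])
      (auto simp: carrier_quot[OF sub] quot_module_smult[OF N] add_quot[OF sub] smult_closed
        smult_l_distr smult_r_distr smult_assoc smult_one)
qed

context left_module
begin

text \<open>All elements of a coset of an annihilating ideal act alike, so the definite description in
  \<^const>\<open>over_quotient\<close> has a unique witness.\<close>

lemma over_quotient_smult:
  assumes I: "ideal I A" and ann: "\<And>a v. a \<in> I \<Longrightarrow> v \<in> carrier M \<Longrightarrow> a \<odot> v = \<zero>"
    and "a \<in> carrier A" "v \<in> carrier M"
  shows "(I +>\<^bsub>A\<^esub> a) \<odot>\<^bsub>over_quotient M\<^esub> v = a \<odot> v"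
proof -
  interpret I: ideal I A by fact
  have same: "b \<odot> v = a \<odot> v" if "b \<in> I +>\<^bsub>A\<^esub> a" for b
  proof -
    obtain i where i: "i \<in> I" "b = i \<oplus>\<^bsub>A\<^esub> a"
      using \<open>b \<in> _\<close> by (auto simp: a_r_coset_def')
    then show ?thesis
      using assms ann[of i v] by (simp add: smult_l_distr smult_closed)
  qed
  have "a \<in> I +>\<^bsub>A\<^esub> a"
    using assms I.a_rcos_self by simp
  with same have "(THE w. \<forall>b\<in>I +>\<^bsub>A\<^esub> a. b \<odot> v = w) = a \<odot> v"
    by (intro the_equality) (blast, metis)
  then show ?thesis
    by (simp add: over_quotient_def)
qed

lemma left_module_over_quotient:
  assumes I: "ideal I A" and ann: "\<And>a v. a \<in> I \<Longrightarrow> v \<in> carrier M \<Longrightarrow> a \<odot> v = \<zero>"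
  shows "left_module (A Quot I) (over_quotient M)"
proof -
  interpret I: ideal I A by fact
  have car: "carrier (A Quot I) = (\<lambda>a. I +>\<^bsub>A\<^esub> a) ` carrier A"
    by (auto simp: FactRing_def A_RCOSETS_def')
  have ops: "(I +>\<^bsub>A\<^esub> a) \<otimes>\<^bsub>A Quot I\<^esub> (I +>\<^bsub>A\<^esub> b) = I +>\<^bsub>A\<^esub> (a \<otimes>\<^bsub>A\<^esub> b)"
    "(I +>\<^bsub>A\<^esub> a) \<oplus>\<^bsub>A Quot I\<^esub> (I +>\<^bsub>A\<^esub> b) = I +>\<^bsub>A\<^esub> (a \<oplus>\<^bsub>A\<^esub> b)"
    if "a \<in> carrier A" "b \<in> carrier A" for a b
    using ring_hom_mult[OF I.rcos_ring_hom] ring_hom_add[OF I.rcos_ring_hom] that by auto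
  have one: "\<one>\<^bsub>A Quot I\<^esub> = I +>\<^bsub>A\<^esub> \<one>\<^bsub>A\<^esub>"
    by (simp add: FactRing_def)
  note smult = over_quotient_smult[OF I ann]
  show ?thesis
    by (intro left_module.intro left_module_axioms.intro I.quotient_is_ring
        abelian_group_cong[OF M.abelian_group_axioms])
      (auto simp: car ops one smult smult_closed smult_l_distr smult_r_distr smult_assoc smult_one)
qed

end


subsection \<open>Tensor products\<close>

lemma additive_subgroup_generate:
  assumes "abelian_group M" "X \<subseteq> carrier M"
  shows "additive_subgroup (generate (add_monoid M) X) M"
proof -
  interpret abelian_group M by fact
  show ?thesis
    using group.generate_is_subgroup[OF a_group] assms(2)
    by (intro additive_subgroup.intro) simp
qed

lemma abelian_subgroup_generate:
  assumes "abelian_group M" "X \<subseteq> carrier M"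
  shows "abelian_subgroup (generate (add_monoid M) X) M"
  using assms by (intro abelian_subgroupI3 additive_subgroup_generate)

lemma additive_zero_minus:
  assumes M: "abelian_group M" and M': "abelian_group M'"
    and f: "\<And>v. v \<in> carrier M \<Longrightarrow> f v \<in> carrier M'"
    and add: "\<And>v w. v \<in> carrier M \<Longrightarrow> w \<in> carrier M \<Longrightarrow> f (v \<oplus>\<^bsub>M\<^esub> w) = f v \<oplus>\<^bsub>M'\<^esub> f w"
  shows additive_zero: "f \<zero>\<^bsub>M\<^esub> = \<zero>\<^bsub>M'\<^esub>"
    and additive_minus: "v \<in> carrier M \<Longrightarrow> f (\<ominus>\<^bsub>M\<^esub> v) = \<ominus>\<^bsub>M'\<^esub> f v"
proof -
  interpret M: abelian_group M by fact
  interpret M': abelian_group M' by fact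
  show zero: "f \<zero>\<^bsub>M\<^esub> = \<zero>\<^bsub>M'\<^esub>"
    using add[of "\<zero>\<^bsub>M\<^esub>" "\<zero>\<^bsub>M\<^esub>"] f[of "\<zero>\<^bsub>M\<^esub>"] by (simp add: M'.add.r_cancel_one')
  show "f (\<ominus>\<^bsub>M\<^esub> v) = \<ominus>\<^bsub>M'\<^esub> f v" if v: "v \<in> carrier M"
  proof -
    have "f (\<ominus>\<^bsub>M\<^esub> v) \<oplus>\<^bsub>M'\<^esub> f v = \<zero>\<^bsub>M'\<^esub>"
      using add[of "\<ominus>\<^bsub>M\<^esub> v" v] v by (simp add: M.l_neg zero)
    then show ?thesis
      using f v by (simp add: M'.minus_equality)
  qed
qed

text \<open>The elements that an additive map sends into a given subgroup form a subgroup, so it is enough to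
  test generators.\<close>

lemma generate_additive_image:
  assumes M: "abelian_group M" and N: "abelian_subgroup N' M'" and X: "X \<subseteq> carrier M"
    and f: "\<And>v. v \<in> carrier M \<Longrightarrow> f v \<in> carrier M'"
    and add: "\<And>v w. v \<in> carrier M \<Longrightarrow> w \<in> carrier M \<Longrightarrow> f (v \<oplus>\<^bsub>M\<^esub> w) = f v \<oplus>\<^bsub>M'\<^esub> f w"
    and sub: "\<And>v. v \<in> X \<Longrightarrow> f v \<in> N'" and x: "x \<in> generate (add_monoid M) X"
  shows "f x \<in> N'"
proof -
  interpret M: abelian_group M by fact
  interpret N: abelian_subgroup N' M' by fact
  note zero = additive_zero[OF M N.abelian_group_axioms f add]
    and minus = additive_minus[OF M N.abelian_group_axioms f add]
  have "f x \<in> N' \<and> x \<in> carrier M"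
    using x
  proof induction
    case one
    then show ?case by (simp add: zero)
  next
    case (incl h)
    then show ?case using sub X by auto
  next
    case (inv h)
    then show ?case using sub X minus[of h]
      by (auto simp flip: a_inv_def)
  next
    case (eng h1 h2)
    then show ?case by (auto simp: add)
  qed
  then show ?thesis ..
qed

locale tensor_context = B?: ring B + N?: left_module A N
  for A :: "('a, 'e) ring_scheme" and \<phi> :: "'a \<Rightarrow> 'b" and B :: "('b, 'c) ring_scheme"
    and N :: "('a, 'n, 'd) module_scheme" +
  assumes map_closed: "a \<in> carrier A \<Longrightarrow> \<phi> a \<in> carrier B"
begin

abbreviation "F \<equiv> tensor_free B N"
abbreviation "rels \<equiv> tensor_relations A \<phi> B N"
abbreviation "T \<equiv> tensor A \<phi> B N"
abbreviation "pt \<equiv> pure_tensor A \<phi> B N"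

lemma free_simps [simp]:
  "carrier F = {t. Poly_Mapping.keys t \<subseteq> carrier B \<times> carrier N}" "t \<oplus>\<^bsub>F\<^esub> u = t + u" "\<zero>\<^bsub>F\<^esub> = 0"
  "b \<odot>\<^bsub>F\<^esub> t = frag_extend (\<lambda>(c, n). frag_of (b \<otimes>\<^bsub>B\<^esub> c, n)) t"
  by (simp_all add: tensor_free_def)

lemma abelian_group_free: "abelian_group F"
proof (rule abelian_groupI)
  fix t assume "t \<in> carrier F"
  then show "\<exists>u\<in>carrier F. u \<oplus>\<^bsub>F\<^esub> t = \<zero>\<^bsub>F\<^esub>"
    by (intro bexI[of _ "-t"]) auto
next
  show "t \<oplus>\<^bsub>F\<^esub> u \<in> carrier F" if "t \<in> carrier F" "u \<in> carrier F" for t u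
    using that Poly_Mapping.keys_add[of t u] by auto
qed (auto simp: add_ac)

interpretation F: abelian_group F
  by (rule abelian_group_free)

definition "bilinear_relations =
     {frag_of (b \<oplus>\<^bsub>B\<^esub> c, n) - frag_of (b, n) - frag_of (c, n) | b c n.
         b \<in> carrier B \<and> c \<in> carrier B \<and> n \<in> carrier N}
    \<union> {frag_of (b, m \<oplus>\<^bsub>N\<^esub> n) - frag_of (b, m) - frag_of (b, n) | b m n.
         b \<in> carrier B \<and> m \<in> carrier N \<and> n \<in> carrier N}
    \<union> {frag_of (b \<otimes>\<^bsub>B\<^esub> \<phi> a, n) - frag_of (b, a \<odot>\<^bsub>N\<^esub> n) | a b n.
         a \<in> carrier A \<and> b \<in> carrier B \<and> n \<in> carrier N}"

lemma bilinear_relationsI: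
  "\<lbrakk>b \<in> carrier B; c \<in> carrier B; n \<in> carrier N\<rbrakk> \<Longrightarrow>
    frag_of (b \<oplus>\<^bsub>B\<^esub> c, n) - frag_of (b, n) - frag_of (c, n) \<in> bilinear_relations"
  "\<lbrakk>b \<in> carrier B; m \<in> carrier N; n \<in> carrier N\<rbrakk> \<Longrightarrow>
    frag_of (b, m \<oplus>\<^bsub>N\<^esub> n) - frag_of (b, m) - frag_of (b, n) \<in> bilinear_relations"
  "\<lbrakk>a \<in> carrier A; b \<in> carrier B; n \<in> carrier N\<rbrakk> \<Longrightarrow>
    frag_of (b \<otimes>\<^bsub>B\<^esub> \<phi> a, n) - frag_of (b, a \<odot>\<^bsub>N\<^esub> n) \<in> bilinear_relations"
  unfolding bilinear_relations_def by blast+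

lemma frag_of_closed: "b \<in> carrier B \<Longrightarrow> n \<in> carrier N \<Longrightarrow> frag_of (b, n) \<in> carrier F"
  by (simp add: keys_frag_of)

lemma diff_closed: "t \<in> carrier F \<Longrightarrow> u \<in> carrier F \<Longrightarrow> t - u \<in> carrier F"
  using keys_diff[of t u] by auto

lemma bilinear_relations_closed: "bilinear_relations \<subseteq> carrier F"
  unfolding bilinear_relations_def
  by (auto intro!: diff_closed frag_of_closed simp: N.smult_closed map_closed simp del: free_simps)

lemma rels_eq: "rels = generate (add_monoid F) bilinear_relations"
  by (simp only: tensor_relations_def bilinear_relations_def)

lemma rels_subgroup: "abelian_subgroup rels F"
  unfolding rels_eq
  by (intro abelian_subgroup_generate bilinear_relations_closed F.abelian_group_axioms)

interpretation rels: abelian_subgroup rels F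
  by (rule rels_subgroup)

lemma diff_in_rels: "t \<in> carrier F \<Longrightarrow> u \<in> carrier F \<Longrightarrow> t - u \<in> rels \<longleftrightarrow> rels +>\<^bsub>F\<^esub> t = rels +>\<^bsub>F\<^esub> u"
proof -
  assume "t \<in> carrier F" and u: "u \<in> carrier F"
  have "\<ominus>\<^bsub>F\<^esub> u = - u"
    using u by (intro F.minus_equality) auto
  then have "t \<ominus>\<^bsub>F\<^esub> u = t - u"
    by (simp add: F.minus_eq)
  then show ?thesis
    using coset_eq_iff[OF rels_subgroup] \<open>t \<in> _\<close> u by simp
qed

lemma coset_add: "t \<in> carrier F \<Longrightarrow> u \<in> carrier F \<Longrightarrow>
    (rels +>\<^bsub>F\<^esub> t) \<oplus>\<^bsub>T\<^esub> (rels +>\<^bsub>F\<^esub> u) = rels +>\<^bsub>F\<^esub> (t + u)"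
  using add_quot[OF rels_subgroup, of t u] by (simp add: tensor_def)

lemma carrier_tensor: "carrier T = (\<lambda>t. rels +>\<^bsub>F\<^esub> t) ` carrier F"
  unfolding tensor_def by (rule carrier_quot[OF rels_subgroup])

lemma abelian_group_tensor: "abelian_group T"
  unfolding tensor_def by (rule abelian_group_quot[OF rels_subgroup])

interpretation T: abelian_group T
  by (rule abelian_group_tensor)

lemma pt_closed: "b \<in> carrier B \<Longrightarrow> n \<in> carrier N \<Longrightarrow> pt b n \<in> carrier T"
  using frag_of_closed by (auto simp: carrier_tensor pure_tensor_def simp del: free_simps)

lemma pt_add_left:
  assumes "b \<in> carrier B" "c \<in> carrier B" "n \<in> carrier N"
  shows "pt (b \<oplus>\<^bsub>B\<^esub> c) n = pt b n \<oplus>\<^bsub>T\<^esub> pt c n"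
proof -
  have "frag_of (b \<oplus>\<^bsub>B\<^esub> c, n) - frag_of (b, n) - frag_of (c, n) \<in> rels"
    unfolding rels_eq
    by (rule generate.incl) (intro bilinear_relationsI assms)
  then have "rels +>\<^bsub>F\<^esub> frag_of (b \<oplus>\<^bsub>B\<^esub> c, n) = rels +>\<^bsub>F\<^esub> (frag_of (b, n) + frag_of (c, n))"
    using assms frag_of_closed F.add.m_closed[of "frag_of (b, n)" "frag_of (c, n)"]
    by (subst diff_in_rels[symmetric]) (simp_all add: diff_diff_eq keys_frag_of)
  then show ?thesis
    using assms by (simp add: pure_tensor_def coset_add keys_frag_of)
qed

lemma pt_add_right:
  assumes "b \<in> carrier B" "m \<in> carrier N" "n \<in> carrier N"
  shows "pt b (m \<oplus>\<^bsub>N\<^esub> n) = pt b m \<oplus>\<^bsub>T\<^esub> pt b n"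
proof -
  have "frag_of (b, m \<oplus>\<^bsub>N\<^esub> n) - frag_of (b, m) - frag_of (b, n) \<in> rels"
    unfolding rels_eq
    by (rule generate.incl) (intro bilinear_relationsI assms)
  then have "rels +>\<^bsub>F\<^esub> frag_of (b, m \<oplus>\<^bsub>N\<^esub> n) = rels +>\<^bsub>F\<^esub> (frag_of (b, m) + frag_of (b, n))"
    using assms frag_of_closed F.add.m_closed[of "frag_of (b, m)" "frag_of (b, n)"]
    by (subst diff_in_rels[symmetric]) (simp_all add: diff_diff_eq keys_frag_of)
  then show ?thesis
    using assms by (simp add: pure_tensor_def coset_add keys_frag_of)
qed

lemma pt_balanced:
  assumes "a \<in> carrier A" "b \<in> carrier B" "n \<in> carrier N"
  shows "pt (b \<otimes>\<^bsub>B\<^esub> \<phi> a) n = pt b (a \<odot>\<^bsub>N\<^esub> n)"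
proof -
  have "frag_of (b \<otimes>\<^bsub>B\<^esub> \<phi> a, n) - frag_of (b, a \<odot>\<^bsub>N\<^esub> n) \<in> rels"
    unfolding rels_eq
    by (rule generate.incl) (intro bilinear_relationsI assms)
  then show ?thesis
    using assms N.smult_closed map_closed
    by (subst (asm) diff_in_rels) (simp_all add: pure_tensor_def keys_frag_of)
qed

lemma pt_zero_right:
  assumes "b \<in> carrier B" shows "pt b \<zero>\<^bsub>N\<^esub> = \<zero>\<^bsub>T\<^esub>"
proof -
  have "pt b \<zero>\<^bsub>N\<^esub> \<oplus>\<^bsub>T\<^esub> pt b \<zero>\<^bsub>N\<^esub> = pt b \<zero>\<^bsub>N\<^esub>"
    using pt_add_right[of b "\<zero>\<^bsub>N\<^esub>" "\<zero>\<^bsub>N\<^esub>"] assms by simp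
  then show ?thesis
    using assms pt_closed[of b "\<zero>\<^bsub>N\<^esub>"] by (simp add: T.add.r_cancel_one)
qed

text \<open>The free abelian group on the pairs is generated by them, so its quotient is generated by the
  pure tensors.\<close>

lemma tensor_subgroup_eq:
  assumes G: "additive_subgroup G T"
    and pt: "\<And>b n. b \<in> carrier B \<Longrightarrow> n \<in> carrier N \<Longrightarrow> pt b n \<in> G"
  shows "G = carrier T"
proof -
  interpret G: additive_subgroup G T by fact
  have "rels +>\<^bsub>F\<^esub> t \<in> G" if "t \<in> carrier F" for t
  proof -
    have "rels +>\<^bsub>F\<^esub> t \<in> G \<and> t \<in> carrier F"
      using that[simplified]
    proof (induction t rule: frag_induction)
      case zero
      then show ?case
        using zero_quot[OF rels_subgroup] coset_eq_subgroup_iff[OF rels_subgroup, of 0] G.zero_closed rels.zero_closed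
        by (simp add: tensor_def)
    next
      case (one x)
      then show ?case using pt frag_of_closed by (auto simp: pure_tensor_def)
    next
      case (diff a b)
      have ab: "a - b \<in> carrier F" using diff diff_closed by blast
      then have "(rels +>\<^bsub>F\<^esub> (a - b)) \<oplus>\<^bsub>T\<^esub> (rels +>\<^bsub>F\<^esub> b) = rels +>\<^bsub>F\<^esub> a"
        using diff by (subst coset_add) auto
      moreover have "rels +>\<^bsub>F\<^esub> (a - b) \<in> carrier T"
        using ab carrier_tensor by blast
      moreover have "rels +>\<^bsub>F\<^esub> b \<in> carrier T"
        using diff G.a_subset by blast
      ultimately have "rels +>\<^bsub>F\<^esub> (a - b) = (rels +>\<^bsub>F\<^esub> a) \<oplus>\<^bsub>T\<^esub> \<ominus>\<^bsub>T\<^esub> (rels +>\<^bsub>F\<^esub> b)"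
        by (metis T.a_assoc T.r_neg T.r_zero T.a_inv_closed)
      then show ?case
        using ab diff by (metis G.a_closed G.a_inv_closed)
    qed
    then show ?thesis ..
  qed
  then show ?thesis
    using G.a_subset by (auto simp: carrier_tensor)
qed

lemma additive_frag_extend:
  assumes f: "\<And>b n. b \<in> carrier B \<Longrightarrow> n \<in> carrier N \<Longrightarrow> f (b, n) \<in> carrier F" and t: "t \<in> carrier F"
  shows "frag_extend f t \<in> carrier F"
proof -
  have "Poly_Mapping.keys (f x) \<subseteq> carrier B \<times> carrier N" if "x \<in> Poly_Mapping.keys t" for x
    using f[of "fst x" "snd x"] t that by (cases x) auto
  then show ?thesis
    using keys_frag_extend[of f t] by (simp, blast)
qed

text \<open>An additive endomorphism of the free group that respects the three kinds of relations descends
  to the tensor product; scalar multiplication and \<^const>\<open>id_tensor\<close> are of this form.\<close>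

lemma bilinear_map_descends:
  assumes g: "\<And>b. b \<in> carrier B \<Longrightarrow> g b \<in> carrier B" and h: "\<And>n. n \<in> carrier N \<Longrightarrow> h n \<in> carrier N"
    and g_add: "\<And>b c. b \<in> carrier B \<Longrightarrow> c \<in> carrier B \<Longrightarrow> g (b \<oplus>\<^bsub>B\<^esub> c) = g b \<oplus>\<^bsub>B\<^esub> g c"
    and h_add: "\<And>m n. m \<in> carrier N \<Longrightarrow> n \<in> carrier N \<Longrightarrow> h (m \<oplus>\<^bsub>N\<^esub> n) = h m \<oplus>\<^bsub>N\<^esub> h n"
    and g_map: "\<And>a b. a \<in> carrier A \<Longrightarrow> b \<in> carrier B \<Longrightarrow> g (b \<otimes>\<^bsub>B\<^esub> \<phi> a) = g b \<otimes>\<^bsub>B\<^esub> \<phi> a"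
    and h_smult: "\<And>a n. a \<in> carrier A \<Longrightarrow> n \<in> carrier N \<Longrightarrow> h (a \<odot>\<^bsub>N\<^esub> n) = a \<odot>\<^bsub>N\<^esub> h n"
    and t: "t \<in> carrier F"
  defines "f \<equiv> frag_extend (\<lambda>(b, n). frag_of (g b, h n))"
  shows "(\<Union>u\<in>rels +>\<^bsub>F\<^esub> t. rels +>\<^bsub>F\<^esub> f u) = rels +>\<^bsub>F\<^esub> f t"
    and "\<And>u. u \<in> rels \<Longrightarrow> f u \<in> rels" and "\<And>u. u \<in> carrier F \<Longrightarrow> f u \<in> carrier F"
proof -
  show f_closed: "f u \<in> carrier F" if "u \<in> carrier F" for u
    unfolding f_def using that g h
    by (intro additive_frag_extend) (auto simp: keys_frag_of)
  have f_add: "f (u \<oplus>\<^bsub>F\<^esub> v) = f u \<oplus>\<^bsub>F\<^esub> f v" for u v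
    by (simp add: f_def frag_extend_add)
  show rels: "f u \<in> rels" if "u \<in> rels" for u
  proof (rule generate_additive_image[OF F.abelian_group_axioms rels_subgroup
        bilinear_relations_closed f_closed f_add])
    show "u \<in> generate (add_monoid F) bilinear_relations"
      using that by (simp only: rels_eq)
    fix v assume "v \<in> bilinear_relations"
    then consider
        b c n where "v = frag_of (b \<oplus>\<^bsub>B\<^esub> c, n) - frag_of (b, n) - frag_of (c, n)"
          "b \<in> carrier B" "c \<in> carrier B" "n \<in> carrier N"
      | b m n where "v = frag_of (b, m \<oplus>\<^bsub>N\<^esub> n) - frag_of (b, m) - frag_of (b, n)"
          "b \<in> carrier B" "m \<in> carrier N" "n \<in> carrier N"
      | a b n where "v = frag_of (b \<otimes>\<^bsub>B\<^esub> \<phi> a, n) - frag_of (b, a \<odot>\<^bsub>N\<^esub> n)"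
          "a \<in> carrier A" "b \<in> carrier B" "n \<in> carrier N"
      unfolding bilinear_relations_def by blast
    then have "f v \<in> bilinear_relations"
    proof cases
      case (1 b c n)
      then show ?thesis
        using bilinear_relationsI(1)[of "g b" "g c" "h n"] g h
        by (simp add: f_def frag_extend_diff g_add)
    next
      case (2 b m n)
      then show ?thesis
        using bilinear_relationsI(2)[of "g b" "h m" "h n"] g h
        by (simp add: f_def frag_extend_diff h_add)
    next
      case (3 a b n)
      then show ?thesis
        using bilinear_relationsI(3)[of a "g b" "h n"] g h
        by (simp add: f_def frag_extend_diff g_map h_smult)
    qed
    then show "f v \<in> rels"
      unfolding rels_eq by (rule generate.incl)
  qed
  show "(\<Union>u\<in>rels +>\<^bsub>F\<^esub> t. rels +>\<^bsub>F\<^esub> f u) = rels +>\<^bsub>F\<^esub> f t"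
    using UN_coset[OF rels_subgroup rels_subgroup f_closed f_add rels t] by simp
qed

lemma smult_coset:
  assumes "b \<in> carrier B" "t \<in> carrier F"
  shows "b \<odot>\<^bsub>T\<^esub> (rels +>\<^bsub>F\<^esub> t) = rels +>\<^bsub>F\<^esub> (b \<odot>\<^bsub>F\<^esub> t)"
  unfolding tensor_def
  by (rule quot_smult[OF rels_subgroup])
    (use assms bilinear_map_descends[of "\<lambda>c. b \<otimes>\<^bsub>B\<^esub> c" "\<lambda>n. n"] in
      \<open>simp_all add: B.r_distr B.m_assoc map_closed frag_extend_add\<close>)

lemma smult_pt:
  assumes "b \<in> carrier B" "c \<in> carrier B" "n \<in> carrier N"
  shows "b \<odot>\<^bsub>T\<^esub> pt c n = pt (b \<otimes>\<^bsub>B\<^esub> c) n"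
  using smult_coset[of b "frag_of (c, n)"] assms by (simp add: pure_tensor_def keys_frag_of)

lemma smult_tensor_closed:
  assumes "b \<in> carrier B" "z \<in> carrier T" shows "b \<odot>\<^bsub>T\<^esub> z \<in> carrier T"
proof -
  obtain t where t: "t \<in> carrier F" "z = rels +>\<^bsub>F\<^esub> t"
    using assms by (auto simp: carrier_tensor simp del: free_simps)
  then show ?thesis
    using assms bilinear_map_descends(3)[of "\<lambda>c. b \<otimes>\<^bsub>B\<^esub> c" "\<lambda>n. n" t t]
    by (auto simp: smult_coset carrier_tensor B.r_distr B.m_assoc map_closed)
qed

lemma smult_tensor_add:
  assumes "b \<in> carrier B" "z \<in> carrier T" "y \<in> carrier T"
  shows "b \<odot>\<^bsub>T\<^esub> (z \<oplus>\<^bsub>T\<^esub> y) = b \<odot>\<^bsub>T\<^esub> z \<oplus>\<^bsub>T\<^esub> b \<odot>\<^bsub>T\<^esub> y"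
proof -
  obtain t u where t: "t \<in> carrier F" "z = rels +>\<^bsub>F\<^esub> t" "u \<in> carrier F" "y = rels +>\<^bsub>F\<^esub> u"
    using assms by (auto simp: carrier_tensor simp del: free_simps)
  have cl: "b \<odot>\<^bsub>F\<^esub> v \<in> carrier F" if "v \<in> carrier F" for v
    using assms that bilinear_map_descends(3)[of "\<lambda>c. b \<otimes>\<^bsub>B\<^esub> c" "\<lambda>n. n" v v]
    by (simp add: B.r_distr B.m_assoc map_closed)
  have "t + u \<in> carrier F" using F.add.m_closed[of t u] t by simp
  moreover have "b \<odot>\<^bsub>F\<^esub> (t + u) = b \<odot>\<^bsub>F\<^esub> t + b \<odot>\<^bsub>F\<^esub> u"
    by (simp add: frag_extend_add)
  ultimately show ?thesis
    using assms t cl by (simp add: smult_coset coset_add del: free_simps)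
qed

text \<open>Additive maps agree on a subgroup, so only pure tensors have to be compared.\<close>

lemma tensor_eqI:
  assumes "\<And>z y. z \<in> carrier T \<Longrightarrow> y \<in> carrier T \<Longrightarrow> f (z \<oplus>\<^bsub>T\<^esub> y) = f z \<oplus>\<^bsub>T\<^esub> f y"
    and "\<And>z y. z \<in> carrier T \<Longrightarrow> y \<in> carrier T \<Longrightarrow> g (z \<oplus>\<^bsub>T\<^esub> y) = g z \<oplus>\<^bsub>T\<^esub> g y"
    and "\<And>z. z \<in> carrier T \<Longrightarrow> f z \<in> carrier T" "\<And>z. z \<in> carrier T \<Longrightarrow> g z \<in> carrier T"
    and "\<And>b n. b \<in> carrier B \<Longrightarrow> n \<in> carrier N \<Longrightarrow> f (pt b n) = g (pt b n)"
    and "z \<in> carrier T"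
  shows "f z = g z"
proof -
  note f_simps = additive_zero_minus[OF abelian_group_tensor abelian_group_tensor assms(3,1)]
    and g_simps = additive_zero_minus[OF abelian_group_tensor abelian_group_tensor assms(4,2)]
  have "additive_subgroup {z \<in> carrier T. f z = g z} T"
    using assms
    by (intro additive_subgroup.intro subgroup.intro) (auto simp: f_simps g_simps simp flip: a_inv_def)
  then have "{z \<in> carrier T. f z = g z} = carrier T"
    by (rule tensor_subgroup_eq) (use assms pt_closed in auto)
  then show ?thesis using assms by auto
qed

theorem left_module_tensor: "left_module B T"
proof (intro left_module.intro left_module_axioms.intro B.ring_axioms abelian_group_tensor
    smult_tensor_closed smult_tensor_add)
  fix a b z assume *: "a \<in> carrier B" "b \<in> carrier B" "z \<in> carrier T"
  note [simp] = smult_tensor_add smult_tensor_closed smult_pt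
  show "(a \<oplus>\<^bsub>B\<^esub> b) \<odot>\<^bsub>T\<^esub> z = a \<odot>\<^bsub>T\<^esub> z \<oplus>\<^bsub>T\<^esub> b \<odot>\<^bsub>T\<^esub> z"
    by (rule tensor_eqI[where f = "\<lambda>z. (a \<oplus>\<^bsub>B\<^esub> b) \<odot>\<^bsub>T\<^esub> z" and g = "\<lambda>z. a \<odot>\<^bsub>T\<^esub> z \<oplus>\<^bsub>T\<^esub> b \<odot>\<^bsub>T\<^esub> z" and z = z])
      (use * in \<open>auto simp: B.l_distr pt_add_left T.a_ac\<close>)
  show "(a \<otimes>\<^bsub>B\<^esub> b) \<odot>\<^bsub>T\<^esub> z = a \<odot>\<^bsub>T\<^esub> (b \<odot>\<^bsub>T\<^esub> z)"
    by (rule tensor_eqI[where f = "\<lambda>z. (a \<otimes>\<^bsub>B\<^esub> b) \<odot>\<^bsub>T\<^esub> z" and g = "\<lambda>z. a \<odot>\<^bsub>T\<^esub> (b \<odot>\<^bsub>T\<^esub> z)" and z = z])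
      (use * in \<open>auto simp: B.m_assoc\<close>)
next
  fix z assume *: "z \<in> carrier T"
  note [simp] = smult_tensor_add smult_tensor_closed smult_pt
  show "\<one>\<^bsub>B\<^esub> \<odot>\<^bsub>T\<^esub> z = z"
    by (rule tensor_eqI[where f = "\<lambda>z. \<one>\<^bsub>B\<^esub> \<odot>\<^bsub>T\<^esub> z" and g = "\<lambda>z. z" and z = z]) (use * in auto)
qed

lemma id_tensor_hom:
  assumes h: "\<And>n. n \<in> carrier N \<Longrightarrow> h n \<in> carrier N"
    and h_add: "\<And>m n. m \<in> carrier N \<Longrightarrow> n \<in> carrier N \<Longrightarrow> h (m \<oplus>\<^bsub>N\<^esub> n) = h m \<oplus>\<^bsub>N\<^esub> h n"
    and h_smult: "\<And>a n. a \<in> carrier A \<Longrightarrow> n \<in> carrier N \<Longrightarrow> h (a \<odot>\<^bsub>N\<^esub> n) = a \<odot>\<^bsub>N\<^esub> h n"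
  shows "\<And>b n. b \<in> carrier B \<Longrightarrow> n \<in> carrier N \<Longrightarrow> id_tensor A \<phi> B N h (pt b n) = pt b (h n)"
    and "\<And>z. z \<in> carrier T \<Longrightarrow> id_tensor A \<phi> B N h z \<in> carrier T"
    and "\<And>z y. z \<in> carrier T \<Longrightarrow> y \<in> carrier T \<Longrightarrow>
      id_tensor A \<phi> B N h (z \<oplus>\<^bsub>T\<^esub> y) = id_tensor A \<phi> B N h z \<oplus>\<^bsub>T\<^esub> id_tensor A \<phi> B N h y"
    and "\<And>b z. b \<in> carrier B \<Longrightarrow> z \<in> carrier T \<Longrightarrow>
      id_tensor A \<phi> B N h (b \<odot>\<^bsub>T\<^esub> z) = b \<odot>\<^bsub>T\<^esub> id_tensor A \<phi> B N h z"
proof -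
  let ?f = "frag_extend (\<lambda>(b, n). frag_of (b, h n))"
  note desc = bilinear_map_descends[of "\<lambda>b. b" h, OF _ h _ h_add _ h_smult, simplified]
  have coset: "id_tensor A \<phi> B N h (rels +>\<^bsub>F\<^esub> t) = rels +>\<^bsub>F\<^esub> ?f t" if "t \<in> carrier F" for t
    using desc(1)[of t] that by (simp add: id_tensor_def)
  show pt: "id_tensor A \<phi> B N h (pt b n) = pt b (h n)" if "b \<in> carrier B" "n \<in> carrier N" for b n
    using that by (simp add: pure_tensor_def coset keys_frag_of)
  show closed: "id_tensor A \<phi> B N h z \<in> carrier T" if "z \<in> carrier T" for z
    using that desc(3) by (auto simp: carrier_tensor coset)
  show add: "id_tensor A \<phi> B N h (z \<oplus>\<^bsub>T\<^esub> y) = id_tensor A \<phi> B N h z \<oplus>\<^bsub>T\<^esub> id_tensor A \<phi> B N h y"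
    if zy: "z \<in> carrier T" "y \<in> carrier T" for z y
  proof -
    obtain t u where t: "t \<in> carrier F" "z = rels +>\<^bsub>F\<^esub> t" "u \<in> carrier F" "y = rels +>\<^bsub>F\<^esub> u"
      using zy by (auto simp: carrier_tensor simp del: free_simps)
    moreover have "t + u \<in> carrier F" using F.add.m_closed[of t u] t by simp
    moreover have "?f t \<in> carrier F" "?f u \<in> carrier F"
      using desc(3)[of t] desc(3)[of u] t by simp_all
    ultimately show ?thesis
      by (simp add: coset coset_add frag_extend_add del: free_simps)
  qed
  show "id_tensor A \<phi> B N h (b \<odot>\<^bsub>T\<^esub> z) = b \<odot>\<^bsub>T\<^esub> id_tensor A \<phi> B N h z"
    if b: "b \<in> carrier B" and z: "z \<in> carrier T" for b z
  proof (rule tensor_eqI[where f = "\<lambda>z. id_tensor A \<phi> B N h (b \<odot>\<^bsub>T\<^esub> z)"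
          and g = "\<lambda>z. b \<odot>\<^bsub>T\<^esub> id_tensor A \<phi> B N h z" and z = z])
    fix c n assume "c \<in> carrier B" "n \<in> carrier N"
    then show "id_tensor A \<phi> B N h (b \<odot>\<^bsub>T\<^esub> pt c n) = b \<odot>\<^bsub>T\<^esub> id_tensor A \<phi> B N h (pt c n)"
      using b by (simp add: smult_pt pt h)
  next
    fix z y assume zy: "z \<in> carrier T" "y \<in> carrier T"
    show "id_tensor A \<phi> B N h (b \<odot>\<^bsub>T\<^esub> (z \<oplus>\<^bsub>T\<^esub> y)) =
        id_tensor A \<phi> B N h (b \<odot>\<^bsub>T\<^esub> z) \<oplus>\<^bsub>T\<^esub> id_tensor A \<phi> B N h (b \<odot>\<^bsub>T\<^esub> y)"
      unfolding smult_tensor_add[OF b zy] using b zy by (intro add smult_tensor_closed)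
    show "b \<odot>\<^bsub>T\<^esub> id_tensor A \<phi> B N h (z \<oplus>\<^bsub>T\<^esub> y) =
        b \<odot>\<^bsub>T\<^esub> id_tensor A \<phi> B N h z \<oplus>\<^bsub>T\<^esub> b \<odot>\<^bsub>T\<^esub> id_tensor A \<phi> B N h y"
      unfolding add[OF zy] using b zy by (intro smult_tensor_add closed)
  qed (use b z in \<open>auto intro: smult_tensor_closed closed\<close>)
qed

end


section \<open>The p-th power of a difference of commuting operators\<close>

text \<open>Left multiplication by \<open>a\<close> and right multiplication by \<open>b\<close> commute, so their difference obeys
  the binomial theorem although \<open>a\<close>, \<open>b\<close> and \<open>x\<close> need not commute.\<close>

lemma funpow_left_minus_right:
  fixes a b x :: "'r::ring_1"
  shows "((\<lambda>x. a * x - x * b) ^^ n) x =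
    (\<Sum>k\<le>n. of_int ((-1) ^ k * int (n choose k)) * (a ^ (n - k) * x * b ^ k))"
proof (induction n)
  case (Suc n)
  define c :: "nat \<Rightarrow> nat \<Rightarrow> 'r" where "c m k = of_int ((-1) ^ k * int (m choose k))" for m k
  define T where "T m k = a ^ (m - k) * x * b ^ k" for m k
  have comm: "z * c m k = c m k * z" for z m k
    unfolding c_def by (rule mult_of_int_commute[symmetric])
  \<comment> \<open>Pascal's rule with signs\<close>
  have c_Suc: "c (Suc n) (Suc k) = c n (Suc k) - c n k" for k
  proof -
    have "(-1) ^ Suc k * int (Suc n choose Suc k) =
        (-1) ^ Suc k * int (n choose Suc k) - (-1) ^ k * int (n choose k)"
      by (simp add: algebra_simps)
    then show ?thesis
      by (simp only: c_def of_int_diff)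
  qed
  have aT: "a * T n k = T (Suc n) k" if "k \<le> n" for k
    using that by (simp add: T_def Suc_diff_le mult.assoc)
  have Tb: "T n k * b = T (Suc n) (Suc k)" for k
    by (simp add: T_def mult.assoc power_commutes)
  have IH: "((\<lambda>x. a * x - x * b) ^^ n) x = (\<Sum>k\<le>n. c n k * T n k)"
    using Suc by (simp add: c_def T_def)
  have "((\<lambda>x. a * x - x * b) ^^ Suc n) x
      = a * (\<Sum>k\<le>n. c n k * T n k) - (\<Sum>k\<le>n. c n k * T n k) * b"
    by (simp add: IH)
  also have "a * (\<Sum>k\<le>n. c n k * T n k) = (\<Sum>k\<le>n. c n k * T (Suc n) k)"
    unfolding sum_distrib_left
  proof (intro sum.cong refl)
    fix k assume "k \<in> {..n}"
    then have "a * (c n k * T n k) = c n k * (a * T n k)"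
      by (metis comm mult.assoc)
    then show "a * (c n k * T n k) = c n k * T (Suc n) k"
      using aT \<open>k \<in> _\<close> by simp
  qed
  also have "(\<Sum>k\<le>n. c n k * T n k) * b = (\<Sum>k\<le>n. c n k * T (Suc n) (Suc k))"
    unfolding sum_distrib_right by (simp add: mult.assoc Tb)
  also have "(\<Sum>k\<le>n. c n k * T (Suc n) k) = (\<Sum>k\<le>Suc n. c n k * T (Suc n) k)"
    by (simp add: c_def binomial_eq_0)
  also have "\<dots> = c n 0 * T (Suc n) 0 + (\<Sum>k\<le>n. c n (Suc k) * T (Suc n) (Suc k))"
    by (rule sum.atMost_Suc_shift)
  also have "\<dots> - (\<Sum>k\<le>n. c n k * T (Suc n) (Suc k)) =
      c (Suc n) 0 * T (Suc n) 0 + (\<Sum>k\<le>n. c (Suc n) (Suc k) * T (Suc n) (Suc k))"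
    by (simp add: c_Suc left_diff_distrib sum_subtractf) (simp add: c_def)
  also have "\<dots> = (\<Sum>k\<le>Suc n. c (Suc n) k * T (Suc n) k)"
    by (rule sum.atMost_Suc_shift[symmetric])
  finally show ?case by (simp only: c_def T_def)
qed simp

text \<open>In characteristic \<open>p\<close> only the two extreme binomial coefficients survive. For \<open>a = b\<close> this is
  \<open>ad(a)\<^sup>p = ad(a\<^sup>p)\<close>.\<close>

lemma funpow_prime_left_minus_right:
  fixes a b x :: "'r::ring_1"
  assumes p: "prime p" and char: "of_nat p = (0 :: 'r)"
  shows "((\<lambda>x. a * x - x * b) ^^ p) x = a ^ p * x - x * b ^ p"
proof -
  obtain q where q: "p = Suc q" "q > 0"
    using prime_gt_1_nat[OF p] by (cases p) auto
  have zero: "of_int ((-1) ^ k * int (p choose k)) = (0 :: 'r)" if "0 < k" "k < p" for k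
  proof -
    have "p dvd p choose k"
      using that p by (intro dvd_choose_prime) auto
    then obtain m where "p choose k = p * m" ..
    then show ?thesis by (simp add: char)
  qed
  \<comment> \<open>for \<open>p = 2\<close> the sign is immaterial, as \<open>1 = - 1\<close> in characteristic two\<close>
  have "(-1) ^ p = (-1 :: 'r)"
  proof (cases "p = 2")
    case True
    then have "(1 :: 'r) + 1 = 0"
      using char by simp
    then show ?thesis using True by (simp add: eq_neg_iff_add_eq_0)
  next
    case False
    then show ?thesis
      using prime_odd_nat[OF p] prime_gt_1_nat[OF p] by simp
  qed
  then have last: "of_int ((-1) ^ p * int (p choose p)) = (-1 :: 'r)"
    by simp
  have "((\<lambda>x. a * x - x * b) ^^ p) x =
      (\<Sum>k\<le>Suc q. of_int ((-1) ^ k * int (p choose k)) * (a ^ (p - k) * x * b ^ k))"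
    unfolding funpow_left_minus_right by (simp only: q(1))
  also have "\<dots> = (\<Sum>k\<in>{0, p}. of_int ((-1) ^ k * int (p choose k)) * (a ^ (p - k) * x * b ^ k))"
    using zero q by (intro sum.mono_neutral_right) (auto simp del: of_int_mult of_int_power)
  also have "\<dots> = a ^ p * x - x * b ^ p"
    using last q by (simp del: of_int_mult of_int_power)
  finally show ?thesis .
qed

text \<open>For commuting \<open>a\<close> and \<open>b\<close>, applying the difference of multiplications \<open>n\<close> times to \<open>1\<close> gives
  \<open>(a - b)\<^sup>n\<close>.\<close>

lemma power_prime_diff_commuting:
  fixes a b :: "'r::ring_1"
  assumes p: "prime p" and char: "of_nat p = (0 :: 'r)" and comm: "a * b = b * a"
  shows "(a - b) ^ p = a ^ p - b ^ p"
proof -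
  have "((\<lambda>x. a * x - x * b) ^^ n) 1 = (a - b) ^ n" for n
  proof (induction n)
    case (Suc n)
    have "(a - b) ^ n * b = b * (a - b) ^ n"
      by (rule power_commuting_commutes) (simp add: algebra_simps comm)
    then show ?case using Suc by (simp add: algebra_simps)
  qed simp
  then show ?thesis
    using funpow_prime_left_minus_right[OF p char, of a b 1] by simp
qed


section \<open>The free algebra\<close>

lemma type_ring_simps [simp]:
  "carrier type_ring = UNIV" "x \<otimes>\<^bsub>type_ring\<^esub> y = x * y" "\<one>\<^bsub>type_ring\<^esub> = 1" "\<zero>\<^bsub>type_ring\<^esub> = 0"
  "x \<oplus>\<^bsub>type_ring\<^esub> y = x + y"
  by (simp_all add: type_ring_def)

lemma free_algebra_simps [simp]:
  "carrier (free_algebra X) = {t. \<forall>w\<in>Poly_Mapping.keys t. set (letters w) \<subseteq> X}"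
  "s \<otimes>\<^bsub>free_algebra X\<^esub> t = s * t" "\<one>\<^bsub>free_algebra X\<^esub> = 1" "\<zero>\<^bsub>free_algebra X\<^esub> = 0"
  "s \<oplus>\<^bsub>free_algebra X\<^esub> t = s + t"
  by (simp_all add: free_algebra_def type_ring_def)

lemma ring_type_ring: "ring (type_ring :: 'a::ring_1 ring)"
proof (rule ringI)
  show "abelian_group (type_ring :: 'a ring)"
  proof (rule abelian_groupI)
    show "\<exists>y\<in>carrier type_ring. y \<oplus>\<^bsub>type_ring\<^esub> x = \<zero>\<^bsub>type_ring\<^esub>" for x :: 'a
      by (rule bexI[of _ "- x"]) simp_all
  qed (simp_all add: add_ac)
  show "Group.monoid (type_ring :: 'a ring)"
    by (rule monoidI) (simp_all add: mult.assoc)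
qed (simp_all add: distrib_left distrib_right)

lemma letters_simps [simp]: "letters 0 = []" "letters (u + v) = letters u @ letters v"
  by (simp_all add: zero_word_def plus_word_def)

lemma free_algebra_mult_closed:
  assumes "s \<in> carrier (free_algebra X)" "t \<in> carrier (free_algebra X)"
  shows "s * t \<in> carrier (free_algebra X)"
  using assms keys_mult[of s t] by fastforce

lemma ring_free_algebra: "ring (free_algebra X :: ('a word \<Rightarrow>\<^sub>0 'k::field) ring)"
proof (rule ringI)
  show "abelian_group (free_algebra X :: ('a word \<Rightarrow>\<^sub>0 'k) ring)"
  proof (rule abelian_groupI)
    show "\<exists>y\<in>carrier (free_algebra X). y \<oplus>\<^bsub>free_algebra X\<^esub> x = \<zero>\<^bsub>free_algebra X\<^esub>"
      if "x \<in> carrier (free_algebra X)" for x :: "'a word \<Rightarrow>\<^sub>0 'k"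
      using that by (intro bexI[of _ "- x"]) (auto simp: in_keys_iff)
    show "x \<oplus>\<^bsub>free_algebra X\<^esub> y \<in> carrier (free_algebra X)"
      if "x \<in> carrier (free_algebra X)" "y \<in> carrier (free_algebra X)" for x y :: "'a word \<Rightarrow>\<^sub>0 'k"
      using that Poly_Mapping.keys_add[of x y] by auto
  qed (auto simp: add_ac)
  show "Group.monoid (free_algebra X :: ('a word \<Rightarrow>\<^sub>0 'k) ring)"
  proof (rule monoidI)
    show "s \<otimes>\<^bsub>free_algebra X\<^esub> t \<in> carrier (free_algebra X)"
      if "s \<in> carrier (free_algebra X)" "t \<in> carrier (free_algebra X)" for s t :: "'a word \<Rightarrow>\<^sub>0 'k"
      using free_algebra_mult_closed[OF that] by simp
  qed (simp_all add: mult.assoc)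
qed (auto simp: distrib_left distrib_right)

lemma gen_closed: "gen x \<in> carrier (free_algebra X) \<longleftrightarrow> x \<in> X"
  by (simp add: gen_def)

lemma scalar_closed: "scalar c \<in> carrier (free_algebra X)"
  by (simp add: scalar_def)

lemma scalar_simps:
  fixes c d :: "'k::field"
  shows "scalar (c + d) = (scalar c + scalar d :: 'a word \<Rightarrow>\<^sub>0 'k)"
    "scalar (c * d) = (scalar c * scalar d :: 'a word \<Rightarrow>\<^sub>0 'k)" "scalar 1 = (1 :: 'a word \<Rightarrow>\<^sub>0 'k)"
    "scalar 0 = (0 :: 'a word \<Rightarrow>\<^sub>0 'k)" "scalar (- c) = (- scalar c :: 'a word \<Rightarrow>\<^sub>0 'k)"
    "scalar c ^ n = (scalar (c ^ n) :: 'a word \<Rightarrow>\<^sub>0 'k)"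
proof -
  show *: "scalar (c * d) = (scalar c * scalar d :: 'a word \<Rightarrow>\<^sub>0 'k)" for c d :: 'k
    by (simp add: scalar_def mult_single)
  show **: "scalar 1 = (1 :: 'a word \<Rightarrow>\<^sub>0 'k)"
    by (simp add: scalar_def)
  show "scalar c ^ n = (scalar (c ^ n) :: 'a word \<Rightarrow>\<^sub>0 'k)"
    by (induction n) (simp_all add: * **)
qed (simp_all add: scalar_def single_add single_uminus)

lemma scalar_commute: "scalar c * t = t * scalar c"
proof (induction t rule: update_induct)
  case (update f w d)
  then have "Poly_Mapping.update w d f = f + Poly_Mapping.single w d"
    by (intro poly_mapping_eqI) (auto simp: lookup_update lookup_add lookup_single in_keys_iff when_def)
  then show ?case
    using update by (simp add: scalar_def distrib_left distrib_right mult_single mult.commute)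
qed simp

lemma free_algebra_monomial_induct [consumes 1, case_names single add]:
  assumes t: "t \<in> carrier (free_algebra X)"
    and single: "\<And>w c. set (letters w) \<subseteq> X \<Longrightarrow> P (Poly_Mapping.single w c)"
    and add: "\<And>s t. s \<in> carrier (free_algebra X) \<Longrightarrow> t \<in> carrier (free_algebra X) \<Longrightarrow>
      P s \<Longrightarrow> P t \<Longrightarrow> P (s + t)"
  shows "P t"
  using t
proof (induction t rule: update_induct)
  case const
  show ?case using single[of 0 0] by simp
next
  case (update f w c)
  then have eq: "Poly_Mapping.update w c f = f + Poly_Mapping.single w c"
    by (intro poly_mapping_eqI) (auto simp: lookup_update lookup_add lookup_single in_keys_iff when_def)
  have "Poly_Mapping.keys (Poly_Mapping.update w c f) = insert w (Poly_Mapping.keys f)"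
    using update by (simp add: keys_update)
  then have "set (letters w) \<subseteq> X" "f \<in> carrier (free_algebra X)"
    using update.prems by auto
  then show ?case
    unfolding eq using update.IH by (intro add single) auto
qed

lemma free_algebra_subset:
  fixes P :: "('a word \<Rightarrow>\<^sub>0 'k::field) set"
  assumes scalar: "\<And>c. scalar c \<in> P" and gen: "\<And>x. x \<in> X \<Longrightarrow> gen x \<in> P"
    and add: "\<And>s t. s \<in> P \<Longrightarrow> t \<in> P \<Longrightarrow> s + t \<in> P" and mult: "\<And>s t. s \<in> P \<Longrightarrow> t \<in> P \<Longrightarrow> s * t \<in> P"
  shows "carrier (free_algebra X) \<subseteq> P"
proof
  fix t :: "'a word \<Rightarrow>\<^sub>0 'k" assume "t \<in> carrier (free_algebra X)"
  then show "t \<in> P"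
  proof (induction t rule: free_algebra_monomial_induct)
    case (single w c)
    have "Poly_Mapping.single (Word xs) c \<in> P" if "set xs \<subseteq> X" for xs
      using that
    proof (induction xs)
      case Nil
      then show ?case using scalar[of c] by (simp add: scalar_def zero_word_def)
    next
      case (Cons x xs)
      have "Poly_Mapping.single (Word (x # xs)) c = gen x * Poly_Mapping.single (Word xs) c"
        by (simp add: gen_def mult_single plus_word_def)
      then show ?case using Cons gen mult by auto
    qed
    then show ?case using single by (metis word.collapse)
  qed (use add in auto)
qed


section \<open>Enveloping algebras\<close>

lemma free_algebra_add_closed:
  "s \<in> carrier (free_algebra X) \<Longrightarrow> t \<in> carrier (free_algebra X) \<Longrightarrow> s + t \<in> carrier (free_algebra X)"
  using Poly_Mapping.keys_add[of s t] by auto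

lemma (in ring) commute_mult:
  assumes "a \<in> carrier R" "b \<in> carrier R" "c \<in> carrier R" "a \<otimes> c = c \<otimes> a" "b \<otimes> c = c \<otimes> b"
  shows "(a \<otimes> b) \<otimes> c = c \<otimes> (a \<otimes> b)"
proof -
  have "(a \<otimes> b) \<otimes> c = a \<otimes> (b \<otimes> c)"
    using assms(1-3) by (rule m_assoc)
  also have "\<dots> = (a \<otimes> c) \<otimes> b"
    unfolding assms(5) using assms(1-3) by (simp only: m_assoc)
  also have "\<dots> = c \<otimes> (a \<otimes> b)"
    unfolding assms(4) using assms(1-3) by (simp only: m_assoc)
  finally show ?thesis .
qed

lemma (in ring) carrier_Quot: "carrier (R Quot I) = (\<lambda>a. I +> a) ` carrier R"
  by (auto simp: FactRing_def A_RCOSETS_def')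

lemma (in ideal) Quot_simps:
  "a \<in> carrier R \<Longrightarrow> b \<in> carrier R \<Longrightarrow> (I +> a) \<otimes>\<^bsub>R Quot I\<^esub> (I +> b) = I +> (a \<otimes> b)"
  "a \<in> carrier R \<Longrightarrow> b \<in> carrier R \<Longrightarrow> (I +> a) \<oplus>\<^bsub>R Quot I\<^esub> (I +> b) = I +> (a \<oplus> b)"
  "I +> \<one> = \<one>\<^bsub>R Quot I\<^esub>" "I +> \<zero> = \<zero>\<^bsub>R Quot I\<^esub>"
proof -
  interpret h: ring_hom_ring R "R Quot I" "(+>) I"
    by (rule rcos_ring_hom_ring)
  show "a \<in> carrier R \<Longrightarrow> b \<in> carrier R \<Longrightarrow> (I +> a) \<otimes>\<^bsub>R Quot I\<^esub> (I +> b) = I +> (a \<otimes> b)"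
    "a \<in> carrier R \<Longrightarrow> b \<in> carrier R \<Longrightarrow> (I +> a) \<oplus>\<^bsub>R Quot I\<^esub> (I +> b) = I +> (a \<oplus> b)"
    "I +> \<one> = \<one>\<^bsub>R Quot I\<^esub>" "I +> \<zero> = \<zero>\<^bsub>R Quot I\<^esub>"
    by simp_all
qed

lemma (in ideal) coset_eq_zero_iff: "a \<in> carrier R \<Longrightarrow> I +> a = \<zero>\<^bsub>R Quot I\<^esub> \<longleftrightarrow> a \<in> I"
  by (simp add: FactRing_def a_rcos_const) (metis a_rcos_const a_rcos_self)

lemma (in left_module) ideal_annihilator: "ideal {a \<in> carrier A. \<forall>v\<in>carrier M. a \<odot> v = \<zero>} A"
proof (rule idealI)
  show "subgroup {a \<in> carrier A. \<forall>v\<in>carrier M. a \<odot> v = \<zero>} (add_monoid A)"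
    by (rule subgroup.intro)
      (auto simp: smult_l_distr smult_zero_left smult_minus_left simp flip: a_inv_def)
qed (auto simp: smult_assoc smult_closed smult_zero_right A.ring_axioms)

locale closed_lie =
  fixes L :: "('a::ab_group_add, 'k::field, 'm) lie_scheme"
  assumes lie_add_closed: "x \<in> lie_carrier L \<Longrightarrow> y \<in> lie_carrier L \<Longrightarrow> x + y \<in> lie_carrier L"
    and lie_scale_closed: "x \<in> lie_carrier L \<Longrightarrow> lie_scale L c x \<in> lie_carrier L"
    and lie_bracket_closed:
      "x \<in> lie_carrier L \<Longrightarrow> y \<in> lie_carrier L \<Longrightarrow> lie_bracket L x y \<in> lie_carrier L"
begin

abbreviation "FL \<equiv> free_algebra (lie_carrier L) :: ('a word \<Rightarrow>\<^sub>0 'k) ring"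
abbreviation "UL \<equiv> env_alg L"

sublocale FL: ring FL
  by (rule ring_free_algebra)

lemma FL_minus: "t \<in> carrier FL \<Longrightarrow> \<ominus>\<^bsub>FL\<^esub> t = - t"
  by (intro FL.minus_equality) auto

lemma FL_diff: "s \<in> carrier FL \<Longrightarrow> t \<in> carrier FL \<Longrightarrow> s \<ominus>\<^bsub>FL\<^esub> t = s - t"
  by (simp add: FL.minus_eq FL_minus)

lemma FL_diff_closed: "s \<in> carrier FL \<Longrightarrow> t \<in> carrier FL \<Longrightarrow> s - t \<in> carrier FL"
  by (metis FL_diff FL.minus_closed)

lemma FL_pow: "t [^]\<^bsub>FL\<^esub> (n::nat) = t ^ n"
  by (induction n) (simp_all add: power_Suc2 del: power_Suc)

definition env_relations :: "('a word \<Rightarrow>\<^sub>0 'k) set" where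
  "env_relations =
     {gen (x + y) - gen x - gen y | x y. x \<in> lie_carrier L \<and> y \<in> lie_carrier L}
    \<union> {gen (lie_scale L c x) - scalar c * gen x | c x. x \<in> lie_carrier L}
    \<union> {gen x * gen y - gen y * gen x - gen (lie_bracket L x y) | x y.
         x \<in> lie_carrier L \<and> y \<in> lie_carrier L}"

lemma env_relationsI:
  "x \<in> lie_carrier L \<Longrightarrow> y \<in> lie_carrier L \<Longrightarrow> gen (x + y) - gen x - gen y \<in> env_relations"
  "x \<in> lie_carrier L \<Longrightarrow> gen (lie_scale L c x) - scalar c * gen x \<in> env_relations"
  "x \<in> lie_carrier L \<Longrightarrow> y \<in> lie_carrier L \<Longrightarrow>
    gen x * gen y - gen y * gen x - gen (lie_bracket L x y) \<in> env_relations"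
  unfolding env_relations_def by blast+

lemma env_ideal_eq: "env_ideal L = Idl\<^bsub>FL\<^esub> env_relations"
  by (simp only: env_ideal_def env_relations_def)

lemma env_relations_closed: "env_relations \<subseteq> carrier FL"
  unfolding env_relations_def
  by (auto intro!: FL_diff_closed free_algebra_mult_closed
      simp: gen_closed scalar_closed lie_add_closed lie_scale_closed lie_bracket_closed
      simp del: free_algebra_simps)

sublocale I: ideal "env_ideal L" FL
  unfolding env_ideal_eq by (rule FL.genideal_ideal[OF env_relations_closed])

sublocale UL: ring UL
  unfolding env_alg_def by (rule I.quotient_is_ring)

lemma env_relations_in_ideal: "env_relations \<subseteq> env_ideal L"
  unfolding env_ideal_eq by (rule FL.genideal_self[OF env_relations_closed])

end

text \<open>The enveloping algebra and its reduced quotients are treated together, as images of the free algebra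
  in which the defining relations hold.\<close>

locale lie_quotient = closed_lie L + A?: ring A
  for L :: "('a::ab_group_add, 'k::field, 'm) lie_scheme" and A :: "('u, 'n) ring_scheme" +
  fixes \<pi> :: "('a word \<Rightarrow>\<^sub>0 'k) \<Rightarrow> 'u"
  assumes \<pi>_hom: "\<pi> \<in> Ring.ring_hom FL A" and \<pi>_surj: "\<pi> ` carrier FL = carrier A"
    and \<pi>_relations: "t \<in> env_relations \<Longrightarrow> \<pi> t = \<zero>\<^bsub>A\<^esub>"
begin

abbreviation "\<kappa> c \<equiv> \<pi> (scalar c)"
abbreviation "\<iota> x \<equiv> \<pi> (gen x)"

sublocale \<pi>: ring_hom_ring FL A \<pi>
  by (intro ring_hom_ringI2 FL.ring_axioms A.ring_axioms \<pi>_hom)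

lemma \<pi>_add: "s \<in> carrier FL \<Longrightarrow> t \<in> carrier FL \<Longrightarrow> \<pi> (s + t) = \<pi> s \<oplus>\<^bsub>A\<^esub> \<pi> t"
  and \<pi>_mult: "s \<in> carrier FL \<Longrightarrow> t \<in> carrier FL \<Longrightarrow> \<pi> (s * t) = \<pi> s \<otimes>\<^bsub>A\<^esub> \<pi> t"
  and \<pi>_one: "\<pi> 1 = \<one>\<^bsub>A\<^esub>" and \<pi>_zero: "\<pi> 0 = \<zero>\<^bsub>A\<^esub>"
  using \<pi>.hom_add[of s t] \<pi>.hom_mult[of s t] \<pi>.hom_one \<pi>.hom_zero by auto

lemma \<pi>_diff: "s \<in> carrier FL \<Longrightarrow> t \<in> carrier FL \<Longrightarrow> \<pi> (s - t) = \<pi> s \<ominus>\<^bsub>A\<^esub> \<pi> t"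
proof -
  assume st: "s \<in> carrier FL" "t \<in> carrier FL"
  then have "\<pi> (s - t) \<oplus>\<^bsub>A\<^esub> \<pi> t = \<pi> s"
    by (subst \<pi>_add[symmetric]) (simp_all add: FL_diff_closed del: free_algebra_simps)
  then show ?thesis
    using st \<pi>.hom_closed FL_diff_closed[OF st] by (metis A.diff_eq_iff)
qed

lemma \<pi>_pow: "t \<in> carrier FL \<Longrightarrow> \<pi> (t ^ n) = \<pi> t [^]\<^bsub>A\<^esub> (n::nat)"
  using \<pi>.hom_nat_pow[of t n] by (simp add: FL_pow)

lemma \<kappa>_closed: "\<kappa> c \<in> carrier A" and \<iota>_closed: "x \<in> lie_carrier L \<Longrightarrow> \<iota> x \<in> carrier A"
  using \<pi>.hom_closed scalar_closed gen_closed by metis+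

lemma \<kappa>_simps: "\<kappa> (c + d) = \<kappa> c \<oplus>\<^bsub>A\<^esub> \<kappa> d" "\<kappa> (c * d) = \<kappa> c \<otimes>\<^bsub>A\<^esub> \<kappa> d" "\<kappa> 1 = \<one>\<^bsub>A\<^esub>" "\<kappa> 0 = \<zero>\<^bsub>A\<^esub>"
  by (simp_all add: scalar_simps \<pi>_add \<pi>_mult scalar_closed \<pi>_one \<pi>_zero del: free_algebra_simps)

lemma \<kappa>_central: "a \<in> carrier A \<Longrightarrow> \<kappa> c \<otimes>\<^bsub>A\<^esub> a = a \<otimes>\<^bsub>A\<^esub> \<kappa> c"
  unfolding \<pi>_surj[symmetric]
  by (auto simp: scalar_commute scalar_closed simp flip: \<pi>_mult simp del: free_algebra_simps)

lemma \<iota>_add: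
  assumes "x \<in> lie_carrier L" "y \<in> lie_carrier L" shows "\<iota> (x + y) = \<iota> x \<oplus>\<^bsub>A\<^esub> \<iota> y"
proof -
  have "\<pi> (gen (x + y) - gen x - gen y) = \<zero>\<^bsub>A\<^esub>"
    by (intro \<pi>_relations env_relationsI assms)
  then have "\<iota> (x + y) \<ominus>\<^bsub>A\<^esub> \<iota> x \<ominus>\<^bsub>A\<^esub> \<iota> y = \<zero>\<^bsub>A\<^esub>"
    using assms by (simp add: \<pi>_diff FL_diff_closed gen_closed lie_add_closed del: free_algebra_simps)
  then show ?thesis
    using assms \<iota>_closed lie_add_closed by (simp add: A.diff_eq_iff A.r_right_minus_eq A.a_comm)
qed

lemma \<iota>_scale:
  assumes "x \<in> lie_carrier L" shows "\<iota> (lie_scale L c x) = \<kappa> c \<otimes>\<^bsub>A\<^esub> \<iota> x"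
proof -
  have "\<pi> (gen (lie_scale L c x) - scalar c * gen x) = \<zero>\<^bsub>A\<^esub>"
    by (intro \<pi>_relations env_relationsI assms)
  then show ?thesis
    using assms \<kappa>_closed \<iota>_closed
    by (simp add: \<pi>_diff \<pi>_mult gen_closed scalar_closed free_algebra_mult_closed
        lie_scale_closed A.r_right_minus_eq del: free_algebra_simps)
qed

lemma \<iota>_bracket:
  assumes "x \<in> lie_carrier L" "y \<in> lie_carrier L"
  shows "\<iota> (lie_bracket L x y) = \<iota> x \<otimes>\<^bsub>A\<^esub> \<iota> y \<ominus>\<^bsub>A\<^esub> \<iota> y \<otimes>\<^bsub>A\<^esub> \<iota> x"
proof -
  have "\<pi> (gen x * gen y - gen y * gen x - gen (lie_bracket L x y)) = \<zero>\<^bsub>A\<^esub>"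
    by (intro \<pi>_relations env_relationsI assms)
  then have "(\<iota> x \<otimes>\<^bsub>A\<^esub> \<iota> y \<ominus>\<^bsub>A\<^esub> \<iota> y \<otimes>\<^bsub>A\<^esub> \<iota> x) \<ominus>\<^bsub>A\<^esub> \<iota> (lie_bracket L x y) = \<zero>\<^bsub>A\<^esub>"
    using assms by (simp add: \<pi>_diff \<pi>_mult gen_closed free_algebra_mult_closed FL_diff_closed
        lie_bracket_closed del: free_algebra_simps)
  then show ?thesis
    using A.r_right_minus_eq[of "\<iota> x \<otimes>\<^bsub>A\<^esub> \<iota> y \<ominus>\<^bsub>A\<^esub> \<iota> y \<otimes>\<^bsub>A\<^esub> \<iota> x" "\<iota> (lie_bracket L x y)"]
      assms \<iota>_closed lie_bracket_closed by (metis A.m_closed A.minus_closed)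
qed

lemma \<iota>_zero: assumes "0 \<in> lie_carrier L" shows "\<iota> 0 = \<zero>\<^bsub>A\<^esub>"
proof -
  have "\<iota> 0 \<oplus>\<^bsub>A\<^esub> \<iota> 0 = \<iota> 0"
    using \<iota>_add[of 0 0] assms by simp
  then show ?thesis
    using \<iota>_closed[OF assms] by (simp add: A.add.r_cancel_one)
qed

lemma \<iota>_sum:
  assumes "finite T" "0 \<in> lie_carrier L" "\<And>b. b \<in> T \<Longrightarrow> f b \<in> lie_carrier L"
  shows "\<iota> (\<Sum>b\<in>T. f b) = (\<Oplus>\<^bsub>A\<^esub>b\<in>T. \<iota> (f b)) \<and> (\<Sum>b\<in>T. f b) \<in> lie_carrier L"
  using assms
  by (induction rule: finite_induct) (auto simp: \<iota>_zero \<iota>_add \<iota>_closed lie_add_closed)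

lemma generated:
  assumes "\<And>c. \<kappa> c \<in> P" "\<And>x. x \<in> lie_carrier L \<Longrightarrow> \<iota> x \<in> P"
    and "\<And>a b. a \<in> P \<Longrightarrow> b \<in> P \<Longrightarrow> a \<in> carrier A \<Longrightarrow> b \<in> carrier A \<Longrightarrow> a \<oplus>\<^bsub>A\<^esub> b \<in> P"
    and "\<And>a b. a \<in> P \<Longrightarrow> b \<in> P \<Longrightarrow> a \<in> carrier A \<Longrightarrow> b \<in> carrier A \<Longrightarrow> a \<otimes>\<^bsub>A\<^esub> b \<in> P"
  shows "carrier A \<subseteq> P"
proof -
  have "carrier FL \<subseteq> {t \<in> carrier FL. \<pi> t \<in> P}"
    by (rule free_algebra_subset)
      (use assms in \<open>auto simp: scalar_closed gen_closed \<pi>_add \<pi>_mult free_algebra_mult_closed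
        free_algebra_add_closed simp del: free_algebra_simps\<close>)
  then show ?thesis
    unfolding \<pi>_surj[symmetric] by auto
qed

end

context closed_lie
begin

abbreviation "\<pi>U t \<equiv> env_ideal L +>\<^bsub>FL\<^esub> t"

sublocale U: lie_quotient L UL "\<lambda>t. \<pi>U t"
proof (intro lie_quotient.intro lie_quotient_axioms.intro closed_lie_axioms UL.ring_axioms)
  show "(\<lambda>t. \<pi>U t) \<in> Ring.ring_hom FL UL"
    unfolding env_alg_def by (rule I.rcos_ring_hom)
  show "(\<lambda>t. \<pi>U t) ` carrier FL = carrier UL"
    unfolding env_alg_def FL.carrier_Quot ..
  show "\<pi>U t = \<zero>\<^bsub>UL\<^esub>" if "t \<in> env_relations" for t
    using that env_relations_closed env_relations_in_ideal I.coset_eq_zero_iff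
    unfolding env_alg_def by blast
qed

lemma env_incl_eq: "env_incl L x = U.\<iota> x" and env_scalar_eq: "env_scalar L c = U.\<kappa> c"
  by (simp_all add: env_incl_def env_scalar_def)

lemma of_nat_CHAR_word: "of_nat CHAR('k) = (0 :: 'a word \<Rightarrow>\<^sub>0 'k)"
  by (metis of_nat_CHAR single_of_nat single_zero)

text \<open>In the enveloping algebra \<open>ad(x)\<^sup>p\<close> is \<open>ad\<close> of the \<open>p\<close>-th power of \<open>x\<close>, while in the Lie algebra
  it is \<open>ad(x\<^sup>[\<^sup>p\<^sup>])\<close>. Hence \<open>x\<^sup>p - x\<^sup>[\<^sup>p\<^sup>]\<close> commutes with all generators.\<close>

lemma p_central_commutes:
  assumes char: "CHAR('k) > 0" and rs: "restricted_structure L pm"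
    and x: "x \<in> lie_carrier L" and a: "a \<in> carrier UL"
  shows "p_central L pm x \<otimes>\<^bsub>UL\<^esub> a = a \<otimes>\<^bsub>UL\<^esub> p_central L pm x"
proof -
  define p where "p = CHAR('k)"
  have p: "prime p"
    using char prime_CHAR_semidom by (simp add: p_def)
  have pm: "pm x \<in> lie_carrier L"
    using rs x by (simp add: restricted_structure_def)
  let ?z = "gen x ^ p - gen (pm x) :: 'a word \<Rightarrow>\<^sub>0 'k"
  have pow: "gen x ^ n \<in> carrier FL" for n
    using FL.nat_pow_closed[of "gen x" n] x by (simp add: gen_closed FL_pow del: free_algebra_simps)
  have z: "?z \<in> carrier FL"
    using pow pm by (intro FL_diff_closed) (simp_all add: gen_closed del: free_algebra_simps)
  have z_eq: "p_central L pm x = \<pi>U ?z"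
    using x pm pow unfolding p_central_def env_incl_eq
    by (simp add: U.\<pi>_diff U.\<pi>_pow gen_closed p_def del: free_algebra_simps)
  have comm: "\<pi>U ?z \<otimes>\<^bsub>UL\<^esub> U.\<iota> y = U.\<iota> y \<otimes>\<^bsub>UL\<^esub> \<pi>U ?z" if y: "y \<in> lie_carrier L" for y
  proof -
    have ad: "\<pi>U (((\<lambda>b. gen x * b - b * gen x) ^^ n) (gen y)) = U.\<iota> ((lie_bracket L x ^^ n) y) \<and>
        ((\<lambda>b. gen x * b - b * gen x) ^^ n) (gen y) \<in> carrier FL \<and>
        (lie_bracket L x ^^ n) y \<in> lie_carrier L" for n
    proof (induction n)
      case 0
      then show ?case using y by (simp add: gen_closed del: free_algebra_simps)
    next
      case (Suc n)
      then show ?case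
        using x by (simp add: U.\<pi>_diff U.\<pi>_mult FL_diff_closed free_algebra_mult_closed gen_closed
            U.\<iota>_bracket lie_bracket_closed del: free_algebra_simps)
    qed
    have "\<pi>U (gen x ^ p * gen y - gen y * gen x ^ p) = U.\<iota> ((lie_bracket L x ^^ p) y)"
      using ad[of p] funpow_prime_left_minus_right[OF p, of "gen x :: 'a word \<Rightarrow>\<^sub>0 'k" "gen x" "gen y"]
        of_nat_CHAR_word by (simp add: p_def del: free_algebra_simps)
    also have "(lie_bracket L x ^^ p) y = lie_bracket L (pm x) y"
      using rs x y by (simp add: restricted_structure_def p_def)
    also have "U.\<iota> (lie_bracket L (pm x) y) = \<pi>U (gen (pm x) * gen y - gen y * gen (pm x))"
      using pm y by (simp add: U.\<pi>_diff U.\<pi>_mult free_algebra_mult_closed gen_closed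
          U.\<iota>_bracket del: free_algebra_simps)
    finally have "\<pi>U (gen x ^ p * gen y - gen y * gen x ^ p -
        (gen (pm x) * gen y - gen y * gen (pm x))) = \<zero>\<^bsub>UL\<^esub>"
      using pm y pow x by (subst U.\<pi>_diff)
        (simp_all add: FL_diff_closed free_algebra_mult_closed gen_closed UL.r_right_minus_eq
          U.\<pi>.hom_closed del: free_algebra_simps)
    also have "gen x ^ p * gen y - gen y * gen x ^ p - (gen (pm x) * gen y - gen y * gen (pm x)) =
        ?z * gen y - gen y * ?z"
      by (simp add: algebra_simps)
    finally show ?thesis
      using z y by (simp add: U.\<pi>_diff U.\<pi>_mult free_algebra_mult_closed gen_closed
          UL.r_right_minus_eq U.\<pi>.hom_closed del: free_algebra_simps)
  qed
  have zc: "\<pi>U ?z \<in> carrier UL"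
    using z by (rule U.\<pi>.hom_closed)
  have "carrier UL \<subseteq> {a \<in> carrier UL. \<pi>U ?z \<otimes>\<^bsub>UL\<^esub> a = a \<otimes>\<^bsub>UL\<^esub> \<pi>U ?z}"
  proof (rule U.generated)
    fix a b assume "a \<in> {a \<in> carrier UL. \<pi>U ?z \<otimes>\<^bsub>UL\<^esub> a = a \<otimes>\<^bsub>UL\<^esub> \<pi>U ?z}"
      "b \<in> {a \<in> carrier UL. \<pi>U ?z \<otimes>\<^bsub>UL\<^esub> a = a \<otimes>\<^bsub>UL\<^esub> \<pi>U ?z}"
    then have ab: "a \<in> carrier UL" "b \<in> carrier UL" "\<pi>U ?z \<otimes>\<^bsub>UL\<^esub> a = a \<otimes>\<^bsub>UL\<^esub> \<pi>U ?z"
        "\<pi>U ?z \<otimes>\<^bsub>UL\<^esub> b = b \<otimes>\<^bsub>UL\<^esub> \<pi>U ?z"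
      by blast+
    then show "a \<otimes>\<^bsub>UL\<^esub> b \<in> {a \<in> carrier UL. \<pi>U ?z \<otimes>\<^bsub>UL\<^esub> a = a \<otimes>\<^bsub>UL\<^esub> \<pi>U ?z}"
      using UL.commute_mult[of a b "\<pi>U ?z"] zc by simp
  qed (use comm zc in \<open>auto simp: U.\<kappa>_closed U.\<iota>_closed U.\<kappa>_central UL.r_distr UL.l_distr\<close>)
  then show ?thesis
    using a unfolding z_eq by blast
qed

end


section \<open>Modules over enveloping algebras\<close>

locale lie_rep = closed_lie L + V: left_module "type_ring :: 'k ring" V
  for L :: "('a::ab_group_add, 'k::field, 'm) lie_scheme" and V :: "('k, 'v, 'n) module_scheme" +
  fixes \<rho> :: "'a \<Rightarrow> 'v \<Rightarrow> 'v"
  assumes rep_closed: "x \<in> lie_carrier L \<Longrightarrow> v \<in> carrier V \<Longrightarrow> \<rho> x v \<in> carrier V"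
    and rep_add_right: "\<lbrakk>x \<in> lie_carrier L; v \<in> carrier V; w \<in> carrier V\<rbrakk> \<Longrightarrow>
      \<rho> x (v \<oplus>\<^bsub>V\<^esub> w) = \<rho> x v \<oplus>\<^bsub>V\<^esub> \<rho> x w"
    and rep_smult: "\<lbrakk>x \<in> lie_carrier L; v \<in> carrier V\<rbrakk> \<Longrightarrow> \<rho> x (c \<odot>\<^bsub>V\<^esub> v) = c \<odot>\<^bsub>V\<^esub> \<rho> x v"
    and rep_add: "\<lbrakk>x \<in> lie_carrier L; y \<in> lie_carrier L; v \<in> carrier V\<rbrakk> \<Longrightarrow>
      \<rho> (x + y) v = \<rho> x v \<oplus>\<^bsub>V\<^esub> \<rho> y v"
    and rep_scale: "\<lbrakk>x \<in> lie_carrier L; v \<in> carrier V\<rbrakk> \<Longrightarrow> \<rho> (lie_scale L c x) v = c \<odot>\<^bsub>V\<^esub> \<rho> x v"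
    and rep_bracket: "\<lbrakk>x \<in> lie_carrier L; y \<in> lie_carrier L; v \<in> carrier V\<rbrakk> \<Longrightarrow>
      \<rho> (lie_bracket L x y) v = \<rho> x (\<rho> y v) \<ominus>\<^bsub>V\<^esub> \<rho> y (\<rho> x v)"
begin

abbreviation "FM \<equiv> free_algebra_module V \<rho>"

lemma FM_simps [simp]:
  "carrier FM = carrier V" "\<zero>\<^bsub>FM\<^esub> = \<zero>\<^bsub>V\<^esub>" "v \<oplus>\<^bsub>FM\<^esub> w = v \<oplus>\<^bsub>V\<^esub> w"
  by (simp_all add: free_algebra_module_def)

lemma foldr_rep_closed:
  "set xs \<subseteq> lie_carrier L \<Longrightarrow> v \<in> carrier V \<Longrightarrow> foldr \<rho> xs v \<in> carrier V"
  by (induction xs) (auto simp: rep_closed)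

lemma smult_V_closed: "v \<in> carrier V \<Longrightarrow> c \<odot>\<^bsub>V\<^esub> v \<in> carrier V"
  using V.smult_closed[of c v] by simp

text \<open>Summing over any finite set of words that contains the support makes the actions of two elements
  comparable term by term.\<close>

lemma act_superset:
  assumes "finite S" "Poly_Mapping.keys t \<subseteq> S" "v \<in> carrier V"
    and "\<And>w. w \<in> S \<Longrightarrow> set (letters w) \<subseteq> lie_carrier L"
  shows "t \<odot>\<^bsub>FM\<^esub> v = (\<Oplus>\<^bsub>V\<^esub>w\<in>S. Poly_Mapping.lookup t w \<odot>\<^bsub>V\<^esub> foldr \<rho> (letters w) v)"
proof -
  have "(\<Oplus>\<^bsub>V\<^esub>w\<in>Poly_Mapping.keys t. Poly_Mapping.lookup t w \<odot>\<^bsub>V\<^esub> foldr \<rho> (letters w) v) =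
      (\<Oplus>\<^bsub>V\<^esub>w\<in>S. Poly_Mapping.lookup t w \<odot>\<^bsub>V\<^esub> foldr \<rho> (letters w) v)"
  proof (rule V.add.finprod_mono_neutral_cong_left)
    show "Poly_Mapping.lookup t w \<odot>\<^bsub>V\<^esub> foldr \<rho> (letters w) v = \<zero>\<^bsub>V\<^esub>"
      if "w \<in> S - Poly_Mapping.keys t" for w
      using that assms foldr_rep_closed[of "letters w" v] V.smult_zero_left[of "foldr \<rho> (letters w) v"]
      by (simp add: in_keys_iff)
  qed (use assms in \<open>auto intro!: smult_V_closed foldr_rep_closed\<close>)
  then show ?thesis
    by (simp add: free_algebra_module_def)
qed

lemma act_closed:
  assumes "t \<in> carrier FL" "v \<in> carrier V" shows "t \<odot>\<^bsub>FM\<^esub> v \<in> carrier V"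
  using assms
  by (auto simp: free_algebra_module_def intro!: V.finsum_closed smult_V_closed foldr_rep_closed)

lemma act_single:
  assumes "set (letters w) \<subseteq> lie_carrier L" "v \<in> carrier V"
  shows "Poly_Mapping.single w c \<odot>\<^bsub>FM\<^esub> v = c \<odot>\<^bsub>V\<^esub> foldr \<rho> (letters w) v"
  using assms act_superset[of "{w}" "Poly_Mapping.single w c" v] smult_V_closed foldr_rep_closed
  by auto

lemma act_add_left:
  assumes s: "s \<in> carrier FL" and t: "t \<in> carrier FL" and v: "v \<in> carrier V"
  shows "(s + t) \<odot>\<^bsub>FM\<^esub> v = s \<odot>\<^bsub>FM\<^esub> v \<oplus>\<^bsub>V\<^esub> t \<odot>\<^bsub>FM\<^esub> v"
proof -
  let ?S = "Poly_Mapping.keys s \<union> Poly_Mapping.keys t"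
  have S: "set (letters w) \<subseteq> lie_carrier L" if "w \<in> ?S" for w
    using s t that by auto
  have "(s + t) \<odot>\<^bsub>FM\<^esub> v =
      (\<Oplus>\<^bsub>V\<^esub>w\<in>?S. Poly_Mapping.lookup (s + t) w \<odot>\<^bsub>V\<^esub> foldr \<rho> (letters w) v)"
    using v S keys_add[of s t] by (intro act_superset) auto
  also have "\<dots> = (\<Oplus>\<^bsub>V\<^esub>w\<in>?S. Poly_Mapping.lookup s w \<odot>\<^bsub>V\<^esub> foldr \<rho> (letters w) v
      \<oplus>\<^bsub>V\<^esub> Poly_Mapping.lookup t w \<odot>\<^bsub>V\<^esub> foldr \<rho> (letters w) v)"
  proof (intro V.finsum_cong' refl)
    fix w assume "w \<in> ?S"
    then have "foldr \<rho> (letters w) v \<in> carrier V"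
      using S v foldr_rep_closed by blast
    then show "Poly_Mapping.lookup (s + t) w \<odot>\<^bsub>V\<^esub> foldr \<rho> (letters w) v =
        Poly_Mapping.lookup s w \<odot>\<^bsub>V\<^esub> foldr \<rho> (letters w) v \<oplus>\<^bsub>V\<^esub>
        Poly_Mapping.lookup t w \<odot>\<^bsub>V\<^esub> foldr \<rho> (letters w) v"
      using V.smult_l_distr[of "Poly_Mapping.lookup s w" "Poly_Mapping.lookup t w"]
      by (simp add: lookup_add)
  qed (use S v in \<open>auto intro!: smult_V_closed foldr_rep_closed\<close>)
  also have "\<dots> = (\<Oplus>\<^bsub>V\<^esub>w\<in>?S. Poly_Mapping.lookup s w \<odot>\<^bsub>V\<^esub> foldr \<rho> (letters w) v) \<oplus>\<^bsub>V\<^esub>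
      (\<Oplus>\<^bsub>V\<^esub>w\<in>?S. Poly_Mapping.lookup t w \<odot>\<^bsub>V\<^esub> foldr \<rho> (letters w) v)"
    using S v by (intro V.finsum_addf) (auto intro!: smult_V_closed foldr_rep_closed)
  also have "\<dots> = s \<odot>\<^bsub>FM\<^esub> v \<oplus>\<^bsub>V\<^esub> t \<odot>\<^bsub>FM\<^esub> v"
    using v S by (subst (1 2) act_superset[of ?S]) auto
  finally show ?thesis .
qed

lemma foldr_rep_linear:
  assumes "set xs \<subseteq> lie_carrier L" "v \<in> carrier V" "w \<in> carrier V"
  shows "foldr \<rho> xs (v \<oplus>\<^bsub>V\<^esub> w) = foldr \<rho> xs v \<oplus>\<^bsub>V\<^esub> foldr \<rho> xs w"
    and "foldr \<rho> xs (c \<odot>\<^bsub>V\<^esub> v) = c \<odot>\<^bsub>V\<^esub> foldr \<rho> xs v"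
  using assms by (induction xs) (simp_all add: rep_add_right rep_smult foldr_rep_closed)

lemma smult_V_simps:
  "v \<in> carrier V \<Longrightarrow> w \<in> carrier V \<Longrightarrow> c \<odot>\<^bsub>V\<^esub> (v \<oplus>\<^bsub>V\<^esub> w) = c \<odot>\<^bsub>V\<^esub> v \<oplus>\<^bsub>V\<^esub> c \<odot>\<^bsub>V\<^esub> w"
  "v \<in> carrier V \<Longrightarrow> (c * d) \<odot>\<^bsub>V\<^esub> v = c \<odot>\<^bsub>V\<^esub> (d \<odot>\<^bsub>V\<^esub> v)"
  "v \<in> carrier V \<Longrightarrow> 1 \<odot>\<^bsub>V\<^esub> v = v"
  using V.smult_r_distr[of c v w] V.smult_assoc[of c d v] V.smult_one[of v] by simp_all

lemma act_add_right:
  assumes t: "t \<in> carrier FL" and "v \<in> carrier V" "w \<in> carrier V"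
  shows "t \<odot>\<^bsub>FM\<^esub> (v \<oplus>\<^bsub>V\<^esub> w) = t \<odot>\<^bsub>FM\<^esub> v \<oplus>\<^bsub>V\<^esub> t \<odot>\<^bsub>FM\<^esub> w"
  using t
proof (induction t rule: free_algebra_monomial_induct)
  case (single u c)
  then show ?case
    using assms by (simp add: act_single foldr_rep_linear foldr_rep_closed smult_V_simps)
next
  case (add s t)
  then show ?case
    using assms by (simp add: act_add_left act_closed V.a_ac del: free_algebra_simps)
qed

lemma act_single_mult:
  assumes u: "set (letters u) \<subseteq> lie_carrier L" and t: "t \<in> carrier FL" and v: "v \<in> carrier V"
  shows "(Poly_Mapping.single u c * t) \<odot>\<^bsub>FM\<^esub> v = Poly_Mapping.single u c \<odot>\<^bsub>FM\<^esub> (t \<odot>\<^bsub>FM\<^esub> v)"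
  using t
proof (induction t rule: free_algebra_monomial_induct)
  case (single w d)
  then show ?case
    using u v by (simp add: mult_single act_single foldr_rep_linear foldr_rep_closed smult_V_closed
        smult_V_simps)
next
  case (add s t)
  have "Poly_Mapping.single u c \<in> carrier FL"
    using u by simp
  then show ?case
    using add v by (simp add: distrib_left act_add_left act_add_right act_closed
        free_algebra_mult_closed del: free_algebra_simps)
qed

lemma act_mult:
  assumes s: "s \<in> carrier FL" and t: "t \<in> carrier FL" and v: "v \<in> carrier V"
  shows "(s * t) \<odot>\<^bsub>FM\<^esub> v = s \<odot>\<^bsub>FM\<^esub> (t \<odot>\<^bsub>FM\<^esub> v)"
  using s
proof (induction s rule: free_algebra_monomial_induct)
  case (single u c)
  then show ?case using act_single_mult t v by blast
next
  case (add r s)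
  then show ?case
    using t v by (simp add: distrib_right act_add_left act_closed free_algebra_mult_closed
        del: free_algebra_simps)
qed

lemma act_gen: "x \<in> lie_carrier L \<Longrightarrow> v \<in> carrier V \<Longrightarrow> gen x \<odot>\<^bsub>FM\<^esub> v = \<rho> x v"
  by (simp add: gen_def act_single rep_closed smult_V_simps)

lemma act_scalar: "v \<in> carrier V \<Longrightarrow> scalar c \<odot>\<^bsub>FM\<^esub> v = c \<odot>\<^bsub>V\<^esub> v"
  by (simp add: scalar_def act_single)

lemma left_module_FM: "left_module FL FM"
proof (intro left_module.intro left_module_axioms.intro FL.ring_axioms)
  show "abelian_group FM"
    by (rule abelian_group_cong[OF V.abelian_group_axioms]) (simp_all add: free_algebra_module_def)
  show "\<one>\<^bsub>FL\<^esub> \<odot>\<^bsub>FM\<^esub> v = v" if "v \<in> carrier FM" for v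
    using act_scalar[of v 1] that by (simp add: scalar_simps smult_V_simps)
qed (use act_closed act_add_left act_add_right act_mult in simp_all)

interpretation FM: left_module FL FM
  by (rule left_module_FM)

lemma FM_diff:
  assumes "s \<in> carrier FL" "t \<in> carrier FL" "v \<in> carrier V"
  shows "(s - t) \<odot>\<^bsub>FM\<^esub> v = s \<odot>\<^bsub>FM\<^esub> v \<ominus>\<^bsub>V\<^esub> t \<odot>\<^bsub>FM\<^esub> v"
proof -
  have "(s - t) \<odot>\<^bsub>FM\<^esub> v \<oplus>\<^bsub>V\<^esub> t \<odot>\<^bsub>FM\<^esub> v = s \<odot>\<^bsub>FM\<^esub> v"
    using assms by (subst act_add_left[symmetric]) (simp_all add: FL_diff_closed del: free_algebra_simps)
  then show ?thesis
    using assms V.diff_eq_iff act_closed FL_diff_closed by metis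
qed

text \<open>The axioms of a representation say that the defining relations act as zero, and the annihilator of
  a module is an ideal.\<close>

lemma env_ideal_annihilates:
  assumes "t \<in> env_ideal L" "v \<in> carrier V" shows "t \<odot>\<^bsub>FM\<^esub> v = \<zero>\<^bsub>V\<^esub>"
proof -
  have ann: "r \<odot>\<^bsub>FM\<^esub> v = \<zero>\<^bsub>V\<^esub>" if r: "r \<in> env_relations" and v: "v \<in> carrier V" for r v
  proof -
    note simps = FM_diff FL_diff_closed gen_closed scalar_closed free_algebra_mult_closed act_gen
      act_scalar act_mult rep_closed smult_V_closed
    consider x y where "r = gen (x + y) - gen x - gen y" "x \<in> lie_carrier L" "y \<in> lie_carrier L"
      | c x where "r = gen (lie_scale L c x) - scalar c * gen x" "x \<in> lie_carrier L"
      | x y where "r = gen x * gen y - gen y * gen x - gen (lie_bracket L x y)"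
          "x \<in> lie_carrier L" "y \<in> lie_carrier L"
      using r unfolding env_relations_def by blast
    then show ?thesis
    proof cases
      case (1 x y)
      then show ?thesis
        using v lie_add_closed[of x y]
        by (simp add: simps rep_add V.diff_eq_iff V.a_comm del: free_algebra_simps)
    next
      case (2 c x)
      then show ?thesis
        using v lie_scale_closed[of x c]
        by (simp add: simps rep_scale V.diff_zero_iff del: free_algebra_simps)
    next
      case (3 x y)
      then show ?thesis
        using v lie_bracket_closed[of x y]
        by (simp add: simps rep_bracket V.diff_zero_iff del: free_algebra_simps)
    qed
  qed
  have "env_ideal L \<subseteq> {t \<in> carrier FL. \<forall>v\<in>carrier FM. t \<odot>\<^bsub>FM\<^esub> v = \<zero>\<^bsub>FM\<^esub>}"
    unfolding env_ideal_eq
    by (rule FL.genideal_minimal[OF FM.ideal_annihilator])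
      (use ann env_relations_closed in \<open>auto simp del: free_algebra_simps\<close>)
  then show ?thesis using assms by auto
qed

abbreviation "EM \<equiv> env_module V \<rho>"

lemma left_module_env_module: "left_module UL EM"
  unfolding env_alg_def env_module_def
  by (rule FM.left_module_over_quotient[OF I.ideal_axioms]) (simp add: env_ideal_annihilates)

lemma env_module_simps [simp]:
  "carrier EM = carrier V" "\<zero>\<^bsub>EM\<^esub> = \<zero>\<^bsub>V\<^esub>" "v \<oplus>\<^bsub>EM\<^esub> w = v \<oplus>\<^bsub>V\<^esub> w"
  by (simp_all add: env_module_def)

lemma env_module_smult:
  assumes "t \<in> carrier FL" "v \<in> carrier V" shows "\<pi>U t \<odot>\<^bsub>EM\<^esub> v = t \<odot>\<^bsub>FM\<^esub> v"
  unfolding env_module_def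
  by (rule FM.over_quotient_smult[OF I.ideal_axioms])
    (use assms in \<open>simp_all add: env_ideal_annihilates del: free_algebra_simps\<close>)

lemma env_incl_smult: "x \<in> lie_carrier L \<Longrightarrow> v \<in> carrier V \<Longrightarrow> env_incl L x \<odot>\<^bsub>EM\<^esub> v = \<rho> x v"
  using env_module_smult[of "gen x" v] by (simp add: env_incl_eq gen_closed act_gen del: free_algebra_simps)

lemma env_scalar_smult: "v \<in> carrier V \<Longrightarrow> env_scalar L c \<odot>\<^bsub>EM\<^esub> v = c \<odot>\<^bsub>V\<^esub> v"
  using env_module_smult[of "scalar c" v]
  by (simp add: env_scalar_eq scalar_closed act_scalar del: free_algebra_simps)

end


section \<open>Restricted structures\<close>

locale restricted_lie = closed_lie L
  for L :: "('a::ab_group_add, 'k::field, 'm) lie_scheme" +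
  fixes pm :: "'a \<Rightarrow> 'a"
  assumes pm_closed: "x \<in> lie_carrier L \<Longrightarrow> pm x \<in> lie_carrier L"
begin

lemma p_central_closed: "x \<in> lie_carrier L \<Longrightarrow> p_central L pm x \<in> carrier UL"
  by (simp add: p_central_def env_incl_eq U.\<iota>_closed pm_closed)

lemma p_relations_closed: "p_character_relations L pm \<chi> \<subseteq> carrier UL"
  by (auto simp: p_character_relations_def p_central_closed env_scalar_eq U.\<kappa>_closed)

lemma reduced_ideal_ideal: "ideal (reduced_ideal L pm \<chi>) UL"
  unfolding reduced_ideal_def by (rule UL.genideal_ideal[OF p_relations_closed])

lemma p_relations_in_reduced_ideal: "p_character_relations L pm \<chi> \<subseteq> reduced_ideal L pm \<chi>"
  unfolding reduced_ideal_def by (rule UL.genideal_self[OF p_relations_closed])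

lemma ring_reduced_env: "ring (reduced_env L pm \<chi>)"
  unfolding reduced_env_def by (rule ideal.quotient_is_ring[OF reduced_ideal_ideal])

abbreviation "\<pi>A \<chi> t \<equiv> reduced_ideal L pm \<chi> +>\<^bsub>UL\<^esub> (\<pi>U t)"

lemma reduced_lie_quotient: "lie_quotient L (reduced_env L pm \<chi>) (\<pi>A \<chi>)"
proof (intro lie_quotient.intro lie_quotient_axioms.intro closed_lie_axioms ring_reduced_env)
  interpret J: ideal "reduced_ideal L pm \<chi>" UL
    by (rule reduced_ideal_ideal)
  have hom: "(+>\<^bsub>UL\<^esub>) (reduced_ideal L pm \<chi>) \<in> Ring.ring_hom UL (reduced_env L pm \<chi>)"
    unfolding reduced_env_def by (rule J.rcos_ring_hom)
  then show "\<pi>A \<chi> \<in> Ring.ring_hom FL (reduced_env L pm \<chi>)"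
    using ring_hom_trans[OF U.\<pi>_hom hom] by (simp add: comp_def)
  show "\<pi>A \<chi> ` carrier FL = carrier (reduced_env L pm \<chi>)"
    unfolding reduced_env_def UL.carrier_Quot U.\<pi>_surj[symmetric] by (simp add: image_image)
  show "\<pi>A \<chi> t = \<zero>\<^bsub>reduced_env L pm \<chi>\<^esub>" if "t \<in> env_relations" for t
    unfolding U.\<pi>_relations[OF that] reduced_env_def by (rule J.Quot_simps)
qed

lemma p_relation_eq:
  assumes "x \<in> lie_carrier L"
  shows "p_central L pm x \<ominus>\<^bsub>UL\<^esub> env_scalar L (\<chi> x ^ CHAR('k)) =
    \<pi>U (gen x ^ CHAR('k) - gen (pm x) - scalar (\<chi> x ^ CHAR('k)))"
    and "gen x ^ CHAR('k) - gen (pm x) - scalar (\<chi> x ^ CHAR('k)) \<in> carrier FL"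
proof -
  have pow: "gen x ^ CHAR('k) \<in> carrier FL"
    using FL.nat_pow_closed[of "gen x" "CHAR('k)"] assms
    by (simp add: gen_closed FL_pow del: free_algebra_simps)
  then show "gen x ^ CHAR('k) - gen (pm x) - scalar (\<chi> x ^ CHAR('k)) \<in> carrier FL"
    using assms pm_closed
    by (intro FL_diff_closed) (simp_all add: gen_closed scalar_closed del: free_algebra_simps)
  show "p_central L pm x \<ominus>\<^bsub>UL\<^esub> env_scalar L (\<chi> x ^ CHAR('k)) =
    \<pi>U (gen x ^ CHAR('k) - gen (pm x) - scalar (\<chi> x ^ CHAR('k)))"
    using pow assms pm_closed
    by (simp add: p_central_def env_incl_eq env_scalar_eq U.\<pi>_diff U.\<pi>_pow FL_diff_closed gen_closed
        scalar_closed del: free_algebra_simps)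
qed

lemma reduced_relation:
  assumes "x \<in> lie_carrier L"
  shows "\<pi>A \<chi> (gen x ^ CHAR('k) - gen (pm x) - scalar (\<chi> x ^ CHAR('k))) = \<zero>\<^bsub>reduced_env L pm \<chi>\<^esub>"
proof -
  interpret J: ideal "reduced_ideal L pm \<chi>" UL
    by (rule reduced_ideal_ideal)
  have "\<pi>U (gen x ^ CHAR('k) - gen (pm x) - scalar (\<chi> x ^ CHAR('k))) \<in> reduced_ideal L pm \<chi>"
    using p_relations_in_reduced_ideal assms
    by (auto simp: p_character_relations_def p_relation_eq)
  then show ?thesis
    unfolding reduced_env_def by (subst J.coset_eq_zero_iff) auto
qed

text \<open>Again the annihilator is an ideal, so the generating relations decide.\<close>

lemma reduced_ideal_annihilates:
  assumes M: "left_module UL M"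
    and ann: "\<And>x v. x \<in> lie_carrier L \<Longrightarrow> v \<in> carrier M \<Longrightarrow>
      (p_central L pm x \<ominus>\<^bsub>UL\<^esub> env_scalar L (\<chi> x ^ CHAR('k))) \<odot>\<^bsub>M\<^esub> v = \<zero>\<^bsub>M\<^esub>"
    and "a \<in> reduced_ideal L pm \<chi>" "v \<in> carrier M"
  shows "a \<odot>\<^bsub>M\<^esub> v = \<zero>\<^bsub>M\<^esub>"
proof -
  interpret M: left_module UL M by fact
  have "reduced_ideal L pm \<chi> \<subseteq> {a \<in> carrier UL. \<forall>v\<in>carrier M. a \<odot>\<^bsub>M\<^esub> v = \<zero>\<^bsub>M\<^esub>}"
    unfolding reduced_ideal_def
    by (rule UL.genideal_minimal[OF M.ideal_annihilator])
      (use ann in \<open>auto simp: p_character_relations_def p_central_closed env_scalar_eq U.\<kappa>_closed\<close>)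
  then show ?thesis using assms by auto
qed

context
  assumes char: "CHAR('k) > 0" and rs: "restricted_structure L pm"
begin

lemma p_centre_gens_closed:
  "range (env_scalar L) \<union> p_central L pm ` lie_carrier L \<subseteq> carrier UL"
  by (auto simp: env_scalar_eq U.\<kappa>_closed p_central_closed)

lemma p_centre_central:
  assumes z: "z \<in> carrier (p_centre L pm)" and a: "a \<in> carrier UL"
  shows "z \<in> carrier UL \<and> z \<otimes>\<^bsub>UL\<^esub> a = a \<otimes>\<^bsub>UL\<^esub> z"
proof -
  have "z \<in> generate_ring UL (range (env_scalar L) \<union> p_central L pm ` lie_carrier L)"
    using z by (simp add: p_centre_def)
  then show ?thesis
  proof induction
    case (incl z)
    then show ?case
      using a p_centre_gens_closed p_central_commutes[OF char rs _ a] U.\<kappa>_central[OF a]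
      by (auto simp: env_scalar_eq U.\<kappa>_closed p_central_closed)
  next
    case (eng_mult z1 z2)
    then show ?case using a UL.commute_mult[of z1 z2 a] by simp
  qed (use a in \<open>auto simp: UL.l_minus UL.r_minus UL.l_distr UL.r_distr\<close>)
qed

lemma ring_p_centre: "ring (p_centre L pm)"
  unfolding p_centre_def by (rule UL.generate_ring_is_ring[OF p_centre_gens_closed])

lemma p_relations_in_p_centre: "p_character_relations L pm \<chi> \<subseteq> carrier (p_centre L pm)"
proof -
  have "p_central L pm x \<ominus>\<^bsub>UL\<^esub> env_scalar L (\<chi> x ^ CHAR('k)) \<in>
      generate_ring UL (range (env_scalar L) \<union> p_central L pm ` lie_carrier L)"
    if "x \<in> lie_carrier L" for x
    unfolding UL.minus_eq using that
    by (intro generate_ring.eng_add generate_ring.a_inv generate_ring.incl) auto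
  then show ?thesis
    by (auto simp: p_centre_def p_character_relations_def)
qed

lemma J_ideal_central: "j \<in> J_ideal L pm \<chi> \<Longrightarrow> a \<in> carrier UL \<Longrightarrow> j \<in> carrier UL \<and> j \<otimes>\<^bsub>UL\<^esub> a = a \<otimes>\<^bsub>UL\<^esub> j"
proof -
  interpret Z: ring "p_centre L pm" by (rule ring_p_centre)
  interpret J: ideal "J_ideal L pm \<chi>" "p_centre L pm"
    unfolding J_ideal_def by (rule Z.genideal_ideal[OF p_relations_in_p_centre])
  show "j \<in> J_ideal L pm \<chi> \<Longrightarrow> a \<in> carrier UL \<Longrightarrow> j \<in> carrier UL \<and> j \<otimes>\<^bsub>UL\<^esub> a = a \<otimes>\<^bsub>UL\<^esub> j"
    using p_centre_central J.a_subset by blast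
qed

lemma p_relations_in_J_ideal: "p_character_relations L pm \<chi> \<subseteq> J_ideal L pm \<chi>"
  unfolding J_ideal_def by (rule ring.genideal_self[OF ring_p_centre p_relations_in_p_centre])

text \<open>Since \<open>J\<^sub>\<chi>\<close> consists of central elements of the enveloping algebra, \<open>a (j v) = j (a v)\<close>.\<close>

lemma submodule_J_submodule:
  assumes M: "left_module UL M"
  shows "submodule (J_submodule L pm \<chi> M) UL M"
proof -
  interpret M: left_module UL M by fact
  let ?X = "{j \<odot>\<^bsub>M\<^esub> v | j v. j \<in> J_ideal L pm \<chi> \<and> v \<in> carrier M}"
  have jU: "j \<in> carrier UL" if "j \<in> J_ideal L pm \<chi>" for j
    using J_ideal_central[OF that UL.one_closed] by simp
  have X: "?X \<subseteq> carrier M"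
    using jU M.smult_closed by blast
  have sub: "abelian_subgroup (J_submodule L pm \<chi> M) M"
    unfolding J_submodule_def by (rule abelian_subgroup_generate[OF M.abelian_group_axioms X])
  show ?thesis
  proof (intro submodule.intro submodule_axioms.intro)
    show "subgroup (J_submodule L pm \<chi> M) (add_monoid M)"
      using sub by (simp add: abelian_subgroup_def additive_subgroup_def)
    fix a x assume a: "a \<in> carrier UL" and x: "x \<in> J_submodule L pm \<chi> M"
    show "a \<odot>\<^bsub>M\<^esub> x \<in> J_submodule L pm \<chi> M"
    proof (rule generate_additive_image[where f = "\<lambda>v. a \<odot>\<^bsub>M\<^esub> v", OF M.abelian_group_axioms sub X])
      show "x \<in> generate (add_monoid M) ?X"
        using x by (simp add: J_submodule_def)
      fix y assume "y \<in> ?X"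
      then obtain j v where jv: "y = j \<odot>\<^bsub>M\<^esub> v" "j \<in> J_ideal L pm \<chi>" "v \<in> carrier M" by blast
      then have "a \<odot>\<^bsub>M\<^esub> y = j \<odot>\<^bsub>M\<^esub> (a \<odot>\<^bsub>M\<^esub> v)"
        using a jU[of j] J_ideal_central[of j \<chi> a] by (metis M.smult_assoc)
      then show "a \<odot>\<^bsub>M\<^esub> y \<in> J_submodule L pm \<chi> M"
        unfolding J_submodule_def using jv a M.smult_closed by (intro generate.incl) blast
    qed (use a in \<open>auto simp: M.smult_closed M.smult_r_distr\<close>)
  qed
qed

text \<open>The relations \<open>x\<^sup>p - x\<^sup>[\<^sup>p\<^sup>] - \<chi>(x)\<^sup>p\<close> lie in \<open>J\<^sub>\<chi>\<close> and so annihilate \<open>M / J\<^sub>\<chi> M\<close>. The remaining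
  claims describe this quotient by cosets of elements of \<open>M\<close>.\<close>

lemma left_module_reduced_quotient:
  fixes \<chi> :: "'a \<Rightarrow> 'k"
  assumes M: "left_module UL M"
  defines "W \<equiv> over_quotient (M QuotM J_submodule L pm \<chi> M)"
  shows "left_module (reduced_env L pm \<chi>) W"
    and "carrier W = (\<lambda>v. J_submodule L pm \<chi> M +>\<^bsub>M\<^esub> v) ` carrier M"
    and "t \<in> carrier FL \<Longrightarrow> v \<in> carrier M \<Longrightarrow>
      \<pi>A \<chi> t \<odot>\<^bsub>W\<^esub> (J_submodule L pm \<chi> M +>\<^bsub>M\<^esub> v) = J_submodule L pm \<chi> M +>\<^bsub>M\<^esub> (\<pi>U t \<odot>\<^bsub>M\<^esub> v)"
    and "\<zero>\<^bsub>W\<^esub> = J_submodule L pm \<chi> M +>\<^bsub>M\<^esub> \<zero>\<^bsub>M\<^esub>"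
proof -
  interpret M: left_module UL M by fact
  let ?J = "J_submodule L pm \<chi> M"
  note J = submodule_J_submodule[OF M, of \<chi>]
  note Jsub = M.submodule_abelian_subgroup[OF J]
  interpret Q: left_module UL "M QuotM ?J"
    by (rule M.left_module_quot[OF J])
  have rel: "(p_central L pm x \<ominus>\<^bsub>UL\<^esub> env_scalar L (\<chi> x ^ CHAR('k))) \<odot>\<^bsub>M QuotM ?J\<^esub> C = \<zero>\<^bsub>M QuotM ?J\<^esub>"
    if x: "x \<in> lie_carrier L" and C: "C \<in> carrier (M QuotM ?J)" for x C
  proof -
    let ?r = "p_central L pm x \<ominus>\<^bsub>UL\<^esub> env_scalar L (\<chi> x ^ CHAR('k))"
    obtain v where v: "v \<in> carrier M" "C = ?J +>\<^bsub>M\<^esub> v"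
      using C by (auto simp: carrier_quot[OF Jsub])
    have r: "?r \<in> p_character_relations L pm \<chi>"
      using x by (auto simp: p_character_relations_def)
    then have r': "?r \<in> carrier UL" and "?r \<in> J_ideal L pm \<chi>"
      using p_relations_closed p_relations_in_J_ideal by blast+
    then have "?r \<odot>\<^bsub>M\<^esub> v \<in> ?J"
      unfolding J_submodule_def using v by (intro generate.incl) blast
    then show ?thesis
      using v r' by (simp add: M.quot_module_smult[OF J] zero_quot[OF Jsub]
          coset_eq_subgroup_iff[OF Jsub] M.smult_closed)
  qed
  note ann = reduced_ideal_annihilates[OF Q.left_module_axioms rel]
  show "left_module (reduced_env L pm \<chi>) W"
    unfolding W_def reduced_env_def
    by (rule Q.left_module_over_quotient[OF reduced_ideal_ideal ann])
  show "carrier W = (\<lambda>v. ?J +>\<^bsub>M\<^esub> v) ` carrier M"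
    by (simp add: W_def carrier_quot[OF Jsub])
  show "\<pi>A \<chi> t \<odot>\<^bsub>W\<^esub> (?J +>\<^bsub>M\<^esub> v) = ?J +>\<^bsub>M\<^esub> (\<pi>U t \<odot>\<^bsub>M\<^esub> v)" if "t \<in> carrier FL" "v \<in> carrier M"
    unfolding W_def using that U.\<pi>.hom_closed[of t]
    by (subst Q.over_quotient_smult[OF reduced_ideal_ideal ann])
      (auto simp: carrier_quot[OF Jsub] M.quot_module_smult[OF J] simp del: free_algebra_simps)
  show "\<zero>\<^bsub>W\<^esub> = ?J +>\<^bsub>M\<^esub> \<zero>\<^bsub>M\<^esub>"
    using coset_eq_subgroup_iff[OF Jsub, of "\<zero>\<^bsub>M\<^esub>"] Jsub
    by (simp add: W_def zero_quot[OF Jsub] additive_subgroup.zero_closed abelian_subgroup_def)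
qed

end

end


section \<open>Modules generated by an eigenvector of a Borel subalgebra\<close>

text \<open>An abstraction of \<open>U\<^sub>\<chi>(\<gg>)\<close>: \<open>B\<close> is a basis of \<open>\<gg>\<close> with structure constants \<open>c\<close>, \<open>Neg\<close> is the set of
  negative root vectors, \<open>e\<close> is the map to the algebra and \<open>ht\<close> is the height of the opposite root. The
  axiom \<open>negative\<close> says that brackets of negative root vectors have larger height and are killed by
  \<open>\<chi>\<close>.\<close>

locale triangular_ring = A?: ring A
  for A :: "('u, 'r) ring_scheme" +
  fixes \<kappa> :: "'k::field \<Rightarrow> 'u" and B :: "'b set" and Neg :: "'b set" and e :: "'b \<Rightarrow> 'u"
    and c :: "'b \<Rightarrow> 'b \<Rightarrow> 'b \<Rightarrow> 'k" and \<chi> :: "'b \<Rightarrow> 'k" and ht :: "'b \<Rightarrow> nat" and p :: nat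
  assumes finite_B: "finite B" and Neg_subset: "Neg \<subseteq> B"
    and scalar_closed: "\<kappa> x \<in> carrier A"
    and scalar_add: "\<kappa> (x + x') = \<kappa> x \<oplus>\<^bsub>A\<^esub> \<kappa> x'"
    and scalar_mult: "\<kappa> (x * x') = \<kappa> x \<otimes>\<^bsub>A\<^esub> \<kappa> x'"
    and scalar_one: "\<kappa> 1 = \<one>\<^bsub>A\<^esub>"
    and scalar_central: "u \<in> carrier A \<Longrightarrow> \<kappa> x \<otimes>\<^bsub>A\<^esub> u = u \<otimes>\<^bsub>A\<^esub> \<kappa> x"
    and e_closed: "b \<in> B \<Longrightarrow> e b \<in> carrier A"
    and commutation: "a \<in> B \<Longrightarrow> b \<in> B \<Longrightarrow>
      e a \<otimes>\<^bsub>A\<^esub> e b = e b \<otimes>\<^bsub>A\<^esub> e a \<oplus>\<^bsub>A\<^esub> (\<Oplus>\<^bsub>A\<^esub>d\<in>B. \<kappa> (c a b d) \<otimes>\<^bsub>A\<^esub> e d)"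
    and generation: "\<lbrakk>\<And>x. \<kappa> x \<in> P; \<And>b. b \<in> B \<Longrightarrow> e b \<in> P;
      \<And>u v. u \<in> P \<Longrightarrow> v \<in> P \<Longrightarrow> u \<in> carrier A \<Longrightarrow> v \<in> carrier A \<Longrightarrow> u \<oplus>\<^bsub>A\<^esub> v \<in> P;
      \<And>u v. u \<in> P \<Longrightarrow> v \<in> P \<Longrightarrow> u \<in> carrier A \<Longrightarrow> v \<in> carrier A \<Longrightarrow> u \<otimes>\<^bsub>A\<^esub> v \<in> P\<rbrakk> \<Longrightarrow> carrier A \<subseteq> P"
    and negative: "\<lbrakk>a \<in> Neg; b \<in> Neg; d \<in> B; c a b d \<noteq> 0\<rbrakk> \<Longrightarrow> d \<in> Neg \<and> \<chi> d = 0 \<and> ht b < ht d"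
    and nilpotent: "b \<in> Neg \<Longrightarrow> (e b \<ominus>\<^bsub>A\<^esub> \<kappa> (\<chi> b)) [^]\<^bsub>A\<^esub> p = \<zero>\<^bsub>A\<^esub>"
begin

text \<open>The element \<open>e b\<close> need not be nilpotent, but its shift by \<open>\<chi> b\<close> is.\<close>

definition y :: "'b \<Rightarrow> 'u" where "y b = e b \<ominus>\<^bsub>A\<^esub> \<kappa> (\<chi> b)"

lemma scalar_zero: "\<kappa> 0 = \<zero>\<^bsub>A\<^esub>"
  using scalar_add[of 0 0] scalar_closed[of 0] by (simp add: A.add.r_cancel_one')

lemma y_closed: "b \<in> Neg \<Longrightarrow> y b \<in> carrier A"
  using Neg_subset by (auto simp: y_def scalar_closed e_closed)

text \<open>The shifts are by central elements, so they do not change commutators.\<close>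

lemma y_commutation:
  assumes "a \<in> Neg" "b \<in> Neg"
  shows "y a \<otimes>\<^bsub>A\<^esub> y b = y b \<otimes>\<^bsub>A\<^esub> y a \<oplus>\<^bsub>A\<^esub> (\<Oplus>\<^bsub>A\<^esub>d\<in>B. \<kappa> (c a b d) \<otimes>\<^bsub>A\<^esub> e d)"
proof -
  have ab: "e a \<in> carrier A" "e b \<in> carrier A"
    using assms Neg_subset e_closed by auto
  have s: "(\<Oplus>\<^bsub>A\<^esub>d\<in>B. \<kappa> (c a b d) \<otimes>\<^bsub>A\<^esub> e d) \<in> carrier A"
    by (intro A.finsum_closed) (auto simp: scalar_closed e_closed)
  have diff: "y a \<otimes>\<^bsub>A\<^esub> y b \<ominus>\<^bsub>A\<^esub> y b \<otimes>\<^bsub>A\<^esub> y a = e a \<otimes>\<^bsub>A\<^esub> e b \<ominus>\<^bsub>A\<^esub> e b \<otimes>\<^bsub>A\<^esub> e a"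
  proof -
    have expand: "(u \<ominus>\<^bsub>A\<^esub> k) \<otimes>\<^bsub>A\<^esub> (v \<ominus>\<^bsub>A\<^esub> l) = u \<otimes>\<^bsub>A\<^esub> v \<ominus>\<^bsub>A\<^esub> (k \<otimes>\<^bsub>A\<^esub> v \<oplus>\<^bsub>A\<^esub> l \<otimes>\<^bsub>A\<^esub> u \<ominus>\<^bsub>A\<^esub> k \<otimes>\<^bsub>A\<^esub> l)"
      if "u \<in> carrier A" "v \<in> carrier A" "k \<in> carrier A" "l \<in> carrier A" "u \<otimes>\<^bsub>A\<^esub> l = l \<otimes>\<^bsub>A\<^esub> u"
      for u v k l
      using that by (simp add: A.minus_eq A.l_distr A.r_distr A.l_minus A.r_minus A.minus_add
          A.a_ac)
    have cancel: "(u \<ominus>\<^bsub>A\<^esub> z) \<ominus>\<^bsub>A\<^esub> (v \<ominus>\<^bsub>A\<^esub> z) = u \<ominus>\<^bsub>A\<^esub> v"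
      if "u \<in> carrier A" "v \<in> carrier A" "z \<in> carrier A" for u v z
    proof -
      have "(u \<ominus>\<^bsub>A\<^esub> z) \<ominus>\<^bsub>A\<^esub> (v \<ominus>\<^bsub>A\<^esub> z) = (u \<ominus>\<^bsub>A\<^esub> v) \<oplus>\<^bsub>A\<^esub> (z \<ominus>\<^bsub>A\<^esub> z)"
        using that by (simp add: A.minus_eq A.minus_add A.a_ac)
      then show ?thesis using that by (simp add: A.r_neg A.minus_eq)
    qed
    let ?k = "\<kappa> (\<chi> a)" and ?l = "\<kappa> (\<chi> b)"
    let ?z = "?k \<otimes>\<^bsub>A\<^esub> e b \<oplus>\<^bsub>A\<^esub> ?l \<otimes>\<^bsub>A\<^esub> e a \<ominus>\<^bsub>A\<^esub> ?k \<otimes>\<^bsub>A\<^esub> ?l"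
    have lk: "?l \<otimes>\<^bsub>A\<^esub> ?k = ?k \<otimes>\<^bsub>A\<^esub> ?l"
      by (rule scalar_central[OF scalar_closed])
    have sum: "?l \<otimes>\<^bsub>A\<^esub> e a \<oplus>\<^bsub>A\<^esub> ?k \<otimes>\<^bsub>A\<^esub> e b = ?k \<otimes>\<^bsub>A\<^esub> e b \<oplus>\<^bsub>A\<^esub> ?l \<otimes>\<^bsub>A\<^esub> e a"
      using ab by (intro A.a_comm A.m_closed scalar_closed)
    have "y a \<otimes>\<^bsub>A\<^esub> y b = e a \<otimes>\<^bsub>A\<^esub> e b \<ominus>\<^bsub>A\<^esub> ?z"
      unfolding y_def by (rule expand[OF ab scalar_closed scalar_closed scalar_central[OF ab(1), symmetric]])
    moreover have "y b \<otimes>\<^bsub>A\<^esub> y a = e b \<otimes>\<^bsub>A\<^esub> e a \<ominus>\<^bsub>A\<^esub> ?z"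
      unfolding y_def lk[symmetric] sum[symmetric]
      by (rule expand[OF ab(2,1) scalar_closed scalar_closed scalar_central[OF ab(2), symmetric]])
    moreover have "e a \<otimes>\<^bsub>A\<^esub> e b \<in> carrier A" "e b \<otimes>\<^bsub>A\<^esub> e a \<in> carrier A" "?z \<in> carrier A"
      using ab scalar_closed by simp_all
    ultimately show ?thesis
      using cancel by simp
  qed
  have "e a \<otimes>\<^bsub>A\<^esub> e b \<ominus>\<^bsub>A\<^esub> e b \<otimes>\<^bsub>A\<^esub> e a = (\<Oplus>\<^bsub>A\<^esub>d\<in>B. \<kappa> (c a b d) \<otimes>\<^bsub>A\<^esub> e d)"
    using commutation[of a b] assms Neg_subset ab s by (subst A.diff_eq_iff) (auto simp: A.a_comm)
  then show ?thesis
    using diff assms y_closed s A.diff_eq_iff[of "y a \<otimes>\<^bsub>A\<^esub> y b" "y b \<otimes>\<^bsub>A\<^esub> y a"]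
    by (auto simp: A.a_comm)
qed

text \<open>The additive group \<open>\<Sum>\<^sub>b\<^sub>\<in>\<^sub>T y\<^sub>b M\<close>. Adding one summand at a time gives an induction rule in which the
  same \<open>b\<close> may occur repeatedly.\<close>

inductive_set neg_span :: "('u, 'w, 'x) module_scheme \<Rightarrow> 'b set \<Rightarrow> 'w set"
  for M :: "('u, 'w, 'x) module_scheme" and T where
  zero: "\<zero>\<^bsub>M\<^esub> \<in> neg_span M T"
| step: "\<lbrakk>w \<in> neg_span M T; b \<in> T; v \<in> carrier M\<rbrakk> \<Longrightarrow> w \<oplus>\<^bsub>M\<^esub> y b \<odot>\<^bsub>M\<^esub> v \<in> neg_span M T"

context
  fixes M :: "('u, 'w, 'x) module_scheme" (structure)
  assumes M: "left_module A M"
begin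

interpretation M: left_module A M
  by (rule M)

lemma neg_span_closed: "w \<in> neg_span M T \<Longrightarrow> T \<subseteq> Neg \<Longrightarrow> w \<in> carrier M"
  by (induction rule: neg_span.induct) (auto intro!: M.smult_closed y_closed)

lemma neg_span_add:
  assumes "w' \<in> neg_span M T" "w \<in> neg_span M T" "T \<subseteq> Neg" shows "w \<oplus> w' \<in> neg_span M T"
  using assms
proof (induction rule: neg_span.induct)
  case zero
  then show ?case using neg_span_closed by simp
next
  case (step w' b v)
  then have "w \<oplus> w' \<oplus> y b \<odot> v \<in> neg_span M T"
    by (intro neg_span.step) auto
  moreover have "y b \<odot> v \<in> carrier M"
    using step by (intro M.smult_closed y_closed) auto
  ultimately show ?case
    using step neg_span_closed by (simp add: M.a_assoc)
qed

lemma neg_span_single: "b \<in> T \<Longrightarrow> v \<in> carrier M \<Longrightarrow> T \<subseteq> Neg \<Longrightarrow> y b \<odot> v \<in> neg_span M T"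
  using neg_span.step[OF neg_span.zero, of b T v M] M.smult_closed[OF y_closed, of b v] by auto

lemma neg_span_scalar: "w \<in> neg_span M T \<Longrightarrow> T \<subseteq> Neg \<Longrightarrow> \<kappa> x \<odot> w \<in> neg_span M T"
proof (induction rule: neg_span.induct)
  case zero
  then show ?case by (simp add: M.smult_zero_right scalar_closed neg_span.zero)
next
  case (step w b v)
  have "\<kappa> x \<odot> (w \<oplus> y b \<odot> v) = \<kappa> x \<odot> w \<oplus> y b \<odot> (\<kappa> x \<odot> v)"
    using step neg_span_closed[of w T] y_closed[of b]
    by (auto simp: M.smult_r_distr M.smult_closed scalar_closed scalar_central simp flip: M.smult_assoc)
  then show ?case
    using step by (auto intro!: neg_span.step M.smult_closed scalar_closed)
qed

lemma neg_span_finsum: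
  assumes "finite S" "\<And>d. d \<in> S \<Longrightarrow> g d \<in> neg_span M T" "T \<subseteq> Neg"
  shows "(\<Oplus>d\<in>S. g d) \<in> neg_span M T"
  using assms
proof (induction rule: finite_induct)
  case (insert d S)
  then have "g \<in> S \<rightarrow> carrier M" "g d \<in> carrier M"
    using neg_span_closed by blast+
  then show ?case using insert neg_span_add by simp
qed (simp add: neg_span.zero)

text \<open>Modulo \<open>y\<^sub>b y\<^sub>a v\<close>, which lies in the span, \<open>y\<^sub>a y\<^sub>b v\<close> is \<open>[y\<^sub>a, y\<^sub>b] v\<close>, and the bracket is a combination of
  the \<open>y\<^sub>d\<close> with \<open>d\<close> higher than \<open>b\<close>. These belong to \<open>T\<close>, as \<open>T\<close> is an upper set.\<close>

lemma neg_span_stable: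
  assumes upper: "\<And>b d. b \<in> T \<Longrightarrow> d \<in> Neg \<Longrightarrow> ht b < ht d \<Longrightarrow> d \<in> T" and T: "T \<subseteq> Neg"
    and a: "a \<in> Neg" and w: "w \<in> neg_span M T"
  shows "y a \<odot> w \<in> neg_span M T"
  using w
proof (induction rule: neg_span.induct)
  case zero
  then show ?case using a by (simp add: M.smult_zero_right y_closed neg_span.zero)
next
  case (step w b v)
  have b: "b \<in> Neg" using step T by auto
  have tm: "\<kappa> (c a b d) \<otimes>\<^bsub>A\<^esub> e d \<in> carrier A" if "d \<in> B" for d
    using that by (simp add: scalar_closed e_closed)
  have "(\<Oplus>\<^bsub>A\<^esub>d\<in>B. \<kappa> (c a b d) \<otimes>\<^bsub>A\<^esub> e d) \<odot> v = (\<Oplus>d\<in>B. (\<kappa> (c a b d) \<otimes>\<^bsub>A\<^esub> e d) \<odot> v)"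
    using step tm finite_B by (intro M.smult_finsum_left) auto
  also have "\<dots> \<in> neg_span M T"
  proof (rule neg_span_finsum[OF finite_B _ T])
    fix d assume d: "d \<in> B"
    show "(\<kappa> (c a b d) \<otimes>\<^bsub>A\<^esub> e d) \<odot> v \<in> neg_span M T"
    proof (cases "c a b d = 0")
      case True
      then show ?thesis
        using step d by (simp add: scalar_zero M.smult_zero_left neg_span.zero e_closed)
    next
      case False
      then have d': "d \<in> T" "\<chi> d = 0"
        using negative[of a b d] a b d upper[of b d] step by auto
      then have "e d = y d"
        using d e_closed by (simp add: y_def scalar_zero A.minus_eq)
      then show ?thesis
        using neg_span_scalar[OF neg_span_single, of d T v] d' T step d e_closed[of d]
        by (simp add: M.smult_assoc scalar_closed)
    qed
  qed
  finally have *: "(\<Oplus>\<^bsub>A\<^esub>d\<in>B. \<kappa> (c a b d) \<otimes>\<^bsub>A\<^esub> e d) \<odot> v \<in> neg_span M T" .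
  have s: "(\<Oplus>\<^bsub>A\<^esub>d\<in>B. \<kappa> (c a b d) \<otimes>\<^bsub>A\<^esub> e d) \<in> carrier A"
    using tm by (intro A.finsum_closed) auto
  have "y a \<odot> (y b \<odot> v) = (y a \<otimes>\<^bsub>A\<^esub> y b) \<odot> v"
    using a b step by (simp add: y_closed M.smult_assoc)
  also have "\<dots> = y b \<odot> (y a \<odot> v) \<oplus> (\<Oplus>\<^bsub>A\<^esub>d\<in>B. \<kappa> (c a b d) \<otimes>\<^bsub>A\<^esub> e d) \<odot> v"
    unfolding y_commutation[OF a b]
    using a b step s by (simp add: y_closed M.smult_assoc M.smult_l_distr)
  also have "\<dots> \<in> neg_span M T"
    using * a step T by (intro neg_span_add neg_span_single) (auto simp: M.smult_closed y_closed)
  finally have "y a \<odot> w \<oplus> y a \<odot> (y b \<odot> v) \<in> neg_span M T"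
    using step T neg_span_add by blast
  then show ?case
    using a b step T neg_span_closed by (simp add: M.smult_r_distr y_closed M.smult_closed)
qed

text \<open>Collecting all contributions of \<open>y t\<close> in one vector shows that \<open>y t\<close> is surjective modulo the rest,
  when the span is everything.\<close>

lemma neg_span_remove:
  assumes "w \<in> neg_span M T" "T \<subseteq> Neg" "t \<in> T"
  shows "\<exists>s\<in>neg_span M (T - {t}). \<exists>v\<in>carrier M. w = s \<oplus> y t \<odot> v"
  using assms
proof (induction rule: neg_span.induct)
  case zero
  then show ?case
    using y_closed[of t]
    by (intro bexI[of _ \<zero>] neg_span.zero) (auto simp: M.smult_zero_right)
next
  case (step w b v)
  then obtain s u where su: "s \<in> neg_span M (T - {t})" "u \<in> carrier M" "w = s \<oplus> y t \<odot> u"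
    by blast
  have cl: "s \<in> carrier M" "y t \<in> carrier A" "y b \<in> carrier A" "y b \<odot> v \<in> carrier M" "y t \<odot> u \<in> carrier M"
    using su step neg_span_closed[of s "T - {t}"] by (auto intro!: y_closed M.smult_closed)
  show ?case
  proof (cases "b = t")
    case True
    then show ?thesis
      using su step cl
      by (intro bexI[of _ s] bexI[of _ "u \<oplus> v"]) (auto simp: M.smult_r_distr M.a_assoc)
  next
    case False
    then have "s \<oplus> y b \<odot> v \<in> neg_span M (T - {t})"
      using su step by (intro neg_span.step) auto
    then show ?thesis
      using su cl by (intro bexI[of _ "s \<oplus> y b \<odot> v"] bexI[of _ u]) (auto simp: M.a_ac)
  qed
qed

text \<open>A Nakayama-type argument. Remove an element \<open>t\<close> of minimal height from the upper set. The smaller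
  span is stable under \<open>y t\<close>, and \<open>y t\<close> acts on the quotient by it surjectively and
  nilpotently. So the quotient vanishes, and the smaller span is again everything.\<close>

lemma neg_span_full_imp_trivial:
  assumes "finite T" "T \<subseteq> Neg" "\<And>b d. b \<in> T \<Longrightarrow> d \<in> Neg \<Longrightarrow> ht b < ht d \<Longrightarrow> d \<in> T"
    and "neg_span M T = carrier M"
  shows "carrier M = {\<zero>}"
  using assms
proof (induction "card T" arbitrary: T)
  case 0
  then have "neg_span M T = {\<zero>}"
    by (auto intro: neg_span.zero elim: neg_span.cases)
  then show ?case using 0 by simp
next
  case (Suc n)
  then have "T \<noteq> {}" by auto
  then obtain t where t: "t \<in> T" "\<And>b. b \<in> T \<Longrightarrow> ht t \<le> ht b"
    using ex_min_if_finite[of "ht ` T"] Suc.prems(1) by (auto simp: not_less)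
  let ?T = "T - {t}"
  have T': "?T \<subseteq> Neg" and tN: "t \<in> Neg" using Suc.prems t by auto
  have upper: "d \<in> ?T" if "b \<in> ?T" "d \<in> Neg" "ht b < ht d" for b d
    using Suc.prems(3)[of b d] that t(2)[of b] by auto
  have pow: "y t [^]\<^bsub>A\<^esub> m \<in> carrier A" for m :: nat
    using y_closed[OF tN] by simp
  have stable: "y t [^]\<^bsub>A\<^esub> m \<odot> s \<in> neg_span M ?T" if "s \<in> neg_span M ?T" for m :: nat and s
    using that
  proof (induction m arbitrary: s)
    case 0
    then show ?case using neg_span_closed[OF 0 T'] by (simp add: M.smult_one)
  next
    case (Suc m)
    then show ?case
      using neg_span_stable[OF upper T' tN] neg_span_closed[OF _ T'] pow y_closed[OF tN]
      by (simp add: M.smult_assoc)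
  qed
  have "\<exists>s\<in>neg_span M ?T. \<exists>v\<in>carrier M. w = s \<oplus> y t [^]\<^bsub>A\<^esub> m \<odot> v" if "w \<in> carrier M" for w and m :: nat
  proof (induction m)
    case 0
    show ?case
      using that by (intro bexI[of _ \<zero>] bexI[of _ w] neg_span.zero) (auto simp: M.smult_one)
  next
    case (Suc m)
    then obtain s v where sv: "s \<in> neg_span M ?T" "v \<in> carrier M" "w = s \<oplus> y t [^]\<^bsub>A\<^esub> m \<odot> v"
      by blast
    obtain s' v' where sv': "s' \<in> neg_span M ?T" "v' \<in> carrier M" "v = s' \<oplus> y t \<odot> v'"
      using neg_span_remove[of v T t] Suc.prems sv(2) t(1) \<open>neg_span M T = carrier M\<close> \<open>T \<subseteq> Neg\<close> by blast
    have cl: "s \<in> carrier M" "s' \<in> carrier M" "y t \<odot> v' \<in> carrier M"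
      using sv sv' neg_span_closed[OF _ T'] y_closed[OF tN] M.smult_closed by blast+
    have "w = (s \<oplus> y t [^]\<^bsub>A\<^esub> m \<odot> s') \<oplus> y t [^]\<^bsub>A\<^esub> Suc m \<odot> v'"
      using sv sv' cl pow[of m] y_closed[OF tN]
      by (simp add: M.smult_r_distr M.smult_assoc M.smult_closed M.a_assoc)
    then show ?case
      using sv sv' stable neg_span_add[OF _ _ T'] by blast
  qed
  note decomp = this
  have "w \<in> neg_span M ?T" if w: "w \<in> carrier M" for w
  proof -
    obtain s v where "s \<in> neg_span M ?T" "v \<in> carrier M" "w = s \<oplus> y t [^]\<^bsub>A\<^esub> p \<odot> v"
      using decomp[OF w, of p] by blast
    then show ?thesis
      using nilpotent[OF tN] neg_span_closed[OF _ T'] by (simp add: M.smult_zero_left flip: y_def)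
  qed
  then have "neg_span M ?T = carrier M"
    using neg_span_closed[OF _ T'] by blast
  moreover have "n = card ?T"
    using Suc t by simp
  ultimately show ?case
    using Suc.hyps(1)[of ?T] Suc.prems(1) T' upper by blast
qed

end


subsection \<open>Comparing two such modules\<close>

context
  fixes W :: "('u, 'w, 'x) module_scheme" and Q :: "('u, 'q, 'z) module_scheme" and w q wt
  assumes W: "left_module A W" and Q: "left_module A Q"
    and w: "w \<in> carrier W" and q: "q \<in> carrier Q"
    and eigen_W: "b \<in> B - Neg \<Longrightarrow> e b \<odot>\<^bsub>W\<^esub> w = \<kappa> (wt b) \<odot>\<^bsub>W\<^esub> w"
    and eigen_Q: "b \<in> B - Neg \<Longrightarrow> e b \<odot>\<^bsub>Q\<^esub> q = \<kappa> (wt b) \<odot>\<^bsub>Q\<^esub> q"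
begin

interpretation W: left_module A W
  by (rule W)

interpretation Q: left_module A Q
  by (rule Q)

text \<open>Elements that can be rewritten with the Borel part acting on \<open>w\<close> and \<open>q\<close> by scalars. The
  annihilator of the two vectors replaces the left ideal generated by the elements \<open>e b - wt b\<close>, so
  that \<open>W\<close> and \<open>Q\<close> are handled by the same induction.\<close>

inductive_set straightened :: "'u set" where
  annihilating: "\<lbrakk>a \<in> carrier A; a \<odot>\<^bsub>W\<^esub> w = \<zero>\<^bsub>W\<^esub>; a \<odot>\<^bsub>Q\<^esub> q = \<zero>\<^bsub>Q\<^esub>\<rbrakk> \<Longrightarrow> a \<in> straightened"
| scalar: "\<kappa> x \<in> straightened"
| add: "\<lbrakk>a \<in> straightened; a' \<in> straightened\<rbrakk> \<Longrightarrow> a \<oplus>\<^bsub>A\<^esub> a' \<in> straightened"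
| lower: "\<lbrakk>a \<in> straightened; b \<in> Neg\<rbrakk> \<Longrightarrow> e b \<otimes>\<^bsub>A\<^esub> a \<in> straightened"

lemma straightened_closed: "a \<in> straightened \<Longrightarrow> a \<in> carrier A"
  by (induction rule: straightened.induct) (use Neg_subset in \<open>auto simp: scalar_closed e_closed\<close>)

lemma straightened_finsum:
  assumes "finite S" "\<And>d. d \<in> S \<Longrightarrow> g d \<in> straightened" shows "(\<Oplus>\<^bsub>A\<^esub>d\<in>S. g d) \<in> straightened"
  using assms
proof (induction rule: finite_induct)
  case empty
  then show ?case using straightened.scalar[of 0] by (simp add: scalar_zero)
next
  case (insert d S)
  then have "g \<in> S \<rightarrow> carrier A" "g d \<in> carrier A"
    using straightened_closed by blast+
  then show ?case using insert straightened.add by simp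
qed

lemma straightened_scalar: "a \<in> straightened \<Longrightarrow> \<kappa> x \<otimes>\<^bsub>A\<^esub> a \<in> straightened"
proof (induction rule: straightened.induct)
  case (annihilating a)
  then show ?case
    by (intro straightened.annihilating)
      (simp_all add: scalar_closed W.smult_assoc Q.smult_assoc w q W.smult_zero_right Q.smult_zero_right)
next
  case (scalar x')
  then show ?case using straightened.scalar by (simp flip: scalar_mult)
next
  case (add a a')
  then show ?case
    using straightened.add by (simp add: A.r_distr straightened_closed scalar_closed)
next
  case (lower a b)
  then have "\<kappa> x \<otimes>\<^bsub>A\<^esub> (e b \<otimes>\<^bsub>A\<^esub> a) = e b \<otimes>\<^bsub>A\<^esub> (\<kappa> x \<otimes>\<^bsub>A\<^esub> a)"
  proof -
    have "e b \<in> carrier A" "a \<in> carrier A"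
      using lower e_closed Neg_subset straightened_closed by auto
    then show ?thesis
      using scalar_closed[of x] by (simp add: scalar_central[of "e b"] flip: A.m_assoc)
  qed
  then show ?case using lower straightened.lower by simp
qed

text \<open>Straightening: \<open>e b\<close> is moved to the right past each negative factor. The commutator terms are
  shorter products, covered by the induction hypothesis.\<close>

lemma straightened_e: "a \<in> straightened \<Longrightarrow> b \<in> B \<Longrightarrow> e b \<otimes>\<^bsub>A\<^esub> a \<in> straightened"
proof (induction arbitrary: b rule: straightened.induct)
  case (annihilating a)
  then show ?case
    by (intro straightened.annihilating)
      (simp_all add: e_closed W.smult_assoc Q.smult_assoc w q W.smult_zero_right Q.smult_zero_right)
next
  case (scalar x)
  show ?case
  proof (cases "b \<in> Neg")
    case False
    let ?z = "e b \<ominus>\<^bsub>A\<^esub> \<kappa> (wt b)"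
    have z: "?z \<in> carrier A" using scalar by (simp add: e_closed scalar_closed)
    have "?z \<in> straightened"
      using scalar False z w q eigen_W[of b] eigen_Q[of b]
      by (intro straightened.annihilating)
        (simp_all add: W.smult_diff_left Q.smult_diff_left e_closed scalar_closed
          W.diff_zero_iff Q.diff_zero_iff W.smult_closed Q.smult_closed)
    then have "?z \<oplus>\<^bsub>A\<^esub> \<kappa> (wt b) \<in> straightened"
      using straightened.add straightened.scalar by blast
    also have "?z \<oplus>\<^bsub>A\<^esub> \<kappa> (wt b) = e b"
      using A.diff_eq_iff[of "e b" "\<kappa> (wt b)" ?z] z scalar e_closed[of b] scalar_closed[of "wt b"] by simp
    finally show ?thesis
      using straightened_scalar scalar_central[of "e b" x] e_closed scalar by metis
  qed (use straightened.lower straightened.scalar in blast)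
next
  case (add a a')
  then show ?case using straightened.add by (simp add: A.r_distr straightened_closed e_closed)
next
  case (lower a d)
  then have d: "d \<in> B" and a: "a \<in> carrier A" using Neg_subset straightened_closed by auto
  have tm: "\<kappa> (c b d f) \<otimes>\<^bsub>A\<^esub> e f \<in> carrier A" if "f \<in> B" for f
    using that by (simp add: scalar_closed e_closed)
  then have s: "(\<Oplus>\<^bsub>A\<^esub>f\<in>B. \<kappa> (c b d f) \<otimes>\<^bsub>A\<^esub> e f) \<in> carrier A"
    by (intro A.finsum_closed) auto
  have "e b \<otimes>\<^bsub>A\<^esub> (e d \<otimes>\<^bsub>A\<^esub> a) = (e b \<otimes>\<^bsub>A\<^esub> e d) \<otimes>\<^bsub>A\<^esub> a"
    using lower.prems d a by (simp add: e_closed A.m_assoc)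
  also have "\<dots> = e d \<otimes>\<^bsub>A\<^esub> (e b \<otimes>\<^bsub>A\<^esub> a) \<oplus>\<^bsub>A\<^esub> (\<Oplus>\<^bsub>A\<^esub>f\<in>B. \<kappa> (c b d f) \<otimes>\<^bsub>A\<^esub> e f) \<otimes>\<^bsub>A\<^esub> a"
    unfolding commutation[OF lower.prems d] using lower.prems d a s
    by (simp add: e_closed A.m_assoc A.l_distr)
  also have "(\<Oplus>\<^bsub>A\<^esub>f\<in>B. \<kappa> (c b d f) \<otimes>\<^bsub>A\<^esub> e f) \<otimes>\<^bsub>A\<^esub> a = (\<Oplus>\<^bsub>A\<^esub>f\<in>B. \<kappa> (c b d f) \<otimes>\<^bsub>A\<^esub> (e f \<otimes>\<^bsub>A\<^esub> a))"
    using finite_B a tm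
    by (subst A.finsum_ldistr) (auto intro!: A.finsum_cong' simp: scalar_closed e_closed A.m_assoc)
  finally show ?case
    using lower d straightened_finsum[OF finite_B] straightened_scalar
    by (simp add: straightened.add straightened.lower)
qed

text \<open>The straightened elements form a left ideal that contains \<open>1\<close>.\<close>

lemma straightened_eq: "straightened = carrier A"
proof -
  have "carrier A \<subseteq> {a \<in> carrier A. \<forall>h\<in>straightened. a \<otimes>\<^bsub>A\<^esub> h \<in> straightened}"
    by (rule generation)
      (auto simp: scalar_closed e_closed straightened_scalar straightened_e A.l_distr A.m_assoc straightened_closed
        intro: straightened.add)
  then have "a \<in> straightened" if "a \<in> carrier A" for a
    using that straightened.scalar[of 1] by (force simp: scalar_one)
  then show ?thesis using straightened_closed by blast
qed

text \<open>The scalar is determined by a straightened expression of \<open>a\<close> and not by the module: replacing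
  \<open>e b\<close> by \<open>y b + \<chi> b\<close> turns each factor \<open>e b\<close> into the scalar \<open>\<chi> b\<close>, up to the span of the images of
  the \<open>y b\<close>. This is why the two modules are treated as a pair.\<close>

lemma common_scalar:
  assumes "a \<in> carrier A"
  obtains x s t where "s \<in> neg_span W Neg" "t \<in> neg_span Q Neg"
    "a \<odot>\<^bsub>W\<^esub> w = \<kappa> x \<odot>\<^bsub>W\<^esub> w \<oplus>\<^bsub>W\<^esub> s" "a \<odot>\<^bsub>Q\<^esub> q = \<kappa> x \<odot>\<^bsub>Q\<^esub> q \<oplus>\<^bsub>Q\<^esub> t"
proof -
  have lower_M: "\<exists>s'\<in>neg_span M Neg. (e b \<otimes>\<^bsub>A\<^esub> a) \<odot>\<^bsub>M\<^esub> m = \<kappa> (\<chi> b * x) \<odot>\<^bsub>M\<^esub> m \<oplus>\<^bsub>M\<^esub> s'"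
    if M: "left_module A M" and m: "m \<in> carrier M" and b: "b \<in> Neg" and a: "a \<in> carrier A"
      and s: "s \<in> neg_span M Neg" and eq: "a \<odot>\<^bsub>M\<^esub> m = \<kappa> x \<odot>\<^bsub>M\<^esub> m \<oplus>\<^bsub>M\<^esub> s"
    for M :: "('u, 'v, 'y) module_scheme" and m s a b x
  proof -
    interpret M: left_module A M by fact
    have eb: "e b \<in> carrier A" using b Neg_subset e_closed by auto
    have am: "a \<odot>\<^bsub>M\<^esub> m \<in> carrier M" using a m by (rule M.smult_closed)
    have "e b = y b \<oplus>\<^bsub>A\<^esub> \<kappa> (\<chi> b)"
      using A.diff_eq_iff[of "e b" "\<kappa> (\<chi> b)" "y b"] eb y_closed[OF b] by (simp add: y_def scalar_closed)
    then have "(e b \<otimes>\<^bsub>A\<^esub> a) \<odot>\<^bsub>M\<^esub> m = y b \<odot>\<^bsub>M\<^esub> (a \<odot>\<^bsub>M\<^esub> m) \<oplus>\<^bsub>M\<^esub> \<kappa> (\<chi> b) \<odot>\<^bsub>M\<^esub> (a \<odot>\<^bsub>M\<^esub> m)"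
      using eb a m am y_closed[OF b] by (simp add: M.smult_assoc M.smult_l_distr scalar_closed)
    also have "\<kappa> (\<chi> b) \<odot>\<^bsub>M\<^esub> (a \<odot>\<^bsub>M\<^esub> m) = \<kappa> (\<chi> b * x) \<odot>\<^bsub>M\<^esub> m \<oplus>\<^bsub>M\<^esub> \<kappa> (\<chi> b) \<odot>\<^bsub>M\<^esub> s"
      unfolding eq using m neg_span_closed[OF M s]
      by (simp add: scalar_closed M.smult_closed M.smult_r_distr scalar_mult M.smult_assoc)
    finally have "(e b \<otimes>\<^bsub>A\<^esub> a) \<odot>\<^bsub>M\<^esub> m =
        \<kappa> (\<chi> b * x) \<odot>\<^bsub>M\<^esub> m \<oplus>\<^bsub>M\<^esub> (y b \<odot>\<^bsub>M\<^esub> (a \<odot>\<^bsub>M\<^esub> m) \<oplus>\<^bsub>M\<^esub> \<kappa> (\<chi> b) \<odot>\<^bsub>M\<^esub> s)"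
      using m am neg_span_closed[OF M s] y_closed[OF b]
      by (simp add: scalar_closed M.smult_closed M.a_ac)
    moreover have "y b \<odot>\<^bsub>M\<^esub> (a \<odot>\<^bsub>M\<^esub> m) \<oplus>\<^bsub>M\<^esub> \<kappa> (\<chi> b) \<odot>\<^bsub>M\<^esub> s \<in> neg_span M Neg"
      using neg_span_add[OF M neg_span_scalar[OF M s] neg_span_single[OF M b am]] by simp
    ultimately show ?thesis by blast
  qed
  have "\<exists>x. (\<exists>s\<in>neg_span W Neg. a \<odot>\<^bsub>W\<^esub> w = \<kappa> x \<odot>\<^bsub>W\<^esub> w \<oplus>\<^bsub>W\<^esub> s) \<and>
      (\<exists>t\<in>neg_span Q Neg. a \<odot>\<^bsub>Q\<^esub> q = \<kappa> x \<odot>\<^bsub>Q\<^esub> q \<oplus>\<^bsub>Q\<^esub> t)"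
    using assms unfolding straightened_eq[symmetric]
  proof (induction rule: straightened.induct)
    case (annihilating a)
    then show ?case
      by (intro exI[of _ 0] conjI bexI[OF _ neg_span.zero])
        (simp_all add: scalar_zero W.smult_zero_left Q.smult_zero_left w q)
  next
    case (scalar x)
    show ?case
      by (intro exI[of _ x] conjI bexI[OF _ neg_span.zero])
        (simp_all add: scalar_closed w q W.smult_closed Q.smult_closed)
  next
    case (add a a')
    then obtain x s t x' s' t' where *: "s \<in> neg_span W Neg" "t \<in> neg_span Q Neg"
      "a \<odot>\<^bsub>W\<^esub> w = \<kappa> x \<odot>\<^bsub>W\<^esub> w \<oplus>\<^bsub>W\<^esub> s" "a \<odot>\<^bsub>Q\<^esub> q = \<kappa> x \<odot>\<^bsub>Q\<^esub> q \<oplus>\<^bsub>Q\<^esub> t"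
      "s' \<in> neg_span W Neg" "t' \<in> neg_span Q Neg"
      "a' \<odot>\<^bsub>W\<^esub> w = \<kappa> x' \<odot>\<^bsub>W\<^esub> w \<oplus>\<^bsub>W\<^esub> s'" "a' \<odot>\<^bsub>Q\<^esub> q = \<kappa> x' \<odot>\<^bsub>Q\<^esub> q \<oplus>\<^bsub>Q\<^esub> t'"
      by blast
    have cl: "s \<in> carrier W" "s' \<in> carrier W" "t \<in> carrier Q" "t' \<in> carrier Q"
      using * neg_span_closed[OF W] neg_span_closed[OF Q] by blast+
    have "a \<in> carrier A" "a' \<in> carrier A" using add straightened_closed by auto
    then have "(a \<oplus>\<^bsub>A\<^esub> a') \<odot>\<^bsub>W\<^esub> w = \<kappa> (x + x') \<odot>\<^bsub>W\<^esub> w \<oplus>\<^bsub>W\<^esub> (s \<oplus>\<^bsub>W\<^esub> s')"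
      "(a \<oplus>\<^bsub>A\<^esub> a') \<odot>\<^bsub>Q\<^esub> q = \<kappa> (x + x') \<odot>\<^bsub>Q\<^esub> q \<oplus>\<^bsub>Q\<^esub> (t \<oplus>\<^bsub>Q\<^esub> t')"
      using * cl w q by (simp_all add: W.smult_l_distr Q.smult_l_distr scalar_add scalar_closed
          W.a_ac Q.a_ac W.smult_closed Q.smult_closed)
    moreover have "s \<oplus>\<^bsub>W\<^esub> s' \<in> neg_span W Neg" "t \<oplus>\<^bsub>Q\<^esub> t' \<in> neg_span Q Neg"
      using * neg_span_add[OF W] neg_span_add[OF Q] by blast+
    ultimately show ?case by blast
  next
    case (lower a b)
    then show ?case
      using lower_M[OF W w, of b a] lower_M[OF Q q, of b a] straightened_closed by blast
  qed
  then show ?thesis using that by blast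
qed

text \<open>If the generator lies in the span of the images of the \<open>y b\<close>, so does every \<open>\<kappa> x w + s\<close>, and the span is
  the whole module.\<close>

lemma cyclic_neg_span_trivial_pair:
  assumes cyclic: "\<And>z. z \<in> carrier W \<Longrightarrow> \<exists>a\<in>carrier A. z = a \<odot>\<^bsub>W\<^esub> w" and "w \<in> neg_span W Neg"
  shows "carrier W = {\<zero>\<^bsub>W\<^esub>}"
proof (rule neg_span_full_imp_trivial[OF W])
  show "neg_span W Neg = carrier W"
  proof
    show "carrier W \<subseteq> neg_span W Neg"
    proof
      fix z assume "z \<in> carrier W"
      then obtain a where "a \<in> carrier A" "z = a \<odot>\<^bsub>W\<^esub> w" using cyclic by blast
      then obtain x s where "s \<in> neg_span W Neg" "z = \<kappa> x \<odot>\<^bsub>W\<^esub> w \<oplus>\<^bsub>W\<^esub> s"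
        using common_scalar by metis
      then show "z \<in> neg_span W Neg"
        using neg_span_add[OF W] neg_span_scalar[OF W assms(2)] by blast
    qed
  qed (use neg_span_closed[OF W] in blast)
qed (use finite_B Neg_subset finite_subset in auto)

end

text \<open>The preceding lemma for a single module, obtained from the pair of two copies of it.\<close>

lemma cyclic_neg_span_trivial:
  assumes M: "left_module A M" and m: "m \<in> carrier M"
    and eigen: "\<And>b. b \<in> B - Neg \<Longrightarrow> e b \<odot>\<^bsub>M\<^esub> m = \<kappa> (wt b) \<odot>\<^bsub>M\<^esub> m"
    and cyclic: "\<And>z. z \<in> carrier M \<Longrightarrow> \<exists>a\<in>carrier A. z = a \<odot>\<^bsub>M\<^esub> m" and "m \<in> neg_span M Neg"
  shows "carrier M = {\<zero>\<^bsub>M\<^esub>}"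
  using cyclic_neg_span_trivial_pair[OF M M m m eigen eigen cyclic] assms(5) by blast

context
  fixes W :: "('u, 'w, 'x) module_scheme" and Q :: "('u, 'q, 'z) module_scheme" and w q wt
  assumes W: "left_module A W" and Q: "left_module A Q"
    and w: "w \<in> carrier W" and q: "q \<in> carrier Q"
    and eigen_W: "\<And>b. b \<in> B - Neg \<Longrightarrow> e b \<odot>\<^bsub>W\<^esub> w = \<kappa> (wt b) \<odot>\<^bsub>W\<^esub> w"
    and eigen_Q: "\<And>b. b \<in> B - Neg \<Longrightarrow> e b \<odot>\<^bsub>Q\<^esub> q = \<kappa> (wt b) \<odot>\<^bsub>Q\<^esub> q"
    and cyclic_W: "\<And>z. z \<in> carrier W \<Longrightarrow> \<exists>a\<in>carrier A. z = a \<odot>\<^bsub>W\<^esub> w"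
    and cyclic_Q: "\<And>z. z \<in> carrier Q \<Longrightarrow> \<exists>a\<in>carrier A. z = a \<odot>\<^bsub>Q\<^esub> q"
    and simple_Q: "simple_left_module A Q" and nonzero_W: "carrier W \<noteq> {\<zero>\<^bsub>W\<^esub>}"
begin

interpretation W: left_module A W
  by (rule W)

interpretation Q: left_module A Q
  by (rule Q)

text \<open>Multiplying \<open>a\<close> from the left, one may assume that it fixes \<open>q\<close> and kills \<open>w\<close>. Depending on
  whether the common scalar is zero, \<open>q\<close> or \<open>w\<close> then lies in the span of the images of the \<open>y b\<close>,
  and \<open>Q\<close> or \<open>W\<close> would be zero.\<close>

lemma annihilator_subset:
  assumes a: "a \<in> carrier A" and aw: "a \<odot>\<^bsub>W\<^esub> w = \<zero>\<^bsub>W\<^esub>" shows "a \<odot>\<^bsub>Q\<^esub> q = \<zero>\<^bsub>Q\<^esub>"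
proof (rule ccontr)
  assume nz: "a \<odot>\<^bsub>Q\<^esub> q \<noteq> \<zero>\<^bsub>Q\<^esub>"
  have aq: "a \<odot>\<^bsub>Q\<^esub> q \<in> carrier Q" using a q Q.smult_closed by blast
  have "submodule ((\<lambda>u. u \<odot>\<^bsub>Q\<^esub> (a \<odot>\<^bsub>Q\<^esub> q)) ` carrier A) A Q"
    by (rule Q.cyclic_submodule[OF aq])
  moreover have "a \<odot>\<^bsub>Q\<^esub> q \<in> (\<lambda>u. u \<odot>\<^bsub>Q\<^esub> (a \<odot>\<^bsub>Q\<^esub> q)) ` carrier A"
    using Q.smult_one[OF aq] by (intro image_eqI[of _ _ "\<one>\<^bsub>A\<^esub>"]) auto
  ultimately have "(\<lambda>u. u \<odot>\<^bsub>Q\<^esub> (a \<odot>\<^bsub>Q\<^esub> q)) ` carrier A = carrier Q"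
    using simple_left_module.simple[OF simple_Q] nz by blast
  then obtain u where u: "u \<in> carrier A" "q = u \<odot>\<^bsub>Q\<^esub> (a \<odot>\<^bsub>Q\<^esub> q)"
    using q by blast
  have "u \<otimes>\<^bsub>A\<^esub> a \<in> carrier A" using u a by simp
  then obtain x s t where xst: "s \<in> neg_span W Neg" "t \<in> neg_span Q Neg"
    "(u \<otimes>\<^bsub>A\<^esub> a) \<odot>\<^bsub>W\<^esub> w = \<kappa> x \<odot>\<^bsub>W\<^esub> w \<oplus>\<^bsub>W\<^esub> s" "(u \<otimes>\<^bsub>A\<^esub> a) \<odot>\<^bsub>Q\<^esub> q = \<kappa> x \<odot>\<^bsub>Q\<^esub> q \<oplus>\<^bsub>Q\<^esub> t"
    by (rule common_scalar[where wt = wt, OF W Q w q, rotated 2])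
      (assumption | erule eigen_W | erule eigen_Q)+
  have s: "s \<in> carrier W" and t: "t \<in> carrier Q"
    using xst neg_span_closed[OF W] neg_span_closed[OF Q] by blast+
  show False
  proof (cases "x = 0")
    case True
    then have "q = t"
      using xst u a q t by (simp add: Q.smult_assoc scalar_zero Q.smult_zero_left)
    then show False
      using cyclic_neg_span_trivial[OF Q q eigen_Q cyclic_Q] xst simple_left_module.nonzero[OF simple_Q] by blast
  next
    case False
    have "\<kappa> x \<odot>\<^bsub>W\<^esub> w \<oplus>\<^bsub>W\<^esub> s = \<zero>\<^bsub>W\<^esub>"
      using xst(3) u a w by (simp add: W.smult_assoc aw W.smult_zero_right)
    then have "\<kappa> (inverse x) \<odot>\<^bsub>W\<^esub> (\<kappa> x \<odot>\<^bsub>W\<^esub> w \<oplus>\<^bsub>W\<^esub> s) = \<zero>\<^bsub>W\<^esub>"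
      by (simp add: W.smult_zero_right scalar_closed)
    then have "w \<oplus>\<^bsub>W\<^esub> \<kappa> (inverse x) \<odot>\<^bsub>W\<^esub> s = \<zero>\<^bsub>W\<^esub>"
      using w s False
      by (simp add: W.smult_r_distr W.smult_closed scalar_closed scalar_one W.smult_one
          flip: W.smult_assoc scalar_mult)
    then have "w = \<ominus>\<^bsub>W\<^esub> (\<kappa> (inverse x) \<odot>\<^bsub>W\<^esub> s)"
      using w s by (intro W.minus_equality[symmetric]) (simp_all add: W.smult_closed scalar_closed)
    moreover have "\<kappa> (-1) = \<ominus>\<^bsub>A\<^esub> \<one>\<^bsub>A\<^esub>"
      using scalar_add[of "-1" 1] by (intro A.minus_equality[symmetric])
        (simp_all add: scalar_closed scalar_zero scalar_one)
    ultimately have "w = \<kappa> (-1) \<odot>\<^bsub>W\<^esub> (\<kappa> (inverse x) \<odot>\<^bsub>W\<^esub> s)"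
      using s by (simp add: W.smult_minus_left W.smult_closed scalar_closed W.smult_one)
    then have "w \<in> neg_span W Neg"
      using neg_span_scalar[OF W neg_span_scalar[OF W xst(1)]] by simp
    then show False
      using cyclic_neg_span_trivial[OF W w eigen_W cyclic_W] nonzero_W by blast
  qed
qed

text \<open>The inclusion of annihilators makes \<open>a w \<mapsto> a q\<close> well defined.\<close>

theorem surjection_exists:
  "\<exists>f. left_module_hom A W Q f \<and> f ` carrier W = carrier Q"
proof -
  define f where "f z = (THE x. \<exists>a\<in>carrier A. z = a \<odot>\<^bsub>W\<^esub> w \<and> x = a \<odot>\<^bsub>Q\<^esub> q)" for z
  have f: "f (a \<odot>\<^bsub>W\<^esub> w) = a \<odot>\<^bsub>Q\<^esub> q" if a: "a \<in> carrier A" for a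
    unfolding f_def
  proof (rule the_equality)
    show "\<exists>a'\<in>carrier A. a \<odot>\<^bsub>W\<^esub> w = a' \<odot>\<^bsub>W\<^esub> w \<and> a \<odot>\<^bsub>Q\<^esub> q = a' \<odot>\<^bsub>Q\<^esub> q"
      using a by blast
    fix x assume "\<exists>a'\<in>carrier A. a \<odot>\<^bsub>W\<^esub> w = a' \<odot>\<^bsub>W\<^esub> w \<and> x = a' \<odot>\<^bsub>Q\<^esub> q"
    then obtain a' where a': "a' \<in> carrier A" "a \<odot>\<^bsub>W\<^esub> w = a' \<odot>\<^bsub>W\<^esub> w" "x = a' \<odot>\<^bsub>Q\<^esub> q"
      by blast
    have "(a' \<ominus>\<^bsub>A\<^esub> a) \<odot>\<^bsub>W\<^esub> w = \<zero>\<^bsub>W\<^esub>"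
      using a a' w by (simp add: W.smult_diff_left W.smult_closed W.diff_zero_iff)
    then have "(a' \<ominus>\<^bsub>A\<^esub> a) \<odot>\<^bsub>Q\<^esub> q = \<zero>\<^bsub>Q\<^esub>"
      using a a' by (intro annihilator_subset) simp_all
    then show "x = a \<odot>\<^bsub>Q\<^esub> q"
      using a a' q by (simp add: Q.smult_diff_left Q.smult_closed Q.diff_zero_iff)
  qed
  have "left_module_hom A W Q f"
  proof (intro left_module_hom.intro left_module_hom_axioms.intro W Q)
    fix v assume "v \<in> carrier W"
    then obtain a where a: "a \<in> carrier A" "v = a \<odot>\<^bsub>W\<^esub> w" using cyclic_W by blast
    then show "f v \<in> carrier Q" using q by (simp add: f Q.smult_closed)
    show "f (u \<odot>\<^bsub>W\<^esub> v) = u \<odot>\<^bsub>Q\<^esub> f v" if u: "u \<in> carrier A" for u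
    proof -
      have "f (u \<odot>\<^bsub>W\<^esub> v) = f ((u \<otimes>\<^bsub>A\<^esub> a) \<odot>\<^bsub>W\<^esub> w)"
        unfolding a(2) W.smult_assoc[OF u a(1) w] ..
      also have "\<dots> = u \<odot>\<^bsub>Q\<^esub> (a \<odot>\<^bsub>Q\<^esub> q)"
        using f[of "u \<otimes>\<^bsub>A\<^esub> a"] u a(1) q by (simp only: A.m_closed Q.smult_assoc)
      finally show ?thesis
        unfolding a(2) f[OF a(1)] .
    qed
    show "f (v \<oplus>\<^bsub>W\<^esub> v') = f v \<oplus>\<^bsub>Q\<^esub> f v'" if v': "v' \<in> carrier W" for v'
    proof -
      obtain a' where a': "a' \<in> carrier A" "v' = a' \<odot>\<^bsub>W\<^esub> w" using v' cyclic_W by blast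
      have "f (v \<oplus>\<^bsub>W\<^esub> v') = f ((a \<oplus>\<^bsub>A\<^esub> a') \<odot>\<^bsub>W\<^esub> w)"
        unfolding a(2) a'(2) W.smult_l_distr[OF a(1) a'(1) w] ..
      also have "\<dots> = a \<odot>\<^bsub>Q\<^esub> q \<oplus>\<^bsub>Q\<^esub> a' \<odot>\<^bsub>Q\<^esub> q"
        using f[of "a \<oplus>\<^bsub>A\<^esub> a'"] a(1) a'(1) q by (simp only: A.add.m_closed Q.smult_l_distr)
      finally show ?thesis
        unfolding a(2) a'(2) f[OF a(1)] f[OF a'(1)] .
    qed
  qed
  moreover have "f ` carrier W = carrier Q"
  proof
    show "f ` carrier W \<subseteq> carrier Q"
      using calculation by (auto intro: left_module_hom.hom_closed)
    show "carrier Q \<subseteq> f ` carrier W"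
    proof
      fix z assume "z \<in> carrier Q"
      then obtain a where a: "a \<in> carrier A" "z = a \<odot>\<^bsub>Q\<^esub> q" using cyclic_Q by blast
      then show "z \<in> f ` carrier W"
        using w by (intro image_eqI[of _ _ "a \<odot>\<^bsub>W\<^esub> w"]) (simp_all add: f W.smult_closed)
    qed
  qed
  ultimately show ?thesis by blast
qed

end

end


section \<open>Weights of the adapted basis\<close>

text \<open>The properties of the basis that are shared by the simple Lie algebras with a Chevalley basis and
  by \<open>\<gg>\<ll>\<^sub>n\<close> with its matrix units.\<close>

locale split_datum =
  fixes D :: "'g::ab_group_add split_lie"
  assumes complex_lie: "complex_lie_algebra D"
    and finite_basis: "finite (adapted_basis D)"
    and independent_basis: "\<not> module.dependent (lie_scale D) (adapted_basis D)"
    and span_basis: "module.span (lie_scale D) (adapted_basis D) = UNIV"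
    and torus_basis_subset: "torus_basis D \<subseteq> torus D"
    and torus_commutes: "x \<in> torus D \<Longrightarrow> y \<in> torus D \<Longrightarrow> lie_bracket D x y = 0"
    and root_vector_in: "\<alpha> \<in> roots D \<Longrightarrow> root_vector D \<alpha> \<in> root_space D \<alpha>"
    and base: "is_base D"
    and structure_integral: "\<lbrakk>a \<in> adapted_basis D; b \<in> adapted_basis D; d \<in> adapted_basis D\<rbrakk> \<Longrightarrow>
      coord D (lie_bracket D a b) d \<in> \<int>"
begin

sublocale VS: vector_space "lie_scale D"
  using complex_lie by (simp add: complex_lie_algebra_def)

lemma bracket_simps:
  "lie_bracket D (x + y) z = lie_bracket D x z + lie_bracket D y z"
  "lie_bracket D x (y + z) = lie_bracket D x y + lie_bracket D x z"
  "lie_bracket D (lie_scale D t x) y = lie_scale D t (lie_bracket D x y)"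
  "lie_bracket D x (lie_scale D t y) = lie_scale D t (lie_bracket D x y)"
  "lie_bracket D x x = 0"
  using complex_lie unfolding complex_lie_algebra_def by blast+

lemma jacobi:
  "lie_bracket D x (lie_bracket D y z) + lie_bracket D y (lie_bracket D z x)
           + lie_bracket D z (lie_bracket D x y) = 0"
  using complex_lie unfolding complex_lie_algebra_def by blast

lemma bracket_zero: "lie_bracket D 0 x = 0" "lie_bracket D x 0 = 0"
  using bracket_simps(1)[of 0 0 x] bracket_simps(2)[of x 0 0] by simp_all

lemma bracket_antisym: "lie_bracket D x y = - lie_bracket D y x"
proof -
  have "lie_bracket D (x + y) (x + y) = lie_bracket D x y + lie_bracket D y x"
    unfolding bracket_simps(1,2) by (simp add: bracket_simps(5) add.commute)
  then show ?thesis
    by (simp add: bracket_simps(5) eq_neg_iff_add_eq_0)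
qed

lemma coord_simps:
  "coord D (x + y) b = coord D x b + coord D y b"
  "coord D (lie_scale D t x) b = t * coord D x b"
  "coord D 0 b = 0"
  "a \<in> adapted_basis D \<Longrightarrow> coord D a b = (if a = b then 1 else 0)"
  using VS.representation_add[OF independent_basis, of y x] VS.representation_scale[OF independent_basis, of x t]
    VS.representation_zero[of "adapted_basis D"] VS.representation_basis[OF independent_basis, of a]
  by (auto simp: span_basis)

lemma basis_expansion: "(\<Sum>b\<in>adapted_basis D. lie_scale D (coord D x b) b) = x"
  using VS.sum_representation_eq[OF independent_basis, of x "adapted_basis D"]
  by (simp add: span_basis finite_basis)

lemma coord_sum: "coord D (\<Sum>i\<in>T. f i) b = (\<Sum>i\<in>T. coord D (f i) b)"
  by (induction T rule: infinite_finite_induct) (simp_all add: coord_simps)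

lemma bracket_sum:
  "lie_bracket D (\<Sum>i\<in>T. f i) y = (\<Sum>i\<in>T. lie_bracket D (f i) y)"
  "lie_bracket D x (\<Sum>i\<in>T. f i) = (\<Sum>i\<in>T. lie_bracket D x (f i))"
  by (induction T rule: infinite_finite_induct) (simp_all add: bracket_simps bracket_zero)

lemma coord_bracket:
  "coord D (lie_bracket D x y) d = (\<Sum>a\<in>adapted_basis D. \<Sum>b\<in>adapted_basis D.
    coord D x a * coord D y b * coord D (lie_bracket D a b) d)"
proof -
  have "lie_bracket D x y = lie_bracket D (\<Sum>a\<in>adapted_basis D. lie_scale D (coord D x a) a)
      (\<Sum>b\<in>adapted_basis D. lie_scale D (coord D y b) b)"
    by (simp add: basis_expansion)
  also have "\<dots> = (\<Sum>a\<in>adapted_basis D. \<Sum>b\<in>adapted_basis D.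
      lie_scale D (coord D x a) (lie_scale D (coord D y b) (lie_bracket D a b)))"
    by (simp only: bracket_sum(1) bracket_simps(3))
      (simp only: bracket_sum(2) bracket_simps(4) VS.scale_sum_right)
  finally show ?thesis
    by (simp add: coord_sum coord_simps mult.assoc)
qed

lemma finite_torus_basis: "finite (torus_basis D)"
  using finite_basis by (rule finite_subset[rotated]) (auto simp: adapted_basis_def)

lemma basis_nonzero: "b \<in> adapted_basis D \<Longrightarrow> b \<noteq> 0"
  using independent_basis VS.dependent_zero by blast

lemma root_in_dual: "\<alpha> \<in> roots D \<Longrightarrow> x \<notin> torus D \<Longrightarrow> \<alpha> x = 0"
  by (simp add: roots_def torus_dual_def)

lemma root_nonzero: "\<alpha> \<in> roots D \<Longrightarrow> \<exists>h\<in>torus D. \<alpha> h \<noteq> 0"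
  using root_in_dual[of \<alpha>] by (auto simp: roots_def fun_eq_iff)

lemma root_vector_in_basis: "\<alpha> \<in> roots D \<Longrightarrow> root_vector D \<alpha> \<in> adapted_basis D"
  by (simp add: adapted_basis_def)

lemma root_vector_not_torus: "\<alpha> \<in> roots D \<Longrightarrow> root_vector D \<alpha> \<notin> torus D"
proof
  assume \<alpha>: "\<alpha> \<in> roots D" and t: "root_vector D \<alpha> \<in> torus D"
  obtain h where h: "h \<in> torus D" "\<alpha> h \<noteq> 0" using root_nonzero[OF \<alpha>] by blast
  then have "lie_scale D (\<alpha> h) (root_vector D \<alpha>) = 0"
    using root_vector_in[OF \<alpha>] torus_commutes[OF h(1) t] by (simp add: root_space_def)
  then show False
    using h basis_nonzero[OF root_vector_in_basis[OF \<alpha>]] by simp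
qed

lemma root_vector_inj: "\<alpha> \<in> roots D \<Longrightarrow> \<beta> \<in> roots D \<Longrightarrow> root_vector D \<alpha> = root_vector D \<beta> \<Longrightarrow> \<alpha> = \<beta>"
proof
  fix x assume *: "\<alpha> \<in> roots D" "\<beta> \<in> roots D" "root_vector D \<alpha> = root_vector D \<beta>"
  show "\<alpha> x = \<beta> x"
  proof (cases "x \<in> torus D")
    case True
    then have "lie_scale D (\<alpha> x) (root_vector D \<alpha>) = lie_scale D (\<beta> x) (root_vector D \<alpha>)"
      using root_vector_in[of \<alpha>] root_vector_in[of \<beta>] * by (auto simp: root_space_def)
    then show ?thesis
      using basis_nonzero[OF root_vector_in_basis[OF *(1)]] VS.scale_right_imp_eq by blast
  qed (use * root_in_dual[of \<alpha> x] root_in_dual[of \<beta> x] in simp)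
qed

text \<open>The root is unique by \<open>root_vector_inj\<close>.\<close>

definition basis_weight :: "'g \<Rightarrow> 'g \<Rightarrow> complex" where
  "basis_weight b = (if b \<in> torus_basis D then (\<lambda>_. 0)
     else (THE \<alpha>. \<alpha> \<in> roots D \<and> b = root_vector D \<alpha>))"

lemma basis_weight_torus: "b \<in> torus_basis D \<Longrightarrow> basis_weight b = (\<lambda>_. 0)"
  by (simp add: basis_weight_def)

lemma basis_weight_root: "\<alpha> \<in> roots D \<Longrightarrow> basis_weight (root_vector D \<alpha>) = \<alpha>"
  using root_vector_not_torus torus_basis_subset
  by (auto simp: basis_weight_def intro!: the_equality root_vector_inj)

lemma basis_cases:
  assumes "b \<in> adapted_basis D"
  obtains "b \<in> torus_basis D" "basis_weight b = (\<lambda>_. 0)"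
  | \<alpha> where "\<alpha> \<in> roots D" "b = root_vector D \<alpha>" "basis_weight b = \<alpha>"
  using assms basis_weight_root basis_weight_torus by (auto simp: adapted_basis_def)

lemma basis_weight_off_torus: "b \<in> adapted_basis D \<Longrightarrow> x \<notin> torus D \<Longrightarrow> basis_weight b x = 0"
  by (erule basis_cases) (auto intro: root_in_dual)

lemma basis_weight_space: "b \<in> adapted_basis D \<Longrightarrow> b \<in> root_space D (basis_weight b)"
  using torus_commutes torus_basis_subset root_vector_in
  by (erule_tac basis_cases) (auto simp: root_space_def)

text \<open>The adapted basis diagonalises \<open>ad h\<close>.\<close>

lemma coord_ad_torus:
  assumes h: "h \<in> torus D" and d: "d \<in> adapted_basis D"
  shows "coord D (lie_bracket D h x) d = basis_weight d h * coord D x d"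
proof -
  have "coord D (lie_bracket D h b) d = basis_weight d h * coord D b d" if "b \<in> adapted_basis D" for b
    using basis_weight_space[OF that] h that d by (simp add: root_space_def coord_simps)
  then have "coord D (lie_bracket D h (\<Sum>b\<in>adapted_basis D. lie_scale D (coord D x b) b)) d =
      (\<Sum>b\<in>adapted_basis D. coord D x b * (basis_weight d h * coord D b d))"
    by (simp add: bracket_sum bracket_simps coord_sum coord_simps)
  also have "\<dots> = basis_weight d h * coord D (\<Sum>b\<in>adapted_basis D. lie_scale D (coord D x b) b) d"
    by (simp add: coord_sum coord_simps(2) sum_distrib_left mult_ac)
  finally show ?thesis by (simp add: basis_expansion)
qed

lemma coord_root_space:
  assumes "x \<in> root_space D \<mu>" "d \<in> adapted_basis D" "coord D x d \<noteq> 0" "h \<in> torus D"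
  shows "basis_weight d h = \<mu> h"
  using coord_ad_torus[OF assms(4,2), of x] assms by (simp add: root_space_def coord_simps)

text \<open>By the Jacobi identity \<open>ad h\<close> is a derivation.\<close>

lemma root_space_bracket:
  assumes "x \<in> root_space D \<mu>" "y \<in> root_space D \<nu>"
  shows "lie_bracket D x y \<in> root_space D (\<mu> + \<nu>)"
proof -
  have "lie_bracket D h (lie_bracket D x y) = lie_scale D (\<mu> h + \<nu> h) (lie_bracket D x y)"
    if h: "h \<in> torus D" for h
  proof -
    have "lie_bracket D h (lie_bracket D x y) =
        - lie_bracket D x (lie_bracket D y h) - lie_bracket D y (lie_bracket D h x)"
      using jacobi[of h x y] by (simp add: algebra_simps eq_neg_iff_add_eq_0)
    also have "lie_bracket D y h = - lie_scale D (\<nu> h) y"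
      using assms h bracket_antisym[of y h] by (simp add: root_space_def)
    also have "lie_bracket D x (- lie_scale D (\<nu> h) y) = - lie_scale D (\<nu> h) (lie_bracket D x y)"
      using bracket_simps(4)[of x "- \<nu> h" y] by simp
    also have "lie_bracket D y (lie_bracket D h x) = - lie_scale D (\<mu> h) (lie_bracket D x y)"
      using assms h bracket_antisym[of y x] by (simp add: root_space_def bracket_simps)
    finally show ?thesis by (simp add: VS.scale_left_distrib add.commute)
  qed
  then show ?thesis by (simp add: root_space_def)
qed

text \<open>The vector \<open>[a, b]\<close> has the weight on the right, and only basis vectors of the same weight occur in
  a weight vector.\<close>

lemma bracket_weight:
  assumes "a \<in> adapted_basis D" "b \<in> adapted_basis D" "d \<in> adapted_basis D"
    and "coord D (lie_bracket D a b) d \<noteq> 0"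
  shows "basis_weight d = basis_weight a + basis_weight b"
proof
  fix x
  show "basis_weight d x = (basis_weight a + basis_weight b) x"
    using coord_root_space[OF root_space_bracket[OF basis_weight_space basis_weight_space], of a b d x]
      assms basis_weight_off_torus[of _ x] by (cases "x \<in> torus D") auto
qed


subsection \<open>Heights\<close>

definition cone :: "('g \<Rightarrow> complex) set" where "cone = range (nat_combination D)"

lemma finite_simple: "finite (simple_roots D)"
  using base by (simp add: is_base_def)

text \<open>Linear independence of the simple roots over \<open>\<complex>\<close>.\<close>

lemma nat_combination_unique:
  assumes "nat_combination D m = nat_combination D m'" "\<beta> \<in> simple_roots D" shows "m \<beta> = m' \<beta>"
proof -
  have "(\<Sum>\<beta>\<in>simple_roots D. (of_nat (m \<beta>) - of_nat (m' \<beta>)) * \<beta> x) = 0" for x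
    using fun_cong[OF assms(1), of x] by (simp add: nat_combination_def algebra_simps sum_subtractf)
  moreover have "\<forall>c. (\<forall>x. (\<Sum>\<beta>\<in>simple_roots D. c \<beta> * \<beta> x) = (0::complex)) \<longrightarrow> (\<forall>\<beta>\<in>simple_roots D. c \<beta> = 0)"
    using base unfolding is_base_def by blast
  ultimately have "\<forall>\<beta>\<in>simple_roots D. of_nat (m \<beta>) - of_nat (m' \<beta>) = (0 :: complex)"
    by (elim allE[of _ "\<lambda>\<beta>. of_nat (m \<beta>) - of_nat (m' \<beta>)"]) simp
  then have "of_nat (m \<beta>) - of_nat (m' \<beta>) = (0 :: complex)"
    using assms(2) by blast
  then show ?thesis by simp
qed

text \<open>The coefficients are unique by \<open>nat_combination_unique\<close>; outside the cone the value is arbitrary.\<close>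

definition height :: "('g \<Rightarrow> complex) \<Rightarrow> nat" where
  "height \<alpha> = (\<Sum>\<beta>\<in>simple_roots D. (SOME m. \<alpha> = nat_combination D m) \<beta>)"

lemma height_nat_combination: "height (nat_combination D m) = (\<Sum>\<beta>\<in>simple_roots D. m \<beta>)"
proof -
  have "nat_combination D m = nat_combination D (SOME m'. nat_combination D m = nat_combination D m')"
    by (rule someI[of "\<lambda>m'. nat_combination D m = nat_combination D m'" m, OF refl])
  then show ?thesis
    unfolding height_def by (intro sum.cong refl) (metis nat_combination_unique)
qed

lemma nat_combination_add:
  "nat_combination D m + nat_combination D m' = nat_combination D (\<lambda>\<beta>. m \<beta> + m' \<beta>)"
  by (auto simp: nat_combination_def fun_eq_iff algebra_simps sum.distrib)

lemma cone_add:
  assumes "\<alpha> \<in> cone" "\<beta> \<in> cone" shows "\<alpha> + \<beta> \<in> cone" "height (\<alpha> + \<beta>) = height \<alpha> + height \<beta>"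
  using assms by (auto simp: cone_def nat_combination_add height_nat_combination sum.distrib)

lemma cone_zero: "0 \<in> cone"
  by (auto simp: cone_def nat_combination_def fun_eq_iff intro!: image_eqI[of _ _ "\<lambda>_. 0"])

lemma height_eq_0: "\<alpha> \<in> cone \<Longrightarrow> height \<alpha> = 0 \<longleftrightarrow> \<alpha> = 0"
proof
  assume "\<alpha> \<in> cone" and h: "height \<alpha> = 0"
  then obtain m where m: "\<alpha> = nat_combination D m" by (auto simp: cone_def)
  then have "m \<beta> = 0" if "\<beta> \<in> simple_roots D" for \<beta>
    using h finite_simple that by (simp add: height_nat_combination)
  then show "\<alpha> = 0"
    by (simp add: m nat_combination_def fun_eq_iff)
next
  assume "\<alpha> \<in> cone" "\<alpha> = 0"
  then show "height \<alpha> = 0"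
    using cone_add(2)[OF cone_zero cone_zero] by simp
qed

text \<open>Heights are natural numbers and add up, so the cone contains no line.\<close>

lemma cone_sum_zero: "\<alpha> \<in> cone \<Longrightarrow> \<beta> \<in> cone \<Longrightarrow> \<alpha> + \<beta> = 0 \<Longrightarrow> \<alpha> = 0 \<and> \<beta> = 0"
  using cone_add(2)[of \<alpha> \<beta>] height_eq_0[of "\<alpha> + \<beta>"] height_eq_0 cone_add(1) by fastforce

lemma height_simple:
  assumes "\<beta> \<in> simple_roots D" shows "height \<beta> = 1"
proof -
  have "\<beta> = nat_combination D (\<lambda>\<gamma>. if \<gamma> = \<beta> then 1 else 0)"
  proof
    fix x
    have "nat_combination D (\<lambda>\<gamma>. if \<gamma> = \<beta> then 1 else 0) x = (\<Sum>\<gamma>\<in>simple_roots D. if \<gamma> = \<beta> then \<gamma> x else 0)"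
      unfolding nat_combination_def by (intro sum.cong) auto
    then show "\<beta> x = nat_combination D (\<lambda>\<gamma>. if \<gamma> = \<beta> then 1 else 0) x"
      using assms finite_simple by (simp add: sum.delta')
  qed
  then have "height \<beta> = (\<Sum>\<gamma>\<in>simple_roots D. if \<gamma> = \<beta> then 1 else 0)"
    by (metis height_nat_combination)
  then show ?thesis using assms finite_simple by simp
qed

lemma positive_roots_eq: "positive_roots D = roots D \<inter> cone"
  by (auto simp: positive_roots_def cone_def)

text \<open>A complement instead of the image of the negative roots, so that \<^const>\<open>borel_K\<close> consists of the
  functions that vanish on it.\<close>

definition negative_basis :: "'g set" where
  "negative_basis = adapted_basis D - (torus_basis D \<union> root_vector D ` positive_roots D)"

lemma borel_basis_weight:
  "b \<in> adapted_basis D \<Longrightarrow> b \<notin> negative_basis \<Longrightarrow> basis_weight b \<in> cone"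
proof (erule basis_cases)
  assume "basis_weight b = (\<lambda>_. 0)"
  then show "basis_weight b \<in> cone" using cone_zero by (simp add: zero_fun_def)
next
  fix \<alpha> assume b: "b \<notin> negative_basis" and \<alpha>: "\<alpha> \<in> roots D" "b = root_vector D \<alpha>" "basis_weight b = \<alpha>"
  then have "root_vector D \<alpha> \<in> torus_basis D \<union> root_vector D ` positive_roots D"
    by (simp add: negative_basis_def root_vector_in_basis)
  then show "basis_weight b \<in> cone"
    using root_vector_not_torus[OF \<alpha>(1)] torus_basis_subset \<alpha> root_vector_inj
    by (auto simp: positive_roots_eq)
qed

lemma negative_basis_weight:
  assumes "b \<in> negative_basis"
  shows "- basis_weight b \<in> positive_roots D" "basis_weight b \<in> roots D"
    "b = root_vector D (basis_weight b)" "basis_weight b \<noteq> 0"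
proof -
  have b: "b \<in> adapted_basis D" using assms by (simp add: negative_basis_def)
  then obtain \<alpha> where \<alpha>: "\<alpha> \<in> roots D" "b = root_vector D \<alpha>" "basis_weight b = \<alpha>"
    using assms by (auto simp: negative_basis_def elim: basis_cases)
  then have "\<alpha> \<notin> positive_roots D"
    using assms by (auto simp: negative_basis_def)
  then show "- basis_weight b \<in> positive_roots D"
    using base \<alpha> by (auto simp: is_base_def)
  show "basis_weight b \<in> roots D" "b = root_vector D (basis_weight b)" "basis_weight b \<noteq> 0"
    using \<alpha> by (auto simp: roots_def)
qed

lemma negative_in_basis: "b \<in> negative_basis \<Longrightarrow> b \<in> adapted_basis D"
  by (simp add: negative_basis_def)

text \<open>Weights add, and the cone contains no line. A component in the torus would have weight \<open>0\<close>; then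
  \<open>a\<close> and \<open>b\<close> both have weight \<open>0\<close> and commute.\<close>

lemma borel_bracket:
  assumes a: "a \<in> adapted_basis D - negative_basis" and b: "b \<in> adapted_basis D - negative_basis"
    and d: "d \<in> adapted_basis D" and nz: "coord D (lie_bracket D a b) d \<noteq> 0"
  shows "d \<notin> negative_basis" "d \<notin> torus_basis D"
proof -
  have w: "basis_weight d = basis_weight a + basis_weight b"
    using bracket_weight a b d nz by blast
  have cone: "basis_weight a \<in> cone" "basis_weight b \<in> cone"
    using borel_basis_weight a b by auto
  show "d \<notin> negative_basis"
  proof
    assume d': "d \<in> negative_basis"
    then have "- basis_weight d \<in> cone"
      using negative_basis_weight(1) by (simp add: positive_roots_eq)
    then show False
      using cone_sum_zero[OF cone_add(1)[OF cone], of "- basis_weight d"] w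
        negative_basis_weight(4)[OF d'] by simp
  qed
  show "d \<notin> torus_basis D"
  proof
    assume "d \<in> torus_basis D"
    then have "basis_weight d = 0"
      by (simp add: basis_weight_torus zero_fun_def)
    then have "basis_weight a + basis_weight b = 0"
      by (simp only: w)
    note zero = cone_sum_zero[OF cone this]
    have "x \<in> torus_basis D" if "x \<in> adapted_basis D" "basis_weight x = 0" for x
      using that(1) by (rule basis_cases) (use that(2) in \<open>auto simp: roots_def\<close>)
    then have "a \<in> torus D" "b \<in> torus D"
      using a b zero torus_basis_subset by blast+
    then show False
      using torus_commutes nz by (simp add: coord_simps)
  qed
qed

text \<open>Heights of positive roots are positive and add up, so a bracket has height at least two. It follows
  that its root is not simple; this is where forms in standard Levi form vanish.\<close>

lemma negative_bracket:
  assumes a: "a \<in> negative_basis" and b: "b \<in> negative_basis"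
    and d: "d \<in> adapted_basis D" and nz: "coord D (lie_bracket D a b) d \<noteq> 0"
  shows "d \<in> negative_basis" "- basis_weight d \<notin> simple_roots D"
    "height (- basis_weight b) < height (- basis_weight d)"
proof -
  have w: "- basis_weight d = - basis_weight a + - basis_weight b"
    using bracket_weight[of a b d] a b d nz negative_in_basis by simp
  have cone: "- basis_weight a \<in> cone" "- basis_weight b \<in> cone"
    using negative_basis_weight(1) a b by (simp_all add: positive_roots_eq)
  have pos: "height (- basis_weight a) > 0" "height (- basis_weight b) > 0"
    using height_eq_0[OF cone(1)] height_eq_0[OF cone(2)] negative_basis_weight(4)[OF a]
      negative_basis_weight(4)[OF b] by simp_all
  have ht: "height (- basis_weight d) = height (- basis_weight a) + height (- basis_weight b)"
    unfolding w by (rule cone_add(2)[OF cone])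
  show "height (- basis_weight b) < height (- basis_weight d)"
    using ht pos by simp
  show "- basis_weight d \<notin> simple_roots D"
    using ht pos height_simple[of "- basis_weight d"] by auto
  show "d \<in> negative_basis"
  proof (rule ccontr)
    assume "d \<notin> negative_basis"
    then have "basis_weight d \<in> cone" using borel_basis_weight d by blast
    moreover have "- basis_weight d \<in> cone" unfolding w by (rule cone_add(1)[OF cone])
    ultimately have "- basis_weight d = 0"
      using cone_sum_zero[of "basis_weight d" "- basis_weight d"] by simp
    then show False
      using ht pos height_eq_0[OF cone_zero] by simp
  qed
qed


subsection \<open>The Borel subalgebra\<close>

text \<open>The spanning weight vectors have weights in the cone, and no basis vector of such a weight is
  negative.\<close>

lemma borel_carrier_eq: "borel_carrier D = {x. \<forall>b\<in>negative_basis. coord D x b = 0}"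
proof
  have "torus D \<union> (\<Union>\<alpha>\<in>positive_roots D. root_space D \<alpha>) \<subseteq> {x. \<forall>b\<in>negative_basis. coord D x b = 0}"
  proof (intro subsetI CollectI ballI)
    fix x b assume x: "x \<in> torus D \<union> (\<Union>\<alpha>\<in>positive_roots D. root_space D \<alpha>)" and b: "b \<in> negative_basis"
    have "x \<in> root_space D 0" if "x \<in> torus D"
      using that torus_commutes by (simp add: root_space_def)
    then obtain \<mu> where \<mu>: "\<mu> \<in> cone" "x \<in> root_space D \<mu>" "\<forall>y. y \<notin> torus D \<longrightarrow> \<mu> y = 0"
      using x cone_zero root_in_dual by (fastforce simp: positive_roots_eq)
    show "coord D x b = 0"
    proof (rule ccontr)
      assume "coord D x b \<noteq> 0"
      then have "basis_weight b h = \<mu> h" if "h \<in> torus D" for h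
        using coord_root_space[OF \<mu>(2) negative_in_basis[OF b]] that by blast
      then have "basis_weight b x = \<mu> x" for x
        using basis_weight_off_torus[OF negative_in_basis[OF b], of x] \<mu>(3) by (cases "x \<in> torus D") auto
      then have "basis_weight b = \<mu>" ..
      then show False
        using cone_sum_zero[of \<mu> "- basis_weight b"] \<mu>(1) negative_basis_weight[OF b]
        by (auto simp: positive_roots_eq)
    qed
  qed
  moreover have "VS.subspace {x. \<forall>b\<in>negative_basis. coord D x b = 0}"
    by (rule VS.subspaceI) (simp_all add: coord_simps)
  ultimately show "borel_carrier D \<subseteq> {x. \<forall>b\<in>negative_basis. coord D x b = 0}"
    unfolding borel_carrier_def by (rule VS.span_minimal)
  show "{x. \<forall>b\<in>negative_basis. coord D x b = 0} \<subseteq> borel_carrier D"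
  proof
    fix x assume x: "x \<in> {x. \<forall>b\<in>negative_basis. coord D x b = 0}"
    have "lie_scale D (coord D x b) b \<in> borel_carrier D" if "b \<in> adapted_basis D" for b
    proof (cases "b \<in> negative_basis")
      case False
      then have "b \<in> torus D \<union> (\<Union>\<alpha>\<in>positive_roots D. root_space D \<alpha>)"
        using that torus_basis_subset root_vector_in by (auto simp: negative_basis_def positive_roots_eq)
      then show ?thesis
        unfolding borel_carrier_def by (intro VS.span_scale VS.span_base)
    qed (use x VS.span_zero in \<open>simp add: borel_carrier_def\<close>)
    then have "(\<Sum>b\<in>adapted_basis D. lie_scale D (coord D x b) b) \<in> borel_carrier D"
      unfolding borel_carrier_def by (rule VS.span_sum)
    then show "x \<in> borel_carrier D" by (simp add: basis_expansion)
  qed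
qed

lemma borel_coord_bracket:
  assumes x: "x \<in> borel_carrier D" and y: "y \<in> borel_carrier D"
    and d: "d \<in> negative_basis \<union> torus_basis D"
  shows "coord D (lie_bracket D x y) d = 0"
proof -
  have d': "d \<in> adapted_basis D"
    using d negative_in_basis by (auto simp: adapted_basis_def)
  have "coord D x a * coord D y b * coord D (lie_bracket D a b) d = 0"
    if "a \<in> adapted_basis D" "b \<in> adapted_basis D" for a b
  proof (rule ccontr)
    assume nz: "coord D x a * coord D y b * coord D (lie_bracket D a b) d \<noteq> 0"
    then have "a \<notin> negative_basis" "b \<notin> negative_basis"
      using x y by (auto simp: borel_carrier_eq)
    then show False
      using borel_bracket[of a b d] that d d' nz by auto
  qed
  then show ?thesis
    by (subst coord_bracket) (intro sum.neutral ballI)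
qed

lemma borel_bracket_closed:
  "x \<in> borel_carrier D \<Longrightarrow> y \<in> borel_carrier D \<Longrightarrow> lie_bracket D x y \<in> borel_carrier D"
proof -
  assume "x \<in> borel_carrier D" "y \<in> borel_carrier D"
  then have "lie_bracket D x y \<in> {x. \<forall>b\<in>negative_basis. coord D x b = 0}"
    using borel_coord_bracket by simp
  then show ?thesis
    by (simp only: borel_carrier_eq)
qed

lemma weight_C_bracket:
  "x \<in> borel_carrier D \<Longrightarrow> y \<in> borel_carrier D \<Longrightarrow> weight_C D lam (lie_bracket D x y) = 0"
  by (simp add: weight_C_def borel_coord_bracket)

end

lemma simple_datum_split: "simple_datum D \<Longrightarrow> split_datum D"
proof -
  assume D: "simple_datum D"
  then have ch: "chevalley_basis D" and b: "is_base D" and t: "toral D (torus D)"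
    and l: "complex_lie_algebra D"
    by (auto simp: simple_datum_def maximal_toral_def simple_lie_algebra_def)
  show ?thesis
  proof
    have "torus_basis D = coroot D ` simple_roots D" "\<forall>\<alpha>\<in>roots D. coroot D \<alpha> \<in> torus D"
      "simple_roots D \<subseteq> roots D"
      using ch b by (auto simp: chevalley_basis_def is_base_def)
    then show "torus_basis D \<subseteq> torus D"
      by auto
  qed (use ch b t l in \<open>simp_all add: chevalley_basis_def toral_def\<close>)
qed


section \<open>The general linear Lie algebra\<close>

locale gl_lie =
  fixes n :: nat and D :: "'g::ab_group_add split_lie" and \<phi> :: "'g \<Rightarrow> complex mat"
  assumes complex_lie: "complex_lie_algebra D"
    and bij: "bij_betw \<phi> UNIV (carrier_mat n n)"
    and \<phi>_add: "\<phi> (x + y) = \<phi> x + \<phi> y" and \<phi>_scale: "\<phi> (lie_scale D c x) = c \<cdot>\<^sub>m \<phi> x"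
    and \<phi>_bracket: "\<phi> (lie_bracket D x y) = \<phi> x * \<phi> y - \<phi> y * \<phi> x"
    and torus_eq: "torus D = {x. \<forall>i<n. \<forall>j<n. i \<noteq> j \<longrightarrow> \<phi> x $$ (i, j) = 0}"
    and torus_basis_image: "\<phi> ` torus_basis D = {matrix_unit n i i | i. i < n}"
begin

definition \<epsilon> :: "nat \<Rightarrow> nat \<Rightarrow> 'g \<Rightarrow> complex" where
  "\<epsilon> i j x = (if x \<in> torus D then \<phi> x $$ (i, i) - \<phi> x $$ (j, j) else 0)"

definition E :: "nat \<Rightarrow> nat \<Rightarrow> 'g" where
  "E i j = inv_into UNIV \<phi> (matrix_unit n i j)"

abbreviation entry :: "nat \<Rightarrow> nat \<Rightarrow> 'g \<Rightarrow> complex" where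
  "entry i j x \<equiv> \<phi> x $$ (i, j)"

lemma \<phi>_carrier: "\<phi> x \<in> carrier_mat n n"
  using bij by (auto simp: bij_betw_def)

lemma \<phi>_dim [simp]: "dim_row (\<phi> x) = n" "dim_col (\<phi> x) = n"
  using \<phi>_carrier[of x] by auto

lemma \<phi>_E: "\<phi> (E i j) = matrix_unit n i j"
  unfolding E_def using bij by (intro f_inv_into_f) (auto simp: bij_betw_def matrix_unit_def)

lemma entry_E: "k < n \<Longrightarrow> l < n \<Longrightarrow> entry k l (E i j) = (if k = i \<and> l = j then 1 else 0)"
  by (simp add: \<phi>_E matrix_unit_def)

lemma \<phi>_inj: "\<phi> x = \<phi> y \<longleftrightarrow> x = y"
  using bij by (auto simp: bij_betw_def inj_on_def)

lemma eq_iff_entries: "x = y \<longleftrightarrow> (\<forall>k<n. \<forall>l<n. entry k l x = entry k l y)"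
  unfolding \<phi>_inj[symmetric] by (auto intro: eq_matI)

lemma entry_add: "k < n \<Longrightarrow> l < n \<Longrightarrow> entry k l (x + y) = entry k l x + entry k l y"
  by (simp add: \<phi>_add)

lemma entry_scale: "k < n \<Longrightarrow> l < n \<Longrightarrow> entry k l (lie_scale D c x) = c * entry k l x"
  by (simp add: \<phi>_scale)

lemma entry_zero: "k < n \<Longrightarrow> l < n \<Longrightarrow> entry k l 0 = 0"
  using entry_add[of k l 0 0] by simp

lemma entry_sum: "k < n \<Longrightarrow> l < n \<Longrightarrow> entry k l (\<Sum>i\<in>T. f i) = (\<Sum>i\<in>T. entry k l (f i))"
  by (induction T rule: infinite_finite_induct) (simp_all add: entry_zero entry_add)

lemma entry_bracket:
  assumes "k < n" "l < n"
  shows "entry k l (lie_bracket D x y) =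
    (\<Sum>m<n. entry k m x * entry m l y) - (\<Sum>m<n. entry k m y * entry m l x)"
  using assms by (simp add: \<phi>_bracket scalar_prod_def atLeast0LessThan)

lemma entry_bracket_torus:
  assumes h: "h \<in> torus D" and k: "k < n" and l: "l < n"
  shows "entry k l (lie_bracket D h x) = (entry k k h - entry l l h) * entry k l x"
proof -
  have "(\<Sum>m<n. entry k m h * entry m l x) = (\<Sum>m<n. if m = k then entry k k h * entry k l x else 0)"
    using h k by (intro sum.cong) (auto simp: torus_eq)
  moreover have "(\<Sum>m<n. entry k m x * entry m l h) = (\<Sum>m<n. if m = l then entry k l x * entry l l h else 0)"
    using h l by (intro sum.cong) (auto simp: torus_eq)
  ultimately show ?thesis
    using k l by (simp add: entry_bracket algebra_simps)
qed

lemma E_diagonal_torus: "i < n \<Longrightarrow> E i i \<in> torus D"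
  by (simp add: torus_eq entry_E)

lemma sum_diagonal_torus: "T \<subseteq> {..<n} \<Longrightarrow> (\<Sum>i\<in>T. E i i) \<in> torus D"
  by (auto simp: torus_eq entry_sum entry_E intro!: sum.neutral)

lemma entry_sum_diagonal:
  "k < n \<Longrightarrow> T \<subseteq> {..<n} \<Longrightarrow> entry k k (\<Sum>i\<in>T. E i i) = (if k \<in> T then 1 else 0)"
  using finite_subset[of T "{..<n}"] by (simp add: entry_sum entry_E)

lemma torus_basis_eq: "torus_basis D = {E i i | i. i < n}"
proof -
  have "\<phi> ` torus_basis D = \<phi> ` {E i i | i. i < n}"
    unfolding torus_basis_image by (auto simp: \<phi>_E image_iff) (metis \<phi>_E)+
  then show ?thesis
    using \<phi>_inj by (auto simp: image_iff set_eq_iff) (metis \<phi>_inj)+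
qed

lemma bracket_E:
  assumes "h \<in> torus D" "i < n" "j < n"
  shows "lie_bracket D h (E i j) = lie_scale D (entry i i h - entry j j h) (E i j)"
  using assms by (simp add: eq_iff_entries entry_bracket_torus entry_scale entry_E)

lemma \<epsilon>_in_dual: "i < n \<Longrightarrow> j < n \<Longrightarrow> \<epsilon> i j \<in> torus_dual D"
  by (auto simp: torus_dual_def \<epsilon>_def torus_eq entry_add entry_scale algebra_simps)

lemma \<epsilon>_E: "i < n \<Longrightarrow> j < n \<Longrightarrow> k < n \<Longrightarrow> \<epsilon> i j (E k k) = (if i = k then 1 else 0) - (if j = k then 1 else 0)"
  by (simp add: \<epsilon>_def E_diagonal_torus entry_E)

text \<open>If the entry at \<open>(k, l)\<close> of a weight vector is nonzero, its weight is \<open>\<epsilon>\<^sub>k - \<epsilon>\<^sub>l\<close>.\<close>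

lemma roots_eq: "roots D = {\<epsilon> i j | i j. i < n \<and> j < n \<and> i \<noteq> j}"
proof (intro equalityI subsetI)
  fix \<alpha> assume "\<alpha> \<in> roots D"
  then have \<alpha>: "\<alpha> \<in> torus_dual D" "\<alpha> \<noteq> 0" and "root_space D \<alpha> \<noteq> {0}"
    by (auto simp: roots_def)
  moreover have "0 \<in> root_space D \<alpha>"
    by (simp add: root_space_def eq_iff_entries entry_bracket_torus entry_scale entry_zero)
  ultimately obtain x where x: "x \<in> root_space D \<alpha>" "x \<noteq> 0" by blast
  then obtain k l where kl: "k < n" "l < n" "entry k l x \<noteq> 0"
    by (auto simp: eq_iff_entries[of x 0] entry_zero)
  have "\<alpha> h = \<epsilon> k l h" for h
  proof (cases "h \<in> torus D")
    case True
    then have "entry k l (lie_bracket D h x) = entry k l (lie_scale D (\<alpha> h) x)"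
      using x by (simp add: root_space_def)
    then show ?thesis
      using kl True by (simp add: entry_bracket_torus entry_scale \<epsilon>_def)
  next
    case False
    then show ?thesis using \<alpha> by (simp add: torus_dual_def \<epsilon>_def)
  qed
  then have eq: "\<alpha> = \<epsilon> k l" ..
  moreover have "\<alpha> = 0" if "k = l"
    by (rule ext) (simp add: eq that \<epsilon>_def)
  then have "k \<noteq> l"
    using \<alpha>(2) by blast
  ultimately show "\<alpha> \<in> {\<epsilon> i j | i j. i < n \<and> j < n \<and> i \<noteq> j}"
    using kl by blast
next
  fix \<alpha> assume "\<alpha> \<in> {\<epsilon> i j | i j. i < n \<and> j < n \<and> i \<noteq> j}"
  then obtain i j where ij: "\<alpha> = \<epsilon> i j" "i < n" "j < n" "i \<noteq> j" by blast
  have "\<epsilon> i j (E i i) = 1" using ij by (simp add: \<epsilon>_E)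
  then have "\<alpha> (E i i) \<noteq> 0" using ij by simp
  then have "\<alpha> \<noteq> 0" by (metis zero_fun_apply)
  moreover have "E i j \<in> root_space D \<alpha>"
    using ij bracket_E by (simp add: root_space_def \<epsilon>_def)
  moreover have "E i j \<noteq> 0"
    using ij entry_E[of i j i j] entry_zero[of i j] by auto
  ultimately show "\<alpha> \<in> roots D"
    using ij \<epsilon>_in_dual by (auto simp: roots_def)
qed

lemma \<epsilon>_inj:
  assumes "i < n" "j < n" "i \<noteq> j" "i' < n" "j' < n" "i' \<noteq> j'" "\<epsilon> i j = \<epsilon> i' j'"
  shows "i = i' \<and> j = j'"
proof -
  have "(if i = k then 1 else 0) - (if j = k then 1 else 0) =
      (if i' = k then 1 else 0) - (if j' = k then 1 else (0 :: complex))" if "k < n" for k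
    using fun_cong[OF assms(7), of "E k k"] that assms(1-6) by (simp add: \<epsilon>_E)
  from this[of i] this[of j] assms(1-6) show ?thesis
    by (auto split: if_splits)
qed

lemma expansion: "x = (\<Sum>(i, j)\<in>{..<n} \<times> {..<n}. lie_scale D (entry i j x) (E i j))"
proof -
  have "entry k l (\<Sum>(i, j)\<in>{..<n} \<times> {..<n}. lie_scale D (entry i j x) (E i j)) = entry k l x"
    if "k < n" "l < n" for k l
  proof -
    have "entry k l (\<Sum>(i, j)\<in>{..<n} \<times> {..<n}. lie_scale D (entry i j x) (E i j)) =
        (\<Sum>s\<in>{..<n} \<times> {..<n}. if s = (k, l) then entry k l x else 0)"
      unfolding entry_sum[OF that] using that
      by (intro sum.cong) (auto simp: entry_scale entry_E split: if_splits)
    then show ?thesis using that by simp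
  qed
  then show ?thesis by (simp add: eq_iff_entries)
qed

lemma simple_sum_\<epsilon>:
  assumes "i \<le> j" "j < n"
  shows "\<epsilon> i j x = (\<Sum>k=i..<j. \<epsilon> k (k + 1) x)"
  using assms
proof (induction j rule: dec_induct)
  case base
  then show ?case by (simp add: \<epsilon>_def)
next
  case (step j)
  have "\<epsilon> i (Suc j) x = \<epsilon> i j x + \<epsilon> j (j + 1) x"
    by (simp add: \<epsilon>_def)
  then show ?case using step by simp
qed

context
  assumes simple_eq: "simple_roots D = {\<epsilon> i (i + 1) | i. i + 1 < n}"
    and root_vector_\<epsilon>: "i < n \<Longrightarrow> j < n \<Longrightarrow> i \<noteq> j \<Longrightarrow> \<phi> (root_vector D (\<epsilon> i j)) = matrix_unit n i j"
begin

lemma root_vector_eq: "i < n \<Longrightarrow> j < n \<Longrightarrow> i \<noteq> j \<Longrightarrow> root_vector D (\<epsilon> i j) = E i j"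
  using root_vector_\<epsilon>[of i j] by (simp add: \<phi>_E flip: \<phi>_inj)

lemma basis_eq: "adapted_basis D = (\<lambda>(i, j). E i j) ` ({..<n} \<times> {..<n})"
proof -
  have "root_vector D ` roots D = (\<lambda>(i, j). root_vector D (\<epsilon> i j)) ` {(i, j). i < n \<and> j < n \<and> i \<noteq> j}"
    by (auto simp: roots_eq)
  also have "\<dots> = (\<lambda>(i, j). E i j) ` {(i, j). i < n \<and> j < n \<and> i \<noteq> j}"
    by (intro image_cong) (auto simp: root_vector_eq)
  finally have "adapted_basis D =
      (\<lambda>(i, j). E i j) ` {(i, j). i < n \<and> j < n \<and> i \<noteq> j} \<union> (\<lambda>(i, j). E i j) ` {(i, j). i < n \<and> i = j}"
    by (auto simp: adapted_basis_def torus_basis_eq)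
  also have "\<dots> = (\<lambda>(i, j). E i j) ` ({(i, j). i < n \<and> j < n \<and> i \<noteq> j} \<union> {(i, j). i < n \<and> i = j})"
    by (rule image_Un[symmetric])
  also have "{(i, j). i < n \<and> j < n \<and> i \<noteq> j} \<union> {(i, j). i < n \<and> i = j} = {..<n} \<times> {..<n}"
    by auto
  finally show ?thesis .
qed

lemma E_inj: "inj_on (\<lambda>(i, j). E i j) ({..<n} \<times> {..<n})"
proof (rule inj_onI, clarsimp)
  fix i j i' j' assume "i < n" "j < n" "i' < n" "j' < n" "E i j = E i' j'"
  then show "i = i' \<and> j = j'"
    using entry_E[of i j i j] entry_E[of i j i' j'] by (auto split: if_splits)
qed

interpretation VS: vector_space "lie_scale D"
  using complex_lie by (simp add: complex_lie_algebra_def)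

lemma independent: "\<not> VS.dependent (adapted_basis D)"
proof
  assume "VS.dependent (adapted_basis D)"
  then obtain u v where u: "v \<in> adapted_basis D" "u v \<noteq> 0"
      "(\<Sum>v\<in>adapted_basis D. lie_scale D (u v) v) = 0"
    using VS.dependent_finite[of "adapted_basis D"] by (auto simp: basis_eq)
  then obtain i j where ij: "i < n" "j < n" "v = E i j" by (auto simp: basis_eq)
  have "0 = entry i j (\<Sum>v\<in>adapted_basis D. lie_scale D (u v) v)"
    using u ij by (simp add: entry_zero)
  also have "\<dots> = (\<Sum>s\<in>{..<n} \<times> {..<n}. if s = (i, j) then u v else 0)"
    unfolding entry_sum[OF ij(1,2)] basis_eq sum.reindex[OF E_inj]
    using ij by (intro sum.cong) (auto simp: entry_scale entry_E split: if_splits)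
  also have "\<dots> = u v" using ij by simp
  finally show False using u by simp
qed

lemma span_UNIV: "VS.span (adapted_basis D) = UNIV"
proof -
  have "x \<in> VS.span (adapted_basis D)" for x
    by (subst expansion, rule VS.span_sum) (force intro: VS.span_scale VS.span_base simp: basis_eq)
  then show ?thesis by blast
qed

lemma coord_E:
  assumes "i < n" "j < n" shows "coord D x (E i j) = entry i j x"
proof -
  have "(\<Sum>b\<in>adapted_basis D. lie_scale D (coord D x b) b) = x"
    by (rule VS.sum_representation_eq[OF independent _ _ order_refl])
      (simp_all add: span_UNIV, simp add: basis_eq)
  then have "entry i j x = entry i j (\<Sum>b\<in>adapted_basis D. lie_scale D (coord D x b) b)"
    by simp
  also have "\<dots> = (\<Sum>s\<in>{..<n} \<times> {..<n}. if s = (i, j) then coord D x (E i j) else 0)"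
    unfolding entry_sum[OF assms]
    by (subst (1) basis_eq, subst sum.reindex[OF E_inj])
      (use assms in \<open>intro sum.cong; auto simp: entry_scale entry_E split: if_splits\<close>)
  also have "\<dots> = coord D x (E i j)" using assms by simp
  finally show ?thesis by simp
qed

text \<open>For \<open>i < j\<close> the root \<open>\<epsilon>\<^sub>i - \<epsilon>\<^sub>j\<close> is a telescoping sum of simple roots.\<close>

lemma gl_is_base: "is_base D"
proof -
  have simple_image: "simple_roots D = (\<lambda>i. \<epsilon> i (i + 1)) ` {i. i + 1 < n}"
    by (auto simp: simple_eq)
  have inj: "inj_on (\<lambda>i. \<epsilon> i (i + 1)) {i. i + 1 < n}"
  proof (rule inj_onI)
    fix i j assume "i \<in> {i. i + 1 < n}" "j \<in> {i. i + 1 < n}" "\<epsilon> i (i + 1) = \<epsilon> j (j + 1)"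
    then show "i = j" using \<epsilon>_inj[of i "i + 1" j "j + 1"] by simp
  qed
  have fin: "finite {i. i + 1 < n}"
    by (rule finite_subset[of _ "{..<n}"]) auto
  have indep: "c \<beta> = 0" if sum: "\<forall>x. (\<Sum>\<beta>\<in>simple_roots D. c \<beta> * \<beta> x) = (0::complex)" and \<beta>: "\<beta> \<in> simple_roots D" for c \<beta>
  proof -
    obtain k where k: "k + 1 < n" "\<beta> = \<epsilon> k (k + 1)" using \<beta> by (auto simp: simple_eq)
    \<comment> \<open>the fundamental coweight: the simple root with index \<open>k\<close> is \<open>1\<close> on it and the others are \<open>0\<close>\<close>
    let ?x = "\<Sum>i\<le>k. E i i"
    have sub: "{..k} \<subseteq> {..<n}" using k by auto
    then have x: "?x \<in> torus D" by (rule sum_diagonal_torus)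
    have "\<epsilon> i (i + 1) ?x = (if i = k then 1 else 0)" if "i + 1 < n" for i
      using x that entry_sum_diagonal[of i "{..k}"] entry_sum_diagonal[of "i + 1" "{..k}"] sub
      by (auto simp: \<epsilon>_def)
    then have "(\<Sum>i | i + 1 < n. c (\<epsilon> i (i + 1)) * \<epsilon> i (i + 1) ?x) =
        (\<Sum>i | i + 1 < n. if i = k then c (\<epsilon> k (k + 1)) else 0)"
      by (intro sum.cong) auto
    moreover have "(\<Sum>\<beta>\<in>simple_roots D. c \<beta> * \<beta> ?x) = (\<Sum>i | i + 1 < n. c (\<epsilon> i (i + 1)) * \<epsilon> i (i + 1) ?x)"
      unfolding simple_image sum.reindex[OF inj] comp_def ..
    ultimately show ?thesis
      using sum k fin by simp
  qed
  have pos: "\<epsilon> i j \<in> positive_roots D" if "i < j" "j < n" for i j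
  proof -
    let ?T = "(\<lambda>k. \<epsilon> k (k + 1)) ` {i..<j}"
    have "\<epsilon> i j x = nat_combination D (\<lambda>\<beta>. if \<beta> \<in> ?T then 1 else 0) x" for x
    proof -
      have "?T \<subseteq> simple_roots D" using that by (auto simp: simple_eq)
      then have "nat_combination D (\<lambda>\<beta>. if \<beta> \<in> ?T then 1 else 0) x = (\<Sum>\<beta>\<in>?T. \<beta> x)"
        unfolding nat_combination_def using fin
        by (intro sum.mono_neutral_cong_right) (auto simp: simple_image)
      also have "\<dots> = (\<Sum>k=i..<j. \<epsilon> k (k + 1) x)"
      proof -
        have "inj_on (\<lambda>k. \<epsilon> k (k + 1)) {i..<j}"
          by (rule inj_on_subset[OF inj]) (use that in auto)
        then show ?thesis by (simp only: sum.reindex comp_def)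
      qed
      finally show ?thesis using simple_sum_\<epsilon>[of i j x] that by simp
    qed
    then have "\<epsilon> i j = nat_combination D (\<lambda>\<beta>. if \<beta> \<in> ?T then 1 else 0)" ..
    moreover have "\<epsilon> i j \<in> roots D"
      unfolding roots_eq using that by (intro CollectI exI[of _ i] exI[of _ j]) auto
    ultimately show ?thesis
      unfolding positive_roots_def by blast
  qed
  have "\<alpha> \<in> positive_roots D \<or> - \<alpha> \<in> positive_roots D" if \<alpha>: "\<alpha> \<in> roots D" for \<alpha>
  proof -
    obtain i j where ij: "i < n" "j < n" "i \<noteq> j" "\<alpha> = \<epsilon> i j" using \<alpha> by (auto simp: roots_eq)
    have "- \<epsilon> i j = \<epsilon> j i" by (auto simp: \<epsilon>_def fun_eq_iff)
    then show ?thesis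
      using pos[of i j] pos[of j i] ij by (cases "i < j") auto
  qed
  moreover have "simple_roots D \<subseteq> roots D"
  proof
    fix \<beta> assume "\<beta> \<in> simple_roots D"
    then obtain i where "i + 1 < n" "\<beta> = \<epsilon> i (i + 1)" by (auto simp: simple_eq)
    then show "\<beta> \<in> roots D"
      unfolding roots_eq by (intro CollectI exI[of _ i] exI[of _ "i + 1"]) simp
  qed
  moreover have "finite (simple_roots D)"
    unfolding simple_image using fin by simp
  ultimately show ?thesis
    using indep unfolding is_base_def by blast
qed

lemma gl_split: "split_datum D"
proof
  show "finite (adapted_basis D)" by (simp add: basis_eq)
  show "torus_basis D \<subseteq> torus D" using E_diagonal_torus by (auto simp: torus_basis_eq)
  show "lie_bracket D x y = 0" if "x \<in> torus D" "y \<in> torus D" for x y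
    using that by (auto simp: eq_iff_entries entry_bracket_torus entry_zero) (auto simp: torus_eq)
  show "root_vector D \<alpha> \<in> root_space D \<alpha>" if "\<alpha> \<in> roots D" for \<alpha>
    using that by (auto simp: roots_eq root_vector_eq root_space_def bracket_E \<epsilon>_def)
  show "coord D (lie_bracket D a b) d \<in> \<int>"
    if ab: "a \<in> adapted_basis D" "b \<in> adapted_basis D" and d': "d \<in> adapted_basis D" for a b d
  proof -
    obtain i j where d: "i < n" "j < n" "d = E i j" using d' by (auto simp: basis_eq)
    have int: "entry k l x \<in> \<int>" if "x \<in> adapted_basis D" "k < n" "l < n" for x k l
      using that by (auto simp: basis_eq entry_E)
    show ?thesis
      unfolding d(3) coord_E[OF d(1,2)] entry_bracket[OF d(1,2)]
      using ab d int by (intro Ints_diff Ints_sum Ints_mult) auto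
  qed
qed (use complex_lie independent span_UNIV gl_is_base in auto)

end

end

lemma gl_datum_split: "gl_datum n D \<Longrightarrow> split_datum D"
proof -
  assume D: "gl_datum n D"
  then have lie: "complex_lie_algebra D"
    unfolding gl_datum_def by (rule conjunct1)
  obtain \<phi> where \<phi>: "bij_betw \<phi> UNIV (carrier_mat n n)" "\<forall>x y. \<phi> (x + y) = \<phi> x + \<phi> y"
      "\<forall>c x. \<phi> (lie_scale D c x) = c \<cdot>\<^sub>m \<phi> x"
      "\<forall>x y. \<phi> (lie_bracket D x y) = \<phi> x * \<phi> y - \<phi> y * \<phi> x"
      "torus D = {x. \<forall>i<n. \<forall>j<n. i \<noteq> j \<longrightarrow> \<phi> x $$ (i, j) = 0}"
      "\<phi> ` torus_basis D = {matrix_unit n i i | i. i < n}"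
      "let \<epsilon>diff = (\<lambda>i j x. if x \<in> torus D then \<phi> x $$ (i, i) - \<phi> x $$ (j, j) else 0) in
        simple_roots D = {\<epsilon>diff i (i + 1) | i. i + 1 < n} \<and>
        (\<forall>i<n. \<forall>j<n. i \<noteq> j \<longrightarrow> \<phi> (root_vector D (\<epsilon>diff i j)) = matrix_unit n i j)"
    using D unfolding gl_datum_def by (elim conjE exE) (rule that; assumption)
  interpret gl_lie n D \<phi>
    using lie \<phi>(1-6) by (intro gl_lie.intro) blast+
  have eps: "(\<lambda>x. if x \<in> torus D then \<phi> x $$ (i, i) - \<phi> x $$ (j, j) else 0) = \<epsilon> i j" for i j
    by (intro ext) (simp add: \<epsilon>_def)
  note \<phi>' = \<phi>(7)[unfolded Let_def eps]
  show ?thesis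
    by (rule gl_split[OF conjunct1[OF \<phi>']]) (use conjunct2[OF \<phi>'] in simp)
qed


section \<open>One-dimensional representations and subalgebras\<close>

lemma left_module_field: "left_module type_ring (with_smult type_ring (*) :: ('k::field, 'k) module)"
  by (intro left_module.intro left_module_axioms.intro ring_type_ring
      abelian_group_cong[OF ring.is_abelian_group[OF ring_type_ring]])
    (simp_all add: algebra_simps)

locale lie_character = closed_lie L
  for L :: "('a::ab_group_add, 'k::field, 'm) lie_scheme" +
  fixes \<mu> :: "'a \<Rightarrow> 'k"
  assumes character_add: "x \<in> lie_carrier L \<Longrightarrow> y \<in> lie_carrier L \<Longrightarrow> \<mu> (x + y) = \<mu> x + \<mu> y"
    and character_scale: "x \<in> lie_carrier L \<Longrightarrow> \<mu> (lie_scale L c x) = c * \<mu> x"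
    and character_bracket: "x \<in> lie_carrier L \<Longrightarrow> y \<in> lie_carrier L \<Longrightarrow> \<mu> (lie_bracket L x y) = 0"
begin

sublocale C: lie_rep L "with_smult type_ring (*)" "\<lambda>x v. \<mu> x * v"
proof (intro lie_rep.intro lie_rep_axioms.intro closed_lie_axioms left_module_field)
  interpret V: left_module type_ring "with_smult type_ring (*) :: ('k, 'k) module"
    by (rule left_module_field)
  fix x y and v :: 'k
  assume "x \<in> lie_carrier L" "y \<in> lie_carrier L"
  then show "\<mu> (lie_bracket L x y) * v =
      \<mu> x * (\<mu> y * v) \<ominus>\<^bsub>with_smult type_ring (*)\<^esub> \<mu> y * (\<mu> x * v)"
    using V.diff_zero_iff[of "\<mu> x * (\<mu> y * v)" "\<mu> y * (\<mu> x * v)"]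
    by (simp add: character_bracket mult.left_commute)
qed (simp_all add: character_add character_scale algebra_simps)

lemma left_module_character: "left_module UL (character_module \<mu>)"
  unfolding character_module_def by (rule C.left_module_env_module)

lemma character_module_simps [simp]:
  "carrier (character_module \<mu>) = UNIV" "\<zero>\<^bsub>character_module \<mu>\<^esub> = 0"
  "v \<oplus>\<^bsub>character_module \<mu>\<^esub> w = v + w"
  by (simp_all add: character_module_def)

lemma character_incl: "x \<in> lie_carrier L \<Longrightarrow> env_incl L x \<odot>\<^bsub>character_module \<mu>\<^esub> v = \<mu> x * v"
  and character_scalar: "env_scalar L c \<odot>\<^bsub>character_module \<mu>\<^esub> v = c * v"
  unfolding character_module_def using C.env_incl_smult[of x v] C.env_scalar_smult[of v c] by simp_all

end

lemma (in left_module) eigenvalue_pow: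
  fixes n :: nat
  assumes "a \<in> carrier A" "v \<in> carrier M" "\<And>w. w \<in> carrier M \<Longrightarrow> a \<odot> w = f w"
  shows "(a [^]\<^bsub>A\<^esub> n) \<odot> v = (f ^^ n) v"
  using assms(2)
proof (induction n arbitrary: v)
  case (Suc n)
  then show ?case
    using assms(1,3) smult_closed[OF assms(1), of v]
    by (simp add: smult_assoc funpow_Suc_right del: funpow.simps)
qed (simp add: smult_one)

locale restricted_character = lie_character L \<mu> + restricted_lie L pm
  for L :: "('a::ab_group_add, 'k::field, 'm) lie_scheme" and \<mu> pm +
  assumes char_pos: "CHAR('k) > 0"
    and character_pm: "x \<in> lie_carrier L \<Longrightarrow> \<mu> (pm x) = \<mu> x ^ CHAR('k)"
begin

text \<open>Both \<open>x\<^sup>p\<close> and \<open>x\<^sup>[\<^sup>p\<^sup>]\<close> act as \<open>\<mu>(x)\<^sup>p\<close>.\<close>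

lemma p_relations_annihilate_character:
  assumes "x \<in> lie_carrier L"
  shows "(p_central L pm x \<ominus>\<^bsub>UL\<^esub> env_scalar L (0 ^ CHAR('k))) \<odot>\<^bsub>character_module \<mu>\<^esub> v =
    \<zero>\<^bsub>character_module \<mu>\<^esub>"
proof -
  interpret M: left_module UL "character_module \<mu>"
    by (rule left_module_character)
  have incl: "env_incl L y \<in> carrier UL" if "y \<in> lie_carrier L" for y
    using that by (simp add: env_incl_eq U.\<iota>_closed)
  have diff: "v \<ominus>\<^bsub>character_module \<mu>\<^esub> w = v - w" for v w
    using M.diff_eq_iff[of v w "v - w"] by simp
  have fpow: "((\<lambda>w. \<mu> x * w) ^^ n) v = \<mu> x ^ n * v" for n
    by (induction n) simp_all
  have "(env_incl L x [^]\<^bsub>UL\<^esub> CHAR('k)) \<odot>\<^bsub>character_module \<mu>\<^esub> v = \<mu> x ^ CHAR('k) * v"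
    using M.eigenvalue_pow[of "env_incl L x" v "\<lambda>w. \<mu> x * w" "CHAR('k)"] incl assms
    by (simp add: character_incl fpow)
  moreover have "env_incl L (pm x) \<odot>\<^bsub>character_module \<mu>\<^esub> v = \<mu> x ^ CHAR('k) * v"
    using assms by (simp add: character_incl pm_closed character_pm)
  moreover have "env_scalar L (0 ^ CHAR('k)) \<odot>\<^bsub>character_module \<mu>\<^esub> v = 0"
    using char_pos by (simp add: character_scalar)
  moreover have "env_scalar L (0 ^ CHAR('k)) \<in> carrier UL"
    by (simp add: env_scalar_eq U.\<kappa>_closed)
  ultimately show ?thesis
    using incl assms pm_closed[OF assms] p_central_closed[OF assms]
    unfolding p_central_def
    by (simp add: M.smult_diff_left diff)
qed

lemma left_module_reduced_character:
  "left_module (reduced_env L pm (\<lambda>_. 0)) (over_quotient (character_module \<mu>))"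
  and reduced_character_smult:
  "t \<in> carrier FL \<Longrightarrow> \<pi>A (\<lambda>_. 0) t \<odot>\<^bsub>over_quotient (character_module \<mu>)\<^esub> v =
    \<pi>U t \<odot>\<^bsub>character_module \<mu>\<^esub> v"
proof -
  interpret M: left_module UL "character_module \<mu>"
    by (rule left_module_character)
  note ann = reduced_ideal_annihilates[OF left_module_character, of "\<lambda>_. 0",
      OF p_relations_annihilate_character]
  show "left_module (reduced_env L pm (\<lambda>_. 0)) (over_quotient (character_module \<mu>))"
    unfolding reduced_env_def
    by (rule M.left_module_over_quotient[OF reduced_ideal_ideal ann])
  show "\<pi>A (\<lambda>_. 0) t \<odot>\<^bsub>over_quotient (character_module \<mu>)\<^esub> v = \<pi>U t \<odot>\<^bsub>character_module \<mu>\<^esub> v"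
    if "t \<in> carrier FL"
    using that U.\<pi>.hom_closed[of t]
    by (intro M.over_quotient_smult[OF reduced_ideal_ideal ann]) simp_all
qed

end

locale sub_lie = L: closed_lie L + L': closed_lie L'
  for L :: "('a::ab_group_add, 'k::field, 'm) lie_scheme"
    and L' :: "('a::ab_group_add, 'k::field, 'n) lie_scheme" +
  assumes sub: "lie_carrier L' \<subseteq> lie_carrier L"
    and same_scale: "lie_scale L' = lie_scale L" and same_bracket: "lie_bracket L' = lie_bracket L"
begin

lemma FL_mono: "t \<in> carrier L'.FL \<Longrightarrow> t \<in> carrier L.FL"
  using sub by auto

text \<open>The relations of the subalgebra are among those of the whole algebra, and the elements of the smaller
  free algebra that fall into the larger ideal form an ideal.\<close>

lemma env_ideal_mono: "env_ideal L' \<subseteq> env_ideal L"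
proof -
  have "ring_hom_ring L'.FL L.FL (\<lambda>t. t)"
    by (intro ring_hom_ringI2 L'.FL.ring_axioms L.FL.ring_axioms ring_hom_memI)
      (use FL_mono in simp_all)
  then have ideal: "ideal {t \<in> carrier L'.FL. t \<in> env_ideal L} L'.FL"
    using ring_hom_ring.ideal_vimage[OF _ L.I.ideal_axioms] by blast
  have "L'.env_relations \<subseteq> L.env_relations"
    using sub unfolding L'.env_relations_def L.env_relations_def same_scale same_bracket by blast
  then have "L'.env_relations \<subseteq> {t \<in> carrier L'.FL. t \<in> env_ideal L}"
    using L'.env_relations_closed L.env_relations_in_ideal by blast
  then have "env_ideal L' \<subseteq> {t \<in> carrier L'.FL. t \<in> env_ideal L}"
    unfolding L'.env_ideal_eq by (rule L'.FL.genideal_minimal[OF ideal])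
  then show ?thesis by blast
qed

lemma abelian_subgroup_ideal: "ideal J R \<Longrightarrow> abelian_subgroup J R"
  by (simp add: abelian_subgroupI3 ideal_def ring.is_abelian_group)

lemma env_map_coset:
  assumes "t \<in> carrier L'.FL" shows "env_map L (L'.\<pi>U t) = L.\<pi>U t"
  unfolding env_map_def quot_map_def
proof (rule UN_coset[where f = "\<lambda>t. t", OF abelian_subgroup_ideal[OF L'.I.ideal_axioms]
      abelian_subgroup_ideal[OF L.I.ideal_axioms]])
  show "t \<in> carrier L.FL" if "t \<in> carrier L'.FL" for t
    using that by (rule FL_mono)
qed (use assms env_ideal_mono in auto)

lemma env_map_closed: "u \<in> carrier L'.UL \<Longrightarrow> env_map L u \<in> carrier L.UL"
  using L.U.\<pi>.hom_closed FL_mono unfolding L'.U.\<pi>_surj[symmetric]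
  by (auto simp: env_map_coset simp del: free_algebra_simps)

lemma env_map_hom: "env_map L \<in> Ring.ring_hom L'.UL L.UL"
proof (rule ring_hom_memI)
  fix u v assume "u \<in> carrier L'.UL" "v \<in> carrier L'.UL"
  then obtain s t where st: "s \<in> carrier L'.FL" "t \<in> carrier L'.FL" "u = L'.\<pi>U s" "v = L'.\<pi>U t"
    unfolding L'.U.\<pi>_surj[symmetric] by blast
  note cl = st(1,2) FL_mono[OF st(1)] FL_mono[OF st(2)]
  show "env_map L (u \<otimes>\<^bsub>L'.UL\<^esub> v) = env_map L u \<otimes>\<^bsub>L.UL\<^esub> env_map L v"
    using cl by (simp add: st env_map_coset free_algebra_mult_closed L.U.\<pi>_mult
        flip: L'.U.\<pi>_mult del: free_algebra_simps)
  show "env_map L (u \<oplus>\<^bsub>L'.UL\<^esub> v) = env_map L u \<oplus>\<^bsub>L.UL\<^esub> env_map L v"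
    using cl by (simp add: st env_map_coset free_algebra_add_closed L.U.\<pi>_add
        flip: L'.U.\<pi>_add del: free_algebra_simps)
next
  show "env_map L \<one>\<^bsub>L'.UL\<^esub> = \<one>\<^bsub>L.UL\<^esub>"
    using env_map_coset[of 1] L'.FL.one_closed by (simp add: L.U.\<pi>_one L'.U.\<pi>_one)
qed (rule env_map_closed)

end

locale restricted_sub_lie = sub_lie L L' + L: restricted_lie L pm + L': restricted_lie L' pm
  for L :: "('a::ab_group_add, 'k::field, 'm) lie_scheme"
    and L' :: "('a::ab_group_add, 'k::field, 'n) lie_scheme" and pm +
  fixes \<chi> :: "'a \<Rightarrow> 'k"
  assumes \<chi>_zero: "x \<in> lie_carrier L' \<Longrightarrow> \<chi> x = 0"
begin

abbreviation "reduced_map \<equiv> quot_map L.UL (reduced_ideal L pm \<chi>) (env_map L)"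

text \<open>As \<open>\<chi>\<close> vanishes on the subalgebra, a generator \<open>x\<^sup>p - x\<^sup>[\<^sup>p\<^sup>]\<close> maps to the generator
  \<open>x\<^sup>p - x\<^sup>[\<^sup>p\<^sup>] - \<chi>(x)\<^sup>p\<close>.\<close>

lemma reduced_ideal_mono:
  assumes "u \<in> reduced_ideal L' pm (\<lambda>_. 0)" shows "env_map L u \<in> reduced_ideal L pm \<chi>"
proof -
  have "ring_hom_ring L'.UL L.UL (env_map L)"
    by (intro ring_hom_ringI2 L'.UL.ring_axioms L.UL.ring_axioms env_map_hom)
  then have ideal: "ideal {u \<in> carrier L'.UL. env_map L u \<in> reduced_ideal L pm \<chi>} L'.UL"
    by (rule ring_hom_ring.ideal_vimage[OF _ L.reduced_ideal_ideal])
  have "p_character_relations L' pm (\<lambda>_. 0) \<subseteq>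
      {u \<in> carrier L'.UL. env_map L u \<in> reduced_ideal L pm \<chi>}"
  proof
    fix r assume r: "r \<in> p_character_relations L' pm (\<lambda>_. 0)"
    then obtain x where x: "x \<in> lie_carrier L'"
      "r = p_central L' pm x \<ominus>\<^bsub>L'.UL\<^esub> env_scalar L' (0 ^ CHAR('k))"
      by (auto simp: p_character_relations_def)
    then have "env_map L r = p_central L pm x \<ominus>\<^bsub>L.UL\<^esub> env_scalar L (\<chi> x ^ CHAR('k))"
      using L'.p_relation_eq[OF x(1), of "\<lambda>_. 0"] L.p_relation_eq[of x \<chi>] sub \<chi>_zero[of x]
      by (auto simp: env_map_coset simp del: free_algebra_simps)
    moreover have "\<dots> \<in> p_character_relations L pm \<chi>"
      using x sub by (auto simp: p_character_relations_def)
    ultimately show "r \<in> {u \<in> carrier L'.UL. env_map L u \<in> reduced_ideal L pm \<chi>}"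
      using r L'.p_relations_closed L.p_relations_in_reduced_ideal[of \<chi>] by auto
  qed
  then have "reduced_ideal L' pm (\<lambda>_. 0) \<subseteq> {u \<in> carrier L'.UL. env_map L u \<in> reduced_ideal L pm \<chi>}"
    unfolding reduced_ideal_def[of L'] by (rule L'.UL.genideal_minimal[OF ideal])
  then show ?thesis using assms by blast
qed

lemma reduced_map_coset:
  assumes t: "t \<in> carrier L'.FL" shows "reduced_map (L'.\<pi>A (\<lambda>_. 0) t) = L.\<pi>A \<chi> t"
proof -
  have "reduced_map (L'.\<pi>A (\<lambda>_. 0) t) = reduced_ideal L pm \<chi> +>\<^bsub>L.UL\<^esub> env_map L (L'.\<pi>U t)"
    unfolding quot_map_def
    using UN_coset[OF abelian_subgroup_ideal[OF L'.reduced_ideal_ideal[of "\<lambda>_. 0"]]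
        abelian_subgroup_ideal[OF L.reduced_ideal_ideal[of \<chi>]], of "env_map L" "L'.\<pi>U t"]
      ring_hom_add[OF env_map_hom] env_map_closed reduced_ideal_mono L'.U.\<pi>.hom_closed[OF t]
    by simp
  then show ?thesis
    using env_map_coset[OF t] by simp
qed

lemma reduced_map_closed:
  "u \<in> carrier (reduced_env L' pm (\<lambda>_. 0)) \<Longrightarrow> reduced_map u \<in> carrier (reduced_env L pm \<chi>)"
proof -
  interpret A: lie_quotient L "reduced_env L pm \<chi>" "L.\<pi>A \<chi>"
    by (rule L.reduced_lie_quotient)
  interpret A': lie_quotient L' "reduced_env L' pm (\<lambda>_. 0)" "L'.\<pi>A (\<lambda>_. 0)"
    by (rule L'.reduced_lie_quotient)
  show "u \<in> carrier (reduced_env L' pm (\<lambda>_. 0)) \<Longrightarrow> reduced_map u \<in> carrier (reduced_env L pm \<chi>)"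
    using A.\<pi>.hom_closed FL_mono unfolding A'.\<pi>_surj[symmetric]
    by (auto simp: reduced_map_coset simp del: free_algebra_simps)
qed

end


section \<open>Reduction modulo p\<close>

text \<open>Fermat's little theorem in the prime field.\<close>

lemma of_int_power_CHAR:
  assumes "CHAR('k::field) > 0" shows "(of_int a :: 'k) ^ CHAR('k) = of_int a"
proof -
  have p: "prime CHAR('k)" using assms prime_CHAR_semidom by blast
  have nat: "(of_nat n :: 'k) ^ CHAR('k) = of_nat n" for n
  proof (induction n)
    case (Suc n)
    then show ?case using freshmans_dream[OF p refl, of 1 "of_nat n"] by simp
  qed (use assms in simp)
  show ?thesis
  proof (cases a)
    case (nonneg n)
    then show ?thesis using nat by simp
  next
    case (neg n)
    have "(- of_nat (Suc n) :: 'k) ^ CHAR('k) = - of_nat (Suc n)"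
      using minus_power_prime_CHAR[OF refl p, of "of_nat (Suc n)"] nat[of "Suc n"] by simp
    then show ?thesis using neg by simp
  qed
qed

locale integral_form = split_datum D
  for D :: "'g::ab_group_add split_lie" +
  fixes S :: "int set" and pm :: "('g \<Rightarrow> 'k::field) \<Rightarrow> 'g \<Rightarrow> 'k"
  assumes S_one: "1 \<in> S" and S_mult: "s \<in> S \<Longrightarrow> s' \<in> S \<Longrightarrow> s * s' \<in> S" and S_zero: "0 \<notin> S"
    and char_pos: "CHAR('k) > 0" and char_not_unit: "1 / of_nat CHAR('k) \<notin> localisation S"
    and p_structure: "p_structure S D pm"
begin

abbreviation "R \<equiv> localisation S"
abbreviation red :: "complex \<Rightarrow> 'k" where "red \<equiv> reduction S"

lemma localisationE:
  assumes "z \<in> R" obtains a s where "s \<in> S" "z = of_int a / of_int s" "of_int s \<noteq> (0 :: complex)"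
proof -
  obtain a s where "s \<in> S" "z = of_int a / of_int s"
    using assms by (auto simp: localisation_def)
  moreover from this have "of_int s \<noteq> (0 :: complex)" using S_zero by auto
  ultimately show ?thesis by (rule that)
qed

text \<open>If \<open>p\<close> divided some \<open>s \<in> S\<close>, then \<open>1/p\<close> would be a fraction with denominator \<open>s\<close>.\<close>

lemma S_unit: assumes "s \<in> S" shows "of_int s \<noteq> (0 :: 'k)"
proof
  assume "of_int s = (0 :: 'k)"
  then obtain m where m: "s = int CHAR('k) * m"
    by (auto simp: of_int_eq_0_iff_char_dvd)
  then have "1 / of_nat CHAR('k) = (of_int m / of_int s :: complex)"
    using S_zero assms by auto
  then show False
    using char_not_unit assms unfolding localisation_def by blast
qed

lemma red_fraction:
  assumes "s \<in> S" shows "red (of_int a / of_int s) = of_int a / of_int s"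
  unfolding reduction_def
proof (rule the_equality)
  fix y assume "\<exists>a'. \<exists>s'\<in>S. of_int a / of_int s = (of_int a' / of_int s' :: complex) \<and>
    y = of_int a' / (of_int s' :: 'k)"
  then obtain a' s' where s': "s' \<in> S" and y: "y = of_int a' / (of_int s' :: 'k)"
    and eq: "of_int a / of_int s = (of_int a' / of_int s' :: complex)" by blast
  have "of_int s \<noteq> (0 :: complex)" "of_int s' \<noteq> (0 :: complex)" using assms s' S_zero by auto
  then have "(of_int (a * s') :: complex) = of_int (a' * s)"
    using eq by (simp add: field_simps)
  then have "a * s' = a' * s" by (simp only: of_int_eq_iff)
  then have "(of_int a * of_int s' :: 'k) = of_int a' * of_int s" by (metis of_int_mult)
  then show "y = of_int a / of_int s"
    unfolding y using S_unit[OF assms] S_unit[OF s'] by (simp add: frac_eq_eq)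
qed (use assms in blast)

lemma localisation_closed: "z \<in> R \<Longrightarrow> z' \<in> R \<Longrightarrow> z + z' \<in> R" "z \<in> R \<Longrightarrow> z' \<in> R \<Longrightarrow> z * z' \<in> R"
  "of_int a \<in> R" "z \<in> R \<Longrightarrow> - z \<in> R"
proof -
  show "of_int a \<in> R" for a
    using S_one unfolding localisation_def by (intro CollectI exI[of _ a] exI[of _ 1]) simp
  show mult: "z * z' \<in> R" if z: "z \<in> R" "z' \<in> R" for z z'
  proof -
    obtain a s a' s' where "s \<in> S" "z = of_int a / of_int s" "s' \<in> S" "z' = of_int a' / of_int s'"
      using z localisationE by metis
    then show ?thesis
      unfolding localisation_def using S_mult
      by (intro CollectI exI[of _ "a * a'"] exI[of _ "s * s'"]) simp
  qed
  show "z + z' \<in> R" if z: "z \<in> R" "z' \<in> R" for z z'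
  proof -
    obtain a s a' s' where "s \<in> S" "z = of_int a / of_int s" "s' \<in> S" "z' = of_int a' / of_int s'"
      "of_int s \<noteq> (0 :: complex)" "of_int s' \<noteq> (0 :: complex)"
      using z localisationE by metis
    then show ?thesis
      unfolding localisation_def using S_mult
      by (intro CollectI exI[of _ "a * s' + a' * s"] exI[of _ "s * s'"]) (simp add: field_simps)
  qed
  show "- z \<in> R" if "z \<in> R" for z
    using mult[OF \<open>\<And>a. of_int a \<in> R\<close>[of "-1"] that] by simp
qed

lemma R_span_base:
  assumes "finite X" and b: "b \<in> X" shows "b \<in> R_span S D X"
proof -
  have "(\<Sum>b'\<in>X. lie_scale D (if b' = b then 1 else 0) b') = (\<Sum>b'\<in>X. if b' = b then b else 0)"
    by (intro sum.cong) (auto simp: VS.scale_one)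
  then have "b = (\<Sum>b'\<in>X. lie_scale D (if b' = b then 1 else 0) b')"
    using assms by simp
  moreover have "0 \<in> R" "1 \<in> R"
    using localisation_closed(3)[of 0] localisation_closed(3)[of 1] by simp_all
  ultimately show ?thesis
    unfolding R_span_def by (intro CollectI exI[of _ "\<lambda>b'. if b' = b then 1 else 0"]) simp
qed

lemma red_of_int: "red (of_int a) = of_int a"
  using red_fraction[OF S_one, of a] by simp

lemma red_0 [simp]: "red 0 = 0" and red_1 [simp]: "red 1 = 1"
  using red_of_int[of 0] red_of_int[of 1] by simp_all

lemma Ints_in_R: "z \<in> \<int> \<Longrightarrow> z \<in> R"
  by (elim Ints_cases) (simp add: localisation_closed)

text \<open>Reductions lie in the prime field, whose elements are fixed by the Frobenius map.\<close>

lemma red_power_p: assumes "z \<in> R" shows "red z ^ CHAR('k) = red z"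
proof -
  obtain a s where "s \<in> S" "z = of_int a / of_int s" using assms by (rule localisationE)
  then show ?thesis
    by (simp add: red_fraction power_divide of_int_power_CHAR[OF char_pos])
qed

lemma ring_localisation: "ring (localisation_ring S)"
proof (rule ringI)
  have R01: "0 \<in> R" "1 \<in> R" using localisation_closed(3)[of 0] localisation_closed(3)[of 1] by simp_all
  show "abelian_group (localisation_ring S)"
  proof (rule abelian_groupI)
    show "\<exists>y\<in>carrier (localisation_ring S). y \<oplus>\<^bsub>localisation_ring S\<^esub> x = \<zero>\<^bsub>localisation_ring S\<^esub>"
      if "x \<in> carrier (localisation_ring S)" for x
      using that localisation_closed by (intro bexI[of _ "- x"]) (simp_all add: localisation_ring_def type_ring_def)
  qed (use localisation_closed R01 in \<open>simp_all add: localisation_ring_def type_ring_def add_ac\<close>)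
  show "Group.monoid (localisation_ring S)"
    by (rule monoidI) (use localisation_closed R01 in \<open>simp_all add: localisation_ring_def type_ring_def\<close>)
qed (simp_all add: localisation_ring_def type_ring_def algebra_simps)

lemma localisation_ring_simps [simp]:
  "carrier (localisation_ring S) = R" "z \<otimes>\<^bsub>localisation_ring S\<^esub> z' = z * z'"
  "z \<oplus>\<^bsub>localisation_ring S\<^esub> z' = z + z'" "\<one>\<^bsub>localisation_ring S\<^esub> = 1" "\<zero>\<^bsub>localisation_ring S\<^esub> = 0"
  by (simp_all add: localisation_ring_def type_ring_def)


subsection \<open>The Lie algebra over the field\<close>

abbreviation "B \<equiv> adapted_basis D"
abbreviation LK :: "('g \<Rightarrow> 'k, 'k) lie" where "LK \<equiv> lie_K S D"
abbreviation LB :: "('g \<Rightarrow> 'k, 'k) lie" where "LB \<equiv> borel_K S D"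
abbreviation bK :: "'g \<Rightarrow> 'g \<Rightarrow> 'k" where "bK \<equiv> basis_K"

lemma lie_K_simps [simp]:
  "lie_carrier LK = {y. \<forall>b. b \<notin> B \<longrightarrow> y b = 0}" "lie_scale LK t y b = t * y b"
  "lie_bracket LK y z d = (if d \<in> B
       then \<Sum>a\<in>B. \<Sum>b\<in>B. y a * z b * red (coord D (lie_bracket D a b) d) else 0)"
  by (simp_all add: lie_K_def)

lemma borel_K_simps:
  "lie_scale LB = lie_scale LK" "lie_bracket LB = lie_bracket LK"
  "lie_carrier LB = {y \<in> lie_carrier LK. \<forall>b\<in>negative_basis. y b = 0}"
  by (auto simp: borel_K_def lie_K_def negative_basis_def adapted_basis_def positive_roots_def)

lemma closed_lie_K: "closed_lie LK"
  by unfold_locales auto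

sublocale K: restricted_lie LK pm
proof (intro restricted_lie.intro restricted_lie_axioms.intro closed_lie_K)
  show "pm x \<in> lie_carrier LK" if "x \<in> lie_carrier LK" for x
    using p_structure that unfolding p_structure_def restricted_structure_def by blast
qed

lemma restricted: "restricted_structure LK pm"
  using p_structure by (simp add: p_structure_def)

lemma basis_K_closed: "b \<in> B \<Longrightarrow> bK b \<in> lie_carrier LK"
  by (auto simp: basis_K_def)

lemma structure_red: "a \<in> B \<Longrightarrow> b \<in> B \<Longrightarrow> d \<in> B \<Longrightarrow> coord D (lie_bracket D a b) d \<in> R"
  using structure_integral Ints_in_R by blast

lemma bracket_basis_K:
  assumes "a \<in> B" "b \<in> B" "d \<in> B"
  shows "lie_bracket LK (bK a) (bK b) d = red (coord D (lie_bracket D a b) d)"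
proof -
  have "(\<Sum>a'\<in>B. \<Sum>b'\<in>B. bK a a' * bK b b' * red (coord D (lie_bracket D a' b') d)) =
      (\<Sum>a'\<in>B. if a' = a then \<Sum>b'\<in>B. if b' = b then red (coord D (lie_bracket D a b) d) else 0 else 0)"
    by (intro sum.cong refl) (auto simp: basis_K_def intro!: sum.cong sum.neutral)
  also have "\<dots> = red (coord D (lie_bracket D a b) d)"
    using assms finite_basis by simp
  finally show ?thesis using assms by simp
qed

lemma basis_K_expansion:
  assumes "y \<in> lie_carrier LK" shows "(\<Sum>b\<in>B. lie_scale LK (y b) (bK b)) = y"
proof
  fix d
  have "(\<Sum>b\<in>T. lie_scale LK (y b) (bK b)) d = (\<Sum>b\<in>T. lie_scale LK (y b) (bK b) d)" for T
    by (induction T rule: infinite_finite_induct) (simp_all del: lie_K_simps)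
  then have "(\<Sum>b\<in>B. lie_scale LK (y b) (bK b)) d = (\<Sum>b\<in>B. lie_scale LK (y b) (bK b) d)" .
  also have "\<dots> = (\<Sum>b\<in>B. if b = d then y d else 0)"
    by (intro sum.cong) (auto simp: basis_K_def)
  also have "\<dots> = y d"
    using finite_basis assms by simp
  finally show "(\<Sum>b\<in>B. lie_scale LK (y b) (bK b)) d = y d" .
qed

lemma zero_in_K: "0 \<in> lie_carrier LK"
  by simp

lemma borel_subset: "lie_carrier LB \<subseteq> lie_carrier LK"
  by (auto simp: borel_K_simps)

lemma borel_K_bracket:
  assumes y: "y \<in> lie_carrier LB" and z: "z \<in> lie_carrier LB" and d: "d \<in> negative_basis \<union> torus_basis D"
  shows "lie_bracket LK y z d = 0"
proof -
  have zero: "y a * z b * red (coord D (lie_bracket D a b) d) = 0" if ab: "a \<in> B" "b \<in> B" and "d \<in> B" for a b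
  proof (rule ccontr)
    assume nz: "y a * z b * red (coord D (lie_bracket D a b) d) \<noteq> 0"
    then have "a \<notin> negative_basis" "b \<notin> negative_basis"
      using y z by (auto simp: borel_K_simps)
    moreover have "coord D (lie_bracket D a b) d \<noteq> 0" using nz by auto
    ultimately show False
      using borel_bracket[of a b d] that d by auto
  qed
  show ?thesis
  proof (cases "d \<in> B")
    case True
    then have "(\<Sum>a\<in>B. \<Sum>b\<in>B. y a * z b * red (coord D (lie_bracket D a b) d)) = 0"
      using zero by (intro sum.neutral ballI) blast
    then show ?thesis by simp
  qed simp
qed

lemma closed_lie_borel: "closed_lie LB"
proof
  show "lie_bracket LB x y \<in> lie_carrier LB" if "x \<in> lie_carrier LB" "y \<in> lie_carrier LB" for x y
    using borel_K_bracket[OF that] K.lie_bracket_closed[of x y] borel_subset that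
    by (auto simp: borel_K_simps simp del: lie_K_simps)
qed (auto simp: borel_K_simps)

lemma pm_scale: "x \<in> lie_carrier LK \<Longrightarrow> pm (lie_scale LK t x) = lie_scale LK (t ^ CHAR('k)) (pm x)"
  and pm_add: "x \<in> lie_carrier LK \<Longrightarrow> y \<in> lie_carrier LK \<Longrightarrow>
    pm (x + y) = pm x + pm y + (\<Sum>i = 1..<CHAR('k). jacobson_term LK i x y)"
  using restricted unfolding restricted_structure_def by blast+

lemma pm_root_vector: "\<alpha> \<in> roots D \<Longrightarrow> pm (bK (root_vector D \<alpha>)) = 0"
  and pm_torus_basis: "h \<in> torus_basis D \<Longrightarrow> pm (bK h) = bK h"
  using p_structure by (simp_all add: p_structure_def)

lemma weight_K_simps:
  "weight_K S D lam (x + y) = (weight_K S D lam x + weight_K S D lam y :: 'k)"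
  "weight_K S D lam (lie_scale LK t x) = t * (weight_K S D lam x :: 'k)"
  "weight_K S D lam 0 = (0 :: 'k)"
  by (simp_all add: weight_K_def sum.distrib algebra_simps sum_distrib_left)

lemma weight_K_bracket:
  "x \<in> lie_carrier LB \<Longrightarrow> y \<in> lie_carrier LB \<Longrightarrow> weight_K S D lam (lie_bracket LK x y) = (0 :: 'k)"
  by (simp add: weight_K_def borel_K_bracket del: lie_K_simps)

text \<open>The Jacobson terms are sums of brackets, so they lie in the derived algebra of the Borel
  subalgebra.\<close>

lemma jacobson_term_borel:
  assumes x: "x \<in> lie_carrier LB" and y: "y \<in> lie_carrier LB"
  shows "jacobson_term LK i x y \<in> lie_carrier LB \<and> weight_K S D lam (jacobson_term LK i x y) = (0 :: 'k)"
proof -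
  interpret LB: closed_lie LB by (rule closed_lie_borel)
  have closed: "foldr (\<lambda>b. lie_bracket LK (if b then x else y)) bs x \<in> lie_carrier LB" for bs
    using x y LB.lie_bracket_closed by (induction bs) (auto simp: borel_K_simps(2) simp del: lie_K_simps)
  \<comment> \<open>each summand is a \<open>(p - 1)\<close>-fold bracket, so at least one bracket is present\<close>
  have p: "CHAR('k) - 1 > 0"
    using prime_CHAR_semidom[OF char_pos] prime_gt_1_nat by fastforce
  have tm: "foldr (\<lambda>b. lie_bracket LK (if b then x else y)) bs x \<in> lie_carrier LB \<and>
      weight_K S D lam (foldr (\<lambda>b. lie_bracket LK (if b then x else y)) bs x) = (0 :: 'k)"
    if "length bs = CHAR('k) - 1" for bs
  proof (cases bs)
    case Nil
    then show ?thesis using that p by simp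
  next
    case (Cons b bs')
    then show ?thesis
      using closed[of bs] closed[of bs'] x y weight_K_bracket by (auto simp del: lie_K_simps)
  qed
  have sum: "(\<Sum>bs\<in>T. f bs) \<in> lie_carrier LB \<and> weight_K S D lam (\<Sum>bs\<in>T. f bs) = (0 :: 'k)"
    if "\<And>bs. bs \<in> T \<Longrightarrow> f bs \<in> lie_carrier LB \<and> weight_K S D lam (f bs) = (0 :: 'k)" for T and f :: "'z \<Rightarrow> 'g \<Rightarrow> 'k"
    using that
    by (induction T rule: infinite_finite_induct)
      (auto simp: weight_K_simps LB.lie_add_closed simp del: lie_K_simps, auto simp: borel_K_simps)
  have scale: "lie_scale LK t z \<in> lie_carrier LB \<and> weight_K S D lam (lie_scale LK t z) = (0 :: 'k)"
    if "z \<in> lie_carrier LB \<and> weight_K S D lam z = (0 :: 'k)" for t z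
    using that LB.lie_scale_closed[of z t] by (simp add: weight_K_simps borel_K_simps(1) del: lie_K_simps)
  show ?thesis
    unfolding jacobson_term_def by (intro scale sum) (use tm in blast)
qed

lemma jacobson_sum_borel:
  assumes x: "x \<in> lie_carrier LB" and y: "y \<in> lie_carrier LB"
  shows "(\<Sum>i\<in>T. jacobson_term LK i x y) \<in> lie_carrier LB \<and>
    weight_K S D lam (\<Sum>i\<in>T. jacobson_term LK i x y) = (0 :: 'k)"
proof -
  interpret LB: closed_lie LB by (rule closed_lie_borel)
  have zero: "(0 :: 'g \<Rightarrow> 'k) \<in> lie_carrier LB" by (simp add: borel_K_simps)
  show ?thesis
  proof (induction T rule: infinite_finite_induct)
    case (insert i T)
    note j = jacobson_term_borel[OF x y, of i lam]
    show ?case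
      unfolding sum.insert[OF insert.hyps] weight_K_simps(1)
      using LB.lie_add_closed[OF conjunct1[OF j] conjunct1[OF insert.IH]]
      by (simp only: conjunct2[OF j] conjunct2[OF insert.IH] add_0_left)
  next
    case (infinite T)
    show ?case
      unfolding sum.infinite[OF infinite.hyps] weight_K_simps(3) using zero by blast
  next
    case empty
    show ?case
      unfolding sum.empty weight_K_simps(3) using zero by blast
  qed
qed

text \<open>By Jacobson's formula the \<open>p\<close>-operation is \<open>p\<close>-semilinear modulo brackets, on which the weight
  vanishes; \<open>x \<mapsto> \<lambda>(x)\<^sup>p\<close> is \<open>p\<close>-semilinear as well. So both claims are decided on the basis, where they
  hold because \<open>e\<^sub>\<alpha>\<^sup>[\<^sup>p\<^sup>] = 0\<close>, \<open>h\<^sup>[\<^sup>p\<^sup>] = h\<close>, and \<open>\<lambda>(h)\<close> lies in the prime field.\<close>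

lemma pm_borel:
  assumes lam: "\<And>h. h \<in> torus_basis D \<Longrightarrow> lam h \<in> R" and x: "x \<in> lie_carrier LB"
  shows "pm x \<in> lie_carrier LB \<and> weight_K S D lam (pm x) = (weight_K S D lam x :: 'k) ^ CHAR('k)"
proof -
  interpret LB: closed_lie LB by (rule closed_lie_borel)
  have p: "prime CHAR('k)" using char_pos prime_CHAR_semidom by blast
  let ?B = "B - negative_basis"
  have bK: "bK b \<in> lie_carrier LB" if "b \<in> ?B" for b
    using that by (auto simp: borel_K_simps basis_K_def)
  have zero: "(0 :: 'g \<Rightarrow> 'k) \<in> lie_carrier LB" by (simp add: borel_K_simps)
  have single: "pm (lie_scale LK t (bK b)) \<in> lie_carrier LB \<and>
      weight_K S D lam (pm (lie_scale LK t (bK b))) = (weight_K S D lam (lie_scale LK t (bK b)) :: 'k) ^ CHAR('k)"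
    if b: "b \<in> ?B" for t b
  proof -
    have eq: "pm (lie_scale LK t (bK b)) = lie_scale LK (t ^ CHAR('k)) (pm (bK b))"
      using b basis_K_closed by (intro pm_scale) auto
    have weight: "weight_K S D lam (bK b) = (if b \<in> torus_basis D then red (lam b) else 0)"
    proof -
      have "weight_K S D lam (bK b) = (\<Sum>h\<in>torus_basis D. if h = b then red (lam b) else 0)"
        unfolding weight_K_def by (intro sum.cong) (auto simp: basis_K_def)
      moreover note finite_torus_basis
      ultimately show ?thesis by simp
    qed
    show ?thesis
    proof (cases "b \<in> torus_basis D")
      case True
      then show ?thesis
        unfolding eq using bK[OF b] LB.lie_scale_closed[of "bK b" "t ^ CHAR('k)"] red_power_p[OF lam[OF True]]
        by (simp add: pm_torus_basis weight_K_simps weight power_mult_distrib borel_K_simps(1) del: lie_K_simps)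
    next
      case False
      then obtain \<alpha> where "\<alpha> \<in> roots D" "b = root_vector D \<alpha>"
        using b by (auto simp: adapted_basis_def)
      then have pm0: "pm (bK b) = 0" by (simp add: pm_root_vector)
      have s0: "lie_scale LK (t ^ CHAR('k)) 0 = 0" by (rule ext) simp
      show ?thesis
        unfolding eq pm0 s0 using zero False char_pos
        by (simp add: weight_K_simps weight del: lie_K_simps)
    qed
  qed
  have "(\<Sum>b\<in>T. lie_scale LK (x b) (bK b)) \<in> lie_carrier LB \<and>
      pm (\<Sum>b\<in>T. lie_scale LK (x b) (bK b)) \<in> lie_carrier LB \<and>
      weight_K S D lam (pm (\<Sum>b\<in>T. lie_scale LK (x b) (bK b))) =
        (weight_K S D lam (\<Sum>b\<in>T. lie_scale LK (x b) (bK b)) :: 'k) ^ CHAR('k)"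
    if "finite T" "T \<subseteq> ?B" for T
    using that
  proof (induction rule: finite_induct)
    case empty
    have "pm (lie_scale LK 0 0) = lie_scale LK (0 ^ CHAR('k)) (pm 0)"
      by (rule pm_scale[OF zero_in_K])
    moreover have "lie_scale LK 0 z = 0" for z :: "'g \<Rightarrow> 'k" by (rule ext) simp
    ultimately have "pm 0 = 0" using char_pos by (simp add: power_0_left del: lie_K_simps)
    then show ?case
      unfolding sum.empty using zero char_pos
      by (simp only: weight_K_simps(3) power_0_left gr_implies_not0 if_False)
  next
    case (insert b T)
    let ?u = "lie_scale LK (x b) (bK b)" and ?v = "\<Sum>b\<in>T. lie_scale LK (x b) (bK b)"
    have b: "b \<in> ?B" using insert by auto
    have u: "?u \<in> lie_carrier LB"
      using LB.lie_scale_closed[OF bK[OF b]] by (simp add: borel_K_simps(1) del: lie_K_simps)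
    have v: "?v \<in> lie_carrier LB" "pm ?v \<in> lie_carrier LB"
      "weight_K S D lam (pm ?v) = (weight_K S D lam ?v :: 'k) ^ CHAR('k)"
      using insert.IH insert.prems by blast+
    let ?j = "\<Sum>i = 1..<CHAR('k). jacobson_term LK i ?u ?v"
    have j: "?j \<in> lie_carrier LB" "weight_K S D lam ?j = (0 :: 'k)"
      using jacobson_sum_borel[OF u v(1), of "{1..<CHAR('k)}" lam] by blast+
    have pm: "pm (?u + ?v) = pm ?u + pm ?v + ?j"
      using u v borel_subset by (intro pm_add) blast+
    have sum: "(\<Sum>b\<in>insert b T. lie_scale LK (x b) (bK b)) = ?u + ?v"
      using insert by (simp del: lie_K_simps)
    show ?case
      unfolding sum pm
    proof (intro conjI LB.lie_add_closed u v j)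
      note single = single[OF b, of "x b"]
      show "pm ?u \<in> lie_carrier LB" using single by blast
      show "weight_K S D lam (pm ?u + pm ?v + ?j) = (weight_K S D lam (?u + ?v) :: 'k) ^ CHAR('k)"
        by (simp only: weight_K_simps(1) v(3) j(2) conjunct2[OF single] add_0_right
            freshmans_dream[OF p refl])
    qed
  qed
  from this[of ?B] have *: "pm (\<Sum>b\<in>?B. lie_scale LK (x b) (bK b)) \<in> lie_carrier LB \<and>
      weight_K S D lam (pm (\<Sum>b\<in>?B. lie_scale LK (x b) (bK b))) =
        (weight_K S D lam (\<Sum>b\<in>?B. lie_scale LK (x b) (bK b)) :: 'k) ^ CHAR('k)"
    using finite_basis by blast
  have "(\<Sum>b\<in>?B. lie_scale LK (x b) (bK b)) = (\<Sum>b\<in>B. lie_scale LK (x b) (bK b))"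
  proof (rule sum.mono_neutral_left)
    show "\<forall>b\<in>B - ?B. lie_scale LK (x b) (bK b) = 0"
    proof
      fix b assume "b \<in> B - ?B"
      then have "x b = 0" using x by (auto simp: borel_K_simps)
      then show "lie_scale LK (x b) (bK b) = 0" by (intro ext) simp
    qed
  qed (use finite_basis in auto)
  then show ?thesis
    using * basis_K_expansion[of x] x borel_subset by auto
qed

end


section \<open>Generators of induced modules\<close>

context tensor_context
begin

text \<open>Elements that come from \<open>A\<close> may be moved across the tensor sign. This gives the action of the Borel
  subalgebra on the generator of an induced module.\<close>

lemma map_smult_pt:
  assumes "a \<in> carrier A" "n \<in> carrier N"
  shows "\<phi> a \<odot>\<^bsub>T\<^esub> pt \<one>\<^bsub>B\<^esub> n = pt \<one>\<^bsub>B\<^esub> (a \<odot>\<^bsub>N\<^esub> n)"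
proof -
  have "\<phi> a \<odot>\<^bsub>T\<^esub> pt \<one>\<^bsub>B\<^esub> n = pt (\<phi> a \<otimes>\<^bsub>B\<^esub> \<one>\<^bsub>B\<^esub>) n"
    using assms map_closed by (intro smult_pt) auto
  also have "\<phi> a \<otimes>\<^bsub>B\<^esub> \<one>\<^bsub>B\<^esub> = \<one>\<^bsub>B\<^esub> \<otimes>\<^bsub>B\<^esub> \<phi> a"
    using assms map_closed by simp
  also have "pt (\<one>\<^bsub>B\<^esub> \<otimes>\<^bsub>B\<^esub> \<phi> a) n = pt \<one>\<^bsub>B\<^esub> (a \<odot>\<^bsub>N\<^esub> n)"
    using assms by (intro pt_balanced) auto
  finally show ?thesis .
qed

lemma cyclic_tensor:
  assumes "n \<in> carrier N" and "\<And>m. m \<in> carrier N \<Longrightarrow> \<exists>a\<in>carrier A. m = a \<odot>\<^bsub>N\<^esub> n"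
  shows "carrier T = (\<lambda>b. b \<odot>\<^bsub>T\<^esub> pt \<one>\<^bsub>B\<^esub> n) ` carrier B"
proof (rule tensor_subgroup_eq[symmetric])
  show "additive_subgroup ((\<lambda>b. b \<odot>\<^bsub>T\<^esub> pt \<one>\<^bsub>B\<^esub> n) ` carrier B) T"
    using left_module.cyclic_submodule[OF left_module_tensor pt_closed[OF B.one_closed assms(1)]]
    by (simp add: submodule_def additive_subgroup_def)
  fix b m assume b: "b \<in> carrier B" and "m \<in> carrier N"
  then obtain a where a: "a \<in> carrier A" "m = a \<odot>\<^bsub>N\<^esub> n" using assms by blast
  then have "pt b m = pt (b \<otimes>\<^bsub>B\<^esub> \<phi> a) n"
    using pt_balanced b assms(1) by simp
  also have "\<dots> = (b \<otimes>\<^bsub>B\<^esub> \<phi> a) \<odot>\<^bsub>T\<^esub> pt \<one>\<^bsub>B\<^esub> n"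
    using a b assms(1) map_closed by (simp add: smult_pt)
  finally show "pt b m \<in> (\<lambda>b. b \<odot>\<^bsub>T\<^esub> pt \<one>\<^bsub>B\<^esub> n) ` carrier B"
    using a b map_closed by (intro image_eqI[of _ _ "b \<otimes>\<^bsub>B\<^esub> \<phi> a"]) auto
qed

end


section \<open>The complex highest weight module\<close>

context split_datum
begin

lemma closed_lie_C: "closed_lie D"
  using complex_lie by unfold_locales (simp_all add: complex_lie_algebra_def)

lemma borel_C_simps [simp]:
  "lie_carrier (borel_C D) = borel_carrier D" "lie_scale (borel_C D) = lie_scale D"
  "lie_bracket (borel_C D) = lie_bracket D"
  by (simp_all add: borel_C_def)

lemma lie_carrier_UNIV: "lie_carrier D = UNIV"
  using complex_lie by (simp add: complex_lie_algebra_def)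

lemma closed_lie_borel_C: "closed_lie (borel_C D)"
  by unfold_locales (simp_all add: borel_bracket_closed, simp_all add: borel_carrier_eq coord_simps)

lemma sub_lie_C: "sub_lie D (borel_C D)"
  by (intro sub_lie.intro sub_lie_axioms.intro closed_lie_C closed_lie_borel_C)
    (simp_all add: lie_carrier_UNIV)

lemma character_C: "lie_character (borel_C D) (weight_C D lam)"
proof (intro lie_character.intro lie_character_axioms.intro closed_lie_borel_C)
  show "weight_C D lam (lie_bracket (borel_C D) x y) = 0"
    if "x \<in> lie_carrier (borel_C D)" "y \<in> lie_carrier (borel_C D)" for x y
    using weight_C_bracket that by simp
qed (simp_all add: weight_C_def coord_simps algebra_simps sum.distrib sum_distrib_left)

text \<open>The weight as a function on the adapted basis; its reduction is the weight for the modules over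
  \<open>\<gg>\<^sub>\<bbbK>\<close>. The value \<open>0\<close> at positive root vectors says that \<open>\<nn>\<^sup>+\<close> acts by zero.\<close>

definition basis_character :: "('g \<Rightarrow> complex) \<Rightarrow> 'g \<Rightarrow> complex" where
  "basis_character lam b = (if b \<in> torus_basis D then lam b else 0)"

lemma weight_C_basis:
  assumes "b \<in> adapted_basis D" shows "weight_C D lam b = basis_character lam b"
proof -
  have "weight_C D lam b = (\<Sum>h\<in>torus_basis D. if h = b then lam b else 0)"
    unfolding weight_C_def using assms by (intro sum.cong) (auto simp: coord_simps)
  moreover note finite_torus_basis
  ultimately show ?thesis by (simp add: basis_character_def)
qed

lemma borel_basis: "b \<in> adapted_basis D \<Longrightarrow> b \<notin> negative_basis \<Longrightarrow> b \<in> borel_carrier D"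
  by (auto simp: borel_carrier_eq coord_simps dest: negative_in_basis)

lemma verma_context:
  "tensor_context (env_alg (borel_C D)) (env_map D) (env_alg D) (character_module (weight_C D lam))"
proof -
  interpret sub: sub_lie D "borel_C D" by (rule sub_lie_C)
  interpret ch: lie_character "borel_C D" "weight_C D lam" by (rule character_C)
  show ?thesis
    by (intro tensor_context.intro tensor_context_axioms.intro sub.L.UL.ring_axioms
        ch.left_module_character sub.env_map_closed)
qed

lemma left_module_verma: "left_module (env_alg D) (verma D lam)"
  unfolding verma_def by (rule tensor_context.left_module_tensor[OF verma_context])

lemma verma_gen_closed: "verma_gen D lam \<in> carrier (verma D lam)"
proof -
  interpret T: tensor_context "env_alg (borel_C D)" "env_map D" "env_alg D"
    "character_module (weight_C D lam)" by (rule verma_context)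
  interpret ch: lie_character "borel_C D" "weight_C D lam" by (rule character_C)
  show ?thesis
    unfolding verma_def verma_gen_def by (intro T.pt_closed) simp_all
qed

lemma verma_gen_eigen:
  assumes "b \<in> adapted_basis D" "b \<notin> negative_basis"
  shows "env_incl D b \<odot>\<^bsub>verma D lam\<^esub> verma_gen D lam =
    env_scalar D (basis_character lam b) \<odot>\<^bsub>verma D lam\<^esub> verma_gen D lam"
proof -
  interpret T: tensor_context "env_alg (borel_C D)" "env_map D" "env_alg D"
    "character_module (weight_C D lam)" by (rule verma_context)
  interpret sub: sub_lie D "borel_C D" by (rule sub_lie_C)
  interpret ch: lie_character "borel_C D" "weight_C D lam" by (rule character_C)
  have b: "b \<in> lie_carrier (borel_C D)" using borel_basis assms by simp
  have "env_map D (env_incl (borel_C D) b) = env_incl D b"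
    "env_map D (env_scalar (borel_C D) t) = env_scalar D t" for t
    unfolding sub.L.env_incl_eq sub.L.env_scalar_eq sub.L'.env_incl_eq sub.L'.env_scalar_eq
    using b by (intro sub.env_map_coset; simp add: gen_closed scalar_closed del: free_algebra_simps)+
  moreover have "env_incl (borel_C D) b \<in> carrier (env_alg (borel_C D))"
    "env_scalar (borel_C D) t \<in> carrier (env_alg (borel_C D))" for t
    unfolding sub.L'.env_incl_eq sub.L'.env_scalar_eq
    by (rule sub.L'.U.\<iota>_closed[OF b], rule sub.L'.U.\<kappa>_closed)
  ultimately show ?thesis
    unfolding verma_def verma_gen_def
    using T.map_smult_pt[of "env_incl (borel_C D) b" 1]
      T.map_smult_pt[of "env_scalar (borel_C D) (basis_character lam b)" 1] b assms
    by (simp add: ch.character_incl ch.character_scalar weight_C_basis)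
qed

end


section \<open>The integral form of the highest weight module\<close>

text \<open>The abbreviations below follow the usual notation: \<open>L\<close> is the quotient of the Verma module with
  highest weight vector \<open>v\<close>, \<open>M\<close> is the \<open>R\<close>-form generated by \<open>v\<close>, and \<open>act b\<close> is the action of a basis
  element on \<open>\<bbbK> \<otimes> M\<close>.\<close>

locale highest_weight_form = integral_form D S pm
  for D :: "'g::ab_group_add split_lie" and S :: "int set" and pm :: "('g \<Rightarrow> 'k::field) \<Rightarrow> 'g \<Rightarrow> 'k" +
  fixes lam :: "'g \<Rightarrow> complex" and N :: "((('g word \<Rightarrow>\<^sub>0 complex) set \<times> complex) \<Rightarrow>\<^sub>0 int) set set"
  assumes integral_weight: "integral_weight S D lam"
    and N: "submodule N (env_alg D) (verma D lam)"
begin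

sublocale C: closed_lie D
  by (rule closed_lie_C)

abbreviation "L \<equiv> verma D lam QuotM N"

definition v where "v = N +>\<^bsub>verma D lam\<^esub> verma_gen D lam"

sublocale verma: left_module "env_alg D" "verma D lam"
  by (rule left_module_verma)

sublocale L: left_module "env_alg D" L
  by (rule verma.left_module_quot[OF N])

lemma v_closed: "v \<in> carrier L"
  unfolding v_def carrier_quot[OF verma.submodule_abelian_subgroup[OF N]]
  using verma_gen_closed by blast

abbreviation "incl \<equiv> env_incl D"
abbreviation "scal \<equiv> env_scalar D"

lemma incl_closed: "incl x \<in> carrier (env_alg D)"
  unfolding C.env_incl_eq by (rule C.U.\<iota>_closed) (simp add: lie_carrier_UNIV)

lemma scal_closed: "scal t \<in> carrier (env_alg D)"
  unfolding C.env_scalar_eq by (rule C.U.\<kappa>_closed)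

lemma v_eigen:
  assumes "b \<in> adapted_basis D" "b \<notin> negative_basis"
  shows "incl b \<odot>\<^bsub>L\<^esub> v = scal (basis_character lam b) \<odot>\<^bsub>L\<^esub> v"
  unfolding v_def using verma_gen_closed verma_gen_eigen[OF assms]
  by (simp add: verma.quot_module_smult[OF N] incl_closed scal_closed)

lemma scal_simps:
  "scal (s + t) = scal s \<oplus>\<^bsub>env_alg D\<^esub> scal t" "scal (s * t) = scal s \<otimes>\<^bsub>env_alg D\<^esub> scal t"
  "scal 1 = \<one>\<^bsub>env_alg D\<^esub>" "scal 0 = \<zero>\<^bsub>env_alg D\<^esub>"
  "u \<in> carrier (env_alg D) \<Longrightarrow> scal s \<otimes>\<^bsub>env_alg D\<^esub> u = u \<otimes>\<^bsub>env_alg D\<^esub> scal s"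
  by (simp_all add: C.env_scalar_eq C.U.\<kappa>_simps C.U.\<kappa>_central)

lemma env_R_gens: "scal ` R \<union> incl ` R_span S D B \<subseteq> carrier (env_alg D)"
  using incl_closed scal_closed by blast

lemma env_R_subset: "env_R S D \<subseteq> carrier (env_alg D)"
  unfolding env_R_def using C.UL.generate_ring_in_carrier[OF env_R_gens] by blast

lemma env_R_closed:
  "u \<in> env_R S D \<Longrightarrow> u' \<in> env_R S D \<Longrightarrow> u \<oplus>\<^bsub>env_alg D\<^esub> u' \<in> env_R S D"
  "u \<in> env_R S D \<Longrightarrow> u' \<in> env_R S D \<Longrightarrow> u \<otimes>\<^bsub>env_alg D\<^esub> u' \<in> env_R S D"
  "u \<in> env_R S D \<Longrightarrow> \<ominus>\<^bsub>env_alg D\<^esub> u \<in> env_R S D"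
  "\<one>\<^bsub>env_alg D\<^esub> \<in> env_R S D" "r \<in> R \<Longrightarrow> scal r \<in> env_R S D"
  unfolding env_R_def by (blast intro: generate_ring.intros)+

lemma incl_in_env_R: "b \<in> B \<Longrightarrow> incl b \<in> env_R S D"
  unfolding env_R_def using R_span_base[OF finite_basis] by (intro generate_ring.incl) blast

abbreviation "M \<equiv> L_R S D lam N"

lemma M_simps [simp]:
  "carrier M = (\<lambda>u. u \<odot>\<^bsub>L\<^esub> v) ` env_R S D" "w \<oplus>\<^bsub>M\<^esub> w' = w \<oplus>\<^bsub>L\<^esub> w'" "\<zero>\<^bsub>M\<^esub> = \<zero>\<^bsub>L\<^esub>"
  "r \<odot>\<^bsub>M\<^esub> w = scal r \<odot>\<^bsub>L\<^esub> w"
  by (simp_all add: L_R_def Let_def v_def)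

lemma M_subset: "carrier M \<subseteq> carrier L"
  using env_R_subset v_closed L.smult_closed by auto

lemma M_act_closed: "u \<in> env_R S D \<Longrightarrow> w \<in> carrier M \<Longrightarrow> u \<odot>\<^bsub>L\<^esub> w \<in> carrier M"
proof -
  assume u: "u \<in> env_R S D" and "w \<in> carrier M"
  then obtain u' where u': "u' \<in> env_R S D" "w = u' \<odot>\<^bsub>L\<^esub> v" by auto
  have "u \<odot>\<^bsub>L\<^esub> w = (u \<otimes>\<^bsub>env_alg D\<^esub> u') \<odot>\<^bsub>L\<^esub> v"
    unfolding u'(2) using u u'(1) env_R_subset v_closed by (intro L.smult_assoc[symmetric]) auto
  then show ?thesis
    using env_R_closed(2)[OF u u'(1)] by simp
qed

lemma v_in_M: "v \<in> carrier M"
  unfolding M_simps(1)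
  by (rule image_eqI[of _ _ "\<one>\<^bsub>env_alg D\<^esub>"]) (simp_all add: L.smult_one[OF v_closed] env_R_closed(4))

lemma left_module_M: "left_module (localisation_ring S) M"
proof (intro left_module.intro left_module_axioms.intro ring_localisation)
  have sub: "w \<in> carrier L" if "w \<in> carrier M" for w using that M_subset by blast
  show "abelian_group M"
  proof (rule abelian_groupI)
    fix w assume "w \<in> carrier M"
    then obtain u where u: "u \<in> env_R S D" "w = u \<odot>\<^bsub>L\<^esub> v" by auto
    then have "(\<ominus>\<^bsub>env_alg D\<^esub> u) \<odot>\<^bsub>L\<^esub> v \<oplus>\<^bsub>L\<^esub> w = \<zero>\<^bsub>L\<^esub>"
      using env_R_subset v_closed by (auto simp: L.smult_minus_left L.smult_closed L.M.l_neg)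
    then show "\<exists>w'\<in>carrier M. w' \<oplus>\<^bsub>M\<^esub> w = \<zero>\<^bsub>M\<^esub>"
      using u env_R_closed(3) by (intro bexI[of _ "(\<ominus>\<^bsub>env_alg D\<^esub> u) \<odot>\<^bsub>L\<^esub> v"]) auto
  next
    fix w w' assume "w \<in> carrier M" "w' \<in> carrier M"
    then obtain u u' where u: "u \<in> env_R S D" "w = u \<odot>\<^bsub>L\<^esub> v" "u' \<in> env_R S D" "w' = u' \<odot>\<^bsub>L\<^esub> v" by auto
    then have "w \<oplus>\<^bsub>L\<^esub> w' = (u \<oplus>\<^bsub>env_alg D\<^esub> u') \<odot>\<^bsub>L\<^esub> v"
      using env_R_subset v_closed by (simp add: L.smult_l_distr subsetD)
    then show "w \<oplus>\<^bsub>M\<^esub> w' \<in> carrier M"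
      using u env_R_closed(1) by auto
  next
    have "\<zero>\<^bsub>L\<^esub> = \<zero>\<^bsub>env_alg D\<^esub> \<odot>\<^bsub>L\<^esub> v" using v_closed L.smult_zero_left by simp
    moreover have "\<zero>\<^bsub>env_alg D\<^esub> \<in> env_R S D"
      unfolding env_R_def by (rule C.UL.zero_in_generate)
    ultimately show "\<zero>\<^bsub>M\<^esub> \<in> carrier M" by auto
  next
    fix w w' assume "w \<in> carrier M" "w' \<in> carrier M"
    then show "w \<oplus>\<^bsub>M\<^esub> w' = w' \<oplus>\<^bsub>M\<^esub> w" using sub L.M.a_comm by simp
  next
    fix w assume "w \<in> carrier M"
    then show "\<zero>\<^bsub>M\<^esub> \<oplus>\<^bsub>M\<^esub> w = w" using sub by simp
  next
    fix x y z assume "x \<in> carrier M" "y \<in> carrier M" "z \<in> carrier M"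
    then show "x \<oplus>\<^bsub>M\<^esub> y \<oplus>\<^bsub>M\<^esub> z = x \<oplus>\<^bsub>M\<^esub> (y \<oplus>\<^bsub>M\<^esub> z)" using sub[of x] sub[of y] sub[of z] L.M.a_assoc by simp
  qed
  fix r s w w' assume r: "r \<in> carrier (localisation_ring S)" and w: "w \<in> carrier M"
  show "r \<odot>\<^bsub>M\<^esub> w \<in> carrier M"
    using M_act_closed[OF env_R_closed(5)] r w by simp
  show "(r \<otimes>\<^bsub>localisation_ring S\<^esub> s) \<odot>\<^bsub>M\<^esub> w = r \<odot>\<^bsub>M\<^esub> (s \<odot>\<^bsub>M\<^esub> w)"
    if "s \<in> carrier (localisation_ring S)"
    using sub[OF w] by (simp add: scal_simps(1,2) scal_closed L.smult_assoc)
  show "(r \<oplus>\<^bsub>localisation_ring S\<^esub> s) \<odot>\<^bsub>M\<^esub> w = r \<odot>\<^bsub>M\<^esub> w \<oplus>\<^bsub>M\<^esub> s \<odot>\<^bsub>M\<^esub> w"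
    if "s \<in> carrier (localisation_ring S)"
    using sub[OF w] by (simp add: scal_simps(1,2) scal_closed L.smult_l_distr)
  show "r \<odot>\<^bsub>M\<^esub> (w \<oplus>\<^bsub>M\<^esub> w') = r \<odot>\<^bsub>M\<^esub> w \<oplus>\<^bsub>M\<^esub> r \<odot>\<^bsub>M\<^esub> w'" if "w' \<in> carrier M"
    using sub[OF w] sub[OF that] by (simp add: scal_closed L.smult_r_distr)
next
  fix w assume "w \<in> carrier M"
  then show "\<one>\<^bsub>localisation_ring S\<^esub> \<odot>\<^bsub>M\<^esub> w = w"
    using M_subset by (simp add: scal_simps(3) del: M_simps(1)) (simp add: subset_iff L.smult_one)
qed

sublocale T: tensor_context "localisation_ring S" red "type_ring :: 'k ring" M
  by (intro tensor_context.intro tensor_context_axioms.intro ring_type_ring left_module_M) simp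

sublocale V: left_module "type_ring :: 'k ring" T.T
  by (rule T.left_module_tensor)

abbreviation "act b \<equiv> id_tensor (localisation_ring S) red (type_ring :: 'k ring) M (\<lambda>w. incl b \<odot>\<^bsub>L\<^esub> w)"

lemma act_hom:
  assumes "b \<in> B"
  shows "\<And>c n. n \<in> carrier M \<Longrightarrow> act b (T.pt c n) = T.pt c (incl b \<odot>\<^bsub>L\<^esub> n)"
    and "\<And>z. z \<in> carrier T.T \<Longrightarrow> act b z \<in> carrier T.T"
    and "\<And>z y. z \<in> carrier T.T \<Longrightarrow> y \<in> carrier T.T \<Longrightarrow> act b (z \<oplus>\<^bsub>T.T\<^esub> y) = act b z \<oplus>\<^bsub>T.T\<^esub> act b y"
    and "\<And>c z. z \<in> carrier T.T \<Longrightarrow> act b (c \<odot>\<^bsub>T.T\<^esub> z) = c \<odot>\<^bsub>T.T\<^esub> act b z"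
proof -
  have closed: "incl b \<odot>\<^bsub>L\<^esub> w \<in> carrier M" if "w \<in> carrier M" for w
    using M_act_closed[OF incl_in_env_R[OF assms] that] .
  have add: "incl b \<odot>\<^bsub>L\<^esub> (w \<oplus>\<^bsub>M\<^esub> w') = incl b \<odot>\<^bsub>L\<^esub> w \<oplus>\<^bsub>M\<^esub> incl b \<odot>\<^bsub>L\<^esub> w'"
    if "w \<in> carrier M" "w' \<in> carrier M" for w w'
    using that M_subset incl_closed by (simp add: L.smult_r_distr subset_iff del: M_simps(1))
  have smult: "incl b \<odot>\<^bsub>L\<^esub> (r \<odot>\<^bsub>M\<^esub> w) = r \<odot>\<^bsub>M\<^esub> (incl b \<odot>\<^bsub>L\<^esub> w)"
    if "r \<in> carrier (localisation_ring S)" "w \<in> carrier M" for r w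
    using that M_subset incl_closed scal_closed scal_simps(5)[of "incl b" r]
    by (simp add: subset_iff del: M_simps(1) flip: L.smult_assoc)
  note hom = T.id_tensor_hom[of "\<lambda>w. incl b \<odot>\<^bsub>L\<^esub> w", OF closed add smult]
  show "\<And>c n. n \<in> carrier M \<Longrightarrow> act b (T.pt c n) = T.pt c (incl b \<odot>\<^bsub>L\<^esub> n)"
    by (rule hom(1)) simp_all
  show "\<And>z. z \<in> carrier T.T \<Longrightarrow> act b z \<in> carrier T.T"
    by (rule hom(2))
  show "\<And>z y. z \<in> carrier T.T \<Longrightarrow> y \<in> carrier T.T \<Longrightarrow> act b (z \<oplus>\<^bsub>T.T\<^esub> y) = act b z \<oplus>\<^bsub>T.T\<^esub> act b y"
    by (rule hom(3))
  show "\<And>c z. z \<in> carrier T.T \<Longrightarrow> act b (c \<odot>\<^bsub>T.T\<^esub> z) = c \<odot>\<^bsub>T.T\<^esub> act b z"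
    by (rule hom(4)) simp_all
qed

lemma T_smult_closed: "z \<in> carrier T.T \<Longrightarrow> c \<odot>\<^bsub>T.T\<^esub> z \<in> carrier T.T"
  using V.smult_closed[of c z] by simp

lemma pt_finsum_right:
  assumes "finite X" "\<And>d. d \<in> X \<Longrightarrow> g d \<in> carrier M"
  shows "T.pt c (\<Oplus>\<^bsub>L\<^esub>d\<in>X. g d) = (\<Oplus>\<^bsub>T.T\<^esub>d\<in>X. T.pt c (g d)) \<and> (\<Oplus>\<^bsub>L\<^esub>d\<in>X. g d) \<in> carrier M"
  using assms
proof (induction rule: finite_induct)
  case empty
  have "\<zero>\<^bsub>L\<^esub> \<in> carrier M"
    using left_module_M abelian_monoid.zero_closed[of M] by (auto simp: left_module_def abelian_group_def simp del: M_simps(1))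
  then show ?case using T.pt_zero_right[of c] by (simp del: M_simps(1))
next
  case (insert d X)
  have gL: "g \<in> X \<rightarrow> carrier L" "g d \<in> carrier L" using insert.prems M_subset by auto
  have gT: "(\<lambda>d. T.pt c (g d)) \<in> X \<rightarrow> carrier T.T" "T.pt c (g d) \<in> carrier T.T"
    using insert.prems T.pt_closed[of c] by (auto simp del: M_simps(1))
  have IH: "T.pt c (\<Oplus>\<^bsub>L\<^esub>d\<in>X. g d) = (\<Oplus>\<^bsub>T.T\<^esub>d\<in>X. T.pt c (g d))" "(\<Oplus>\<^bsub>L\<^esub>d\<in>X. g d) \<in> carrier M"
    using insert by auto
  have gd: "g d \<in> carrier M" using insert.prems by blast
  have "(\<Oplus>\<^bsub>L\<^esub>d\<in>insert d X. g d) = g d \<oplus>\<^bsub>L\<^esub> (\<Oplus>\<^bsub>L\<^esub>d\<in>X. g d)"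
    using insert gL by simp
  moreover have "g d \<oplus>\<^bsub>L\<^esub> (\<Oplus>\<^bsub>L\<^esub>d\<in>X. g d) \<in> carrier M"
    using abelian_monoid.a_closed[of M "g d" "\<Oplus>\<^bsub>L\<^esub>d\<in>X. g d"] left_module_M IH(2) gd
    by (simp add: left_module_def abelian_group_def del: M_simps(1))
  moreover have "T.pt c (g d \<oplus>\<^bsub>L\<^esub> (\<Oplus>\<^bsub>L\<^esub>d\<in>X. g d)) = T.pt c (g d) \<oplus>\<^bsub>T.T\<^esub> T.pt c (\<Oplus>\<^bsub>L\<^esub>d\<in>X. g d)"
    using T.pt_add_right[of c "g d" "\<Oplus>\<^bsub>L\<^esub>d\<in>X. g d"] IH(2) gd by (simp del: M_simps(1))
  ultimately show ?case
    using IH insert gT by simp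
qed

lemma incl_expansion:
  "incl x = (\<Oplus>\<^bsub>env_alg D\<^esub>b\<in>B. scal (coord D x b) \<otimes>\<^bsub>env_alg D\<^esub> incl b)"
proof -
  have "C.U.\<iota> (\<Sum>b\<in>B. lie_scale D (coord D x b) b) =
      (\<Oplus>\<^bsub>env_alg D\<^esub>b\<in>B. C.U.\<iota> (lie_scale D (coord D x b) b))"
    by (rule conjunct1[OF C.U.\<iota>_sum]) (simp_all add: lie_carrier_UNIV finite_basis)
  moreover have "C.U.\<iota> (lie_scale D t b) = C.U.\<kappa> t \<otimes>\<^bsub>env_alg D\<^esub> C.U.\<iota> b" for t b
    by (rule C.U.\<iota>_scale) (simp add: lie_carrier_UNIV)
  ultimately show ?thesis
    by (simp only: basis_expansion C.env_incl_eq C.env_scalar_eq)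
qed

text \<open>Both sides are additive, so it suffices to compare them on \<open>c \<otimes> n\<close>. There \<open>[a, b]\<close> is expanded in
  the basis; its coordinates are integers, and moving them across the tensor sign reduces them.\<close>

lemma act_commutator:
  assumes a: "a \<in> B" and b: "b \<in> B" and z: "z \<in> carrier T.T"
  shows "act a (act b z) =
    act b (act a z) \<oplus>\<^bsub>T.T\<^esub> (\<Oplus>\<^bsub>T.T\<^esub>d\<in>B. red (coord D (lie_bracket D a b) d) \<odot>\<^bsub>T.T\<^esub> act d z)"
proof (rule T.tensor_eqI[where f = "\<lambda>z. act a (act b z)" and z = z and
      g = "\<lambda>z. act b (act a z) \<oplus>\<^bsub>T.T\<^esub> (\<Oplus>\<^bsub>T.T\<^esub>d\<in>B. red (coord D (lie_bracket D a b) d) \<odot>\<^bsub>T.T\<^esub> act d z)"])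
  let ?r = "\<lambda>d. coord D (lie_bracket D a b) d"
  have Rr: "?r d \<in> R" if "d \<in> B" for d using structure_red a b that by blast
  fix c n assume n: "n \<in> carrier M"
  have nL: "n \<in> carrier L" using n M_subset by blast
  have cl: "incl d \<odot>\<^bsub>L\<^esub> n \<in> carrier M" if "d \<in> B" for d
    using M_act_closed[OF incl_in_env_R[OF that] n] .
  have "incl a \<odot>\<^bsub>L\<^esub> (incl b \<odot>\<^bsub>L\<^esub> n) = incl b \<odot>\<^bsub>L\<^esub> (incl a \<odot>\<^bsub>L\<^esub> n) \<oplus>\<^bsub>L\<^esub> incl (lie_bracket D a b) \<odot>\<^bsub>L\<^esub> n"
  proof -
    have "incl (lie_bracket D a b) = incl a \<otimes>\<^bsub>env_alg D\<^esub> incl b \<ominus>\<^bsub>env_alg D\<^esub> incl b \<otimes>\<^bsub>env_alg D\<^esub> incl a"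
      unfolding C.env_incl_eq by (rule C.U.\<iota>_bracket) (simp_all add: lie_carrier_UNIV)
    then have "incl a \<otimes>\<^bsub>env_alg D\<^esub> incl b = incl (lie_bracket D a b) \<oplus>\<^bsub>env_alg D\<^esub> incl b \<otimes>\<^bsub>env_alg D\<^esub> incl a"
      using C.UL.diff_eq_iff[of "incl a \<otimes>\<^bsub>env_alg D\<^esub> incl b" "incl b \<otimes>\<^bsub>env_alg D\<^esub> incl a" "incl (lie_bracket D a b)"]
        incl_closed by simp
    then have "(incl a \<otimes>\<^bsub>env_alg D\<^esub> incl b) \<odot>\<^bsub>L\<^esub> n =
        (incl (lie_bracket D a b) \<oplus>\<^bsub>env_alg D\<^esub> incl b \<otimes>\<^bsub>env_alg D\<^esub> incl a) \<odot>\<^bsub>L\<^esub> n" by simp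
    then show ?thesis
      using nL incl_closed by (simp add: L.smult_assoc L.smult_l_distr L.smult_closed L.M.a_comm)
  qed
  moreover have "incl (lie_bracket D a b) \<odot>\<^bsub>L\<^esub> n = (\<Oplus>\<^bsub>L\<^esub>d\<in>B. scal (?r d) \<odot>\<^bsub>L\<^esub> (incl d \<odot>\<^bsub>L\<^esub> n))"
  proof -
    have "incl (lie_bracket D a b) \<odot>\<^bsub>L\<^esub> n =
        (\<Oplus>\<^bsub>L\<^esub>d\<in>B. (scal (?r d) \<otimes>\<^bsub>env_alg D\<^esub> incl d) \<odot>\<^bsub>L\<^esub> n)"
      unfolding incl_expansion[of "lie_bracket D a b"] using nL finite_basis
      by (intro L.smult_finsum_left) (auto simp: scal_closed incl_closed)
    then show ?thesis using nL by (simp add: L.smult_assoc scal_closed incl_closed)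
  qed
  moreover have sum: "T.pt c (\<Oplus>\<^bsub>L\<^esub>d\<in>B. scal (?r d) \<odot>\<^bsub>L\<^esub> (incl d \<odot>\<^bsub>L\<^esub> n)) =
      (\<Oplus>\<^bsub>T.T\<^esub>d\<in>B. T.pt c (scal (?r d) \<odot>\<^bsub>L\<^esub> (incl d \<odot>\<^bsub>L\<^esub> n)))"
    "(\<Oplus>\<^bsub>L\<^esub>d\<in>B. scal (?r d) \<odot>\<^bsub>L\<^esub> (incl d \<odot>\<^bsub>L\<^esub> n)) \<in> carrier M"
    using pt_finsum_right[OF finite_basis, of "\<lambda>d. scal (?r d) \<odot>\<^bsub>L\<^esub> (incl d \<odot>\<^bsub>L\<^esub> n)" c]
      M_act_closed[OF env_R_closed(5)[OF Rr] cl] by blast+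
  moreover have "(\<Oplus>\<^bsub>T.T\<^esub>d\<in>B. T.pt c (scal (?r d) \<odot>\<^bsub>L\<^esub> (incl d \<odot>\<^bsub>L\<^esub> n))) =
      (\<Oplus>\<^bsub>T.T\<^esub>d\<in>B. red (?r d) \<odot>\<^bsub>T.T\<^esub> act d (T.pt c n))"
  proof (intro V.M.finsum_cong' refl)
    fix d assume d: "d \<in> B"
    have "T.pt c (scal (?r d) \<odot>\<^bsub>L\<^esub> (incl d \<odot>\<^bsub>L\<^esub> n)) = T.pt (c * red (?r d)) (incl d \<odot>\<^bsub>L\<^esub> n)"
      using T.pt_balanced[of "?r d" c "incl d \<odot>\<^bsub>L\<^esub> n"] Rr[OF d] cl[OF d] by (simp del: M_simps(1))
    also have "\<dots> = red (?r d) \<odot>\<^bsub>T.T\<^esub> T.pt c (incl d \<odot>\<^bsub>L\<^esub> n)"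
      using T.smult_pt[of "red (?r d)" c "incl d \<odot>\<^bsub>L\<^esub> n"] cl[OF d] by (simp add: mult.commute del: M_simps(1))
    finally show "T.pt c (scal (?r d) \<odot>\<^bsub>L\<^esub> (incl d \<odot>\<^bsub>L\<^esub> n)) = red (?r d) \<odot>\<^bsub>T.T\<^esub> act d (T.pt c n)"
      using act_hom(1)[OF d n] by simp
  qed (use act_hom(2) T.pt_closed[of c n] n T_smult_closed in \<open>auto simp del: M_simps(1)\<close>)
  ultimately have "T.pt c (incl a \<odot>\<^bsub>L\<^esub> (incl b \<odot>\<^bsub>L\<^esub> n)) = T.pt c (incl b \<odot>\<^bsub>L\<^esub> (incl a \<odot>\<^bsub>L\<^esub> n)) \<oplus>\<^bsub>T.T\<^esub>
      (\<Oplus>\<^bsub>T.T\<^esub>d\<in>B. red (?r d) \<odot>\<^bsub>T.T\<^esub> act d (T.pt c n))"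
    using T.pt_add_right[of c "incl b \<odot>\<^bsub>L\<^esub> (incl a \<odot>\<^bsub>L\<^esub> n)"] M_act_closed[OF incl_in_env_R[OF b] cl[OF a]]
    by (simp del: M_simps(1))
  then show "act a (act b (T.pt c n)) = act b (act a (T.pt c n)) \<oplus>\<^bsub>T.T\<^esub>
      (\<Oplus>\<^bsub>T.T\<^esub>d\<in>B. red (?r d) \<odot>\<^bsub>T.T\<^esub> act d (T.pt c n))"
    using act_hom(1)[OF a n] act_hom(1)[OF b n] act_hom(1)[OF a cl[OF b]] act_hom(1)[OF b cl[OF a]] by simp
next
  let ?r = "\<lambda>d. red (coord D (lie_bracket D a b) d)"
  show "act a (act b z) \<in> carrier T.T" if "z \<in> carrier T.T" for z
    using that act_hom(2) a b by blast
  show "act b (act a z) \<oplus>\<^bsub>T.T\<^esub> (\<Oplus>\<^bsub>T.T\<^esub>d\<in>B. ?r d \<odot>\<^bsub>T.T\<^esub> act d z) \<in> carrier T.T" if "z \<in> carrier T.T" for z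
    using that act_hom(2) a b T_smult_closed by (intro V.M.add.m_closed V.M.finsum_closed) auto
  fix x y assume xy: "x \<in> carrier T.T" "y \<in> carrier T.T"
  show "act a (act b (x \<oplus>\<^bsub>T.T\<^esub> y)) = act a (act b x) \<oplus>\<^bsub>T.T\<^esub> act a (act b y)"
    using xy act_hom(2,3) a b by simp
  have "(\<Oplus>\<^bsub>T.T\<^esub>d\<in>B. ?r d \<odot>\<^bsub>T.T\<^esub> act d (x \<oplus>\<^bsub>T.T\<^esub> y)) =
      (\<Oplus>\<^bsub>T.T\<^esub>d\<in>B. ?r d \<odot>\<^bsub>T.T\<^esub> act d x \<oplus>\<^bsub>T.T\<^esub> ?r d \<odot>\<^bsub>T.T\<^esub> act d y)"
    using xy act_hom(2,3) V.smult_r_distr T_smult_closed by (intro V.M.finsum_cong') auto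
  also have "\<dots> = (\<Oplus>\<^bsub>T.T\<^esub>d\<in>B. ?r d \<odot>\<^bsub>T.T\<^esub> act d x) \<oplus>\<^bsub>T.T\<^esub> (\<Oplus>\<^bsub>T.T\<^esub>d\<in>B. ?r d \<odot>\<^bsub>T.T\<^esub> act d y)"
    using xy act_hom(2) T_smult_closed by (intro V.M.finsum_addf) auto
  finally have eq: "(\<Oplus>\<^bsub>T.T\<^esub>d\<in>B. ?r d \<odot>\<^bsub>T.T\<^esub> act d (x \<oplus>\<^bsub>T.T\<^esub> y)) = \<dots>" .
  have cl: "(\<Oplus>\<^bsub>T.T\<^esub>d\<in>B. ?r d \<odot>\<^bsub>T.T\<^esub> act d z) \<in> carrier T.T" if "z \<in> carrier T.T" for z
    using that act_hom(2) T_smult_closed by (intro V.M.finsum_closed) auto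
  show "act b (act a (x \<oplus>\<^bsub>T.T\<^esub> y)) \<oplus>\<^bsub>T.T\<^esub> (\<Oplus>\<^bsub>T.T\<^esub>d\<in>B. ?r d \<odot>\<^bsub>T.T\<^esub> act d (x \<oplus>\<^bsub>T.T\<^esub> y)) =
      act b (act a x) \<oplus>\<^bsub>T.T\<^esub> (\<Oplus>\<^bsub>T.T\<^esub>d\<in>B. ?r d \<odot>\<^bsub>T.T\<^esub> act d x) \<oplus>\<^bsub>T.T\<^esub>
      (act b (act a y) \<oplus>\<^bsub>T.T\<^esub> (\<Oplus>\<^bsub>T.T\<^esub>d\<in>B. ?r d \<odot>\<^bsub>T.T\<^esub> act d y))"
    unfolding eq using xy cl[OF xy(1)] cl[OF xy(2)] act_hom(2,3) a b by (simp add: V.M.a_ac)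
qed (rule z)

end


section \<open>Base change of the highest weight module\<close>

context highest_weight_form
begin

definition rho where
  "rho = (\<lambda>y C. \<Oplus>\<^bsub>T.T\<^esub>b\<in>B. y b \<odot>\<^bsub>T.T\<^esub> act b C)"

lemma smult_act_closed: "b \<in> B \<Longrightarrow> z \<in> carrier T.T \<Longrightarrow> t \<odot>\<^bsub>T.T\<^esub> act b z \<in> carrier T.T"
  using act_hom(2) T_smult_closed by blast

lemma V_simps:
  "z \<in> carrier T.T \<Longrightarrow> z' \<in> carrier T.T \<Longrightarrow> t \<odot>\<^bsub>T.T\<^esub> (z \<oplus>\<^bsub>T.T\<^esub> z') = t \<odot>\<^bsub>T.T\<^esub> z \<oplus>\<^bsub>T.T\<^esub> t \<odot>\<^bsub>T.T\<^esub> z'"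
  "z \<in> carrier T.T \<Longrightarrow> (s + t) \<odot>\<^bsub>T.T\<^esub> z = s \<odot>\<^bsub>T.T\<^esub> z \<oplus>\<^bsub>T.T\<^esub> t \<odot>\<^bsub>T.T\<^esub> z"
  "z \<in> carrier T.T \<Longrightarrow> (s * t) \<odot>\<^bsub>T.T\<^esub> z = s \<odot>\<^bsub>T.T\<^esub> (t \<odot>\<^bsub>T.T\<^esub> z)"
  "z \<in> carrier T.T \<Longrightarrow> 1 \<odot>\<^bsub>T.T\<^esub> z = z" "z \<in> carrier T.T \<Longrightarrow> 0 \<odot>\<^bsub>T.T\<^esub> z = \<zero>\<^bsub>T.T\<^esub>"
  using V.smult_r_distr[of t z z'] V.smult_l_distr[of s t z] V.smult_assoc[of s t z] V.smult_one[of z]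
    V.smult_zero_left[of z] by simp_all

lemma rho_closed: "z \<in> carrier T.T \<Longrightarrow> rho x z \<in> carrier T.T"
  unfolding rho_def using smult_act_closed by (intro V.M.finsum_closed) auto

lemma rho_add_right:
  assumes "z \<in> carrier T.T" "z' \<in> carrier T.T"
  shows "rho x (z \<oplus>\<^bsub>T.T\<^esub> z') = rho x z \<oplus>\<^bsub>T.T\<^esub> rho x z'"
proof -
  have "rho x (z \<oplus>\<^bsub>T.T\<^esub> z') = (\<Oplus>\<^bsub>T.T\<^esub>b\<in>B. x b \<odot>\<^bsub>T.T\<^esub> act b z \<oplus>\<^bsub>T.T\<^esub> x b \<odot>\<^bsub>T.T\<^esub> act b z')"
    unfolding rho_def using assms act_hom(2,3) smult_act_closed
    by (intro V.M.finsum_cong') (auto simp: V_simps)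
  also have "\<dots> = rho x z \<oplus>\<^bsub>T.T\<^esub> rho x z'"
    unfolding rho_def using assms smult_act_closed by (intro V.M.finsum_addf) auto
  finally show ?thesis .
qed

lemma rho_add:
  assumes "z \<in> carrier T.T" shows "rho (x + y) z = rho x z \<oplus>\<^bsub>T.T\<^esub> rho y z"
proof -
  have "rho (x + y) z = (\<Oplus>\<^bsub>T.T\<^esub>b\<in>B. x b \<odot>\<^bsub>T.T\<^esub> act b z \<oplus>\<^bsub>T.T\<^esub> y b \<odot>\<^bsub>T.T\<^esub> act b z)"
    unfolding rho_def using assms act_hom(2) smult_act_closed
    by (intro V.M.finsum_cong') (auto simp: V_simps)
  also have "\<dots> = rho x z \<oplus>\<^bsub>T.T\<^esub> rho y z"
    unfolding rho_def using assms smult_act_closed by (intro V.M.finsum_addf) auto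
  finally show ?thesis .
qed

lemma rho_smult:
  assumes "z \<in> carrier T.T" shows "rho x (t \<odot>\<^bsub>T.T\<^esub> z) = t \<odot>\<^bsub>T.T\<^esub> rho x z"
proof -
  have "rho x (t \<odot>\<^bsub>T.T\<^esub> z) = (\<Oplus>\<^bsub>T.T\<^esub>b\<in>B. t \<odot>\<^bsub>T.T\<^esub> (x b \<odot>\<^bsub>T.T\<^esub> act b z))"
    unfolding rho_def using assms act_hom(2,4) smult_act_closed T_smult_closed
    by (intro V.M.finsum_cong') (auto simp: mult.commute simp flip: V_simps(3))
  also have "\<dots> = t \<odot>\<^bsub>T.T\<^esub> rho x z"
    unfolding rho_def using assms smult_act_closed finite_basis
    by (intro V.smult_finsum_right[symmetric]) auto
  finally show ?thesis .
qed

lemma rho_scale: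
  assumes "z \<in> carrier T.T" shows "rho (lie_scale LK t x) z = t \<odot>\<^bsub>T.T\<^esub> rho x z"
proof -
  have "rho (lie_scale LK t x) z = (\<Oplus>\<^bsub>T.T\<^esub>b\<in>B. t \<odot>\<^bsub>T.T\<^esub> (x b \<odot>\<^bsub>T.T\<^esub> act b z))"
    unfolding rho_def using assms act_hom(2) smult_act_closed T_smult_closed
    by (intro V.M.finsum_cong') (auto simp: V_simps)
  also have "\<dots> = t \<odot>\<^bsub>T.T\<^esub> rho x z"
    unfolding rho_def using assms smult_act_closed finite_basis
    by (intro V.smult_finsum_right[symmetric]) auto
  finally show ?thesis .
qed

lemma rho_basis:
  assumes b: "b \<in> B" and z: "z \<in> carrier T.T" shows "rho (bK b) z = act b z"
proof -
  have "rho (bK b) z = (\<Oplus>\<^bsub>T.T\<^esub>b'\<in>B. if b = b' then act b' z else \<zero>\<^bsub>T.T\<^esub>)"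
    unfolding rho_def using z act_hom(2)
    by (intro V.M.finsum_cong') (auto simp: basis_K_def V_simps)
  also have "\<dots> = act b z"
    using b z act_hom(2) finite_basis by (intro V.M.finsum_singleton) auto
  finally show ?thesis .
qed

lemma LK_bracket_linear:
  "lie_bracket LK (x + x') y = lie_bracket LK x y + lie_bracket LK x' y"
  "lie_bracket LK x (y + y') = lie_bracket LK x y + lie_bracket LK x y'"
  "lie_bracket LK (lie_scale LK t x) y = lie_scale LK t (lie_bracket LK x y)"
  "lie_bracket LK x (lie_scale LK t y) = lie_scale LK t (lie_bracket LK x y)"
  "lie_bracket LK 0 y = 0" "lie_bracket LK x 0 = 0"
  by (rule ext, simp add: algebra_simps sum.distrib sum_distrib_left)+

lemma LK_induct [consumes 1, case_names zero add basis]: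
  assumes x: "x \<in> lie_carrier LK" and zero: "P 0"
    and add: "\<And>u v. u \<in> lie_carrier LK \<Longrightarrow> v \<in> lie_carrier LK \<Longrightarrow> P u \<Longrightarrow> P v \<Longrightarrow> P (u + v)"
    and basis: "\<And>t b. b \<in> B \<Longrightarrow> P (lie_scale LK t (bK b))"
  shows "P x"
proof -
  have "(\<Sum>b\<in>X. lie_scale LK (x b) (bK b)) \<in> lie_carrier LK \<and> P (\<Sum>b\<in>X. lie_scale LK (x b) (bK b))"
    if "finite X" "X \<subseteq> B" for X
    using that
  proof (induction rule: finite_induct)
    case empty
    show ?case unfolding sum.empty using zero zero_in_K by blast
  next
    case (insert b X)
    then have b: "lie_scale LK (x b) (bK b) \<in> lie_carrier LK" "P (lie_scale LK (x b) (bK b))"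
      using K.lie_scale_closed basis_K_closed basis by blast+
    show ?case
      unfolding sum.insert[OF insert.hyps]
      using insert.IH insert.prems b add K.lie_add_closed by blast
  qed
  then show ?thesis
    using finite_basis basis_K_expansion[OF x] by (metis order_refl)
qed

lemma rho_zero: assumes "z \<in> carrier T.T" shows "rho 0 z = \<zero>\<^bsub>T.T\<^esub>"
proof -
  have "lie_scale LK 0 0 = 0" by (rule ext) simp
  then show ?thesis
    using rho_scale[OF assms, of 0 0] rho_closed[OF assms] V_simps(5) by metis
qed

lemma rho_zero_right: "rho x \<zero>\<^bsub>T.T\<^esub> = \<zero>\<^bsub>T.T\<^esub>"
  using rho_smult[of "\<zero>\<^bsub>T.T\<^esub>" x 0] V_simps(5)[of "\<zero>\<^bsub>T.T\<^esub>"] V_simps(5)[OF rho_closed, of "\<zero>\<^bsub>T.T\<^esub>" x]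
  by simp

text \<open>Additive in each argument, so that it can be checked on basis elements.\<close>

definition preserves_bracket :: "('g \<Rightarrow> 'k) \<Rightarrow> ('g \<Rightarrow> 'k) \<Rightarrow> bool" where
  "preserves_bracket x y \<longleftrightarrow> (\<forall>z\<in>carrier T.T. rho x (rho y z) = rho y (rho x z) \<oplus>\<^bsub>T.T\<^esub> rho (lie_bracket LK x y) z)"

lemma preserves_bracket_basis: "a \<in> B \<Longrightarrow> b \<in> B \<Longrightarrow> preserves_bracket (bK a) (bK b)"
proof (unfold preserves_bracket_def, intro ballI)
  fix z assume *: "a \<in> B" "b \<in> B" "z \<in> carrier T.T"
  have "rho (lie_bracket LK (bK a) (bK b)) z =
      (\<Oplus>\<^bsub>T.T\<^esub>d\<in>B. red (coord D (lie_bracket D a b) d) \<odot>\<^bsub>T.T\<^esub> act d z)"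
    unfolding rho_def using bracket_basis_K * smult_act_closed
    by (intro V.M.finsum_cong') (auto simp del: lie_K_simps zero_fun_apply plus_fun_apply)
  moreover have "rho (bK a) (rho (bK b) z) = act a (act b z)" "rho (bK b) (rho (bK a) z) = act b (act a z)"
    using * act_hom(2) by (simp_all add: rho_basis)
  ultimately show "rho (bK a) (rho (bK b) z) =
      rho (bK b) (rho (bK a) z) \<oplus>\<^bsub>T.T\<^esub> rho (lie_bracket LK (bK a) (bK b)) z"
    using act_commutator[OF *] by (simp only:)
qed

lemma preserves_bracket_all:
  assumes x: "x \<in> lie_carrier LK" and y: "y \<in> lie_carrier LK" shows "preserves_bracket x y"
  using x
proof (induction x rule: LK_induct)
  case zero
  then show ?case
    using rho_closed
    by (simp add: preserves_bracket_def LK_bracket_linear rho_zero rho_zero_right del: lie_K_simps zero_fun_apply plus_fun_apply)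
next
  case (add u v)
  then show ?case
    using rho_closed unfolding preserves_bracket_def
    by (simp add: LK_bracket_linear rho_add rho_add_right V.M.a_ac del: lie_K_simps zero_fun_apply plus_fun_apply)
next
  case (basis t a)
  have "preserves_bracket (bK a) y"
    using y
  proof (induction y rule: LK_induct)
    case zero
    show ?case
      using rho_closed
      by (simp add: preserves_bracket_def LK_bracket_linear rho_zero rho_zero_right del: lie_K_simps zero_fun_apply plus_fun_apply)
  next
    case (add u v)
    then show ?case
      using rho_closed unfolding preserves_bracket_def
      by (simp add: LK_bracket_linear rho_add rho_add_right V.M.a_ac del: lie_K_simps zero_fun_apply plus_fun_apply)
  next
    case (basis t b)
    then show ?case
      using rho_closed preserves_bracket_basis[OF \<open>a \<in> B\<close> basis] unfolding preserves_bracket_def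
      by (simp add: LK_bracket_linear rho_scale rho_smult V_simps(1) del: lie_K_simps zero_fun_apply plus_fun_apply)
  qed
  then show ?case
    using rho_closed unfolding preserves_bracket_def
    by (simp add: LK_bracket_linear rho_scale rho_smult V_simps(1) del: lie_K_simps zero_fun_apply plus_fun_apply)
qed

sublocale rep: lie_rep LK T.T rho
proof (intro lie_rep.intro lie_rep_axioms.intro closed_lie_K V.left_module_axioms)
  fix x y z assume "x \<in> lie_carrier LK" "y \<in> lie_carrier LK" and z: "z \<in> carrier T.T"
  then have "rho x (rho y z) = rho (lie_bracket LK x y) z \<oplus>\<^bsub>T.T\<^esub> rho y (rho x z)"
    using preserves_bracket_all rho_closed unfolding preserves_bracket_def by (metis V.M.a_comm)
  then show "rho (lie_bracket LK x y) z = rho x (rho y z) \<ominus>\<^bsub>T.T\<^esub> rho y (rho x z)"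
    using V.M.diff_eq_iff[of "rho x (rho y z)" "rho y (rho x z)" "rho (lie_bracket LK x y) z"]
      rho_closed z by simp
qed (use rho_closed rho_add_right rho_smult rho_add rho_scale in \<open>simp_all del: lie_K_simps\<close>)

abbreviation Lp where "Lp \<equiv> rep.EM"

lemma L_p_eq: "L_p S D lam N = Lp"
  by (simp add: L_p_def Let_def rho_def)

sublocale Lp: left_module "env_alg LK" Lp
  by (rule rep.left_module_env_module)

definition w0 where "w0 = T.pt 1 v"

lemma w0_closed: "w0 \<in> carrier T.T"
  unfolding w0_def using T.pt_closed[of 1 v] v_in_M by simp

lemma pt_scal: "r \<in> R \<Longrightarrow> n \<in> carrier M \<Longrightarrow> T.pt 1 (scal r \<odot>\<^bsub>L\<^esub> n) = red r \<odot>\<^bsub>T.T\<^esub> T.pt 1 n"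
  using T.pt_balanced[of r 1 n] T.smult_pt[of "red r" 1 n] by (simp del: M_simps(1))

lemma basis_character_in_R: "basis_character lam b \<in> R"
  using integral_weight R_span_base[OF finite_torus_basis] localisation_closed(3)[of 0]
  by (simp add: integral_weight_def basis_character_def)

lemma w0_eigen:
  assumes "b \<in> B - negative_basis"
  shows "env_incl LK (bK b) \<odot>\<^bsub>Lp\<^esub> w0 = env_scalar LK (red (basis_character lam b)) \<odot>\<^bsub>Lp\<^esub> w0"
proof -
  have b: "b \<in> B" "b \<notin> negative_basis" using assms by auto
  have "env_incl LK (bK b) \<odot>\<^bsub>Lp\<^esub> w0 = T.pt 1 (incl b \<odot>\<^bsub>L\<^esub> v)"
    using b basis_K_closed w0_closed act_hom(1)[OF b(1) v_in_M]
    by (simp add: rep.env_incl_smult rho_basis w0_def del: lie_K_simps zero_fun_apply plus_fun_apply)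
  also have "\<dots> = red (basis_character lam b) \<odot>\<^bsub>T.T\<^esub> w0"
    unfolding v_eigen[OF b] w0_def by (rule pt_scal[OF basis_character_in_R v_in_M])
  finally show ?thesis
    using w0_closed by (simp add: rep.env_scalar_smult)
qed

lemma env_scalar_K_closed: "env_scalar LK t \<in> carrier (env_alg LK)"
  unfolding K.env_scalar_eq by (rule K.U.\<kappa>_closed)

lemma env_incl_K_closed: "b \<in> B \<Longrightarrow> env_incl LK (bK b) \<in> carrier (env_alg LK)"
  unfolding K.env_incl_eq by (intro K.U.\<iota>_closed basis_K_closed)

text \<open>The image \<open>G\<close> of \<open>U(\<gg>\<^sub>\<bbbK>)\<close> contains \<open>1 \<otimes> u n\<close> with \<open>1 \<otimes> n\<close> for every \<open>u \<in> U(\<gg>\<^sub>R)\<close>: by induction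
  over the generators of that ring, as elements of \<open>R\<close> act on \<open>1 \<otimes> n\<close> through their reductions and elements of
  \<open>\<gg>\<^sub>R\<close> are \<open>R\<close>-combinations of basis elements. Starting from \<open>n = v\<close> this reaches all pure tensors.\<close>

lemma Lp_cyclic: "carrier Lp = (\<lambda>u. u \<odot>\<^bsub>Lp\<^esub> w0) ` carrier (env_alg LK)"
proof -
  let ?G = "(\<lambda>u. u \<odot>\<^bsub>Lp\<^esub> w0) ` carrier (env_alg LK)"
  have w0: "w0 \<in> carrier Lp" using w0_closed by simp
  have G: "submodule ?G (env_alg LK) Lp"
    by (rule Lp.cyclic_submodule[OF w0])
  have add: "z \<in> ?G \<Longrightarrow> z' \<in> ?G \<Longrightarrow> z \<oplus>\<^bsub>T.T\<^esub> z' \<in> ?G" and zero: "\<zero>\<^bsub>T.T\<^esub> \<in> ?G" for z z'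
    using subgroup.m_closed[OF submodule.axioms(1)[OF G], of z z']
      subgroup.one_closed[OF submodule.axioms(1)[OF G]] by simp_all
  have sub: "?G \<subseteq> carrier T.T"
    using w0 Lp.smult_closed by auto
  have smult: "t \<odot>\<^bsub>T.T\<^esub> z \<in> ?G" if "z \<in> ?G" for t z
  proof -
    have "env_scalar LK t \<odot>\<^bsub>Lp\<^esub> z \<in> ?G"
      by (rule submodule.smult_closed[OF G env_scalar_K_closed that])
    then show ?thesis using that sub by (simp add: rep.env_scalar_smult subset_iff)
  qed
  have neg: "\<ominus>\<^bsub>T.T\<^esub> z \<in> ?G" if "z \<in> ?G" for z
  proof -
    have z: "z \<in> carrier T.T" using that sub by blast
    have "(-1) \<odot>\<^bsub>T.T\<^esub> z \<oplus>\<^bsub>T.T\<^esub> 1 \<odot>\<^bsub>T.T\<^esub> z = \<zero>\<^bsub>T.T\<^esub>"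
      using V_simps(2)[OF z, of "-1" 1] V_simps(5)[OF z] by simp
    then have "\<ominus>\<^bsub>T.T\<^esub> z = (-1) \<odot>\<^bsub>T.T\<^esub> z"
      using z T_smult_closed by (intro V.M.minus_equality) (simp_all add: V_simps)
    then show ?thesis using smult[OF that] by simp
  qed
  have incl_G: "T.pt 1 (incl b \<odot>\<^bsub>L\<^esub> n) \<in> ?G" if b: "b \<in> B" and n: "n \<in> carrier M" "T.pt 1 n \<in> ?G" for b n
  proof -
    have "env_incl LK (bK b) \<odot>\<^bsub>Lp\<^esub> T.pt 1 n \<in> ?G"
      by (rule submodule.smult_closed[OF G env_incl_K_closed[OF b] n(2)])
    moreover have "T.pt 1 n \<in> carrier T.T" using n sub by blast
    ultimately show ?thesis
      using basis_K_closed[OF b] act_hom(1)[OF b n(1)] b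
      by (simp add: rep.env_incl_smult rho_basis del: lie_K_simps zero_fun_apply plus_fun_apply)
  qed
  have step: "\<forall>n\<in>carrier M. T.pt 1 n \<in> ?G \<longrightarrow> T.pt 1 (u \<odot>\<^bsub>L\<^esub> n) \<in> ?G" if u: "u \<in> env_R S D" for u
    using u unfolding env_R_def
  proof induction
    case one
    then show ?case using M_subset L.smult_one by (auto simp del: M_simps(1) simp: subset_iff)
  next
    case (incl h)
    then consider r where "r \<in> R" "h = scal r" | x where "x \<in> R_span S D B" "h = incl x" by blast
    then show ?case
    proof cases
      case (1 r)
      then show ?thesis using pt_scal smult by simp
    next
      case (2 x)
      then obtain r where r: "\<forall>b\<in>B. r b \<in> R" "x = (\<Sum>b\<in>B. lie_scale D (r b) b)"
        by (auto simp: R_span_def)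
      have coord_x: "coord D x d \<in> R" if "d \<in> B" for d
      proof -
        have "coord D x d = (\<Sum>b\<in>B. if b = d then r d else 0)"
          unfolding r(2) coord_sum using that by (intro sum.cong) (auto simp: coord_simps)
        then show ?thesis using r(1) that finite_basis by simp
      qed
      show ?thesis
      proof (intro ballI impI)
        fix n assume n: "n \<in> carrier M" "T.pt 1 n \<in> ?G"
        have nL: "n \<in> carrier L" using n M_subset by blast
        have cl: "incl d \<odot>\<^bsub>L\<^esub> n \<in> carrier M" if "d \<in> B" for d
          using M_act_closed[OF incl_in_env_R[OF that] n(1)] .
        have "h \<odot>\<^bsub>L\<^esub> n = (\<Oplus>\<^bsub>L\<^esub>d\<in>B. (scal (coord D x d) \<otimes>\<^bsub>env_alg D\<^esub> incl d) \<odot>\<^bsub>L\<^esub> n)"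
          unfolding 2(2) incl_expansion[of x] using nL finite_basis
          by (intro L.smult_finsum_left) (auto simp: scal_closed incl_closed)
        also have "\<dots> = (\<Oplus>\<^bsub>L\<^esub>d\<in>B. scal (coord D x d) \<odot>\<^bsub>L\<^esub> (incl d \<odot>\<^bsub>L\<^esub> n))"
          using nL by (simp add: L.smult_assoc scal_closed incl_closed)
        finally have "T.pt 1 (h \<odot>\<^bsub>L\<^esub> n) = (\<Oplus>\<^bsub>T.T\<^esub>d\<in>B. T.pt 1 (scal (coord D x d) \<odot>\<^bsub>L\<^esub> (incl d \<odot>\<^bsub>L\<^esub> n)))"
          using pt_finsum_right[OF finite_basis, of "\<lambda>d. scal (coord D x d) \<odot>\<^bsub>L\<^esub> (incl d \<odot>\<^bsub>L\<^esub> n)" 1]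
            M_act_closed[OF env_R_closed(5)[OF coord_x] cl] by simp
        also have "\<dots> \<in> ?G"
        proof -
          have tm: "T.pt 1 (scal (coord D x d) \<odot>\<^bsub>L\<^esub> (incl d \<odot>\<^bsub>L\<^esub> n)) \<in> ?G" if "d \<in> B" for d
            using pt_scal[OF coord_x[OF that] cl[OF that]] smult[OF incl_G[OF that n]] by simp
          have "(\<Oplus>\<^bsub>T.T\<^esub>d\<in>X. T.pt 1 (scal (coord D x d) \<odot>\<^bsub>L\<^esub> (incl d \<odot>\<^bsub>L\<^esub> n))) \<in> ?G"
            if "finite X" "X \<subseteq> B" for X
            using that
          proof (induction rule: finite_induct)
            case empty
            then show ?case using zero by simp
          next
            case (insert d X)
            have "(\<lambda>d. T.pt 1 (scal (coord D x d) \<odot>\<^bsub>L\<^esub> (incl d \<odot>\<^bsub>L\<^esub> n))) \<in> X \<rightarrow> carrier T.T"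
              "T.pt 1 (scal (coord D x d) \<odot>\<^bsub>L\<^esub> (incl d \<odot>\<^bsub>L\<^esub> n)) \<in> carrier T.T"
              using insert.prems tm sub by blast+
            then show ?case
              using insert tm add by simp
          qed
          then show ?thesis using finite_basis by blast
        qed
        finally show "T.pt 1 (h \<odot>\<^bsub>L\<^esub> n) \<in> ?G" .
      qed
    qed
  next
    case (a_inv h)
    have h: "h \<in> env_R S D" using a_inv.hyps by (simp add: env_R_def)
    show ?case
    proof (intro ballI impI)
      fix n assume n: "n \<in> carrier M" "T.pt 1 n \<in> ?G"
      have hn: "h \<odot>\<^bsub>L\<^esub> n \<in> carrier M" "(\<ominus>\<^bsub>env_alg D\<^esub> h) \<odot>\<^bsub>L\<^esub> n \<in> carrier M"
        using M_act_closed[OF h n(1)] M_act_closed[OF env_R_closed(3)[OF h] n(1)] .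
      have "(\<ominus>\<^bsub>env_alg D\<^esub> h) \<odot>\<^bsub>L\<^esub> n \<oplus>\<^bsub>L\<^esub> h \<odot>\<^bsub>L\<^esub> n = \<zero>\<^bsub>L\<^esub>"
        using h env_R_subset n M_subset by (simp add: L.smult_minus_left L.smult_closed L.M.l_neg subset_iff del: M_simps(1))
      then have "T.pt 1 ((\<ominus>\<^bsub>env_alg D\<^esub> h) \<odot>\<^bsub>L\<^esub> n) \<oplus>\<^bsub>T.T\<^esub> T.pt 1 (h \<odot>\<^bsub>L\<^esub> n) = \<zero>\<^bsub>T.T\<^esub>"
        using T.pt_add_right[of 1 "(\<ominus>\<^bsub>env_alg D\<^esub> h) \<odot>\<^bsub>L\<^esub> n" "h \<odot>\<^bsub>L\<^esub> n"] T.pt_zero_right[of 1] hn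
        by (simp del: M_simps(1))
      then have "T.pt 1 ((\<ominus>\<^bsub>env_alg D\<^esub> h) \<odot>\<^bsub>L\<^esub> n) = \<ominus>\<^bsub>T.T\<^esub> T.pt 1 (h \<odot>\<^bsub>L\<^esub> n)"
        using T.pt_closed[of 1] hn by (intro V.M.minus_equality[symmetric]) (simp_all del: M_simps(1))
      then show "T.pt 1 ((\<ominus>\<^bsub>env_alg D\<^esub> h) \<odot>\<^bsub>L\<^esub> n) \<in> ?G"
        using neg[OF a_inv.IH[rule_format, OF n]] by (simp only:)
    qed
  next
    case (eng_add h1 h2)
    have h: "h1 \<in> env_R S D" "h2 \<in> env_R S D" using eng_add.hyps by (simp_all add: env_R_def)
    show ?case
    proof (intro ballI impI)
      fix n assume n: "n \<in> carrier M" "T.pt 1 n \<in> ?G"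
      have "(h1 \<oplus>\<^bsub>env_alg D\<^esub> h2) \<odot>\<^bsub>L\<^esub> n = h1 \<odot>\<^bsub>L\<^esub> n \<oplus>\<^bsub>L\<^esub> h2 \<odot>\<^bsub>L\<^esub> n"
        using h env_R_subset n M_subset by (intro L.smult_l_distr) auto
      then show "T.pt 1 ((h1 \<oplus>\<^bsub>env_alg D\<^esub> h2) \<odot>\<^bsub>L\<^esub> n) \<in> ?G"
        using T.pt_add_right[of 1 "h1 \<odot>\<^bsub>L\<^esub> n" "h2 \<odot>\<^bsub>L\<^esub> n"] M_act_closed[OF h(1) n(1)]
          M_act_closed[OF h(2) n(1)]
          add[OF eng_add.IH(1)[rule_format, OF n] eng_add.IH(2)[rule_format, OF n]]
        by (simp del: M_simps(1))
    qed
  next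
    case (eng_mult h1 h2)
    have h: "h1 \<in> env_R S D" "h2 \<in> env_R S D" using eng_mult.hyps by (simp_all add: env_R_def)
    show ?case
    proof (intro ballI impI)
      fix n assume n: "n \<in> carrier M" "T.pt 1 n \<in> ?G"
      have "(h1 \<otimes>\<^bsub>env_alg D\<^esub> h2) \<odot>\<^bsub>L\<^esub> n = h1 \<odot>\<^bsub>L\<^esub> (h2 \<odot>\<^bsub>L\<^esub> n)"
        using h env_R_subset n M_subset by (intro L.smult_assoc) auto
      then show "T.pt 1 ((h1 \<otimes>\<^bsub>env_alg D\<^esub> h2) \<odot>\<^bsub>L\<^esub> n) \<in> ?G"
        using eng_mult.IH(1)[rule_format, OF M_act_closed[OF h(2) n(1)] eng_mult.IH(2)[rule_format, OF n]]
        by (simp only:)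
    qed
  qed
  have w0_G: "T.pt 1 v \<in> ?G"
    using Lp.smult_one[OF w0] K.UL.one_closed by (auto simp: w0_def[symmetric] intro!: image_eqI[of _ _ "\<one>\<^bsub>env_alg LK\<^esub>"])
  have "?G = carrier T.T"
  proof (rule T.tensor_subgroup_eq)
    show "additive_subgroup ?G T.T"
      using sub zero add neg by (intro additive_subgroup.intro subgroup.intro) (auto simp flip: a_inv_def)
    fix c n assume n: "n \<in> carrier M"
    then obtain u where u: "u \<in> env_R S D" "n = u \<odot>\<^bsub>L\<^esub> v" by auto
    then have "T.pt 1 n \<in> ?G" using step v_in_M w0_G by blast
    moreover have "T.pt c n = c \<odot>\<^bsub>T.T\<^esub> T.pt 1 n"
      using T.smult_pt[of c 1 n] n by (simp del: M_simps(1))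
    ultimately show "T.pt c n \<in> ?G" using smult by simp
  qed
  then show ?thesis by simp
qed

end


section \<open>The surjection onto the simple quotient of the baby Verma module\<close>

context left_module
begin

lemma quotient_cyclic:
  assumes N: "submodule N A M" and m: "m \<in> carrier M"
    and cyclic: "carrier M = (\<lambda>a. a \<odot> m) ` carrier A" and z: "z \<in> carrier (M QuotM N)"
  shows "\<exists>a\<in>carrier A. z = a \<odot>\<^bsub>M QuotM N\<^esub> (N +> m)"
proof -
  obtain a where "a \<in> carrier A" "z = N +> (a \<odot> m)"
    using z cyclic by (auto simp: carrier_quot[OF submodule_abelian_subgroup[OF N]])
  then show ?thesis
    using quot_module_smult[OF N _ m] by auto
qed

end

locale levi_form = highest_weight_form D S pm lam N
  for D :: "'g::ab_group_add split_lie" and S :: "int set" and pm :: "('g \<Rightarrow> 'k::field) \<Rightarrow> 'g \<Rightarrow> 'k"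
    and lam N +
  fixes \<chi> :: "('g \<Rightarrow> 'k) \<Rightarrow> 'k"
  assumes levi: "standard_levi_form S D \<chi>"
begin

declare lie_K_simps [simp del]

lemma \<chi>_borel: "x \<in> lie_carrier LB \<Longrightarrow> \<chi> x = 0"
  using levi unfolding standard_levi_form_def by blast

lemma \<chi>_not_simple:
  assumes b: "b \<in> negative_basis" and ns: "- basis_weight b \<notin> simple_roots D" shows "\<chi> (bK b) = 0"
proof -
  obtain I where I: "I \<subseteq> simple_roots D"
    "\<forall>\<alpha>\<in>positive_roots D. \<chi> (bK (root_vector D (- \<alpha>))) = (if \<alpha> \<in> I then 1 else 0)"
    using levi unfolding standard_levi_form_def by blast
  have "\<chi> (bK (root_vector D (- (- basis_weight b)))) = (if - basis_weight b \<in> I then 1 else 0)"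
    using I(2) negative_basis_weight(1)[OF b] by blast
  then show ?thesis
    using I(1) ns negative_basis_weight(3)[OF b] by auto
qed

abbreviation "A \<equiv> reduced_env LK pm \<chi>"

sublocale A: lie_quotient LK A "K.\<pi>A \<chi>"
  by (rule K.reduced_lie_quotient)

lemma \<iota>_expansion:
  assumes "y \<in> lie_carrier LK"
  shows "A.\<iota> y = (\<Oplus>\<^bsub>A\<^esub>b\<in>B. A.\<kappa> (y b) \<otimes>\<^bsub>A\<^esub> A.\<iota> (bK b))"
proof -
  have "A.\<iota> (\<Sum>b\<in>B. lie_scale LK (y b) (bK b)) = (\<Oplus>\<^bsub>A\<^esub>b\<in>B. A.\<iota> (lie_scale LK (y b) (bK b)))"
    by (rule conjunct1[OF A.\<iota>_sum[OF finite_basis zero_in_K]])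
      (intro K.lie_scale_closed basis_K_closed)
  also have "\<dots> = (\<Oplus>\<^bsub>A\<^esub>b\<in>B. A.\<kappa> (y b) \<otimes>\<^bsub>A\<^esub> A.\<iota> (bK b))"
  proof (rule A.finsum_cong'[OF refl])
    show "(\<lambda>b. A.\<kappa> (y b) \<otimes>\<^bsub>A\<^esub> A.\<iota> (bK b)) \<in> B \<rightarrow> carrier A"
      by (intro funcsetI A.m_closed A.\<kappa>_closed A.\<iota>_closed basis_K_closed)
  qed (rule A.\<iota>_scale[OF basis_K_closed])
  finally show ?thesis
    unfolding basis_K_expansion[OF assms] .
qed

text \<open>In characteristic \<open>p\<close>, \<open>(e - \<chi>(e))\<^sup>p = e\<^sup>p - \<chi>(e)\<^sup>p\<close>, and this is \<open>e\<^sup>[\<^sup>p\<^sup>] = 0\<close> in the reduced algebra.\<close>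

lemma negative_nilpotent:
  assumes b: "b \<in> negative_basis"
  shows "(A.\<iota> (bK b) \<ominus>\<^bsub>A\<^esub> A.\<kappa> (\<chi> (bK b))) [^]\<^bsub>A\<^esub> CHAR('k) = \<zero>\<^bsub>A\<^esub>"
proof -
  let ?x = "bK b" and ?p = "CHAR('k)"
  have x: "?x \<in> lie_carrier LK" using b negative_in_basis basis_K_closed by blast
  have pm0: "pm ?x = 0"
    using pm_root_vector[OF negative_basis_weight(2)[OF b]] negative_basis_weight(3)[OF b] by simp
  have p: "prime ?p" using char_pos prime_CHAR_semidom by blast
  have cl: "gen ?x \<in> carrier K.FL" "gen (0 :: 'g \<Rightarrow> 'k) \<in> carrier K.FL"
    "scalar t \<in> carrier K.FL" "gen ?x ^ n \<in> carrier K.FL" for t n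
    using x zero_in_K K.FL.nat_pow_closed[of "gen ?x" n]
    by (simp_all add: gen_closed scalar_closed K.FL_pow del: free_algebra_simps)
  have "(A.\<iota> ?x \<ominus>\<^bsub>A\<^esub> A.\<kappa> (\<chi> ?x)) [^]\<^bsub>A\<^esub> ?p = K.\<pi>A \<chi> ((gen ?x - scalar (\<chi> ?x)) ^ ?p)"
    using cl by (simp add: A.\<pi>_pow A.\<pi>_diff K.FL_diff_closed del: free_algebra_simps)
  also have "(gen ?x - scalar (\<chi> ?x)) ^ ?p = gen ?x ^ ?p - scalar (\<chi> ?x ^ ?p)"
    using power_prime_diff_commuting[OF p K.of_nat_CHAR_word scalar_commute[symmetric]]
    by (simp add: scalar_simps)
  also have "K.\<pi>A \<chi> \<dots> = K.\<pi>A \<chi> (gen ?x ^ ?p - gen (0 :: 'g \<Rightarrow> 'k) - scalar (\<chi> ?x ^ ?p))"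
  proof -
    have "a \<ominus>\<^bsub>A\<^esub> \<zero>\<^bsub>A\<^esub> = a" if "a \<in> carrier A" for a
      using that by (simp add: A.minus_eq)
    then have "K.\<pi>A \<chi> (gen ?x ^ ?p) \<ominus>\<^bsub>A\<^esub> A.\<iota> 0 = K.\<pi>A \<chi> (gen ?x ^ ?p)"
      unfolding A.\<iota>_zero[OF zero_in_K] using A.\<pi>.hom_closed[OF cl(4)] by blast
    then show ?thesis
      by (simp only: A.\<pi>_diff[OF cl(4) cl(3)] A.\<pi>_diff[OF K.FL_diff_closed[OF cl(4,2)] cl(3)]
          A.\<pi>_diff[OF cl(4) cl(2)])
  qed
  also have "\<dots> = \<zero>\<^bsub>A\<^esub>"
    using K.reduced_relation[OF x, of \<chi>] unfolding pm0 .
  finally show ?thesis .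
qed

sublocale tri: triangular_ring A "\<lambda>t. A.\<kappa> t" B negative_basis "\<lambda>b. A.\<iota> (bK b)"
  "\<lambda>a b d. red (coord D (lie_bracket D a b) d)" "\<lambda>b. \<chi> (bK b)" "\<lambda>b. height (- basis_weight b)" "CHAR('k)"
proof (intro triangular_ring.intro triangular_ring_axioms.intro A.A.ring_axioms)
  show "negative_basis \<subseteq> B" using negative_in_basis by blast
  show "A.\<iota> (bK b) \<in> carrier A" if "b \<in> B" for b
    using A.\<iota>_closed basis_K_closed that by blast
  fix a b assume a: "a \<in> B" and b: "b \<in> B"
  have cl: "A.\<iota> (bK a) \<in> carrier A" "A.\<iota> (bK b) \<in> carrier A"
    using A.\<iota>_closed basis_K_closed a b by blast+
  have bracket: "lie_bracket LK (bK a) (bK b) \<in> lie_carrier LK"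
    using K.lie_bracket_closed basis_K_closed a b by blast
  have "A.\<iota> (lie_bracket LK (bK a) (bK b)) =
      (\<Oplus>\<^bsub>A\<^esub>d\<in>B. A.\<kappa> (red (coord D (lie_bracket D a b) d)) \<otimes>\<^bsub>A\<^esub> A.\<iota> (bK d))"
    unfolding \<iota>_expansion[OF bracket]
  proof (rule A.finsum_cong'[OF refl])
    show "(\<lambda>d. A.\<kappa> (red (coord D (lie_bracket D a b) d)) \<otimes>\<^bsub>A\<^esub> A.\<iota> (bK d)) \<in> B \<rightarrow> carrier A"
      by (intro funcsetI A.m_closed A.\<kappa>_closed A.\<iota>_closed basis_K_closed)
  qed (simp only: bracket_basis_K[OF a b])
  then show "A.\<iota> (bK a) \<otimes>\<^bsub>A\<^esub> A.\<iota> (bK b) = A.\<iota> (bK b) \<otimes>\<^bsub>A\<^esub> A.\<iota> (bK a) \<oplus>\<^bsub>A\<^esub>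
      (\<Oplus>\<^bsub>A\<^esub>d\<in>B. A.\<kappa> (red (coord D (lie_bracket D a b) d)) \<otimes>\<^bsub>A\<^esub> A.\<iota> (bK d))"
    using A.\<iota>_bracket[OF basis_K_closed[OF a] basis_K_closed[OF b]] cl A.\<iota>_closed[OF bracket]
      A.diff_eq_iff[OF A.m_closed[OF cl] A.m_closed[OF cl(2,1)] A.\<iota>_closed[OF bracket]]
      A.a_comm[OF A.m_closed[OF cl(2,1)] A.\<iota>_closed[OF bracket]]
    by (simp only: simp_thms)
next
  fix P assume \<kappa>P: "\<And>t. A.\<kappa> t \<in> P" and \<iota>P: "\<And>b. b \<in> B \<Longrightarrow> A.\<iota> (bK b) \<in> P"
    and add: "\<And>u v. u \<in> P \<Longrightarrow> v \<in> P \<Longrightarrow> u \<in> carrier A \<Longrightarrow> v \<in> carrier A \<Longrightarrow> u \<oplus>\<^bsub>A\<^esub> v \<in> P"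
    and mult: "\<And>u v. u \<in> P \<Longrightarrow> v \<in> P \<Longrightarrow> u \<in> carrier A \<Longrightarrow> v \<in> carrier A \<Longrightarrow> u \<otimes>\<^bsub>A\<^esub> v \<in> P"
  have "A.\<iota> y \<in> P" if y: "y \<in> lie_carrier LK" for y
  proof -
    have tm: "A.\<kappa> (y b) \<otimes>\<^bsub>A\<^esub> A.\<iota> (bK b) \<in> P \<inter> carrier A" if "b \<in> B" for b
      by (intro IntI mult \<kappa>P \<iota>P A.m_closed A.\<kappa>_closed A.\<iota>_closed basis_K_closed that)
    have "(\<Oplus>\<^bsub>A\<^esub>b\<in>X. A.\<kappa> (y b) \<otimes>\<^bsub>A\<^esub> A.\<iota> (bK b)) \<in> P \<inter> carrier A" if "finite X" "X \<subseteq> B" for X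
      using that
    proof (induction rule: finite_induct)
      case empty
      then show ?case using \<kappa>P[of 0] by (simp add: A.\<kappa>_simps)
    next
      case (insert b X)
      have b: "A.\<kappa> (y b) \<otimes>\<^bsub>A\<^esub> A.\<iota> (bK b) \<in> P" "A.\<kappa> (y b) \<otimes>\<^bsub>A\<^esub> A.\<iota> (bK b) \<in> carrier A"
        using insert.prems tm by blast+
      have X: "(\<Oplus>\<^bsub>A\<^esub>b\<in>X. A.\<kappa> (y b) \<otimes>\<^bsub>A\<^esub> A.\<iota> (bK b)) \<in> P" "(\<Oplus>\<^bsub>A\<^esub>b\<in>X. A.\<kappa> (y b) \<otimes>\<^bsub>A\<^esub> A.\<iota> (bK b)) \<in> carrier A"
        using insert.IH insert.prems by blast+
      have "(\<lambda>b. A.\<kappa> (y b) \<otimes>\<^bsub>A\<^esub> A.\<iota> (bK b)) \<in> X \<rightarrow> carrier A"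
        using insert.prems tm by blast
      then have "(\<Oplus>\<^bsub>A\<^esub>b\<in>insert b X. A.\<kappa> (y b) \<otimes>\<^bsub>A\<^esub> A.\<iota> (bK b)) =
          A.\<kappa> (y b) \<otimes>\<^bsub>A\<^esub> A.\<iota> (bK b) \<oplus>\<^bsub>A\<^esub> (\<Oplus>\<^bsub>A\<^esub>b\<in>X. A.\<kappa> (y b) \<otimes>\<^bsub>A\<^esub> A.\<iota> (bK b))"
        using insert.hyps b(2) by (intro A.finsum_insert)
      then show ?case
        using add[OF b(1) X(1) b(2) X(2)] A.add.m_closed[OF b(2) X(2)] by (simp only: IntI)
    qed
    then show ?thesis
      unfolding \<iota>_expansion[OF y] using finite_basis by blast
  qed
  then show "carrier A \<subseteq> P"
    using A.generated[of P] \<kappa>P add mult by blast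
next
  fix a b d
  assume "a \<in> negative_basis" "b \<in> negative_basis" "d \<in> B" "red (coord D (lie_bracket D a b) d) \<noteq> 0"
  moreover from this have "coord D (lie_bracket D a b) d \<noteq> 0" by auto
  ultimately show "d \<in> negative_basis \<and> \<chi> (bK d) = 0 \<and> height (- basis_weight b) < height (- basis_weight d)"
    using negative_bracket[of a b d] \<chi>_not_simple by blast
qed (rule finite_basis A.\<kappa>_closed A.\<kappa>_simps A.\<kappa>_central negative_nilpotent | assumption)+

abbreviation "wt b \<equiv> red (basis_character lam b)"


subsection \<open>The reduction of the highest weight module\<close>

abbreviation "J \<equiv> J_submodule LK pm \<chi> Lp"
abbreviation "W \<equiv> over_quotient (Lp QuotM J)"

lemma L_p_chi_eq: "L_p_chi S D pm \<chi> lam N = W"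
  by (simp add: L_p_chi_def L_p_eq)

lemmas W_facts = K.left_module_reduced_quotient[where \<chi> = \<chi>, OF char_pos restricted rep.left_module_env_module]

lemma W_closed: "J +>\<^bsub>Lp\<^esub> w0 \<in> carrier W"
  unfolding W_facts(2) using w0_closed by simp

lemma W_eigen:
  assumes "b \<in> B - negative_basis"
  shows "A.\<iota> (bK b) \<odot>\<^bsub>W\<^esub> (J +>\<^bsub>Lp\<^esub> w0) = A.\<kappa> (wt b) \<odot>\<^bsub>W\<^esub> (J +>\<^bsub>Lp\<^esub> w0)"
proof -
  have cl: "gen (bK b) \<in> carrier K.FL" "scalar (wt b) \<in> carrier K.FL"
    using assms basis_K_closed by (simp_all add: gen_closed scalar_closed del: free_algebra_simps)
  have w0: "w0 \<in> carrier Lp" using w0_closed by simp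
  show ?thesis
    unfolding W_facts(3)[OF cl(1) w0] W_facts(3)[OF cl(2) w0]
      w0_eigen[OF assms, unfolded K.env_incl_eq K.env_scalar_eq] ..
qed

lemma W_cyclic:
  assumes "z \<in> carrier W" shows "\<exists>a\<in>carrier A. z = a \<odot>\<^bsub>W\<^esub> (J +>\<^bsub>Lp\<^esub> w0)"
proof -
  obtain u where u: "u \<in> carrier (env_alg LK)" "z = J +>\<^bsub>Lp\<^esub> (u \<odot>\<^bsub>Lp\<^esub> w0)"
    using assms unfolding W_facts(2) Lp_cyclic by blast
  then obtain t where t: "t \<in> carrier K.FL" "u = K.\<pi>U t"
    unfolding K.U.\<pi>_surj[symmetric] by blast
  have "w0 \<in> carrier Lp" using w0_closed by simp
  then have "z = K.\<pi>A \<chi> t \<odot>\<^bsub>W\<^esub> (J +>\<^bsub>Lp\<^esub> w0)"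
    unfolding u(2) t(2) by (rule W_facts(3)[OF t(1), symmetric])
  then show ?thesis
    using A.\<pi>.hom_closed[OF t(1)] by blast
qed


subsection \<open>The baby Verma module\<close>

abbreviation "\<mu> \<equiv> weight_K S D lam :: ('g \<Rightarrow> 'k) \<Rightarrow> 'k"
abbreviation "A' \<equiv> reduced_env LB pm (\<lambda>_. 0)"
abbreviation "C \<equiv> over_quotient (character_module \<mu>)"
abbreviation "Z \<equiv> baby_verma S D pm \<chi> lam"

lemma lam_torus_basis: "h \<in> torus_basis D \<Longrightarrow> lam h \<in> R"
  using basis_character_in_R[of h] by (simp add: basis_character_def)

lemma restricted_borel: "restricted_lie LB pm"
  by (intro restricted_lie.intro restricted_lie_axioms.intro closed_lie_borel)
    (rule conjunct1[OF pm_borel[where lam = lam, OF lam_torus_basis]])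

lemma character_borel: "restricted_character LB \<mu> pm"
proof (intro restricted_character.intro restricted_character_axioms.intro restricted_borel
    lie_character.intro lie_character_axioms.intro closed_lie_borel char_pos)
  show "\<mu> (lie_bracket LB x y) = 0" if "x \<in> lie_carrier LB" "y \<in> lie_carrier LB" for x y
    using weight_K_bracket[OF that] by (simp only: borel_K_simps(2))
  show "\<mu> (lie_scale LB t x) = t * \<mu> x" for t x
    by (simp only: borel_K_simps(1) weight_K_simps)
  show "\<mu> (pm x) = \<mu> x ^ CHAR('k)" if "x \<in> lie_carrier LB" for x
    by (rule conjunct2[OF pm_borel[where lam = lam, OF lam_torus_basis that]])
qed (rule weight_K_simps)

lemma sub_borel: "restricted_sub_lie LK LB pm \<chi>"
  by (intro restricted_sub_lie.intro restricted_sub_lie_axioms.intro sub_lie.intro sub_lie_axioms.intro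
      K.restricted_lie_axioms restricted_borel closed_lie_K closed_lie_borel borel_subset borel_K_simps \<chi>_borel)

abbreviation "\<psi> \<equiv> quot_map (env_alg LK) (reduced_ideal LK pm \<chi>) (env_map LK)"

lemma baby_context: "tensor_context A' \<psi> A C"
  by (intro tensor_context.intro tensor_context_axioms.intro A.A.ring_axioms
      restricted_character.left_module_reduced_character[OF character_borel]
      restricted_sub_lie.reduced_map_closed[OF sub_borel])

lemma Z_eq: "Z = tensor A' \<psi> A C"
  by (simp add: baby_verma_def)

lemma left_module_Z: "left_module A Z"
  unfolding Z_eq by (rule tensor_context.left_module_tensor[OF baby_context])

definition z0 where "z0 = pure_tensor A' \<psi> A C \<one>\<^bsub>A\<^esub> 1"

lemma weight_K_basis:
  assumes "b \<in> B" shows "\<mu> (bK b) = wt b"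
proof -
  have "\<mu> (bK b) = (\<Sum>h\<in>torus_basis D. if h = b then red (lam b) else 0)"
    unfolding weight_K_def by (intro sum.cong) (auto simp: basis_K_def)
  moreover note finite_torus_basis
  ultimately show ?thesis by (simp add: basis_character_def)
qed

lemma z0_facts:
  shows z0_closed: "z0 \<in> carrier Z"
    and z0_cyclic: "carrier Z = (\<lambda>a. a \<odot>\<^bsub>Z\<^esub> z0) ` carrier A"
    and z0_eigen: "b \<in> B - negative_basis \<Longrightarrow> A.\<iota> (bK b) \<odot>\<^bsub>Z\<^esub> z0 = A.\<kappa> (wt b) \<odot>\<^bsub>Z\<^esub> z0"
proof -
  interpret sub: restricted_sub_lie LK LB pm \<chi> by (rule sub_borel)
  interpret ch: restricted_character LB \<mu> pm by (rule character_borel)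
  interpret A': lie_quotient LB A' "sub.L'.\<pi>A (\<lambda>_. 0)" by (rule sub.L'.reduced_lie_quotient)
  interpret T2: tensor_context A' \<psi> A C by (rule baby_context)
  have one: "1 \<in> carrier C" by simp
  show "z0 \<in> carrier Z"
    unfolding Z_eq z0_def by (rule T2.pt_closed[OF A.one_closed one])
  show "carrier Z = (\<lambda>a. a \<odot>\<^bsub>Z\<^esub> z0) ` carrier A"
    unfolding Z_eq z0_def
  proof (rule T2.cyclic_tensor[OF one])
    fix m assume "m \<in> carrier C"
    have "m = sub.L'.\<pi>A (\<lambda>_. 0) (scalar m) \<odot>\<^bsub>C\<^esub> 1"
      using ch.reduced_character_smult[OF scalar_closed, of m 1] ch.character_scalar[of m 1]
      by (simp add: sub.L'.env_scalar_eq)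
    then show "\<exists>a\<in>carrier A'. m = a \<odot>\<^bsub>C\<^esub> 1"
      using A'.\<kappa>_closed by blast
  qed
  show "A.\<iota> (bK b) \<odot>\<^bsub>Z\<^esub> z0 = A.\<kappa> (wt b) \<odot>\<^bsub>Z\<^esub> z0" if b: "b \<in> B - negative_basis"
  proof -
    have bB: "bK b \<in> lie_carrier LB"
      using b by (auto simp: borel_K_simps lie_K_simps basis_K_def)
    have cl: "gen (bK b) \<in> carrier sub.L'.FL" "scalar (wt b) \<in> carrier sub.L'.FL"
      using bB by (simp_all add: gen_closed scalar_closed del: free_algebra_simps)
    have act: "\<psi> (sub.L'.\<pi>A (\<lambda>_. 0) t) \<odot>\<^bsub>Z\<^esub> z0 = pure_tensor A' \<psi> A C \<one>\<^bsub>A\<^esub> (sub.L'.\<pi>A (\<lambda>_. 0) t \<odot>\<^bsub>C\<^esub> 1)"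
      if "t \<in> carrier sub.L'.FL" for t
      unfolding Z_eq z0_def by (rule T2.map_smult_pt[OF A'.\<pi>.hom_closed[OF that] one])
    have "sub.L'.\<pi>A (\<lambda>_. 0) (gen (bK b)) \<odot>\<^bsub>C\<^esub> 1 = sub.L'.\<pi>A (\<lambda>_. 0) (scalar (wt b)) \<odot>\<^bsub>C\<^esub> 1"
      using ch.reduced_character_smult[OF cl(1), of 1] ch.reduced_character_smult[OF cl(2), of 1]
        ch.character_incl[OF bB, of 1] ch.character_scalar[of "wt b" 1] weight_K_basis[of b] b
      by (simp add: sub.L'.env_incl_eq sub.L'.env_scalar_eq)
    then show ?thesis
      unfolding act[OF cl(1), unfolded sub.reduced_map_coset[OF cl(1)]]
        act[OF cl(2), unfolded sub.reduced_map_coset[OF cl(2)]] by (rule arg_cong)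
  qed
qed

theorem surjection:
  assumes N': "submodule N' A Z" and simple: "simple_left_module A (Z QuotM N')"
    and nonzero: "carrier W \<noteq> {\<zero>\<^bsub>W\<^esub>}"
  shows "\<exists>f. left_module_hom A W (Z QuotM N') f \<and> f ` carrier W = carrier (Z QuotM N')"
proof (rule tri.surjection_exists[where w = "J +>\<^bsub>Lp\<^esub> w0" and q = "N' +>\<^bsub>Z\<^esub> z0" and wt = wt])
  interpret Z: left_module A Z by (rule left_module_Z)
  show "left_module A W" by (rule W_facts(1))
  show "left_module A (Z QuotM N')" by (rule Z.left_module_quot[OF N'])
  show "J +>\<^bsub>Lp\<^esub> w0 \<in> carrier W" by (rule W_closed)
  show "N' +>\<^bsub>Z\<^esub> z0 \<in> carrier (Z QuotM N')"
    unfolding carrier_quot[OF Z.submodule_abelian_subgroup[OF N']] using z0_closed by blast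
  show "A.\<iota> (bK b) \<odot>\<^bsub>Z QuotM N'\<^esub> (N' +>\<^bsub>Z\<^esub> z0) = A.\<kappa> (wt b) \<odot>\<^bsub>Z QuotM N'\<^esub> (N' +>\<^bsub>Z\<^esub> z0)"
    if b: "b \<in> B - negative_basis" for b
  proof -
    have cl: "A.\<iota> (bK b) \<in> carrier A" using b A.\<iota>_closed basis_K_closed by blast
    show ?thesis
      unfolding Z.quot_module_smult[OF N' cl z0_closed] Z.quot_module_smult[OF N' A.\<kappa>_closed z0_closed]
        z0_eigen[OF b] ..
  qed
  show "\<exists>a\<in>carrier A. z = a \<odot>\<^bsub>Z QuotM N'\<^esub> (N' +>\<^bsub>Z\<^esub> z0)" if "z \<in> carrier (Z QuotM N')" for z
    by (rule Z.quotient_cyclic[OF N' z0_closed z0_cyclic that])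
qed (use W_eigen W_cyclic simple nonzero in blast)+

end

theorem proposition1p2:
  fixes D :: "'g::ab_group_add split_lie"
    and S :: "int set"
    and pm :: "('g \<Rightarrow> 'k::alg_closed_field) \<Rightarrow> 'g \<Rightarrow> 'k"
    and \<chi> :: "('g \<Rightarrow> 'k) \<Rightarrow> 'k"
    and lam :: "'g \<Rightarrow> complex"
    and N :: "((('g word \<Rightarrow>\<^sub>0 complex) set \<times> complex) \<Rightarrow>\<^sub>0 int) set set"
    and N' :: "(((('g \<Rightarrow> 'k) word \<Rightarrow>\<^sub>0 'k) set set \<times> 'k) \<Rightarrow>\<^sub>0 int) set set"
  assumes "simple_datum D \<or> (\<exists>n\<ge>1. gl_datum n D)"
    and "\<exists>F. finite F \<and> S = mult_closure F" and "0 \<notin> S"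
    and "\<And>q. prime q \<Longrightarrow> \<not> very_good_prime D q \<Longrightarrow> int q \<in> S"
    and "CHAR('k) > 0" and "1 / of_nat CHAR('k) \<notin> localisation S"
    and "p_structure S D pm"
    and "standard_levi_form S D \<chi>"
    and "integral_weight S D lam"
    and "submodule N (env_alg D) (verma D lam)"
    and "simple_left_module (env_alg D) (verma D lam QuotM N)"
    and "submodule N' (reduced_env (lie_K S D) pm \<chi>) (baby_verma S D pm \<chi> lam)"
    and "simple_left_module (reduced_env (lie_K S D) pm \<chi>) (baby_verma S D pm \<chi> lam QuotM N')"
    and "carrier (L_p_chi S D pm \<chi> lam N) \<noteq> {\<zero>\<^bsub>L_p_chi S D pm \<chi> lam N\<^esub>}"
  shows "\<exists>f. left_module_hom (reduced_env (lie_K S D) pm \<chi>)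
               (L_p_chi S D pm \<chi> lam N) (baby_verma S D pm \<chi> lam QuotM N') f \<and>
             f ` carrier (L_p_chi S D pm \<chi> lam N) = carrier (baby_verma S D pm \<chi> lam QuotM N')"
proof -
  have D: "split_datum D"
    using assms(1) simple_datum_split gl_datum_split by blast
  obtain F where F: "S = mult_closure F" using assms(2) by blast
  have "1 \<in> S"
    unfolding F mult_closure_def by (intro CollectI exI[of _ "[]"]) simp
  moreover have "s * s' \<in> S" if s: "s \<in> S" "s' \<in> S" for s s'
  proof -
    obtain xs ys where "s = prod_list xs" "set xs \<subseteq> F" "s' = prod_list ys" "set ys \<subseteq> F"
      using s unfolding F mult_closure_def by blast
    then show ?thesis
      unfolding F mult_closure_def by (intro CollectI exI[of _ "xs @ ys"]) simp
  qed
  ultimately interpret levi_form D S pm lam N \<chi>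
    using D assms by (intro levi_form.intro highest_weight_form.intro integral_form.intro
        levi_form_axioms.intro highest_weight_form_axioms.intro integral_form_axioms.intro) simp_all
  show ?thesis
    using surjection assms by (simp add: L_p_chi_eq)
qed

end
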